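(* Consider the $K$-user parallel MISO broadcast channel with $M$ subchannels and partial CSIT with quality parameters $\alpha_k^{[m]}\in[0,1]$, $k\in\{1,\dots,K\}$, $m\in\{1,\dots,M\}$, as described in the context. Let $\alpha_k=\frac1M\sum_{m=1}^M\alpha_k^{[m]}$ be the average CSIT quality of user $k$, and let users be labelled so that $\alpha_1\ge\alpha_2\ge\cdots\ge\alpha_K$. Then the optimum sum-DoF satisfies $$d_\Sigma\le 1+\alpha_2+\alpha_3+\cdots+\alpha_K .$$ Furthermore, this bound is achievable, i.e. $d_\Sigma=1+\alpha_2+\cdots+\alpha_K$, whenever the users are totally ordered with respect to their CSIT qualities, i.e. whenever there is a permutation $\pi$ of $\{1,\dots,K\}$ such that $\alpha_{\pi(1)}^{[m]}\ge\alpha_{\pi(2)}^{[m]}\ge\cdots\ge\alpha_{\pi(K)}^{[m]}$ for every $m\in\{1,\dots,M\}$.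
   Context: **Channel.** A transmitter with $K$ antennas sends independent messages $W_1,\dots,W_K$ to $K$ single-antenna users over $M$ parallel subchannels ($K$, $M$ fixed). Over $n$ channel uses, user $k$ receives on subchannel $m$ at channel use $t\in\{1,\dots,n\}$ $$y_k^{[m]}(t)=\mathbf h_k^{[m]}(t)\,\mathbf x^{[m]}(t)+z_k^{[m]}(t),$$ where $\mathbf h_k^{[m]}(t)\in\mathbb C^{1\times K}$ is the (row) fading channel vector, $\mathbf x^{[m]}(t)\in\mathbb C^{K\times1}$ is the transmitted vector, and $z_k^{[m]}(t)\sim\mathcal N_{\mathbb C}(0,1)$ is additive white Gaussian noise (independent over $k,m,t$ and independent of the channels and messages). The absolute values of all channel coefficients are bounded away from zero and infinity. The input satisfies the joint power constraint $\frac1{nM}\sum_{t=1}^n\sum_{m=1}^M\|\mathbf x^{[m]}(t)\|^2\le P$. **Partial CSIT.** For all $k,m,t$, $$\mathbf h_k^{[m]}(t)=\hat{\mathbf h}_k^{[m]}(t)+\sqrt{P^{-\alpha_k^{[m]}}}\;\tilde{\mathbf h}_k^{[m]}(t),\qquad \alpha_k^{[m]}\in[0,1],$$ with estimate $\hat{\mathbf h}_k^{[m]}(t)$ and error $\tilde{\mathbf h}_k^{[m]}(t)$ in $\mathbb C^{1\times K}$. The entries of all estimates and errors are drawn from continuous joint distributions with bounded densities: there is a finite constant $f_{\max}>0$, independent of $P$ and $n$, such that for any two disjoint finite subsets $\mathcal B_1,\mathcal B_2$ of these entries (over all users, subchannels, channel uses), the conditional joint density of $\mathcal B_1$ given $\mathcal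 B_2$ is at most $f_{\max}^{|\mathcal B_1|}$. The channels are independent of the messages. The transmitter knows the realizations of the estimates $\hat{\mathbf h}_k^{[m]}(t)$ but not of the errors $\tilde{\mathbf h}_k^{[m]}(t)$; thus the transmitted signals over the block are functions of the messages and the estimates only. All receivers know all channel realizations. Coding may be joint across subchannels. **Rates and DoF.** Achievable rate tuples $(R_1(P),\dots,R_K(P))$ (bits per channel use, counting all $M$ subchannels together) and the capacity region $\mathcal C(P)$ are defined in the standard Shannon sense, with $n\to\infty$ and $M$ fixed. A tuple $(d_1,\dots,d_K)$ is an achievable DoF tuple if there exist $(R_1(P),\dots,R_K(P))\in\mathcal C(P)$ with $d_k=\lim_{P\to\infty}\frac{R_k(P)}{M\log P}$ for all $k$. The DoF region $\mathcal D$ is the closure of the set of achievable DoF tuples, and the sum-DoF is $d_\Sigma=\max_{(d_1,\dots,d_K)\in\mathcal D}\sum_{k=1}^K d_k$. *)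

theory Defs
  imports "HOL-Probability.Probability" "HOL-Combinatorics.Permutations"
begin

text \<open>
  Users, transmit antennas and subchannels are numbered from 1, and so are channel uses.
  The entry \<open>j\<close> of the vector of user \<open>k\<close>, subchannel \<open>m\<close>, time \<open>t\<close> is
  \<open>Estimate k m t j\<close> for the channel estimate and \<open>Error k m t j\<close> for the (unscaled)
  estimation error.
\<close>

datatype entry = Estimate nat nat nat nat | Error nat nat nat nat

definition estimate_entries :: "nat \<Rightarrow> nat \<Rightarrow> nat \<Rightarrow> entry set" where
  "estimate_entries K M n =
    {Estimate k m t j | k m t j. k \<in> {1..K} \<and> m \<in> {1..M} \<and> t \<in> {1..n} \<and> j \<in> {1..K}}"

definition error_entries :: "nat \<Rightarrow> nat \<Rightarrow> nat \<Rightarrow> entry set" where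
  "error_entries K M n =
    {Error k m t j | k m t j. k \<in> {1..K} \<and> m \<in> {1..M} \<and> t \<in> {1..n} \<and> j \<in> {1..K}}"

definition block_entries :: "nat \<Rightarrow> nat \<Rightarrow> nat \<Rightarrow> entry set" where
  "block_entries K M n = estimate_entries K M n \<union> error_entries K M n"

definition all_entries :: "nat \<Rightarrow> nat \<Rightarrow> entry set" where
  "all_entries K M = (\<Union>n. block_entries K M n)"

text \<open>
  \<open>f B\<close> is the joint density of the entries in \<open>B\<close>. The quotient is \<open>0\<close> where the
  conditioning density vanishes.
\<close>

definition cond_density ::
  "(entry set \<Rightarrow> (entry \<Rightarrow> complex) \<Rightarrow> real) \<Rightarrow> entry set \<Rightarrow> entry set \<Rightarrow> (entry \<Rightarrow> complex) \<Rightarrow> real"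
  where
  "cond_density f B1 B2 x = f (B1 \<union> B2) x / f B2 (restrict x B2)"

definition channel_coeff ::
  "(nat \<Rightarrow> nat \<Rightarrow> real) \<Rightarrow> (entry \<Rightarrow> 'a \<Rightarrow> complex) \<Rightarrow> real
    \<Rightarrow> nat \<Rightarrow> nat \<Rightarrow> nat \<Rightarrow> nat \<Rightarrow> 'a \<Rightarrow> complex" where
  "channel_coeff \<alpha> H P k m t j \<omega> =
    H (Estimate k m t j) \<omega> + complex_of_real (sqrt (P powr - \<alpha> k m)) * H (Error k m t j) \<omega>"

definition avg_quality :: "nat \<Rightarrow> (nat \<Rightarrow> nat \<Rightarrow> real) \<Rightarrow> nat \<Rightarrow> real" where
  "avg_quality M \<alpha> k = (\<Sum>m=1..M. \<alpha> k m) / real M"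

definition totally_ordered_quality :: "nat \<Rightarrow> nat \<Rightarrow> (nat \<Rightarrow> nat \<Rightarrow> real) \<Rightarrow> bool" where
  "totally_ordered_quality K M \<alpha> \<longleftrightarrow>
    (\<exists>\<pi>. \<pi> permutes {1..K} \<and>
      (\<forall>m\<in>{1..M}. \<forall>i\<in>{1..K}. \<forall>j\<in>{i..K}. \<alpha> (\<pi> j) m \<le> \<alpha> (\<pi> i) m))"

text \<open>
  The probability space \<open>\<Omega>\<close> carries the channel process \<open>H\<close> and the noise process \<open>Z\<close>,
  neither of which depends on the power \<open>P\<close> or the block length. The messages are not part
  of \<open>\<Omega>\<close>: being uniform and independent of channel and noise, they enter through the average
  over all message tuples in the error probability. The density of the noise is that of the
  circularly symmetric complex Gaussian law with unit variance.
\<close>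

locale parallel_miso_bc = prob_space \<Omega> for \<Omega> :: "'a measure" +
  fixes K M :: nat
    and \<alpha> :: "nat \<Rightarrow> nat \<Rightarrow> real"
    and H :: "entry \<Rightarrow> 'a \<Rightarrow> complex"
    and Z :: "nat \<Rightarrow> nat \<Rightarrow> nat \<Rightarrow> 'a \<Rightarrow> complex"
  assumes users: "1 \<le> K"
    and subchannels: "1 \<le> M"
    and quality: "\<And>k m. k \<in> {1..K} \<Longrightarrow> m \<in> {1..M} \<Longrightarrow> \<alpha> k m \<in> {0..1}"
    and bounded_densities:
      "\<exists>f fmax. 0 < fmax \<and>
        (\<forall>B. finite B \<and> B \<subseteq> all_entries K M \<longrightarrow>
          (\<forall>x. 0 \<le> f B x) \<and>
          distributed \<Omega> (\<Pi>\<^sub>M e\<in>B. lborel) (\<lambda>\<omega>. \<lambda>e\<in>B. H e \<omega>) (\<lambda>x. ennreal (f B x))) \<and>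
        (\<forall>B1 B2. finite B1 \<and> finite B2 \<and> B1 \<inter> B2 = {} \<and> B1 \<union> B2 \<subseteq> all_entries K M \<longrightarrow>
          (AE x in (\<Pi>\<^sub>M e\<in>B1 \<union> B2. lborel). cond_density f B1 B2 x \<le> fmax ^ card B1))"
    and coeff_bounded:
      "\<exists>c C. 0 < c \<and>
        (\<forall>\<^sub>F P in at_top. \<forall>k\<in>{1..K}. \<forall>m\<in>{1..M}. \<forall>t\<ge>1. \<forall>j\<in>{1..K}.
          AE \<omega> in \<Omega>. c \<le> cmod (channel_coeff \<alpha> H P k m t j \<omega>) \<and>
                  cmod (channel_coeff \<alpha> H P k m t j \<omega>) \<le> C)"
    and noise_gaussian:
      "\<And>k m t. k \<in> {1..K} \<Longrightarrow> m \<in> {1..M} \<Longrightarrow> 1 \<le> t \<Longrightarrow>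
        distributed \<Omega> lborel (Z k m t) (\<lambda>z. ennreal (exp (- (cmod z)\<^sup>2) / pi))"
    and noise_indep:
      "indep_vars (\<lambda>_. borel) (\<lambda>(k, m, t). Z k m t) ({1..K} \<times> {1..M} \<times> {1..})"
    and noise_indep_channel:
      "indep_set
        (sets (vimage_algebra (space \<Omega>)
          (\<lambda>\<omega>. \<lambda>(k, m, t)\<in>{1..K} \<times> {1..M} \<times> {1..}. Z k m t \<omega>)
          (\<Pi>\<^sub>M i\<in>{1..K} \<times> {1..M} \<times> {1..}. borel)))
        (sets (vimage_algebra (space \<Omega>)
          (\<lambda>\<omega>. \<lambda>e\<in>all_entries K M. H e \<omega>)
          (\<Pi>\<^sub>M e\<in>all_entries K M. borel)))"
begin

definition messages :: "(nat \<Rightarrow> nat) \<Rightarrow> (nat \<Rightarrow> nat) set" where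
  "messages N = (\<Pi>\<^sub>E k\<in>{1..K}. {..<N k})"

text \<open>
  A code of length \<open>n\<close>: \<open>enc w g m t j\<close> is the symbol sent from antenna \<open>j\<close> on subchannel
  \<open>m\<close> at time \<open>t\<close> for the message tuple \<open>w\<close> and the realization \<open>g\<close> of the estimates of the
  block; \<open>dec k y g\<close> is the decision of user \<open>k\<close> from its channel outputs \<open>y\<close> (indexed by
  subchannel and time) and the realization \<open>g\<close> of all estimates and errors of the block.
\<close>

definition valid_code ::
  "real \<Rightarrow> nat \<Rightarrow> (nat \<Rightarrow> nat)
    \<Rightarrow> ((nat \<Rightarrow> nat) \<Rightarrow> (entry \<Rightarrow> complex) \<Rightarrow> nat \<Rightarrow> nat \<Rightarrow> nat \<Rightarrow> complex)
    \<Rightarrow> (nat \<Rightarrow> (nat \<times> nat \<Rightarrow> complex) \<Rightarrow> (entry \<Rightarrow> complex) \<Rightarrow> nat) \<Rightarrow> bool" where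
  "valid_code P n N enc dec \<longleftrightarrow>
    (\<forall>w\<in>messages N.
      (\<forall>m\<in>{1..M}. \<forall>t\<in>{1..n}. \<forall>j\<in>{1..K}.
        (\<lambda>g. enc w g m t j) \<in> borel_measurable (\<Pi>\<^sub>M e\<in>estimate_entries K M n. borel)) \<and>
      (\<forall>g\<in>estimate_entries K M n \<rightarrow>\<^sub>E UNIV.
        1 / (real n * real M) * (\<Sum>t=1..n. \<Sum>m=1..M. \<Sum>j=1..K. (cmod (enc w g m t j))\<^sup>2) \<le> P)) \<and>
    (\<forall>k\<in>{1..K}.
      (\<lambda>(y, g). dec k y g) \<in>
        (\<Pi>\<^sub>M i\<in>{1..M} \<times> {1..n}. borel) \<Otimes>\<^sub>M (\<Pi>\<^sub>M e\<in>block_entries K M n. borel)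
          \<rightarrow>\<^sub>M count_space UNIV)"

definition received ::
  "real \<Rightarrow> nat
    \<Rightarrow> ((nat \<Rightarrow> nat) \<Rightarrow> (entry \<Rightarrow> complex) \<Rightarrow> nat \<Rightarrow> nat \<Rightarrow> nat \<Rightarrow> complex)
    \<Rightarrow> (nat \<Rightarrow> nat) \<Rightarrow> nat \<Rightarrow> nat \<Rightarrow> nat \<Rightarrow> 'a \<Rightarrow> complex" where
  "received P n enc w k m t \<omega> =
    (\<Sum>j=1..K. channel_coeff \<alpha> H P k m t j \<omega> *
       enc w (\<lambda>e\<in>estimate_entries K M n. H e \<omega>) m t j) + Z k m t \<omega>"

definition error_prob ::
  "real \<Rightarrow> nat \<Rightarrow> (nat \<Rightarrow> nat)
    \<Rightarrow> ((nat \<Rightarrow> nat) \<Rightarrow> (entry \<Rightarrow> complex) \<Rightarrow> nat \<Rightarrow> nat \<Rightarrow> nat \<Rightarrow> complex)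
    \<Rightarrow> (nat \<Rightarrow> (nat \<times> nat \<Rightarrow> complex) \<Rightarrow> (entry \<Rightarrow> complex) \<Rightarrow> nat) \<Rightarrow> real" where
  "error_prob P n N enc dec =
    (\<Sum>w\<in>messages N.
      prob {\<omega>\<in>space \<Omega>. \<exists>k\<in>{1..K}.
        dec k (\<lambda>(m, t)\<in>{1..M} \<times> {1..n}. received P n enc w k m t \<omega>)
              (\<lambda>e\<in>block_entries K M n. H e \<omega>) \<noteq> w k})
    / real (card (messages N))"

text \<open>Rate and DoF tuples are functions on \<open>{1..K}\<close>, extensional outside of it.\<close>

definition achievable_rates :: "real \<Rightarrow> (nat \<Rightarrow> real) set" where
  "achievable_rates P =
    {R \<in> {1..K} \<rightarrow>\<^sub>E {0..}.
      \<exists>enc dec.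
        (\<forall>n\<ge>1. valid_code P n (\<lambda>k. nat \<lceil>2 powr (real n * R k)\<rceil>) (enc n) (dec n)) \<and>
        (\<lambda>n. error_prob P n (\<lambda>k. nat \<lceil>2 powr (real n * R k)\<rceil>) (enc n) (dec n))
          \<longlonglongrightarrow> 0}"

definition capacity_region :: "real \<Rightarrow> (nat \<Rightarrow> real) set" where
  "capacity_region P = closure (achievable_rates P)"

definition achievable_dof :: "(nat \<Rightarrow> real) set" where
  "achievable_dof =
    {d \<in> {1..K} \<rightarrow>\<^sub>E UNIV.
      \<exists>R. (\<forall>\<^sub>F P in at_top. R P \<in> capacity_region P) \<and>
          (\<forall>k\<in>{1..K}. ((\<lambda>P. R P k / (real M * log 2 P)) \<longlongrightarrow> d k) at_top)}"

definition dof_region :: "(nat \<Rightarrow> real) set" where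
  "dof_region = closure achievable_dof"

definition is_sum_dof :: "real \<Rightarrow> bool" where
  "is_sum_dof s \<longleftrightarrow>
    (\<exists>d\<in>dof_region. (\<Sum>k=1..K. d k) = s) \<and> (\<forall>d\<in>dof_region. (\<Sum>k=1..K. d k) \<le> s)"

end

end

theory Submission
  imports Defs "HOL-Real_Asymp.Real_Asymp"
begin

text \<open>
  \<^emph>\<open>Converse.\<close> Quantize the noiseless outputs of user \<open>j\<close> to images and let \<open>V j\<close> and \<open>U j\<close> be the
  expected numbers of pairs of an image at user \<open>j\<close> and the messages of the users \<open>j, \<dots>, K\<close>, respectively
  \<open>j + 1, \<dots>, K\<close>. Since user \<open>j\<close> decodes its message from its image, \<open>V j\<close> is at most \<open>U j\<close> up to a
  constant per slot. Given the channel of user \<open>j\<close>, the channel of user \<open>j + 1\<close> still has a bounded density at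
  scale \<open>P powr (- \<alpha> / 2)\<close>, so two messages with images at distance \<open>d\<close> at user \<open>j\<close> collide at user
  \<open>j + 1\<close> with probability \<open>O(P powr \<alpha> / d\<^sup>2)\<close> per slot; summing over the lattice of images, \<open>U j\<close> exceeds
  \<open>V (j + 1)\<close> by at most a factor \<open>P powr \<alpha>\<close> per slot, up to logarithms. Telescoping from \<open>V 1\<close>, which is
  the number of message tuples, to \<open>U K\<close>, which is at most about \<open>P\<close> per slot, gives the bound.

  \<^emph>\<open>Achievability.\<close> Let \<open>l\<close> be the user with the best estimates on every subchannel. The private
  symbols of each user are sent with power \<open>P powr \<alpha> l m\<close> along a vector that is nearly orthogonal to the
  estimates of all other users, so that user \<open>k\<close> sees interference of power \<open>P powr (\<alpha> l m - \<alpha> k m)\<close> and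
  can carry \<open>\<alpha> k m\<close> degrees of freedom. A common symbol for \<open>l\<close> occupies the remaining \<open>1 - \<alpha> l m\<close>
  power levels and is resolved by all users. Outside a small fraction of the slots, where the noise is large or
  the own gain is small, the symbols are determined by the output; codes of linear Hamming distance over the
  symbol alphabet correct the remaining slots.
\<close>

section \<open>Lattice sums\<close>


text \<open>Two obstacles shape the converse. Collisions at a user are controlled only conditionally
  on data that ignore the errors of this and all later users, whereas decodability of a message
  depends on every channel entry. So decodability is replaced, stage by stage, by events measurable
  for ever smaller sigma-algebras, at a factor 2 per stage, and images are counted through
  representatives chosen from such data. Moreover the power constraint is joint over the block: one
  slot may carry nearly all the power, so the images of a block fill a ball rather than a product of
  discs, and a Gaussian weight restores the product form.

  For achievability, moduli are assumed to be bounded for the coefficients only. Estimates and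
  errors are separately bounded just for positive quality, where the coefficients at two different
  powers determine both; users of quality 0 on a subchannel are therefore left out of the zero
  forcing there. Since fading may be dependent over time, the rarity of bad slots rests on product
  bounds over arbitrary sets of slots and not on a law of large numbers.\<close>

lemma sum_geometric_finite_nat:
  fixes r :: real
  assumes "finite F" "0 \<le> r" "r < 1"
  shows "(\<Sum>x\<in>F. r ^ x) \<le> 1 / (1 - r)"
proof -
  have "(\<Sum>x\<in>F. r ^ x) \<le> (\<Sum>x. r ^ x)"
    using assms by (intro sum_le_suminf) (auto intro: summable_geometric)
  then show ?thesis using assms by (simp add: suminf_geometric)
qed

lemma inverse_one_minus_exp:
  fixes y :: real
  assumes "y > 0"
  shows "1 / (1 - exp (- y)) \<le> 1 + 1 / y"
proof -
  have "exp (-y) \<le> 1 / (1 + y)"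
    using exp_ge_add_one_self[of y] assms by (simp add: exp_minus field_simps)
  then have "y / (1 + y) \<le> 1 - exp (-y)"
    using assms by (simp add: field_simps)
  moreover have "y / (1 + y) > 0" using assms by simp
  ultimately have "1 / (1 - exp (-y)) \<le> 1 / (y / (1 + y))"
    by (intro divide_left_mono) (use assms in auto)
  also have "\<dots> = 1 + 1 / y" using assms by (simp add: field_simps)
  finally show ?thesis .
qed

text \<open>The distance to \<open>a\<close> is injective on each of the two half-lines at
  \<open>a\<close>, so each half is a sum of \<open>f\<close> over a finite set of naturals, bounded
  by \<open>c\<close>.\<close>

lemma sum_int_abs_le:
  fixes f :: "nat \<Rightarrow> real" and F :: "int set"
  assumes "finite F" "\<And>n. 0 \<le> f n"
    and "\<And>G. finite G \<Longrightarrow> (\<Sum>x\<in>G. f x) \<le> c"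
  shows "(\<Sum>x\<in>F. f (nat \<bar>x - a\<bar>)) \<le> 2 * c"
proof -
  let ?F1 = "{x\<in>F. a \<le> x}" and ?F2 = "{x\<in>F. x < a}"
  have "(\<Sum>x\<in>F. f (nat \<bar>x - a\<bar>)) = (\<Sum>x\<in>?F1. f (nat \<bar>x - a\<bar>)) + (\<Sum>x\<in>?F2. f (nat \<bar>x - a\<bar>))"
    using assms(1) by (subst sum.union_disjoint[symmetric]) (auto intro!: sum.cong)
  also have "(\<Sum>x\<in>?F1. f (nat \<bar>x - a\<bar>)) = (\<Sum>x\<in>(\<lambda>x. nat \<bar>x - a\<bar>) ` ?F1. f x)"
    by (subst sum.reindex) (auto simp: inj_on_def)
  also have "(\<Sum>x\<in>?F2. f (nat \<bar>x - a\<bar>)) = (\<Sum>x\<in>(\<lambda>x. nat \<bar>x - a\<bar>) ` ?F2. f x)"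
    by (subst sum.reindex) (auto simp: inj_on_def)
  finally show ?thesis
    using assms(3)[of "(\<lambda>x. nat \<bar>x - a\<bar>) ` ?F1"] assms(3)[of "(\<lambda>x. nat \<bar>x - a\<bar>) ` ?F2"] assms(1)
    by simp
qed

text \<open>The tangent bound \<open>- y\<^sup>2 \<le> 1 - 2 * y\<close> at
  \<open>y = \<bar>x\<bar> / sqrt R\<close> dominates the Gaussian by a geometric series of ratio
  \<open>exp (- 2 / sqrt R)\<close>. The 12 is made of 2 half-lines, \<open>exp 1 \<le> 3\<close>,
  and the bound \<open>2 * sqrt R\<close> for the series.\<close>

lemma sum_gauss_int_le:
  fixes F :: "int set" and R :: real
  assumes F: "finite F" and R: "1 \<le> R"
  shows "(\<Sum>x\<in>F. exp (- (real_of_int x)\<^sup>2 / R)) \<le> 12 * sqrt R"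
proof -
  define r where "r = exp (- 2 / sqrt R)"
  have r: "0 \<le> r" "r < 1" using R by (auto simp: r_def)
  have s: "sqrt R \<ge> 1" using R by simp
  have e: "exp (1::real) \<le> 3" by (rule exp_le)
  have "(\<Sum>x\<in>F. exp (- (real_of_int x)\<^sup>2 / R)) \<le> (\<Sum>x\<in>F. 3 * r ^ nat \<bar>x - 0\<bar>)"
  proof (rule sum_mono)
    fix x
    define y where "y = real_of_int \<bar>x\<bar> / sqrt R"
    have "y\<^sup>2 = (real_of_int x)\<^sup>2 / R" using R by (simp add: y_def power_divide)
    moreover have "(y - 1)\<^sup>2 \<ge> 0" by simp
    ultimately have "- (real_of_int x)\<^sup>2 / R \<le> 1 - 2 * y"
      by (simp add: power2_eq_square algebra_simps)
    then have "exp (- (real_of_int x)\<^sup>2 / R) \<le> exp (1 - 2 * y)" by simp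
    also have "\<dots> = exp 1 * exp (- 2 * y)" by (simp add: exp_add[symmetric])
    also have "exp (- 2 * y) = r ^ nat \<bar>x\<bar>"
      unfolding r_def y_def by (simp add: exp_of_nat_mult[symmetric] field_simps)
    finally show "exp (- (real_of_int x)\<^sup>2 / R) \<le> 3 * r ^ nat \<bar>x - 0\<bar>"
      using mult_right_mono[OF e, of "r ^ nat \<bar>x\<bar>"] r by simp
  qed
  also have "\<dots> \<le> 2 * (3 * (1 / (1 - r)))"
  proof (rule sum_int_abs_le[OF F])
    show "\<And>n. 0 \<le> 3 * r ^ n" using r by simp
    fix G :: "nat set" assume "finite G"
    then show "(\<Sum>x\<in>G. 3 * r ^ x) \<le> 3 * (1 / (1 - r))"
      using sum_geometric_finite_nat[OF _ r, of G] by (simp add: sum_distrib_left[symmetric])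
  qed
  also have "1 / (1 - r) \<le> 1 + 1 / (2 / sqrt R)"
    unfolding r_def using inverse_one_minus_exp[of "2 / sqrt R"] R by simp
  also have "\<dots> \<le> 2 * sqrt R" using s by (simp del: real_sqrt_ge_1_iff)
  finally show ?thesis by simp
qed

lemma sum_harmonic_le:
  assumes "finite G" "\<And>x. x \<in> G \<Longrightarrow> real x \<le> R" "1 \<le> R"
  shows "(\<Sum>x\<in>G. 1 / (1 + real x)) \<le> 2 + ln R"
proof -
  define N where "N = nat \<lfloor>R\<rfloor>"
  have N: "N \<ge> 1" "real N \<le> R" using assms(3) by (auto simp: N_def le_nat_floor)
  have "G \<subseteq> {..N}" using assms(2) by (auto simp: N_def le_nat_floor)
  then have "(\<Sum>x\<in>G. 1 / (1 + real x)) \<le> (\<Sum>x\<le>N. 1 / (1 + real x))"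
    by (intro sum_mono2) auto
  also have "\<dots> = harm (Suc N)"
    unfolding harm_def using sum.shift_bounds_cl_Suc_ivl[of "\<lambda>k. inverse (real k)" 0 N]
    by (simp add: atLeast0AtMost inverse_eq_divide)
  also have "\<dots> = harm N + 1 / (1 + real N)" by (simp add: harm_Suc inverse_eq_divide)
  also have "harm N \<le> 1 + ln (real N)"
    using N(1)
  proof (induction N rule: dec_induct)
    case (step n)
    have "ln (real n / (1 + real n)) \<le> real n / (1 + real n) - 1"
      using step by (intro ln_le_minus_one) auto
    also have "\<dots> = - (1 / (1 + real n))" by (simp add: field_simps)
    finally have "1 / (1 + real n) \<le> ln (1 + real n) - ln (real n)"
      using step by (simp add: ln_div)
    then show ?case using step by (simp add: harm_Suc inverse_eq_divide add.commute)
  qed (simp add: harm_def)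
  also have "ln (real N) \<le> ln R" using N by simp
  also have "1 / (1 + real N) \<le> 1" by simp
  finally show ?thesis by simp
qed

text \<open>Points within distance \<open>R\<close> of \<open>a\<close> form a harmonic sum, hence a
  logarithm, without help of the Gaussian. Farther out the denominator exceeds \<open>R\<close>, and
  the Gaussian sum of order \<open>sqrt R\<close> leaves only a constant. The bound is uniform in
  \<open>a\<close>, which will be a coordinate of the image of a fixed message.\<close>

lemma sum_gauss_harmonic_le:
  fixes F :: "int set" and R :: real
  assumes F: "finite F" and R: "1 \<le> R"
  shows "(\<Sum>x\<in>F. exp (- (real_of_int x)\<^sup>2 / R) / (1 + \<bar>real_of_int (x - a)\<bar>)) \<le> 16 + 2 * ln R"
proof -
  let ?N = "{x\<in>F. \<bar>real_of_int (x - a)\<bar> \<le> R}" and ?D = "{x\<in>F. R < \<bar>real_of_int (x - a)\<bar>}"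
  let ?f = "\<lambda>x. exp (- (real_of_int x)\<^sup>2 / R) / (1 + \<bar>real_of_int (x - a)\<bar>)"
  have "(\<Sum>x\<in>F. ?f x) = (\<Sum>x\<in>?N. ?f x) + (\<Sum>x\<in>?D. ?f x)"
    using F by (subst sum.union_disjoint[symmetric]) (auto intro!: sum.cong)
  moreover have "(\<Sum>x\<in>?N. ?f x) \<le> 2 * (2 + ln R)"
  proof -
    let ?h = "\<lambda>n. if real n \<le> R then 1 / (1 + real n) else 0"
    have "(\<Sum>x\<in>?N. ?f x) \<le> (\<Sum>x\<in>?N. ?h (nat \<bar>x - a\<bar>))"
      using R by (intro sum_mono) (auto simp: divide_simps)
    also have "\<dots> \<le> 2 * (2 + ln R)"
    proof (rule sum_int_abs_le)
      fix G :: "nat set" assume G: "finite G"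
      have "(\<Sum>x\<in>G. ?h x) = (\<Sum>x\<in>{x\<in>G. real x \<le> R}. 1 / (1 + real x))"
        using G by (simp add: sum.If_cases Int_def)
      also have "\<dots> \<le> 2 + ln R" using G R by (intro sum_harmonic_le) auto
      finally show "(\<Sum>x\<in>G. ?h x) \<le> 2 + ln R" .
    qed (use F in auto)
    finally show ?thesis .
  qed
  moreover have "(\<Sum>x\<in>?D. ?f x) \<le> 12"
  proof -
    have "(\<Sum>x\<in>?D. ?f x) \<le> (\<Sum>x\<in>?D. exp (- (real_of_int x)\<^sup>2 / R) / R)"
      using R by (intro sum_mono divide_left_mono) auto
    also have "\<dots> \<le> 12 * sqrt R / R"
      using sum_gauss_int_le[of ?D R] F R by (simp add: sum_divide_distrib[symmetric] divide_right_mono)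
    also have "\<dots> \<le> 12"
      using R real_sqrt_le_mono[of 1 R] by (simp add: field_simps real_le_lsqrt power2_eq_square)
    finally show ?thesis .
  qed
  ultimately show ?thesis by simp
qed

section \<open>Sums over the planar lattice under a Gaussian weight\<close>

definition lat_dist2 :: "int \<times> int \<Rightarrow> int \<times> int \<Rightarrow> real" where
  "lat_dist2 p q = (real_of_int (fst p - fst q))\<^sup>2 + (real_of_int (snd p - snd q))\<^sup>2"

definition lat_norm2 :: "int \<times> int \<Rightarrow> real" where
  "lat_norm2 p = (real_of_int (fst p))\<^sup>2 + (real_of_int (snd p))\<^sup>2"

lemma sum_prod_subset_le:
  fixes f :: "'a \<times> 'b \<Rightarrow> real"
  assumes "finite F" "\<And>x. 0 \<le> f x"
  shows "(\<Sum>x\<in>F. f x) \<le> (\<Sum>x\<in>fst ` F. \<Sum>y\<in>snd ` F. f (x, y))"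
proof -
  have "F \<subseteq> fst ` F \<times> snd ` F" by force
  then have "(\<Sum>x\<in>F. f x) \<le> (\<Sum>x\<in>fst ` F \<times> snd ` F. f x)"
    using assms by (intro sum_mono2) auto
  then show ?thesis by (simp add: sum.cartesian_product)
qed

lemma sum_gauss_lattice_le:
  assumes F: "finite F" and R: "1 \<le> R"
  shows "(\<Sum>p\<in>F. exp (- lat_norm2 p / R)) \<le> 144 * R"
proof -
  have "(\<Sum>p\<in>F. exp (- lat_norm2 p / R)) \<le> (\<Sum>x\<in>fst ` F. \<Sum>y\<in>snd ` F. exp (- lat_norm2 (x, y) / R))"
    using F by (intro sum_prod_subset_le) auto
  also have "\<dots> = (\<Sum>x\<in>fst ` F. exp (- (real_of_int x)\<^sup>2 / R)) * (\<Sum>y\<in>snd ` F. exp (- (real_of_int y)\<^sup>2 / R))"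
    by (simp add: sum_product lat_norm2_def exp_add[symmetric] add_divide_distrib[symmetric] diff_divide_distrib)
  also have "\<dots> \<le> (12 * sqrt R) * (12 * sqrt R)"
    using F R by (intro mult_mono sum_gauss_int_le sum_nonneg) auto
  also have "\<dots> = 144 * R" using R by simp
  finally show ?thesis .
qed

text \<open>Bound for the probability that two signals collide in one slot at one user when their
  images at another user are \<open>p\<close> and \<open>q\<close>. It is inverse to the squared
  distance because a complex entry has to hit a planar disc, and it is capped at 1.\<close>

definition alignment :: "real \<Rightarrow> int \<times> int \<Rightarrow> int \<times> int \<Rightarrow> real" where
  "alignment \<beta> p q = (if lat_dist2 p q \<le> \<beta> then 1 else \<beta> / lat_dist2 p q)"

text \<open>The inverse squared distance does not factor, so it is traded for a product of two
  one-dimensional harmonic terms by \<open>(1 + \<bar>x\<bar>) * (1 + \<bar>y\<bar>) \<le> 2 * (1 +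
  x\<^sup>2 + y\<^sup>2)\<close>. The planar sum becomes a product of two sums, at the price of a
  squared logarithm.\<close>

lemma truncated_inverse_dist_le:
  fixes \<beta> x y :: real
  assumes "1 \<le> \<beta>"
  shows "(if x\<^sup>2 + y\<^sup>2 \<le> \<beta> then 1 else \<beta> / (x\<^sup>2 + y\<^sup>2)) \<le> 4 * \<beta> / ((1 + \<bar>x\<bar>) * (1 + \<bar>y\<bar>))"
proof -
  define s where "s = x\<^sup>2 + y\<^sup>2"
  have s: "0 \<le> s" by (simp add: s_def)
  have 1: "(if s \<le> \<beta> then 1 else \<beta> / s) \<le> 2 * \<beta> / (1 + s)"
  proof (cases "s \<le> \<beta>")
    case True
    then have "1 \<le> 2 * \<beta> / (1 + s)" using assms s by (simp add: field_simps)
    with True show ?thesis by simp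
  next
    case False
    then have "\<beta> / s \<le> 2 * \<beta> / (1 + s)" using assms s by (simp add: field_simps)
    with False show ?thesis by simp
  qed
  have "2 * (\<bar>x\<bar> * \<bar>y\<bar>) \<le> x\<^sup>2 + y\<^sup>2" "2 * \<bar>x\<bar> \<le> 1 + x\<^sup>2" "2 * \<bar>y\<bar> \<le> 1 + y\<^sup>2"
    using sum_squares_bound[of "\<bar>x\<bar>" "\<bar>y\<bar>"] sum_squares_bound[of 1 "\<bar>x\<bar>"] sum_squares_bound[of 1 "\<bar>y\<bar>"]
    by (simp_all add: mult_ac)
  then have "1 + \<bar>x\<bar> + \<bar>y\<bar> + \<bar>x\<bar> * \<bar>y\<bar> \<le> 2 * (1 + s)"
    unfolding s_def using zero_le_power2[of x] zero_le_power2[of y] by argo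
  then have "(1 + \<bar>x\<bar>) * (1 + \<bar>y\<bar>) \<le> 2 * (1 + s)"
    by (simp add: algebra_simps)
  then have "2 * \<beta> / (1 + s) \<le> 4 * \<beta> / ((1 + \<bar>x\<bar>) * (1 + \<bar>y\<bar>))"
    using assms s by (simp add: divide_simps)
  with 1 show ?thesis unfolding s_def by (rule order_trans)
qed

text \<open>Cost of one slot in the passage between neighbouring users: \<open>\<beta>\<close> up to
  a squared logarithm, wherever the point \<open>q\<close> lies.\<close>

lemma sum_gauss_alignment_le:
  assumes F: "finite F" and R: "1 \<le> R" and \<beta>: "1 \<le> \<beta>"
  shows "(\<Sum>p\<in>F. alignment \<beta> p q * exp (- lat_norm2 p / R)) \<le> 4 * \<beta> * (16 + 2 * ln R)\<^sup>2"
proof -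
  let ?g = "\<lambda>x a. exp (- (real_of_int x)\<^sup>2 / R) / (1 + \<bar>real_of_int (x - a)\<bar>)"
  have "(\<Sum>p\<in>F. alignment \<beta> p q * exp (- lat_norm2 p / R))
      \<le> (\<Sum>p\<in>F. 4 * \<beta> * (?g (fst p) (fst q) * ?g (snd p) (snd q)))"
  proof (rule sum_mono)
    fix p
    have "alignment \<beta> p q * exp (- lat_norm2 p / R)
      \<le> 4 * \<beta> / ((1 + \<bar>real_of_int (fst p - fst q)\<bar>) * (1 + \<bar>real_of_int (snd p - snd q)\<bar>)) * exp (- lat_norm2 p / R)"
      unfolding alignment_def lat_dist2_def using \<beta> by (intro mult_right_mono truncated_inverse_dist_le) auto
    also have "\<dots> = 4 * \<beta> * (?g (fst p) (fst q) * ?g (snd p) (snd q))"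
      by (simp add: lat_norm2_def exp_add[symmetric] add_divide_distrib diff_divide_distrib)
    finally show "alignment \<beta> p q * exp (- lat_norm2 p / R) \<le> 4 * \<beta> * (?g (fst p) (fst q) * ?g (snd p) (snd q))" .
  qed
  also have "\<dots> = 4 * \<beta> * (\<Sum>p\<in>F. (?g (fst p) (fst q) * ?g (snd p) (snd q)))"
    by (simp add: sum_distrib_left)
  also have "\<dots> \<le> 4 * \<beta> * (\<Sum>x\<in>fst ` F. \<Sum>y\<in>snd ` F. ?g x (fst q) * ?g y (snd q))"
    using sum_prod_subset_le[OF F, of "\<lambda>p. ?g (fst p) (fst q) * ?g (snd p) (snd q)"] \<beta>
    by (intro mult_left_mono) auto
  also have "\<dots> = 4 * \<beta> * ((\<Sum>x\<in>fst ` F. ?g x (fst q)) * (\<Sum>y\<in>snd ` F. ?g y (snd q)))"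
    by (simp add: sum_product)
  also have "\<dots> \<le> 4 * \<beta> * ((16 + 2 * ln R) * (16 + 2 * ln R))"
    using F R \<beta> by (intro mult_left_mono mult_mono sum_gauss_harmonic_le sum_nonneg) auto
  finally show ?thesis by (simp add: power2_eq_square)
qed

text \<open>Rankin's trick: a power constraint on the whole vector becomes a Gaussian weight in each coordinate.\<close>
lemma sum_prod_power_constraint_le:
  fixes \<tau> :: "'i \<Rightarrow> int \<times> int \<Rightarrow> real"
  assumes I: "finite I" and L: "finite L" "L \<subseteq> I \<rightarrow>\<^sub>E UNIV" and R: "0 < R"
    and power: "\<And>v. v \<in> L \<Longrightarrow> (\<Sum>i\<in>I. lat_norm2 (v i)) \<le> real (card I) * R"
    and nonneg: "\<And>i p. i \<in> I \<Longrightarrow> 0 \<le> \<tau> i p"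
    and bound: "\<And>i F. i \<in> I \<Longrightarrow> finite F \<Longrightarrow> (\<Sum>p\<in>F. \<tau> i p * exp (- lat_norm2 p / R)) \<le> c i"
  shows "(\<Sum>v\<in>L. \<Prod>i\<in>I. \<tau> i (v i)) \<le> exp (real (card I)) * (\<Prod>i\<in>I. c i)"
proof -
  \<comment> \<open>All coordinate values lie in one finite set, so the weighted sum extends to a
    full product set and factors over the coordinates.\<close>
  define F where "F = (\<Union>v\<in>L. v ` I)"
  have F: "finite F" using I L by (auto simp: F_def)
  have sub: "L \<subseteq> I \<rightarrow>\<^sub>E F" using L by (auto simp: F_def PiE_def)
  have "(\<Sum>v\<in>L. \<Prod>i\<in>I. \<tau> i (v i))
    \<le> (\<Sum>v\<in>L. exp (real (card I)) * (\<Prod>i\<in>I. \<tau> i (v i) * exp (- lat_norm2 (v i) / R)))"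
  proof (rule sum_mono)
    fix v assume v: "v \<in> L"
    \<comment> \<open>By the power constraint the total weight of each \<open>v\<close> in
      \<open>L\<close> is at least \<open>exp (- card I)\<close>, so inserting the weight loses only
      this factor.\<close>
    have "1 \<le> exp (real (card I) - (\<Sum>i\<in>I. lat_norm2 (v i)) / R)"
      using power[OF v] R by (simp add: field_simps)
    also have "\<dots> = exp (real (card I)) * (\<Prod>i\<in>I. exp (- lat_norm2 (v i) / R))"
      using I by (simp add: exp_sum[symmetric] exp_add[symmetric] sum_divide_distrib sum_negf)
    finally have "(\<Prod>i\<in>I. \<tau> i (v i)) * 1
        \<le> (\<Prod>i\<in>I. \<tau> i (v i)) * (exp (real (card I)) * (\<Prod>i\<in>I. exp (- lat_norm2 (v i) / R)))"
      using nonneg by (intro mult_left_mono prod_nonneg) auto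
    then show "(\<Prod>i\<in>I. \<tau> i (v i)) \<le> exp (real (card I)) * (\<Prod>i\<in>I. \<tau> i (v i) * exp (- lat_norm2 (v i) / R))"
      by (simp add: prod.distrib mult_ac)
  qed
  also have "\<dots> = exp (real (card I)) * (\<Sum>v\<in>L. \<Prod>i\<in>I. \<tau> i (v i) * exp (- lat_norm2 (v i) / R))"
    by (simp add: sum_distrib_left)
  also have "\<dots> \<le> exp (real (card I)) * (\<Sum>v\<in>I \<rightarrow>\<^sub>E F. \<Prod>i\<in>I. \<tau> i (v i) * exp (- lat_norm2 (v i) / R))"
    using I F sub nonneg by (intro mult_left_mono sum_mono2 prod_nonneg finite_PiE) auto
  also have "(\<Sum>v\<in>I \<rightarrow>\<^sub>E F. \<Prod>i\<in>I. \<tau> i (v i) * exp (- lat_norm2 (v i) / R))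
      = (\<Prod>i\<in>I. \<Sum>p\<in>F. \<tau> i p * exp (- lat_norm2 p / R))"
    using I F by (simp add: prod_sum_PiE)
  also have "\<dots> \<le> (\<Prod>i\<in>I. c i)"
    using F nonneg bound by (intro prod_mono conjI sum_nonneg) auto
  finally show ?thesis by simp
qed

section \<open>Aligned images\<close>

lemma (in prob_space) integrable_event_indicator:
  "C \<in> events \<Longrightarrow> integrable M (indicat_real C)"
  by (rule integrable_real_indicator) (auto simp: less_top[symmetric])

text \<open>\<open>A'\<close> is the event that the conditional probability of \<open>A\<close>
  given \<open>F\<close> is at least 1/2. An \<open>F\<close>-event inside it keeps at least half of
  its probability when intersected with \<open>A\<close>, and outside of it the complement of
  \<open>A\<close> has conditional probability above 1/2. This makes an arbitrary event accessible
  to arguments that require \<open>F\<close>-measurability.\<close>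

lemma (in prob_space) threshold_event:
  assumes sub: "subalgebra M F" and A: "A \<in> sets M"
  shows "\<exists>A'\<in>sets F. (\<forall>C\<in>sets F. C \<subseteq> A' \<longrightarrow> prob C \<le> 2 * prob (C \<inter> A)) \<and>
           prob (space M - A') \<le> 2 * prob (space M - A)"
proof -
  interpret finite_measure_subalgebra M F by unfold_locales (rule sub)
  define r where "r = real_cond_exp M F (indicator A)"
  have rF [measurable]: "r \<in> borel_measurable F" by (simp add: r_def)
  have rM [measurable]: "r \<in> borel_measurable M" by (simp add: r_def)
  have intA: "integrable M (indicator A :: 'a \<Rightarrow> real)" using A by (rule integrable_event_indicator)
  have spF: "space F = space M" using sub by (simp add: subalgebra_def)
  have FM: "C \<in> sets M" if "C \<in> sets F" for C using that sub by (auto simp: subalgebra_def)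
  have ir: "integrable M r" unfolding r_def using real_cond_exp_int[OF intA] by simp
  have key: "(\<integral>x. indicator C x * r x \<partial>M) = prob (C \<inter> A)" if "C \<in> sets F" for C
  proof -
    have "(\<integral>x\<in>C. indicator A x \<partial>M) = (\<integral>x\<in>C. r x \<partial>M)"
      unfolding r_def by (rule real_cond_exp_intA[OF intA that])
    moreover have "(\<integral>x\<in>C. indicator A x \<partial>M) = prob (C \<inter> A)"
      using FM[OF that] A by (simp add: set_lebesgue_integral_def indicator_inter_arith[symmetric])
    ultimately show ?thesis by (simp add: set_lebesgue_integral_def)
  qed
  define A' where "A' = {x\<in>space M. 1/2 \<le> r x}"
  have A': "A' \<in> sets F"
    unfolding A'_def spF[symmetric] by measurable
  show ?thesis
  proof (intro bexI[OF _ A'] conjI ballI impI)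
    fix C assume C: "C \<in> sets F" "C \<subseteq> A'"
    have "1/2 * prob C = (\<integral>x. indicator C x * (1/2) \<partial>M)" using FM[OF C(1)] by simp
    also have "\<dots> \<le> (\<integral>x. indicator C x * r x \<partial>M)"
    proof (rule integral_mono)
      show "integrable M (\<lambda>x. indicat_real C x * (1 / 2))"
        by (intro integrable_mult_left integrable_event_indicator FM) (use C in auto)
      show "integrable M (\<lambda>x. indicat_real C x * r x)"
        using integrable_mult_indicator[OF FM[OF C(1)] ir] by simp
      show "indicat_real C x * (1 / 2) \<le> indicat_real C x * r x" for x
        using C(2) by (auto simp: indicator_def A'_def)
    qed
    finally show "prob C \<le> 2 * prob (C \<inter> A)" using key[OF C(1)] by simp
  next
    define N where "N = space M - A'"
    have N: "N \<in> sets F" unfolding N_def spF[symmetric] using A' by auto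
    have "prob (N \<inter> A) = (\<integral>x. indicator N x * r x \<partial>M)" using key[OF N] by simp
    also have "\<dots> \<le> (\<integral>x. indicator N x * (1/2) \<partial>M)"
    proof (rule integral_mono)
      show "integrable M (\<lambda>x. indicat_real N x * (1 / 2))"
        by (intro integrable_mult_left integrable_event_indicator FM) (use N in auto)
      show "integrable M (\<lambda>x. indicat_real N x * r x)"
        using integrable_mult_indicator[OF FM[OF N] ir] by simp
      show "indicat_real N x * r x \<le> indicat_real N x * (1 / 2)" for x
        by (auto simp: indicator_def N_def A'_def)
    qed
    also have "\<dots> = 1/2 * prob N" using FM[OF N] by simp
    finally have 1: "prob (N \<inter> A) \<le> 1/2 * prob N" .
    have "prob N = prob (N \<inter> A) + prob (N - A)"
      using FM[OF N] A by (subst finite_measure_Union[symmetric]) (auto simp: Int_Diff_Un)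
    also have "prob (N - A) \<le> prob (space M - A)"
      using A FM[OF N] sets.sets_into_space[OF FM[OF N]] by (intro finite_measure_mono) auto
    finally show "prob (space M - A') \<le> 2 * prob (space M - A)" using 1 by (simp add: N_def)
  qed
qed

text \<open>Among the messages active at \<open>x\<close>, those with \<open>x \<in> A w\<close>,
  exactly one is chosen for each value of \<open>f\<close>; \<open>R w\<close> is the event that
  \<open>w\<close> is chosen. The number of distinct images thus becomes a sum of indicators of
  events measurable in \<open>N\<close>, to which conditional estimates can be applied.\<close>

definition representatives ::
  "'a measure \<Rightarrow> 'w set \<Rightarrow> ('w \<Rightarrow> 'a set) \<Rightarrow> ('w \<Rightarrow> 'a \<Rightarrow> 'v) \<Rightarrow> ('w \<Rightarrow> 'a set) \<Rightarrow> bool" where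
  "representatives N W A f R \<longleftrightarrow>
    (\<forall>w\<in>W. R w \<in> sets N \<and> R w \<subseteq> A w) \<and>
    (\<forall>w\<in>W. \<forall>x\<in>A w. \<exists>w'\<in>W. x \<in> R w' \<and> f w' x = f w x) \<and>
    (\<forall>w\<in>W. \<forall>w'\<in>W. \<forall>x\<in>R w \<inter> R w'. f w x = f w' x \<longrightarrow> w = w')"

lemma representativesD:
  assumes "representatives N W A f R"
  shows "w \<in> W \<Longrightarrow> R w \<in> sets N" "w \<in> W \<Longrightarrow> R w \<subseteq> A w"
    and "w \<in> W \<Longrightarrow> x \<in> A w \<Longrightarrow> \<exists>w'\<in>W. x \<in> R w' \<and> f w' x = f w x"
    and "w \<in> W \<Longrightarrow> w' \<in> W \<Longrightarrow> x \<in> R w \<Longrightarrow> x \<in> R w' \<Longrightarrow> f w x = f w' x \<Longrightarrow> w = w'"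
  using assms unfolding representatives_def by (simp, simp, simp, blast)

text \<open>The messages are ordered by an injection into the naturals, and the least active one of
  each image is taken. Only finitely many equality events enter, so measurability in
  \<open>N\<close> is kept.\<close>

lemma representatives_exist:
  assumes W: "finite W" and A: "\<And>w. w \<in> W \<Longrightarrow> A w \<in> sets N"
    and f: "\<And>w w'. w \<in> W \<Longrightarrow> w' \<in> W \<Longrightarrow> {x\<in>space N. f w x = f w' x} \<in> sets N"
  shows "\<exists>R. representatives N W A f R"
proof -
  obtain e :: "'a \<Rightarrow> nat" where e: "inj_on e W"
    using finite_imp_inj_to_nat_seg[OF W] by blast
  define R where "R w = A w - (\<Union>w'\<in>{w'\<in>W. e w' < e w}. A w' \<inter> {x\<in>space N. f w x = f w' x})" for w
  have "representatives N W A f R"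
    unfolding representatives_def
  proof (intro conjI ballI impI)
    fix w assume w: "w \<in> W"
    show "R w \<in> sets N" unfolding R_def
      by (rule sets.Diff[OF A[OF w]], rule sets.finite_UN) (use W w in \<open>auto intro!: A f\<close>)
    show "R w \<subseteq> A w" by (auto simp: R_def)
  next
    fix w x assume w: "w \<in> W" "x \<in> A w"
    define P where "P k = (\<exists>w'\<in>W. x \<in> A w' \<and> f w' x = f w x \<and> e w' = k)" for k
    have "P (e w)" using w by (auto simp: P_def)
    then have L: "P (LEAST k. P k)" by (rule LeastI)
    then obtain w' where w': "w' \<in> W" "x \<in> A w'" "f w' x = f w x" "e w' = (LEAST k. P k)"
      by (auto simp: P_def)
    have "x \<in> R w'"
      unfolding R_def
    proof (intro DiffI notI)
      assume "x \<in> (\<Union>w''\<in>{w''\<in>W. e w'' < e w'}. A w'' \<inter> {x\<in>space N. f w' x = f w'' x})"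
      then obtain w'' where "w'' \<in> W" "e w'' < e w'" "x \<in> A w''" "f w' x = f w'' x" by auto
      then have "P (e w'')" "e w'' < (LEAST k. P k)" using w' by (auto simp: P_def)
      then show False using not_less_Least by blast
    qed (use w' in auto)
    with w' show "\<exists>w'\<in>W. x \<in> R w' \<and> f w' x = f w x" by blast
  next
    fix w w' x assume *: "w \<in> W" "w' \<in> W" "x \<in> R w \<inter> R w'" "f w x = f w' x"
    have "x \<in> space N" using * sets.sets_into_space[OF A] by (auto simp: R_def)
    then have "\<not> e w < e w'" "\<not> e w' < e w" using * by (auto simp: R_def)
    then have "e w = e w'" by simp
    then show "w = w'" using *(1,2) by (rule inj_onD[OF e])
  qed
  then show ?thesis by blast
qed

text \<open>Every message of \<open>U\<close> is active, so its image has a representative; since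
  the image determines \<open>g\<close>, messages with distinct values of \<open>g\<close> have
  distinct representatives.\<close>

lemma representatives_countI:
  assumes "representatives N W A f R" "finite W" "U \<subseteq> W" "\<And>w. w \<in> U \<Longrightarrow> x \<in> A w"
    and "\<And>w w'. w \<in> U \<Longrightarrow> w' \<in> U \<Longrightarrow> f w x = f w' x \<Longrightarrow> g w = g w'"
  shows "card (g ` U) \<le> card {w\<in>W. x \<in> R w}"
proof -
  have "\<exists>w'\<in>W. x \<in> R w' \<and> f w' x = f w x" if "w \<in> U" for w
  proof -
    have "w \<in> W" "x \<in> A w" using that assms(3,4) by auto
    then show ?thesis by (rule representativesD(3)[OF assms(1)])
  qed
  then have "\<forall>w\<in>U. \<exists>w'. w' \<in> W \<and> x \<in> R w' \<and> f w' x = f w x" by blast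
  then obtain h where h: "\<And>w. w \<in> U \<Longrightarrow> h w \<in> W \<and> x \<in> R (h w) \<and> f (h w) x = f w x"
    unfolding bchoice_iff by auto
  have "card (g ` U) \<le> card (h ` U)"
  proof (rule surj_card_le[where f="\<lambda>v. g (SOME w. w \<in> U \<and> h w = v)"])
    show "finite (h ` U)" using assms(2,3) finite_subset by blast
    show "g ` U \<subseteq> (\<lambda>v. g (SOME w. w \<in> U \<and> h w = v)) ` h ` U"
    proof
      fix y assume "y \<in> g ` U"
      then obtain w where w: "w \<in> U" "y = g w" by auto
      have s: "(SOME w'. w' \<in> U \<and> h w' = h w) \<in> U \<and> h (SOME w'. w' \<in> U \<and> h w' = h w) = h w"
        by (rule someI[of "\<lambda>w'. w' \<in> U \<and> h w' = h w" w]) (use w in auto)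
      define v where "v = (SOME w'. w' \<in> U \<and> h w' = h w)"
      have v: "v \<in> U" "h v = h w" using s by (auto simp: v_def)
      have "f v x = f w x" using h[OF v(1)] h[OF w(1)] v(2) by simp
      then have "g v = g w" by (rule assms(5)[OF v(1) w(1)])
      then show "y \<in> (\<lambda>v. g (SOME w. w \<in> U \<and> h w = v)) ` h ` U" using w by (intro rev_image_eqI[OF imageI[OF w(1)]]) (simp add: v_def)
    qed
  qed
  also have "\<dots> \<le> card {w\<in>W. x \<in> R w}"
    using h assms(2) by (intro card_mono) auto
  finally show ?thesis .
qed

lemma (in prob_space) sum_prob_eq_integral_card:
  assumes "finite W" "\<And>w. w \<in> W \<Longrightarrow> R w \<in> events"
  shows "integrable M (\<lambda>x. real (card {w\<in>W. x \<in> R w}))"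
    and "(\<Sum>w\<in>W. prob (R w)) = (\<integral>x. real (card {w\<in>W. x \<in> R w}) \<partial>M)"
proof -
  have eq: "real (card {w\<in>W. x \<in> R w}) = (\<Sum>w\<in>W. indicator (R w) x)" for x
    using assms(1) by (simp add: indicator_def sum.If_cases Int_def)
  show "integrable M (\<lambda>x. real (card {w\<in>W. x \<in> R w}))"
    unfolding eq using assms by (intro Bochner_Integration.integrable_sum integrable_event_indicator)
  show "(\<Sum>w\<in>W. prob (R w)) = (\<integral>x. real (card {w\<in>W. x \<in> R w}) \<partial>M)"
    unfolding eq using assms by (subst Bochner_Integration.integral_sum) (auto intro: integrable_event_indicator)
qed

text \<open>For a fibre of \<open>b\<close> of size \<open>n\<close>, the inequality of the means in
  the form \<open>n \<le> \<theta> + n\<^sup>2 / (4 * \<theta>)\<close> is summed over all fibres.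
  The result is linear in the number of images and in the number of colliding ordered pairs, so it
  survives taking expectations.\<close>

lemma card_le_images_plus_collisions:
  fixes \<theta> :: real
  assumes L: "finite L" and \<theta>: "0 < \<theta>"
  shows "real (card L) \<le> \<theta> * real (card (b ` L)) + real (card {(w, w'). w \<in> L \<and> w' \<in> L \<and> b w = b w'}) / (4 * \<theta>)"
proof -
  let ?n = "\<lambda>s. card {w\<in>L. b w = s}"
  have c1: "card L = (\<Sum>s\<in>b ` L. ?n s)"
    using sum.image_gen[OF L, of "\<lambda>_. 1::nat" b] by simp
  have set: "{(w, w'). w \<in> L \<and> w' \<in> L \<and> b w = b w'} = (\<Union>s\<in>b ` L. {w\<in>L. b w = s} \<times> {w\<in>L. b w = s})"
    by auto
  have c2: "card {(w, w'). w \<in> L \<and> w' \<in> L \<and> b w = b w'} = (\<Sum>s\<in>b ` L. ?n s * ?n s)"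
    unfolding set using L by (subst card_UN_disjoint) (auto simp: card_cartesian_product)
  have "real n \<le> \<theta> + real n * real n / (4 * \<theta>)" for n
  proof -
    have "0 \<le> (2 * \<theta> - real n)\<^sup>2" by simp
    then have "4 * \<theta> * real n \<le> 4 * \<theta> * \<theta> + real n * real n"
      by (simp add: power2_eq_square algebra_simps)
    then show ?thesis using \<theta> by (simp add: field_simps)
  qed
  then have "(\<Sum>s\<in>b ` L. real (?n s)) \<le> (\<Sum>s\<in>b ` L. \<theta> + real (?n s) * real (?n s) / (4 * \<theta>))"
    by (intro sum_mono) auto
  then show ?thesis
    unfolding c1 c2 by (simp add: sum.distrib sum_divide_distrib mult.commute)
qed

text \<open>
  Aligned image sets without entropies. \<open>\<tau>\<close> bounds the conditional probability that two
  messages with given images under \<open>a\<close> collide under \<open>b\<close>; since the representatives are chosen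
  from \<open>F\<close>-measurable data, this bound applies to them.
\<close>
lemma (in prob_space) aligned_images_stage:
  fixes \<theta> :: real and \<tau> :: "'w \<Rightarrow> 'v \<Rightarrow> 'a \<Rightarrow> real"
  assumes sub: "subalgebra M F" and W: "finite W" and \<theta>: "0 < \<theta>"
    and A': "\<And>w. w \<in> W \<Longrightarrow> A' w \<in> sets F" and A: "\<And>w. w \<in> W \<Longrightarrow> A w \<in> events"
    and thr: "\<And>w C. w \<in> W \<Longrightarrow> C \<in> sets F \<Longrightarrow> C \<subseteq> A' w \<Longrightarrow> prob C \<le> 2 * prob (C \<inter> A w)"
    and bm: "\<And>w w'. w \<in> W \<Longrightarrow> w' \<in> W \<Longrightarrow> {x\<in>space M. b w x = b w' x} \<in> events"
    and RU: "representatives F W A' (\<lambda>w x. (\<kappa> w, a w x)) RU"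
    and RV: "representatives M W A (\<lambda>w x. (\<kappa> w, b w x)) RV"
    and coll: "\<And>w w' C. w \<in> W \<Longrightarrow> w' \<in> W \<Longrightarrow> \<kappa> w = \<kappa> w' \<Longrightarrow> C \<in> sets F \<Longrightarrow>
        prob (C \<inter> {x\<in>space M. b w x = b w' x}) \<le> (\<integral>x. indicator C x * \<tau> w (a w' x) x \<partial>M)"
    and int: "\<And>w w'. w \<in> W \<Longrightarrow> w' \<in> W \<Longrightarrow> integrable M (\<lambda>x. \<tau> w (a w' x) x)"
    and sum: "AE x in M. \<forall>w\<in>W. \<forall>U. U \<subseteq> (\<lambda>w'. a w' x) ` W \<longrightarrow> (\<Sum>v\<in>U. \<tau> w v x) \<le> \<theta>"
  shows "(\<Sum>w\<in>W. prob (RU w)) \<le> 4 * \<theta> * (\<Sum>w\<in>W. prob (RV w))"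
proof -
  have spF: "space F = space M" using sub by (simp add: subalgebra_def)
  have FM: "C \<in> sets M" if "C \<in> sets F" for C using that sub by (auto simp: subalgebra_def)
  have RUF: "RU w \<in> sets F" "RU w \<subseteq> A' w" if "w \<in> W" for w
    using representativesD(1,2)[OF RU that] by simp_all
  have RVF: "RV w \<in> sets M" if "w \<in> W" for w
    using representativesD(1)[OF RV that] .
  define E where "E w w' = (if \<kappa> w = \<kappa> w' then RU w \<inter> RU w' \<inter> {x\<in>space M. b w x = b w' x} else {})" for w w'
  have E: "E w w' \<in> events" if "w \<in> W" "w' \<in> W" for w w'
    using that by (auto simp: E_def intro!: sets.Int[OF FM[OF sets.Int] bm] RUF)
  \<comment> \<open>Expected number of colliding pairs. For fixed \<open>w\<close>, the
    representatives \<open>w'\<close> with the same \<open>\<kappa>\<close> have pairwise different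
    images under \<open>a\<close>, so summing \<open>\<tau>\<close> over them is summing over
    distinct images, which \<open>\<theta>\<close> bounds.\<close>
  have spair: "(\<Sum>w\<in>W. \<Sum>w'\<in>W. prob (E w w')) \<le> \<theta> * (\<Sum>w\<in>W. prob (RU w))"
    unfolding sum_distrib_left
  proof (rule sum_mono)
    fix w assume w: "w \<in> W"
    define W' where "W' = {w'\<in>W. \<kappa> w = \<kappa> w'}"
    have W': "finite W'" "W' \<subseteq> W" using W by (auto simp: W'_def)
    have "(\<Sum>w'\<in>W. prob (E w w')) = (\<Sum>w'\<in>W'. prob ((RU w \<inter> RU w') \<inter> {x\<in>space M. b w x = b w' x}))"
      using W by (intro sum.mono_neutral_cong_right) (auto simp: E_def W'_def)
    also have "\<dots> \<le> (\<Sum>w'\<in>W'. (\<integral>x. indicator (RU w \<inter> RU w') x * \<tau> w (a w' x) x \<partial>M))"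
      using w by (intro sum_mono coll) (auto simp: W'_def RUF)
    also have "\<dots> = (\<integral>x. (\<Sum>w'\<in>W'. indicator (RU w \<inter> RU w') x * \<tau> w (a w' x) x) \<partial>M)"
    proof (rule Bochner_Integration.integral_sum[symmetric])
      fix w' assume "w' \<in> W'"
      then have "w' \<in> W" using W' by auto
      then show "integrable M (\<lambda>x. indicator (RU w \<inter> RU w') x * \<tau> w (a w' x) x)"
        using integrable_mult_indicator[OF _ int[OF w \<open>w' \<in> W\<close>], of "RU w \<inter> RU w'"] w RUF FM by auto
    qed
    also have "\<dots> \<le> (\<integral>x. indicator (RU w) x * \<theta> \<partial>M)"
    proof (rule integral_mono_AE)
      show "integrable M (\<lambda>x. \<Sum>w'\<in>W'. indicat_real (RU w \<inter> RU w') x * \<tau> w (a w' x) x)"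
      proof (rule Bochner_Integration.integrable_sum)
        fix w' assume "w' \<in> W'"
        then have "w' \<in> W" using W' by auto
        then show "integrable M (\<lambda>x. indicator (RU w \<inter> RU w') x * \<tau> w (a w' x) x)"
          using integrable_mult_indicator[OF _ int[OF w \<open>w' \<in> W\<close>], of "RU w \<inter> RU w'"] w RUF FM by auto
      qed
      show "integrable M (\<lambda>x. indicat_real (RU w) x * \<theta>)"
        by (intro integrable_mult_left integrable_event_indicator FM RUF w)
      show "AE x in M. (\<Sum>w'\<in>W'. indicat_real (RU w \<inter> RU w') x * \<tau> w (a w' x) x) \<le> indicat_real (RU w) x * \<theta>"
        using sum
      proof eventually_elim
        fix x assume sumx: "\<forall>w\<in>W. \<forall>U. U \<subseteq> (\<lambda>w'. a w' x) ` W \<longrightarrow> (\<Sum>v\<in>U. \<tau> w v x) \<le> \<theta>"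
        show "(\<Sum>w'\<in>W'. indicat_real (RU w \<inter> RU w') x * \<tau> w (a w' x) x) \<le> indicat_real (RU w) x * \<theta>"
        proof (cases "x \<in> RU w")
          case True
          define V where "V = {w'\<in>W'. x \<in> RU w'}"
          have "(\<Sum>w'\<in>W'. indicat_real (RU w \<inter> RU w') x * \<tau> w (a w' x) x) = (\<Sum>w'\<in>V. \<tau> w (a w' x) x)"
            unfolding V_def using W' True by (intro sum.mono_neutral_cong_right) (auto simp: indicator_def)
          also have "\<dots> = (\<Sum>v\<in>(\<lambda>w'. a w' x) ` V. \<tau> w v x)"
          proof (rule sum.reindex_cong[symmetric, where l="\<lambda>w'. a w' x"])
            show "inj_on (\<lambda>w'. a w' x) V"
            proof (rule inj_onI)
              fix u v assume *: "u \<in> V" "v \<in> V" "a u x = a v x"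
              then have "u \<in> W" "v \<in> W" "x \<in> RU u" "x \<in> RU v" "(\<kappa> u, a u x) = (\<kappa> v, a v x)"
                by (auto simp: V_def W'_def)
              then show "u = v" by (rule representativesD(4)[OF RU])
            qed
          qed auto
          also have "\<dots> \<le> \<theta>"
            using W' by (intro sumx[rule_format] w) (auto simp: V_def)
          finally show ?thesis using True by simp
        qed simp
      qed
    qed
    also have "\<dots> = \<theta> * prob (RU w)" using FM[OF RUF(1)[OF w]] by simp
    finally show "(\<Sum>w'\<in>W. prob (E w w')) \<le> \<theta> * prob (RU w)" .
  qed
  have Ep: "(case p of (w, w') \<Rightarrow> E w w') \<in> events" if "p \<in> W \<times> W" for p
    using that E by auto
  have RA: "RU w \<inter> A w \<in> events" if "w \<in> W" for w using that A RUF FM by auto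
  let ?c = "\<lambda>x. real (card {w\<in>W. x \<in> RU w \<inter> A w})" and ?v = "\<lambda>x. real (card {w\<in>W. x \<in> RV w})"
  let ?p = "\<lambda>x. real (card {p\<in>W \<times> W. x \<in> (case p of (w, w') \<Rightarrow> E w w')})"
  note I1 = sum_prob_eq_integral_card[where R="\<lambda>w. RU w \<inter> A w", OF W RA]
  note I2 = sum_prob_eq_integral_card[where R=RV, OF W RVF]
  note I3 = sum_prob_eq_integral_card[where R="\<lambda>p. case p of (w, w') \<Rightarrow> E w w'" and W="W \<times> W", OF _ Ep]
  have pt: "?c x \<le> \<theta> * ?v x + ?p x / (4 * \<theta>)" if x: "x \<in> space M" for x
  proof -
    define L where "L = {w\<in>W. x \<in> RU w \<inter> A w}"
    have L: "finite L" "L \<subseteq> W" using W by (auto simp: L_def)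
    have "real (card L) \<le> \<theta> * real (card ((\<lambda>w. (\<kappa> w, b w x)) ` L)) +
        real (card {(w, w'). w \<in> L \<and> w' \<in> L \<and> (\<kappa> w, b w x) = (\<kappa> w', b w' x)}) / (4 * \<theta>)"
      by (rule card_le_images_plus_collisions[OF L(1) \<theta>])
    also have "card ((\<lambda>w. (\<kappa> w, b w x)) ` L) \<le> card {w\<in>W. x \<in> RV w}"
      by (rule representatives_countI[OF RV W L(2)]) (auto simp: L_def)
    also have "card {(w, w'). w \<in> L \<and> w' \<in> L \<and> (\<kappa> w, b w x) = (\<kappa> w', b w' x)}
        \<le> card {p\<in>W \<times> W. x \<in> (case p of (w, w') \<Rightarrow> E w w')}"
      using W x by (intro card_mono) (auto simp: L_def E_def)
    finally show ?thesis using \<theta> unfolding L_def by (simp add: divide_right_mono)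
  qed
  \<comment> \<open>\<open>RU w\<close> is an \<open>F\<close>-event inside \<open>A' w\<close>, so
    the restriction to \<open>A w\<close>, where representatives under \<open>b\<close> exist, costs
    a factor 2.\<close>
  have "(\<Sum>w\<in>W. prob (RU w)) \<le> (\<Sum>w\<in>W. 2 * prob (RU w \<inter> A w))"
    using RUF by (intro sum_mono thr) auto
  also have "\<dots> = 2 * (\<integral>x. ?c x \<partial>M)"
    unfolding sum_distrib_left[symmetric] using I1(2) by simp
  also have "(\<integral>x. ?c x \<partial>M) \<le> (\<integral>x. \<theta> * ?v x + ?p x / (4 * \<theta>) \<partial>M)"
    using I1(1) I2(1) I3(1) W pt by (intro integral_mono) auto
  also have "\<dots> = \<theta> * (\<Sum>w\<in>W. prob (RV w)) + (\<Sum>p\<in>W \<times> W. prob (case p of (w, w') \<Rightarrow> E w w')) / (4 * \<theta>)"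
    using I2 I3 W by (subst Bochner_Integration.integral_add) auto
  also have "(\<Sum>p\<in>W \<times> W. prob (case p of (w, w') \<Rightarrow> E w w')) = (\<Sum>w\<in>W. \<Sum>w'\<in>W. prob (E w w'))"
    by (simp add: sum.cartesian_product case_prod_unfold)
  \<comment> \<open>With this \<open>\<theta>\<close> the pair term is a quarter of the left-hand
    side of the claim; after the factor 2 it is one half of it and can be absorbed, which leaves
    \<open>4 * \<theta>\<close>.\<close>
  also have "\<theta> * (\<Sum>w\<in>W. prob (RV w)) + (\<Sum>w\<in>W. \<Sum>w'\<in>W. prob (E w w')) / (4 * \<theta>)
      \<le> \<theta> * (\<Sum>w\<in>W. prob (RV w)) + (\<theta> * (\<Sum>w\<in>W. prob (RU w))) / (4 * \<theta>)"
    using spair \<theta> by (intro add_left_mono divide_right_mono) auto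
  finally show ?thesis using \<theta> by simp
qed

text \<open>Iterates the threshold at conditional probability 1/2 along a decreasing sequence of
  sigma-algebras, with a factor 2 at each step. The last clause compares directly with the initial
  event \<open>A0\<close>, because that is where decodability of the message is known.\<close>

lemma (in prob_space) threshold_chain:
  assumes sub: "\<And>i::nat. subalgebra M (F i)" and mono: "\<And>i. sets (F (Suc i)) \<subseteq> sets (F i)"
    and A0: "\<And>w. w \<in> W \<Longrightarrow> A0 w \<in> sets (F 0)"
  shows "\<exists>A. \<forall>w\<in>W. A 0 w = A0 w \<and> (\<forall>i. A i w \<in> sets (F i) \<and>
    (\<forall>C\<in>sets (F (Suc i)). C \<subseteq> A (Suc i) w \<longrightarrow> prob C \<le> 2 * prob (C \<inter> A i w)) \<and>
    prob (space M - A i w) \<le> 2 ^ i * prob (space M - A0 w) \<and>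
    (\<forall>C\<in>sets (F i). C \<subseteq> A i w \<longrightarrow> prob C \<le> 2 ^ i * prob (C \<inter> A0 w)))"
proof -
  have FM: "C \<in> sets M" if "C \<in> sets (F i)" for C i using that sub[of i] by (auto simp: subalgebra_def)
  let ?Q = "\<lambda>i A A'. A' \<in> sets (F (Suc i)) \<and> (\<forall>C\<in>sets (F (Suc i)). C \<subseteq> A' \<longrightarrow> prob C \<le> 2 * prob (C \<inter> A)) \<and>
           prob (space M - A') \<le> 2 * prob (space M - A)"
  have "\<exists>A. A 0 = A0 w \<and> (\<forall>i. A i \<in> sets (F i)) \<and> (\<forall>i. ?Q i (A i) (A (Suc i)))" if w: "w \<in> W" for w
  proof -
    have "\<exists>A. \<forall>i. (A i \<in> sets (F i) \<and> (i = 0 \<longrightarrow> A i = A0 w)) \<and> ?Q i (A i) (A (Suc i))"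
    proof (rule dependent_nat_choice)
      show "\<exists>x. x \<in> sets (F 0) \<and> (0 = 0 \<longrightarrow> x = A0 w)" using A0[OF w] by blast
      fix A i assume "A \<in> sets (F i) \<and> (i = 0 \<longrightarrow> A = A0 w)"
      then have "A \<in> sets M" using FM by blast
      from threshold_event[OF sub this, of "Suc i"]
      obtain A' where "?Q i A A'" by blast
      then show "\<exists>y. (y \<in> sets (F (Suc i)) \<and> (Suc i = 0 \<longrightarrow> y = A0 w)) \<and> ?Q i A y" by blast
    qed
    then show ?thesis by auto
  qed
  then obtain B where B: "\<And>w. w \<in> W \<Longrightarrow> B w 0 = A0 w \<and> (\<forall>i. B w i \<in> sets (F i)) \<and> (\<forall>i. ?Q i (B w i) (B w (Suc i)))"
    by metis
  define A where "A i w = (if w \<in> W then B w i else A0 w)" for i w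
  have A: "A 0 w = A0 w" "A i w \<in> sets (F i)" "?Q i (A i w) (A (Suc i) w)" if "w \<in> W" for i w
    using B[OF that] that by (simp_all add: A_def)
  show ?thesis
  proof (intro exI[of _ A] ballI conjI allI impI)
    fix w assume w: "w \<in> W"
    show "A 0 w = A0 w" using A(1)[OF w] .
    fix i
    show "A i w \<in> sets (F i)" using A(2)[OF w] .
    show "prob C \<le> 2 * prob (C \<inter> A i w)" if "C \<in> sets (F (Suc i))" "C \<subseteq> A (Suc i) w" for C
      using A(3)[OF w, of i] that by blast
    show "prob (space M - A i w) \<le> 2 ^ i * prob (space M - A0 w)"
    proof (induction i)
      case (Suc i)
      have "prob (space M - A (Suc i) w) \<le> 2 * prob (space M - A i w)" using A(3)[OF w, of i] by blast
      then show ?case using Suc by simp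
    qed (simp add: A(1)[OF w])
    show "prob C \<le> 2 ^ i * prob (C \<inter> A0 w)" if "C \<in> sets (F i)" "C \<subseteq> A i w" for C
      using that
    proof (induction i arbitrary: C)
      case 0
      then have "C \<inter> A0 w = C" using A(1)[OF w] by auto
      then show ?case by simp
    next
      case (Suc i)
      have "prob C \<le> 2 * prob (C \<inter> A i w)" using A(3)[OF w, of i] Suc.prems by blast
      also have "prob (C \<inter> A i w) \<le> 2 ^ i * prob (C \<inter> A i w \<inter> A0 w)"
        using Suc.prems(1) mono A(2)[OF w] by (intro Suc.IH) auto
      also have "prob (C \<inter> A i w \<inter> A0 w) \<le> prob (C \<inter> A0 w)"
        using FM[OF Suc.prems(1)] FM[OF A0[OF w]] by (intro finite_measure_mono) auto
      finally show ?case by simp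
    qed
  qed
qed

section \<open>Small-ball estimates for the channel entries\<close>

text \<open>Independence of the coordinates in \<open>E\<close>, stated without reference to a measure.\<close>
definition free_of :: "'e set \<Rightarrow> (('e \<Rightarrow> 'c) \<Rightarrow> 'v) \<Rightarrow> bool" where
  "free_of E f \<longleftrightarrow> (\<forall>g. \<forall>e\<in>E. \<forall>z. f (g(e := z)) = f g)"

lemma free_ofD: "free_of E f \<Longrightarrow> e \<in> E \<Longrightarrow> f (g(e := z)) = f g"
  by (simp add: free_of_def)

lemma free_of_subset: "free_of E f \<Longrightarrow> E' \<subseteq> E \<Longrightarrow> free_of E' f"
  by (auto simp: free_of_def)

lemma finite_block_entries: "finite (block_entries K M n)"
proof -
  let ?S = "{1..K} \<times> {1..M} \<times> {1..n} \<times> {1..K}"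
  have "block_entries K M n \<subseteq> (\<lambda>(k, m, t, j). Estimate k m t j) ` ?S \<union> (\<lambda>(k, m, t, j). Error k m t j) ` ?S"
    unfolding block_entries_def estimate_entries_def error_entries_def by force
  then show ?thesis by (rule finite_subset) auto
qed

context parallel_miso_bc
begin

definition block_space :: "nat \<Rightarrow> (entry \<Rightarrow> complex) measure" where
  "block_space n = PiM (block_entries K M n) (\<lambda>_. borel)"

definition block :: "nat \<Rightarrow> 'a \<Rightarrow> entry \<Rightarrow> complex" where
  "block n \<omega> = (\<lambda>e\<in>block_entries K M n. H e \<omega>)"

definition block_law :: "nat \<Rightarrow> (entry \<Rightarrow> complex) measure" where
  "block_law n = distr \<Omega> (block_space n) (block n)"

lemma block_entries_subset_all: "block_entries K M n \<subseteq> all_entries K M"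
  by (auto simp: all_entries_def)

lemma H_measurable_restrict:
  assumes "finite B" "B \<subseteq> all_entries K M"
  shows "(\<lambda>\<omega>. \<lambda>e\<in>B. H e \<omega>) \<in> measurable \<Omega> (PiM B (\<lambda>_. lborel))"
proof -
  obtain f fmax where f: "\<forall>B. finite B \<and> B \<subseteq> all_entries K M \<longrightarrow>
          (\<forall>x. 0 \<le> (f B x :: real)) \<and>
          distributed \<Omega> (\<Pi>\<^sub>M e\<in>B. lborel) (\<lambda>\<omega>. \<lambda>e\<in>B. H e \<omega>) (\<lambda>x. ennreal (f B x))"
    using bounded_densities by blast
  then have "distributed \<Omega> (\<Pi>\<^sub>M e\<in>B. lborel) (\<lambda>\<omega>. \<lambda>e\<in>B. H e \<omega>) (\<lambda>x. ennreal (f B x))"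
    using assms by blast
  then show ?thesis by (auto simp: distributed_def)
qed

lemma H_measurable [measurable]: "e \<in> all_entries K M \<Longrightarrow> H e \<in> borel_measurable \<Omega>"
  using measurable_component_singleton[of e "{e}" "\<lambda>_. lborel", THEN measurable_comp[rotated, OF _ H_measurable_restrict[of "{e}"]]]
  by (simp add: comp_def)

lemma block_measurable [measurable]: "block n \<in> measurable \<Omega> (block_space n)"
  unfolding block_def block_space_def using block_entries_subset_all
  by (intro measurable_restrict H_measurable) auto

lemma prob_space_block_law: "prob_space (block_law n)"
  unfolding block_law_def by (rule prob_space_distr) simp

lemma space_block_law [simp]: "space (block_law n) = space (block_space n)"
  and sets_block_law [simp, measurable_cong]: "sets (block_law n) = sets (block_space n)"
  by (simp_all add: block_law_def)

text \<open>Given the other entries of the block, the density of entry \<open>e\<close> is at most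
  \<open>fmax\<close>, so it falls into a disc of radius \<open>r\<close> with conditional
  probability at most \<open>fmax * pi * r\<^sup>2\<close>. Centre, radius and weight may be
  functions of the other entries; \<open>free_of {e}\<close> expresses this and takes the place of
  conditional distributions. The constant serves all blocks and entries.\<close>

lemma small_ball_estimate:
  obtains c :: real where "0 < c"
    and "\<And>n e (\<psi> :: (entry \<Rightarrow> complex) \<Rightarrow> ennreal) ce r. e \<in> block_entries K M n \<Longrightarrow>
      \<psi> \<in> borel_measurable (block_space n) \<Longrightarrow> ce \<in> borel_measurable (block_space n) \<Longrightarrow>
      r \<in> borel_measurable (block_space n) \<Longrightarrow> (\<And>g. 0 \<le> r g) \<Longrightarrow>
      free_of {e} \<psi> \<Longrightarrow> free_of {e} ce \<Longrightarrow> free_of {e} r \<Longrightarrow>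
      (\<integral>\<^sup>+g. \<psi> g * indicator {z. cmod (z - ce g) \<le> r g} (g e) \<partial>block_law n)
        \<le> (\<integral>\<^sup>+g. \<psi> g * ennreal (c * (r g)\<^sup>2) \<partial>block_law n)"
proof -
  obtain f fmax where fmax: "0 < fmax" and f0: "\<And>B x. finite B \<Longrightarrow> B \<subseteq> all_entries K M \<Longrightarrow> 0 \<le> f B x"
    and fd: "\<And>B. finite B \<Longrightarrow> B \<subseteq> all_entries K M \<Longrightarrow>
      distributed \<Omega> (\<Pi>\<^sub>M e\<in>B. lborel) (\<lambda>\<omega>. \<lambda>e\<in>B. H e \<omega>) (\<lambda>x. ennreal (f B x))"
    and fb: "\<And>B1 B2. finite B1 \<Longrightarrow> finite B2 \<Longrightarrow> B1 \<inter> B2 = {} \<Longrightarrow> B1 \<union> B2 \<subseteq> all_entries K M \<Longrightarrow>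
      (AE x in (\<Pi>\<^sub>M e\<in>B1 \<union> B2. lborel). cond_density f B1 B2 x \<le> fmax ^ card B1)"
    using bounded_densities by metis
  define V where "V = unit_ball_vol 2"
  have V: "0 < V" by (simp add: V_def)
  show ?thesis
  proof (rule that[of "fmax * V"])
    show "0 < fmax * V" using fmax V by simp
    fix n e and \<psi> :: "(entry \<Rightarrow> complex) \<Rightarrow> ennreal" and ce :: "(entry \<Rightarrow> complex) \<Rightarrow> complex" and r :: "(entry \<Rightarrow> complex) \<Rightarrow> real"
    assume e: "e \<in> block_entries K M n"
      and \<psi>: "\<psi> \<in> borel_measurable (block_space n)" and ce: "ce \<in> borel_measurable (block_space n)"
      and r: "r \<in> borel_measurable (block_space n)" and r0: "\<And>g. 0 \<le> r g"
      and free: "free_of {e} \<psi>" "free_of {e} ce" "free_of {e} r"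
    define Bl where "Bl = block_entries K M n"
    define B2 where "B2 = Bl - {e}"
    have Bl: "finite Bl" "Bl \<subseteq> all_entries K M"
      by (simp_all add: Bl_def finite_block_entries block_entries_subset_all)
    have B2: "finite B2" "B2 \<subseteq> all_entries K M" "e \<notin> B2" "insert e B2 = Bl" "{e} \<union> B2 = Bl" "{e} \<inter> B2 = {}"
      using Bl e by (auto simp: B2_def Bl_def)
    let ?P = "PiM Bl (\<lambda>_. lborel) :: (entry \<Rightarrow> complex) measure"
    let ?Q = "PiM B2 (\<lambda>_. lborel) :: (entry \<Rightarrow> complex) measure"
    have sP: "sets (block_space n) = sets ?P"
      unfolding block_space_def Bl_def by (rule sets_PiM_cong) auto
    note [measurable] = \<psi>[unfolded measurable_cong_sets[OF sP refl]] ce[unfolded measurable_cong_sets[OF sP refl]]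
      r[unfolded measurable_cong_sets[OF sP refl]]
    note [measurable] = \<psi>[unfolded block_space_def Bl_def[symmetric]] ce[unfolded block_space_def Bl_def[symmetric]]
      r[unfolded block_space_def Bl_def[symmetric]]
    have eBl [measurable]: "e \<in> Bl" using e by (simp add: Bl_def)
    have comp [measurable]: "(\<lambda>g. g e) \<in> borel_measurable ?P"
      using measurable_component_singleton[OF eBl, of "\<lambda>_. lborel"] by simp
    have [measurable]: "(\<lambda>g. g e) \<in> borel_measurable (PiM Bl (\<lambda>_. borel) :: (entry \<Rightarrow> complex) measure)"
      using measurable_component_singleton[OF eBl, of "\<lambda>_. borel"] by simp
    have [measurable]: "Measurable.pred (PiM Bl (\<lambda>_. borel)) (\<lambda>g. cmod (g e - ce g) \<le> r g)"
      unfolding pred_def using e ce r unfolding block_space_def Bl_def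
      by (intro borel_measurable_le borel_measurable_norm borel_measurable_diff)
        (auto intro!: measurable_component_singleton)
    have fBl [measurable]: "f Bl \<in> borel_measurable ?P"
      using distributed_real_measurable[OF f0[OF Bl] fd[OF Bl]] .
    have fB2 [measurable]: "f B2 \<in> borel_measurable ?Q"
      using distributed_real_measurable[OF f0[OF B2(1,2)] fd[OF B2(1,2)]] .
    have res [measurable]: "(\<lambda>x. restrict x B2) \<in> measurable ?P ?Q"
      by (rule measurable_restrict_subset) (auto simp: B2_def)
    \<comment> \<open>The quotient in \<open>cond_density\<close> is 0 where the conditioning
      density vanishes, so its bound gives no information there. The joint density, however,
      vanishes almost everywhere on this set.\<close>
    have zero: "AE x in ?P. f B2 (restrict x B2) = 0 \<longrightarrow> f Bl x = 0"
    proof -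
      have "(\<integral>\<^sup>+x. ennreal (f Bl x) * indicator {x. f B2 (restrict x B2) = 0} x \<partial>?P)
          = (\<integral>\<^sup>+\<omega>. indicator {x. f B2 (restrict x B2) = 0} (\<lambda>e\<in>Bl. H e \<omega>) \<partial>\<Omega>)"
        by (rule distributed_nn_integral[OF fd[OF Bl]]) measurable
      also have "\<dots> = (\<integral>\<^sup>+\<omega>. indicator {x. f B2 x = 0} (\<lambda>e\<in>B2. H e \<omega>) \<partial>\<Omega>)"
      proof (rule nn_integral_cong)
        fix \<omega>
        have "restrict (\<lambda>e\<in>Bl. H e \<omega>) B2 = (\<lambda>e\<in>B2. H e \<omega>)" by (auto simp: B2_def restrict_def)
        then show "indicator {x. f B2 (restrict x B2) = 0} (\<lambda>e\<in>Bl. H e \<omega>)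
            = (indicator {x. f B2 x = 0} (\<lambda>e\<in>B2. H e \<omega>) :: ennreal)"
          by (simp add: indicator_def)
      qed
      also have "\<dots> = (\<integral>\<^sup>+x. ennreal (f B2 x) * indicator {x. f B2 x = 0} x \<partial>?Q)"
        by (rule distributed_nn_integral[OF fd[OF B2(1,2)], symmetric]) measurable
      also have "\<dots> = 0"
        by (intro nn_integral_zero') (auto simp: indicator_def)
      finally have "AE x in ?P. ennreal (f Bl x) * indicator {x. f B2 (restrict x B2) = 0} x = 0"
        by (subst (asm) nn_integral_0_iff_AE) auto
      then show ?thesis
        by eventually_elim (use f0[OF Bl] in \<open>auto simp: indicator_def ennreal_eq_0_iff antisym\<close>)
    qed
    have dens: "AE x in ?P. f Bl x \<le> fmax * f B2 (restrict x B2)"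
      using fb[of "{e}" B2, unfolded B2(5)] B2(1,2,6) Bl(2) zero
    proof (simp, elim AE_mp, intro AE_I2 impI)
      fix x assume *: "f B2 (restrict x B2) = 0 \<longrightarrow> f Bl x = 0" "cond_density f {e} B2 x \<le> fmax"
      show "f Bl x \<le> fmax * f B2 (restrict x B2)"
      proof (cases "f B2 (restrict x B2) = 0")
        case False
        then have "0 < f B2 (restrict x B2)" using f0[OF B2(1,2), of "restrict x B2"] by simp
        then show ?thesis using *(2) B2(4) by (simp add: cond_density_def field_simps)
      qed (use * in auto)
    qed
    define \<phi> where "\<phi> g = \<psi> g * indicator {z. cmod (z - ce g) \<le> r g} (g e)" for g
    have \<phi>: "\<phi> \<in> borel_measurable ?P" unfolding \<phi>_def by measurable
    define G where "G g = \<psi> g * ennreal (fmax * V * (r g)\<^sup>2)" for g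
    have Gm: "G \<in> borel_measurable ?P" unfolding G_def by measurable
    have Gfree: "G (g(e := z)) = G g" for g z
      using free unfolding G_def by (simp add: free_of_def)
    have upd: "(\<lambda>x. x(e := (0::complex))) \<in> measurable ?Q ?P"
      using B2 by (intro measurable_fun_upd[of _ B2]) auto
    interpret product_sigma_finite "\<lambda>_::entry. lborel :: complex measure" by standard
    have XB: "(\<lambda>e\<in>Bl. H e \<omega>) = (\<lambda>e\<in>B2. H e \<omega>)(e := H e \<omega>)" for \<omega>
      using B2(4) eBl by (auto simp: B2_def restrict_def fun_eq_iff)
    have blk: "block n = (\<lambda>\<omega>. \<lambda>e\<in>Bl. H e \<omega>)" by (intro ext) (simp add: block_def Bl_def)
    have "(\<integral>\<^sup>+g. \<phi> g \<partial>block_law n) = (\<integral>\<^sup>+\<omega>. \<phi> (\<lambda>e\<in>Bl. H e \<omega>) \<partial>\<Omega>)"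
      by (subst (1) block_law_def, subst nn_integral_distr[OF block_measurable])
        (use \<phi> in \<open>simp_all add: blk measurable_cong_sets[OF sP refl]\<close>)
    also have "\<dots> = (\<integral>\<^sup>+x. ennreal (f Bl x) * \<phi> x \<partial>?P)"
      by (rule distributed_nn_integral[OF fd[OF Bl] \<phi>, symmetric])
    also have "\<dots> \<le> (\<integral>\<^sup>+x. ennreal (fmax * f B2 (restrict x B2)) * \<phi> x \<partial>?P)"
      using dens by (intro nn_integral_mono_AE) (auto elim!: AE_mp intro!: mult_right_mono ennreal_leI)
    also have "\<dots> = (\<integral>\<^sup>+x. (\<integral>\<^sup>+y. ennreal (fmax * f B2 (restrict (x(e := y)) B2)) * \<phi> (x(e := y)) \<partial>lborel) \<partial>?Q)"
      unfolding B2(4)[symmetric]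
      by (rule product_nn_integral_insert[OF B2(1,3)]) (unfold B2(4), use \<phi> in measurable)
    \<comment> \<open>\<open>G\<close> ignores entry \<open>e\<close>. The value 0 only completes
      \<open>x\<close> to a point of the full product, and is exchanged for \<open>H e\<close> on
      the way back to the law of the block.\<close>
    also have "\<dots> = (\<integral>\<^sup>+x. ennreal (f B2 x) * G (x(e := 0)) \<partial>?Q)"
    proof (rule nn_integral_cong)
      fix x assume x: "x \<in> space ?Q"
      have rx: "restrict (x(e := y)) B2 = x" for y
        using x B2(3) by (auto simp: space_PiM restrict_def fun_eq_iff PiE_def extensional_def)
      have \<phi>x: "\<phi> (x(e := y)) = \<psi> x * indicator (cball (ce x) (r x)) y" for y
        using free unfolding \<phi>_def by (simp add: free_of_def indicator_def dist_norm norm_minus_commute)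
      have "(\<integral>\<^sup>+y. ennreal (fmax * f B2 (restrict (x(e := y)) B2)) * \<phi> (x(e := y)) \<partial>lborel)
          = (\<integral>\<^sup>+y. (ennreal (fmax * f B2 x) * \<psi> x) * indicator (cball (ce x) (r x)) y \<partial>lborel)"
        unfolding rx \<phi>x by (simp add: mult.assoc)
      also have "\<dots> = ennreal (fmax * f B2 x) * \<psi> x * emeasure lborel (cball (ce x) (r x))"
        by (rule nn_integral_cmult_indicator) auto
      also have "emeasure lborel (cball (ce x) (r x)) = ennreal (V * (r x)\<^sup>2)"
        using r0[of x] by (simp add: emeasure_cball V_def)
      also have "ennreal (fmax * f B2 x) * \<psi> x * ennreal (V * (r x)\<^sup>2) = ennreal (f B2 x) * G x"
        using fmax f0[OF B2(1,2), of x] V unfolding G_def by (simp add: ennreal_mult mult_ac)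
      finally show "(\<integral>\<^sup>+y. ennreal (fmax * f B2 (restrict (x(e := y)) B2)) * \<phi> (x(e := y)) \<partial>lborel)
          = ennreal (f B2 x) * G (x(e := 0))" unfolding Gfree .
    qed
    also have "\<dots> = (\<integral>\<^sup>+\<omega>. G ((\<lambda>e\<in>B2. H e \<omega>)(e := 0)) \<partial>\<Omega>)"
      using measurable_comp[OF upd Gm] by (intro distributed_nn_integral[OF fd[OF B2(1,2)]]) (simp add: comp_def)
    also have "\<dots> = (\<integral>\<^sup>+\<omega>. G (\<lambda>e\<in>Bl. H e \<omega>) \<partial>\<Omega>)"
      unfolding XB Gfree ..
    also have "\<dots> = (\<integral>\<^sup>+g. G g \<partial>block_law n)"
      by (subst (1) block_law_def, subst nn_integral_distr[OF block_measurable])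
        (use Gm in \<open>simp_all add: blk measurable_cong_sets[OF sP refl]\<close>)
    finally show "(\<integral>\<^sup>+g. \<psi> g * indicator {z. cmod (z - ce g) \<le> r g} (g e) \<partial>block_law n)
        \<le> (\<integral>\<^sup>+g. \<psi> g * ennreal (fmax * V * (r g)\<^sup>2) \<partial>block_law n)"
      by (simp add: \<phi>_def G_def)
  qed
qed

end

section \<open>Events independent of given coordinates, and quantization of outputs\<close>

definition free_events :: "('e \<Rightarrow> 'c) measure \<Rightarrow> 'e set \<Rightarrow> ('e \<Rightarrow> 'c) measure" where
  "free_events N E = sigma (space N) {C \<in> sets N. free_of E (\<lambda>g. g \<in> C)}"

text \<open>These events are already closed under the operations of a sigma-algebra. They play the
  role of the sigma-algebra of the coordinates outside \<open>E\<close>, but on the same space, so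
  that conditioning involves no projection to a smaller product.\<close>

lemma sets_free_events:
  assumes "free_of E (\<lambda>g. g \<in> space N)"
  shows "sets (free_events N E) = {C \<in> sets N. free_of E (\<lambda>g. g \<in> C)}"
proof -
  have "sigma_algebra (space N) {C \<in> sets N. free_of E (\<lambda>g. g \<in> C)}"
    unfolding sigma_algebra_iff2
  proof (intro conjI)
    show "{C \<in> sets N. free_of E (\<lambda>g. g \<in> C)} \<subseteq> Pow (space N)"
      using sets.sets_into_space by blast
    show "\<forall>A. range A \<subseteq> {C \<in> sets N. free_of E (\<lambda>g. g \<in> C)} \<longrightarrow>
        (\<Union>i::nat. A i) \<in> {C \<in> sets N. free_of E (\<lambda>g. g \<in> C)}"
    proof (intro allI impI)
      fix A :: "nat \<Rightarrow> _" assume "range A \<subseteq> {C \<in> sets N. free_of E (\<lambda>g. g \<in> C)}"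
      then have "A i \<in> sets N" "free_of E (\<lambda>g. g \<in> A i)" for i by auto
      then show "(\<Union>i. A i) \<in> {C \<in> sets N. free_of E (\<lambda>g. g \<in> C)}"
        by (auto simp: free_of_def)
    qed
  qed (use assms in \<open>auto simp: free_of_def\<close>)
  then show ?thesis
    unfolding free_events_def by (rule sigma_algebra.sets_measure_of_eq)
qed

lemma subalgebra_free_events:
  assumes "free_of E (\<lambda>g. g \<in> space N)" "sets N = sets N'"
  shows "subalgebra N' (free_events N E)"
  using assms sets_eq_imp_space_eq[OF assms(2)] unfolding subalgebra_def
  by (subst sets_free_events[OF assms(1)]) (auto simp: free_events_def space_measure_of_conv)

definition quantize :: "complex \<Rightarrow> int \<times> int" where
  "quantize z = (\<lfloor>Re z\<rfloor>, \<lfloor>Im z\<rfloor>)"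

lemma quantize_measurable [measurable]: "quantize \<in> borel \<rightarrow>\<^sub>M count_space UNIV"
  unfolding quantize_def by measurable

lemma quantize_eq_imp: "quantize z = quantize z' \<Longrightarrow> cmod (z - z') \<le> 2"
proof -
  assume "quantize z = quantize z'"
  then have "\<bar>Re (z - z')\<bar> \<le> 1" "\<bar>Im (z - z')\<bar> \<le> 1"
    unfolding quantize_def by (simp, linarith)+
  then show ?thesis using cmod_le[of "z - z'"] by linarith
qed

lemma quantize_dist_le: "sqrt (lat_dist2 (quantize z) (quantize z')) \<le> cmod (z - z') + 4"
proof -
  define p where "p z = Complex (of_int (fst (quantize z))) (of_int (snd (quantize z)))" for z
  have d: "cmod (z - p z) \<le> 2" for z
  proof -
    have "\<bar>Re (z - p z)\<bar> \<le> 1" "\<bar>Im (z - p z)\<bar> \<le> 1" unfolding p_def quantize_def by (simp, linarith)+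
    then show ?thesis using cmod_le[of "z - p z"] by linarith
  qed
  have "sqrt (lat_dist2 (quantize z) (quantize z')) = cmod (p z - p z')"
    by (simp add: lat_dist2_def p_def cmod_def)
  also have "p z - p z' = (z - z') - (z - p z) + (z' - p z')" by simp
  also have "cmod \<dots> \<le> cmod (z - z') + cmod (z - p z) + cmod (z' - p z')"
    by (meson norm_triangle_ineq norm_triangle_ineq4 add_right_mono order_trans)
  finally show ?thesis using d[of z] d[of z'] by linarith
qed

lemma quantize_norm_le: "lat_norm2 (quantize z) \<le> 2 * (cmod z)\<^sup>2 + 4"
proof -
  have a: "(of_int \<lfloor>x\<rfloor>)\<^sup>2 \<le> 2 * x\<^sup>2 + 2" for x :: real
  proof -
    define y where "y = x - of_int \<lfloor>x\<rfloor>"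
    have y: "0 \<le> y" "y \<le> 1" unfolding y_def by linarith+
    have "y * y \<le> 1 * 1" using y by (intro mult_mono) auto
    moreover have "(x - y)\<^sup>2 \<le> 2 * x\<^sup>2 + 2 * (y * y)"
      using zero_le_power2[of "x + y"] by (simp add: power2_eq_square algebra_simps)
    ultimately show ?thesis by (simp add: y_def)
  qed
  show ?thesis
    using a[of "Re z"] a[of "Im z"] by (simp add: lat_norm2_def quantize_def cmod_power2)
qed

context parallel_miso_bc
begin

text \<open>Updating a coordinate that belongs to the block stays within, and does not enter, the
  extensional functions.\<close>

lemma free_of_space_block:
  "E \<subseteq> block_entries K M n \<Longrightarrow> free_of E (\<lambda>g. g \<in> space (block_space n))"
  unfolding free_of_def block_space_def space_PiM
  by (auto simp: PiE_def extensional_def)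

text \<open>The discs are removed one entry at a time. As centres and radii are free of all listed
  entries, the indicators of the remaining discs can be moved into the weight, so the areas multiply
  although the entries may be dependent.\<close>

lemma small_balls_estimate:
  obtains c :: real where "0 < c"
    and "\<And>n S (e :: 'i \<Rightarrow> entry) (\<psi> :: (entry \<Rightarrow> complex) \<Rightarrow> ennreal) ce r. finite S \<Longrightarrow> inj_on e S \<Longrightarrow>
      e ` S \<subseteq> block_entries K M n \<Longrightarrow>
      \<psi> \<in> borel_measurable (block_space n) \<Longrightarrow>
      (\<And>i. i \<in> S \<Longrightarrow> ce i \<in> borel_measurable (block_space n)) \<Longrightarrow>
      (\<And>i. i \<in> S \<Longrightarrow> r i \<in> borel_measurable (block_space n)) \<Longrightarrow> (\<And>i g. 0 \<le> r i g) \<Longrightarrow>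
      free_of (e ` S) \<psi> \<Longrightarrow> (\<And>i. i \<in> S \<Longrightarrow> free_of (e ` S) (ce i)) \<Longrightarrow> (\<And>i. i \<in> S \<Longrightarrow> free_of (e ` S) (r i)) \<Longrightarrow>
      (\<integral>\<^sup>+g. \<psi> g * (\<Prod>i\<in>S. indicator {z. cmod (z - ce i g) \<le> r i g} (g (e i))) \<partial>block_law n)
        \<le> (\<integral>\<^sup>+g. \<psi> g * (\<Prod>i\<in>S. ennreal (c * (r i g)\<^sup>2)) \<partial>block_law n)"
proof (rule small_ball_estimate)
  fix c :: real
  assume c: "0 < c"
    and step: "\<And>n e (\<psi> :: (entry \<Rightarrow> complex) \<Rightarrow> ennreal) ce r. e \<in> block_entries K M n \<Longrightarrow>
      \<psi> \<in> borel_measurable (block_space n) \<Longrightarrow> ce \<in> borel_measurable (block_space n) \<Longrightarrow>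
      r \<in> borel_measurable (block_space n) \<Longrightarrow> (\<And>g. 0 \<le> r g) \<Longrightarrow>
      free_of {e} \<psi> \<Longrightarrow> free_of {e} ce \<Longrightarrow> free_of {e} r \<Longrightarrow>
      (\<integral>\<^sup>+g. \<psi> g * indicator {z. cmod (z - ce g) \<le> r g} (g e) \<partial>block_law n)
        \<le> (\<integral>\<^sup>+g. \<psi> g * ennreal (c * (r g)\<^sup>2) \<partial>block_law n)"
  show thesis
  proof (rule that[OF c])
    fix n and S :: "'i set" and e :: "'i \<Rightarrow> entry" and \<psi> :: "(entry \<Rightarrow> complex) \<Rightarrow> ennreal"
      and ce :: "'i \<Rightarrow> (entry \<Rightarrow> complex) \<Rightarrow> complex" and r :: "'i \<Rightarrow> (entry \<Rightarrow> complex) \<Rightarrow> real"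
    assume "finite S" "inj_on e S"
      "e ` S \<subseteq> block_entries K M n"
      "\<psi> \<in> borel_measurable (block_space n)"
      "\<And>i. i \<in> S \<Longrightarrow> ce i \<in> borel_measurable (block_space n)"
      "\<And>i. i \<in> S \<Longrightarrow> r i \<in> borel_measurable (block_space n)" "\<And>i g. 0 \<le> r i g"
      "free_of (e ` S) \<psi>" "\<And>i. i \<in> S \<Longrightarrow> free_of (e ` S) (ce i)" "\<And>i. i \<in> S \<Longrightarrow> free_of (e ` S) (r i)"
    then show "(\<integral>\<^sup>+g. \<psi> g * (\<Prod>i\<in>S. indicator {z. cmod (z - ce i g) \<le> r i g} (g (e i))) \<partial>block_law n)
        \<le> (\<integral>\<^sup>+g. \<psi> g * (\<Prod>i\<in>S. ennreal (c * (r i g)\<^sup>2)) \<partial>block_law n)"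
    proof (induction S arbitrary: \<psi> rule: finite_induct)
      case (insert i S)
      note [measurable] = insert.prems(3) insert.prems(4)[of i] insert.prems(5)[of i]
      have m1 [measurable]: "ce j \<in> borel_measurable (block_space n)" "r j \<in> borel_measurable (block_space n)"
        if "j \<in> S" for j using insert.prems(4,5)[of j] that by auto
      have eS: "e j \<noteq> e i" if "j \<in> S" for j using inj_onD[OF insert.prems(1), of j i] insert.hyps that by auto
      have eB: "e j \<in> block_entries K M n" if "j \<in> S" for j using insert.prems(2) that by auto
      have ind [measurable]: "(\<lambda>g. indicator {z. cmod (z - ce j g) \<le> r j g} (g (e j)) :: ennreal)
          \<in> borel_measurable (block_space n)" if "j \<in> S" for j
      proof -
        have "(\<lambda>g. g (e j)) \<in> borel_measurable (block_space n)"
          unfolding block_space_def by (rule measurable_component_singleton) (rule eB[OF that])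
        then have [measurable]: "(\<lambda>g. g (e j) - ce j g) \<in> borel_measurable (block_space n)"
          by (rule borel_measurable_diff) (rule m1[OF that])
        have "Measurable.pred (block_space n) (\<lambda>g. cmod (g (e j) - ce j g) \<le> r j g)"
          unfolding pred_def
          by (rule borel_measurable_le[OF measurable_compose[OF _ borel_measurable_norm] m1(2)[OF that]])
            measurable
        then have "(\<lambda>g. if cmod (g (e j) - ce j g) \<le> r j g then 1 else 0 :: ennreal) \<in> borel_measurable (block_space n)"
          by measurable
        then show ?thesis by (simp add: indicator_def of_bool_def)
      qed
      let ?I = "\<lambda>g. \<Prod>j\<in>S. indicator {z. cmod (z - ce j g) \<le> r j g} (g (e j)) :: ennreal"
      have "(\<integral>\<^sup>+g. \<psi> g * (\<Prod>j\<in>insert i S. indicator {z. cmod (z - ce j g) \<le> r j g} (g (e j))) \<partial>block_law n)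
          = (\<integral>\<^sup>+g. (\<psi> g * ?I g) * indicator {z. cmod (z - ce i g) \<le> r i g} (g (e i)) \<partial>block_law n)"
        using insert.hyps by (simp add: mult_ac)
      also have "\<dots> \<le> (\<integral>\<^sup>+g. (\<psi> g * ?I g) * ennreal (c * (r i g)\<^sup>2) \<partial>block_law n)"
      proof (rule step)
        show "free_of {e i} (\<lambda>g. \<psi> g * ?I g)"
          unfolding free_of_def
        proof (intro allI ballI)
          fix g e' z assume "e' \<in> {e i}"
          then have e': "e' = e i" by simp
          have "\<psi> (g(e' := z)) = \<psi> g" using insert.prems(7) e' by (intro free_ofD) auto
          moreover have "?I (g(e' := z)) = ?I g"
          proof (rule prod.cong[OF refl])
            fix j assume j: "j \<in> S"
            have "ce j (g(e' := z)) = ce j g" "r j (g(e' := z)) = r j g"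
              using insert.prems(8,9)[of j] j e' by (auto intro: free_ofD)
            then show "indicator {za. cmod (za - ce j (g(e' := z))) \<le> r j (g(e' := z))} ((g(e' := z)) (e j))
                = (indicator {z. cmod (z - ce j g) \<le> r j g} (g (e j)) :: ennreal)"
              using eS[OF j] e' by simp
          qed
          ultimately show "\<psi> (g(e' := z)) * ?I (g(e' := z)) = \<psi> g * ?I g" by simp
        qed
        show "free_of {e i} (ce i)" "free_of {e i} (r i)"
          using insert.prems(8,9)[of i] by (auto simp: free_of_def)
      qed (use insert.prems in auto)
      also have "\<dots> = (\<integral>\<^sup>+g. (\<psi> g * ennreal (c * (r i g)\<^sup>2)) * ?I g \<partial>block_law n)"
        by (simp add: mult_ac)
      also have "\<dots> \<le> (\<integral>\<^sup>+g. (\<psi> g * ennreal (c * (r i g)\<^sup>2)) * (\<Prod>j\<in>S. ennreal (c * (r j g)\<^sup>2)) \<partial>block_law n)"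
      proof (rule insert.IH)
        have fi: "free_of (e ` insert i S) \<psi>" "free_of (e ` insert i S) (r i)" using insert.prems by auto
        show "free_of (e ` S) (\<lambda>g. \<psi> g * ennreal (c * (r i g)\<^sup>2))"
          unfolding free_of_def
        proof (intro allI ballI)
          fix g e' z assume "e' \<in> e ` S"
          then have "e' \<in> e ` insert i S" by auto
          then show "\<psi> (g(e' := z)) * ennreal (c * (r i (g(e' := z)))\<^sup>2) = \<psi> g * ennreal (c * (r i g)\<^sup>2)"
            using fi by (simp add: free_ofD)
        qed
        show "free_of (e ` S) (ce j)" "free_of (e ` S) (r j)" if "j \<in> S" for j
          using insert.prems(8,9)[of j] that by (auto simp: free_of_def)
        show "inj_on e S" using insert.prems(1) by (rule inj_on_subset) auto
        show "e ` S \<subseteq> block_entries K M n" using insert.prems(2) by auto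
        show "(\<lambda>g. \<psi> g * ennreal (c * (r i g)\<^sup>2)) \<in> borel_measurable (block_space n)" by measurable
      qed (use m1 insert.prems(6) in simp_all)
      finally show ?case using insert.hyps by (simp add: mult_ac)
    qed simp
  qed
qed

end

lemma pred_le_real [measurable (raw)]:
  fixes f g :: "'b \<Rightarrow> real"
  shows "f \<in> borel_measurable N \<Longrightarrow> g \<in> borel_measurable N \<Longrightarrow> Measurable.pred N (\<lambda>x. f x \<le> g x)"
  unfolding pred_def by (rule borel_measurable_le)

lemma prod_ennreal_mono:
  fixes f g :: "'i \<Rightarrow> real"
  assumes "\<And>i. i \<in> I \<Longrightarrow> f i \<le> g i" "\<And>i. i \<in> I \<Longrightarrow> 0 \<le> f i"
  shows "(\<Prod>i\<in>I. ennreal (f i)) \<le> (\<Prod>i\<in>I. ennreal (g i))"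
proof -
  have "0 \<le> g i" if "i \<in> I" for i using assms that order_trans by blast
  then show ?thesis
    using assms by (simp add: prod_ennreal prod_mono ennreal_leI)
qed

section \<open>Noiseless signals, their images at the users, and collisions\<close>

context parallel_miso_bc
begin

text \<open>Channel coefficients as functions of a realization \<open>g\<close> of the block instead
  of an outcome in \<open>\<Omega>\<close>.\<close>

abbreviation coeff :: "real \<Rightarrow> nat \<Rightarrow> nat \<Rightarrow> nat \<Rightarrow> nat \<Rightarrow> (entry \<Rightarrow> complex) \<Rightarrow> complex" where
  "coeff \<equiv> channel_coeff \<alpha> (\<lambda>e g. g e)"

definition slots :: "nat \<Rightarrow> (nat \<times> nat) set" where
  "slots n = {1..M} \<times> {1..n}"

lemma finite_slots [simp]: "finite (slots n)"
  by (simp add: slots_def)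

lemma card_slots: "card (slots n) = n * M"
  by (simp add: slots_def card_cartesian_product)

definition signal ::
  "real \<Rightarrow> ((entry \<Rightarrow> complex) \<Rightarrow> nat \<Rightarrow> nat \<Rightarrow> nat \<Rightarrow> complex) \<Rightarrow> nat \<Rightarrow> nat \<times> nat \<Rightarrow> (entry \<Rightarrow> complex) \<Rightarrow> complex" where
  "signal P X k i g = (\<Sum>j=1..K. coeff P k (fst i) (snd i) j g * X g (fst i) (snd i) j)"

definition image_at ::
  "real \<Rightarrow> nat \<Rightarrow> ((entry \<Rightarrow> complex) \<Rightarrow> nat \<Rightarrow> nat \<Rightarrow> nat \<Rightarrow> complex) \<Rightarrow> nat \<Rightarrow> (entry \<Rightarrow> complex) \<Rightarrow> nat \<times> nat \<Rightarrow> int \<times> int" where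
  "image_at P n X k g = (\<lambda>i\<in>slots n. quantize (signal P X k i g))"

text \<open>The transmitter's ignorance of the errors, stated on the whole block, so that inputs can
  stand next to signals and channel events on one space.\<close>

definition estimate_input :: "nat \<Rightarrow> ((entry \<Rightarrow> complex) \<Rightarrow> nat \<Rightarrow> nat \<Rightarrow> nat \<Rightarrow> complex) \<Rightarrow> bool" where
  "estimate_input n X \<longleftrightarrow> (\<forall>m\<in>{1..M}. \<forall>t\<in>{1..n}. \<forall>j\<in>{1..K}.
     (\<lambda>g. X g m t j) \<in> borel_measurable (block_space n) \<and> free_of (error_entries K M n) (\<lambda>g. X g m t j))"

definition user_errors :: "nat \<Rightarrow> nat set \<Rightarrow> entry set" where
  "user_errors n U = {Error k m t j | k m t j. k \<in> U \<and> m \<in> {1..M} \<and> t \<in> {1..n} \<and> j \<in> {1..K}}"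

lemma user_errors_subset: "U \<subseteq> {1..K} \<Longrightarrow> user_errors n U \<subseteq> error_entries K M n"
  by (auto simp: user_errors_def error_entries_def)

lemma user_errors_block: "U \<subseteq> {1..K} \<Longrightarrow> user_errors n U \<subseteq> block_entries K M n"
  using user_errors_subset by (auto simp: block_entries_def)

lemma entry_measurable:
  "e \<in> block_entries K M n \<Longrightarrow> (\<lambda>g. g e) \<in> borel_measurable (block_space n)"
  unfolding block_space_def by (rule measurable_component_singleton)

lemma coeff_measurable:
  assumes "k \<in> {1..K}" "i \<in> slots n" "j \<in> {1..K}"
  shows "coeff P k (fst i) (snd i) j \<in> borel_measurable (block_space n)"
proof -
  have "Estimate k (fst i) (snd i) j \<in> block_entries K M n" "Error k (fst i) (snd i) j \<in> block_entries K M n"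
    using assms by (auto simp: block_entries_def estimate_entries_def error_entries_def slots_def)
  note [measurable] = entry_measurable[OF this(1)] entry_measurable[OF this(2)]
  show ?thesis unfolding channel_coeff_def[abs_def] by measurable
qed

lemma signal_measurable:
  assumes "estimate_input n X" "k \<in> {1..K}" "i \<in> slots n"
  shows "signal P X k i \<in> borel_measurable (block_space n)"
  unfolding signal_def[abs_def]
  by (intro borel_measurable_sum borel_measurable_times coeff_measurable)
    (use assms in \<open>auto simp: estimate_input_def slots_def\<close>)

lemma image_at_measurable:
  assumes "estimate_input n X" "k \<in> {1..K}" "i \<in> slots n"
  shows "(\<lambda>g. image_at P n X k g i) \<in> block_space n \<rightarrow>\<^sub>M count_space UNIV"
  using measurable_compose[OF signal_measurable[OF assms] quantize_measurable] assms
  by (simp add: image_at_def)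

lemma coeff_free: "k \<notin> U \<Longrightarrow> free_of (user_errors n U) (coeff P k m t j)"
  by (auto simp: free_of_def user_errors_def channel_coeff_def)

lemma input_free:
  assumes "estimate_input n X" "U \<subseteq> {1..K}" "i \<in> slots n" "j \<in> {1..K}"
  shows "free_of (user_errors n U) (\<lambda>g. X g (fst i) (snd i) j)"
  using assms by (auto simp: estimate_input_def slots_def intro!: free_of_subset[OF _ user_errors_subset])

lemma signal_free:
  assumes "estimate_input n X" "U \<subseteq> {1..K}" "k \<notin> U" "i \<in> slots n"
  shows "free_of (user_errors n U) (signal P X k i)"
  unfolding free_of_def signal_def
  using coeff_free[OF assms(3)] input_free[OF assms(1,2,4)]
  by (auto simp: free_of_def intro!: sum.cong)

lemma image_at_free:
  assumes "estimate_input n X" "U \<subseteq> {1..K}" "k \<notin> U"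
  shows "free_of (user_errors n U) (image_at P n X k)"
  using signal_free[OF assms] by (auto simp: free_of_def image_at_def intro!: restrict_ext)

text \<open>The signal is affine in each error entry of its user, with slope the error scale times
  the input symbol, since the input does not react to the entry. A coincidence of two images
  therefore confines such an entry to a disc.\<close>

lemma signal_update:
  assumes "estimate_input n X" "u \<in> {1..K}" "i \<in> slots n" "j \<in> {1..K}"
  shows "signal P X u i g = signal P X u i (g(Error u (fst i) (snd i) j := 0))
    + complex_of_real (sqrt (P powr - \<alpha> u (fst i))) * g (Error u (fst i) (snd i) j) * X g (fst i) (snd i) j"
proof -
  let ?e = "Error u (fst i) (snd i) j" and ?s = "complex_of_real (sqrt (P powr - \<alpha> u (fst i)))"
  have "?e \<in> user_errors n {u}" using assms by (auto simp: user_errors_def slots_def)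
  then have X: "X (g(?e := 0)) (fst i) (snd i) l = X g (fst i) (snd i) l" if "l \<in> {1..K}" for l
    using input_free[OF assms(1) _ assms(3) that, of "{u}"] assms(2) by (auto simp: free_of_def)
  have "signal P X u i g = (\<Sum>l=1..K. coeff P u (fst i) (snd i) l (g(?e := 0)) * X (g(?e := 0)) (fst i) (snd i) l
      + (if l = j then ?s * g ?e * X g (fst i) (snd i) j else 0))"
    unfolding signal_def using X by (intro sum.cong) (auto simp: channel_coeff_def algebra_simps)
  also have "\<dots> = signal P X u i (g(?e := 0)) + ?s * g ?e * X g (fst i) (snd i) j"
    unfolding sum.distrib signal_def using assms(4) by simp
  finally show ?thesis .
qed

text \<open>Bounds assumed coefficient by coefficient are collected over the finitely many
  coefficients of a block into one almost sure statement about its law. The constants depend neither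
  on \<open>n\<close> nor on \<open>P\<close>.\<close>

lemma coeff_bounds:
  obtains c C P0 :: real where "0 < c" "1 \<le> C" "1 \<le> P0"
    and "\<And>P n. P0 \<le> P \<Longrightarrow> AE g in block_law n. \<forall>k\<in>{1..K}. \<forall>i\<in>slots n. \<forall>j\<in>{1..K}.
        c \<le> cmod (coeff P k (fst i) (snd i) j g) \<and> cmod (coeff P k (fst i) (snd i) j g) \<le> C"
proof -
  let ?B = "\<lambda>c C P. \<forall>k\<in>{1..K}. \<forall>m\<in>{1..M}. \<forall>t\<ge>1. \<forall>j\<in>{1..K}.
      AE \<omega> in \<Omega>. c \<le> cmod (channel_coeff \<alpha> H P k m t j \<omega>) \<and> cmod (channel_coeff \<alpha> H P k m t j \<omega>) \<le> C"
  obtain c C where c: "0 < c" and ev: "\<forall>\<^sub>F P in at_top. ?B c C P"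
    using coeff_bounded by (elim exE conjE)
  from ev have "\<exists>P1. \<forall>P\<ge>P1. ?B c C P"
    unfolding eventually_at_top_linorder .
  then obtain P1 where P1: "\<forall>P\<ge>P1. ?B c C P" ..
  show ?thesis
  proof (rule that[of c "max C 1" "max P1 1"])
    fix P n assume P: "max P1 1 \<le> P"
    let ?Q = "\<lambda>g. \<forall>k\<in>{1..K}. \<forall>i\<in>slots n. \<forall>j\<in>{1..K}.
        c \<le> cmod (coeff P k (fst i) (snd i) j g) \<and> cmod (coeff P k (fst i) (snd i) j g) \<le> max C 1"
    have eq: "coeff P k (fst i) (snd i) j (block n \<omega>) = channel_coeff \<alpha> H P k (fst i) (snd i) j \<omega>"
      if "k\<in>{1..K}" "i\<in>slots n" "j\<in>{1..K}" for k i j \<omega>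
      using that by (auto simp: channel_coeff_def block_def slots_def block_entries_def estimate_entries_def error_entries_def)
    have "AE \<omega> in \<Omega>. ?Q (block n \<omega>)"
    proof (intro AE_finite_allI)
      fix k i j assume kij: "k\<in>{1..K}" "i\<in>slots n" "j\<in>{1..K}"
      have "AE \<omega> in \<Omega>. c \<le> cmod (channel_coeff \<alpha> H P k (fst i) (snd i) j \<omega>)
          \<and> cmod (channel_coeff \<alpha> H P k (fst i) (snd i) j \<omega>) \<le> C"
        by (rule P1[rule_format]) (use P kij in \<open>simp_all add: slots_def mem_Times_iff\<close>)
      then show "AE \<omega> in \<Omega>. c \<le> cmod (coeff P k (fst i) (snd i) j (block n \<omega>)) \<and> cmod (coeff P k (fst i) (snd i) j (block n \<omega>)) \<le> max C 1"
        by eventually_elim (use eq[OF kij] in \<open>simp add: le_max_iff_disj\<close>)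
    qed auto
    moreover have "{g\<in>space (block_space n). ?Q g} \<in> sets (block_space n)"
    proof -
      have pm: "Measurable.pred (block_space n) (\<lambda>g. c \<le> cmod (coeff P k (fst i) (snd i) j g) \<and> cmod (coeff P k (fst i) (snd i) j g) \<le> max C 1)"
        if "k \<in> {1..K}" "i \<in> slots n" "j \<in> {1..K}" for k i j
        using coeff_measurable[OF that, measurable] by measurable
      show ?thesis unfolding pred_def[symmetric]
        by (intro pred_intros_finite(3) finite_slots finite_atLeastAtMost pm)
    qed
    ultimately show "AE g in block_law n. ?Q g"
      unfolding block_law_def by (intro AE_distr_iff[OF block_measurable, THEN iffD2])
  qed (use c in auto)
qed

text \<open>Equal images at \<open>u\<close> put the two signals within distance 2, which confines
  one error entry of \<open>u\<close> per slot to a disc with radius inverse to the difference of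
  the inputs on its antenna. Distant images at \<open>v\<close> force this difference to be large on
  some antenna. As \<open>v\<close> lies outside \<open>U\<close>, its images, the inputs and
  \<open>A\<close> are all free of the errors of \<open>U\<close>, so the disc estimate applies with
  them as parameters.\<close>

lemma alignment_probability:
  obtains \<beta> P0 :: real where "1 \<le> \<beta>" "1 \<le> P0"
    and "\<And>P n u v U X X' A. P0 \<le> P \<Longrightarrow> U \<subseteq> {1..K} \<Longrightarrow> u \<in> U \<Longrightarrow> v \<in> {1..K} - U \<Longrightarrow>
      estimate_input n X \<Longrightarrow> estimate_input n X' \<Longrightarrow>
      A \<in> sets (free_events (block_space n) (user_errors n U)) \<Longrightarrow>
      emeasure (block_law n) (A \<inter> {g\<in>space (block_space n). image_at P n X u g = image_at P n X' u g})
      \<le> (\<integral>\<^sup>+g. indicator A g * (\<Prod>i\<in>slots n. ennreal (alignment (\<beta> * P powr \<alpha> u (fst i))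
            (image_at P n X' v g i) (image_at P n X v g i))) \<partial>block_law n)"
proof (rule coeff_bounds)
  fix c0 C P0 :: real
  assume C: "1 \<le> C" and P0: "1 \<le> P0"
    and bnd: "\<And>P n. P0 \<le> P \<Longrightarrow> AE g in block_law n. \<forall>k\<in>{1..K}. \<forall>i\<in>slots n. \<forall>j\<in>{1..K}.
        c0 \<le> cmod (coeff P k (fst i) (snd i) j g) \<and> cmod (coeff P k (fst i) (snd i) j g) \<le> C"
  show thesis
  proof (rule small_balls_estimate[where 'i="nat \<times> nat"])
  fix c :: real
  assume c: "0 < c"
    and balls: "\<And>n S (e :: nat \<times> nat \<Rightarrow> entry) (\<psi> :: (entry \<Rightarrow> complex) \<Rightarrow> ennreal) ce r. finite S \<Longrightarrow> inj_on e S \<Longrightarrow>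
      e ` S \<subseteq> block_entries K M n \<Longrightarrow>
      \<psi> \<in> borel_measurable (block_space n) \<Longrightarrow>
      (\<And>i. i \<in> S \<Longrightarrow> ce i \<in> borel_measurable (block_space n)) \<Longrightarrow>
      (\<And>i. i \<in> S \<Longrightarrow> r i \<in> borel_measurable (block_space n)) \<Longrightarrow> (\<And>i g. 0 \<le> r i g) \<Longrightarrow>
      free_of (e ` S) \<psi> \<Longrightarrow> (\<And>i. i \<in> S \<Longrightarrow> free_of (e ` S) (ce i)) \<Longrightarrow> (\<And>i. i \<in> S \<Longrightarrow> free_of (e ` S) (r i)) \<Longrightarrow>
      (\<integral>\<^sup>+g. \<psi> g * (\<Prod>i\<in>S. indicator {z. cmod (z - ce i g) \<le> r i g} (g (e i))) \<partial>block_law n)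
        \<le> (\<integral>\<^sup>+g. \<psi> g * (\<Prod>i\<in>S. ennreal (c * (r i g)\<^sup>2)) \<partial>block_law n)"
  \<comment> \<open>Squared distances above 36 mean distances above 6, where the quantization error
    4 is dominated. The other constant is \<open>4 * c\<close> from the area of the disc times
    \<open>9 * K\<^sup>2 * C\<^sup>2\<close> from the choice of the antenna.\<close>
  define b where "b = max 36 (36 * c * (real K)\<^sup>2 * C\<^sup>2)"
  have K: "1 \<le> real K" using users by simp
  show thesis
  proof (rule that[of b P0])
    show "1 \<le> b" by (simp add: b_def)
    show "1 \<le> P0" by fact
    fix P n u v U X X' A
    assume P: "P0 \<le> P" and U: "U \<subseteq> {1..K}" "u \<in> U" "v \<in> {1..K} - U"
      and X: "estimate_input n X" and X': "estimate_input n X'"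
      and A: "A \<in> sets (free_events (block_space n) (user_errors n U))"
    have uK: "u \<in> {1..K}" and vK: "v \<in> {1..K}" "v \<notin> U" using U by auto
    have Pp: "0 < P" "1 \<le> P" using P P0 by auto
    let ?N = "block_space n" and ?E = "user_errors n U"
    have frS: "free_of ?E (\<lambda>g. g \<in> space ?N)"
      by (rule free_of_space_block[OF user_errors_block[OF U(1)]])
    have A': "A \<in> sets ?N" "free_of ?E (\<lambda>g. g \<in> A)"
      using A unfolding sets_free_events[OF frS] by auto
    define \<Delta> where "\<Delta> i j g = X g (fst i) (snd i) j - X' g (fst i) (snd i) j" for i j g
    have \<Delta>m: "\<Delta> i j \<in> borel_measurable ?N" if "i \<in> slots n" "j \<in> {1..K}" for i j
      unfolding \<Delta>_def[abs_def] using X X' that by (intro borel_measurable_diff) (auto simp: estimate_input_def slots_def)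
    have \<Delta>f: "\<Delta> i j (g(e := z)) = \<Delta> i j g" if "i \<in> slots n" "j \<in> {1..K}" "e \<in> ?E" for i j g e z
      unfolding \<Delta>_def using free_ofD[OF input_free[OF X U(1) that(1,2)] that(3)] free_ofD[OF input_free[OF X' U(1) that(1,2)] that(3)]
      by simp
    define d where "d i g = lat_dist2 (image_at P n X' v g i) (image_at P n X v g i)" for i g
    have dm: "d i \<in> borel_measurable ?N" if "i \<in> slots n" for i
    proof -
      note [measurable] = image_at_measurable[OF X vK(1) that] image_at_measurable[OF X' vK(1) that]
      show ?thesis unfolding d_def[abs_def] by measurable
    qed
    have df: "d i (g(e := z)) = d i g" if "e \<in> ?E" for i g e z
      unfolding d_def using free_ofD[OF image_at_free[OF X U(1) vK(2)] that] free_ofD[OF image_at_free[OF X' U(1) vK(2)] that]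
      by simp
    define \<beta> where "\<beta> i = b * P powr \<alpha> u (fst i)" for i :: "nat \<times> nat"
    have \<beta>36: "36 \<le> \<beta> i" if "i \<in> slots n" for i
    proof -
      have "0 \<le> \<alpha> u (fst i)" using quality[OF uK, of "fst i"] that by (auto simp: slots_def)
      then have "1 \<le> P powr \<alpha> u (fst i)" using Pp by (simp add: ge_one_powr_ge_zero)
      moreover have "36 \<le> b" by (simp add: b_def)
      ultimately have "36 * 1 \<le> b * P powr \<alpha> u (fst i)" by (intro mult_mono) auto
      then show ?thesis by (simp add: \<beta>_def)
    qed
    \<comment> \<open>Some antenna has to carry a \<open>K\<close>-th share of the image distance at
      \<open>v\<close>; the factor 3 leaves room for the quantization error.\<close>
    define big where "big i j g \<longleftrightarrow> j \<in> {1..K} \<and> sqrt (d i g) \<le> 3 * real K * C * cmod (\<Delta> i j g)" for i j g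
    have bigm: "Measurable.pred ?N (big i j)" if "i \<in> slots n" for i j
    proof (cases "j \<in> {1..K}")
      case True
      have "big i j = (\<lambda>g. sqrt (d i g) \<le> 3 * real K * C * cmod (\<Delta> i j g))"
        using True by (intro ext) (simp add: big_def)
      also have "Measurable.pred ?N \<dots>"
        using dm[OF that] \<Delta>m[OF that True]
        by (intro pred_le_real borel_measurable_times borel_measurable_const measurable_compose[OF _ borel_measurable_norm]
          measurable_compose[OF _ borel_measurable_sqrt]) auto
      finally show ?thesis .
    next
      case False
      then have "big i j = (\<lambda>g. False)" by (intro ext) (auto simp: big_def)
      then show ?thesis by simp
    qed
    have bigf: "big i j (g(e := z)) = big i j g" if "i \<in> slots n" "e \<in> ?E" for i j g e z
      using \<Delta>f[OF that(1) _ that(2), of j] df[OF that(2)] unfolding big_def by auto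
    \<comment> \<open>The antenna used in slot \<open>i\<close>. The value 0 marks slots with images
      so close that only the trivial factor 1 is claimed, and \<open>Suc K\<close> the case that no
      antenna qualifies, which has probability 0.\<close>
    define jx where "jx i g = (if d i g \<le> \<beta> i then 0 else if \<exists>j\<in>{1..K}. big i j g then (LEAST j. big i j g) else Suc K)" for i g
    have jxm: "jx i \<in> ?N \<rightarrow>\<^sub>M count_space UNIV" if "i \<in> slots n" for i
    proof -
      note [measurable] = dm[OF that] bigm[OF that]
      show ?thesis unfolding jx_def[abs_def] by measurable
    qed
    have jxf: "jx i (g(e := z)) = jx i g" if "i \<in> slots n" "e \<in> ?E" for i g e z
      unfolding jx_def using bigf[OF that] df[OF that(2)] by simp
    \<comment> \<open>The disc estimate needs a fixed entry in each slot, but the antenna depends on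
      \<open>g\<close>. So the space is cut into finitely many patterns \<open>J\<close> of
      antennas.\<close>
    define Js where "Js = slots n \<rightarrow>\<^sub>E {0..K}"
    have Js: "finite Js" by (simp add: Js_def finite_PiE)
    define pat where "pat J g \<longleftrightarrow> (\<forall>i\<in>slots n. jx i g = J i)" for J :: "nat \<times> nat \<Rightarrow> nat" and g
    have patm: "Measurable.pred ?N (pat J)" for J
      unfolding pat_def[abs_def]
    proof (rule pred_intros_finite(3)[OF finite_slots])
      fix i assume "i \<in> slots n"
      from jxm[OF this, measurable] show "Measurable.pred ?N (\<lambda>g. jx i g = J i)" by measurable
    qed
    have patf: "pat J (g(e := z)) = pat J g" if "e \<in> ?E" for J g e z
      unfolding pat_def using jxf[OF _ that] by simp
    define same where "same g \<longleftrightarrow> image_at P n X u g = image_at P n X' u g" for g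
    define S where "S J = {i\<in>slots n. J i \<noteq> 0}" for J :: "nat \<times> nat \<Rightarrow> nat"
    define e where "e J i = Error u (fst i) (snd i) (J i)" for J :: "nat \<times> nat \<Rightarrow> nat" and i
    define s where "s i = sqrt (P powr - \<alpha> u (fst i))" for i :: "nat \<times> nat"
    have s: "0 < s i" for i using Pp by (simp add: s_def)
    \<comment> \<open>The disc for the error entry: its centre is the zero of the affine signal
      difference, and its radius is where this difference has modulus 2.\<close>
    define ce where "ce J i g = - (signal P X u i (g(e J i := 0)) - signal P X' u i (g(e J i := 0)))
        / (complex_of_real (s i) * \<Delta> i (J i) g)" for J i g
    define r where "r J i g = 2 / (s i * cmod (\<Delta> i (J i) g))" for J i g
    define \<tau> where "\<tau> g = (\<Prod>i\<in>slots n. ennreal (alignment (\<beta> i) (image_at P n X' v g i) (image_at P n X v g i)))" for g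
    have JK: "J i \<in> {1..K}" if "J \<in> Js" "i \<in> S J" for J i
    proof -
      have "i \<in> slots n" "J i \<noteq> 0" using that(2) by (simp_all add: S_def)
      moreover have "J i \<in> {0..K}"
        using that(1)[unfolded Js_def] calculation(1) by (rule PiE_mem)
      ultimately show ?thesis by simp
    qed
    have Ssl: "i \<in> slots n" if "i \<in> S J" for J i using that by (simp add: S_def)
    have eE: "e J ` S J \<subseteq> ?E" if "J \<in> Js" for J
    proof (rule image_subsetI)
      fix i assume i: "i \<in> S J"
      have "u \<in> U \<and> fst i \<in> {1..M} \<and> snd i \<in> {1..n} \<and> J i \<in> {1..K}"
        using Ssl[OF i] JK[OF that i] U(2) by (simp add: slots_def mem_Times_iff)
      then show "e J i \<in> ?E" unfolding e_def user_errors_def by blast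
    qed
    have big_if: "0 < d i g \<and> cmod (\<Delta> i (J i) g) > 0 \<and> d i g \<le> 9 * (real K)\<^sup>2 * C\<^sup>2 * (cmod (\<Delta> i (J i) g))\<^sup>2 \<and> \<beta> i < d i g"
      if "pat J g" "J \<in> Js" "i \<in> S J" for J i g
    proof -
      have i: "i \<in> slots n" using Ssl that by auto
      have jx: "jx i g = J i" using that i by (simp add: pat_def)
      have J: "J i \<noteq> 0" "J i \<noteq> Suc K" using JK[OF that(2,3)] by auto
      have b1: "\<beta> i < d i g" using jx J by (auto simp: jx_def split: if_splits)
      have "\<exists>j. big i j g" "J i = (LEAST j. big i j g)"
        using jx J by (auto simp: jx_def split: if_splits)
      then have "big i (J i) g" by (auto intro: LeastI)
      then have b2: "sqrt (d i g) \<le> 3 * real K * C * cmod (\<Delta> i (J i) g)" by (simp add: big_def)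
      have d0: "0 < d i g" using b1 \<beta>36[OF i] by linarith
      have "cmod (\<Delta> i (J i) g) > 0"
      proof (rule ccontr)
        assume "\<not> cmod (\<Delta> i (J i) g) > 0"
        then have "sqrt (d i g) \<le> 0" using b2 by simp
        then show False using d0 by simp
      qed
      moreover have "d i g = (sqrt (d i g))\<^sup>2" using d0 by simp
      moreover have "(sqrt (d i g))\<^sup>2 \<le> (3 * real K * C * cmod (\<Delta> i (J i) g))\<^sup>2"
        using b2 d0 by (intro power_mono) auto
      ultimately show ?thesis using d0 b1 by (simp add: power_mult_distrib)
    qed
    define ball where "ball J g = (\<Prod>i\<in>S J. indicator {z. cmod (z - ce J i g) \<le> r J i g} (g (e J i)) :: ennreal)" for J g
    have ball1: "ball J g = 1" if "J \<in> Js" "pat J g" "same g" for J g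
      unfolding ball_def
    proof (rule prod.neutral, rule ballI)
      fix i assume i: "i \<in> S J"
      have "quantize (signal P X u i g) = quantize (signal P X' u i g)"
        using fun_cong[OF that(3)[unfolded same_def], of i] Ssl[OF i] by (simp add: image_at_def)
      then have 2: "cmod (signal P X u i g - signal P X' u i g) \<le> 2" by (rule quantize_eq_imp)
      let ?D = "complex_of_real (s i) * \<Delta> i (J i) g"
      have D: "?D \<noteq> 0" using big_if[OF that(2,1) i] s[of i] by auto
      have "signal P X u i g - signal P X' u i g = ?D * (g (e J i) - ce J i g)"
        using signal_update[OF X uK Ssl[OF i] JK[OF that(1) i], of P g]
          signal_update[OF X' uK Ssl[OF i] JK[OF that(1) i], of P g] D
        unfolding ce_def e_def[symmetric] s_def[symmetric]
        by (simp add: field_simps \<Delta>_def)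
      then have "cmod ?D * cmod (g (e J i) - ce J i g) \<le> 2" using 2 by (simp add: norm_mult)
      then have "cmod (g (e J i) - ce J i g) \<le> r J i g"
        using D s[of i] by (simp add: r_def norm_mult field_simps)
      then show "indicator {z. cmod (z - ce J i g) \<le> r J i g} (g (e J i)) = (1::ennreal)" by simp
    qed
    have vol: "(\<Prod>i\<in>S J. ennreal (c * (r J i g)\<^sup>2)) \<le> \<tau> g" if "J \<in> Js" "pat J g" for J g
    proof -
      have al: "alignment (\<beta> i) (image_at P n X' v g i) (image_at P n X v g i) = (if d i g \<le> \<beta> i then 1 else \<beta> i / d i g)" for i
        by (simp add: alignment_def d_def)
      have "(\<Prod>i\<in>S J. ennreal (c * (r J i g)\<^sup>2)) \<le> (\<Prod>i\<in>S J. ennreal (alignment (\<beta> i) (image_at P n X' v g i) (image_at P n X v g i)))"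
      proof (rule prod_ennreal_mono)
        fix i assume i: "i \<in> S J"
        note B = big_if[OF that(2,1) i]
        have "c * (r J i g)\<^sup>2 = 4 * c / ((s i)\<^sup>2 * (cmod (\<Delta> i (J i) g))\<^sup>2)"
          by (simp add: r_def power_divide power_mult_distrib)
        also have "\<dots> \<le> 4 * c * (9 * (real K)\<^sup>2 * C\<^sup>2) / ((s i)\<^sup>2 * d i g)"
        proof -
          have "4 * c * d i g \<le> 4 * c * (9 * (real K)\<^sup>2 * C\<^sup>2 * (cmod (\<Delta> i (J i) g))\<^sup>2)"
            using B c by (intro mult_left_mono) auto
          then show ?thesis using B s[of i] by (simp add: divide_simps)
        qed
        also have "\<dots> = (36 * c * (real K)\<^sup>2 * C\<^sup>2) * P powr \<alpha> u (fst i) / d i g"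
          using Pp by (simp add: s_def powr_minus field_simps)
        also have "\<dots> \<le> \<beta> i / d i g"
          unfolding \<beta>_def b_def using B by (intro divide_right_mono mult_right_mono) auto
        finally show "c * (r J i g)\<^sup>2 \<le> alignment (\<beta> i) (image_at P n X' v g i) (image_at P n X v g i)"
          unfolding al using B by auto
      qed (use c in auto)
      also have "\<dots> = \<tau> g"
        unfolding \<tau>_def
      proof (rule prod.mono_neutral_left)
        show "\<forall>i\<in>slots n - S J. ennreal (alignment (\<beta> i) (image_at P n X' v g i) (image_at P n X v g i)) = 1"
        proof
          fix i assume "i \<in> slots n - S J"
          then have "jx i g = 0" using that(2) by (auto simp: pat_def S_def)
          moreover have "\<not> big i 0 g" by (simp add: big_def)
          then have "(LEAST j. big i j g) \<noteq> 0" if ex: "\<exists>j\<in>{1..K}. big i j g"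
          proof -
            obtain j where "big i j g" using ex by blast
            then have "big i (LEAST j. big i j g) g" by (rule LeastI)
            with \<open>\<not> big i 0 g\<close> show ?thesis by (intro notI) simp
          qed
          ultimately have "d i g \<le> \<beta> i" by (auto simp: jx_def split: if_splits)
          then show "ennreal (alignment (\<beta> i) (image_at P n X' v g i) (image_at P n X v g i)) = 1" unfolding al by simp
        qed
      qed (auto simp: S_def)
      finally show ?thesis .
    qed
    \<comment> \<open>If no antenna qualified, the signals at \<open>v\<close> would differ by at
      most a third of the image distance; adding the quantization error 4 would keep this distance
      at 6 or below, against the lower bound outside the trivial slots.\<close>
    have cover: "AE g in block_law n. \<exists>J\<in>Js. pat J g"
      using bnd[OF P, of n]
    proof eventually_elim
      fix g assume g: "\<forall>k\<in>{1..K}. \<forall>i\<in>slots n. \<forall>j\<in>{1..K}. c0 \<le> cmod (coeff P k (fst i) (snd i) j g) \<and> cmod (coeff P k (fst i) (snd i) j g) \<le> C"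
      have "jx i g \<le> K" if i: "i \<in> slots n" for i
      proof (cases "d i g \<le> \<beta> i")
        case False
        then have d36: "36 < d i g" using \<beta>36[OF i] by linarith
        have "\<exists>j\<in>{1..K}. big i j g"
        proof (rule ccontr)
          assume no: "\<not> (\<exists>j\<in>{1..K}. big i j g)"
          have "sqrt (d i g) \<le> cmod (signal P X' v i g - signal P X v i g) + 4"
            unfolding d_def using quantize_dist_le[of "signal P X' v i g" "signal P X v i g"] i by (simp add: image_at_def)
          also have "signal P X' v i g - signal P X v i g = - (\<Sum>j=1..K. coeff P v (fst i) (snd i) j g * \<Delta> i j g)"
            by (simp add: signal_def \<Delta>_def sum_subtractf algebra_simps)
          also have "cmod \<dots> \<le> (\<Sum>j=1..K. cmod (coeff P v (fst i) (snd i) j g * \<Delta> i j g))"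
            by (simp add: norm_sum)
          also have "\<dots> \<le> (\<Sum>j=1..K. sqrt (d i g) / (3 * real K))"
          proof (rule sum_mono)
            fix j assume j: "j \<in> {1..K}"
            then have "\<not> big i j g" using no by blast
            then have "3 * real K * C * cmod (\<Delta> i j g) < sqrt (d i g)" using j by (simp add: big_def)
            then have "C * cmod (\<Delta> i j g) \<le> sqrt (d i g) / (3 * real K)" using K by (simp add: field_simps)
            moreover have "cmod (coeff P v (fst i) (snd i) j g * \<Delta> i j g) \<le> C * cmod (\<Delta> i j g)"
              using g vK(1) i j by (auto simp: norm_mult intro!: mult_right_mono)
            ultimately show "cmod (coeff P v (fst i) (snd i) j g * \<Delta> i j g) \<le> sqrt (d i g) / (3 * real K)" by linarith
          qed
          also have "\<dots> = sqrt (d i g) / 3" using K by simp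
          finally have "sqrt (d i g) \<le> 6" by simp
          then have "d i g \<le> 6\<^sup>2" by (rule sqrt_le_D)
          then show False using d36 by simp
        qed
        then obtain j where j: "j \<in> {1..K}" "big i j g" by auto
        then have "(LEAST j. big i j g) \<le> j" by (intro Least_le)
        then show ?thesis using False j by (auto simp: jx_def)
      qed (simp add: jx_def)
      then show "\<exists>J\<in>Js. pat J g"
        by (intro bexI[of _ "\<lambda>i\<in>slots n. jx i g"]) (auto simp: pat_def Js_def)
    qed
    have Sm: "{g\<in>space ?N. same g} \<in> sets ?N"
    proof -
      have "{g\<in>space ?N. same g} = {g\<in>space ?N. \<forall>i\<in>slots n. image_at P n X u g i = image_at P n X' u g i}"
        unfolding same_def image_at_def by (auto simp: fun_eq_iff restrict_def)
      also have "\<dots> \<in> sets ?N"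
      proof -
        have "Measurable.pred ?N (\<lambda>g. image_at P n X u g i = image_at P n X' u g i)" if "i \<in> slots n" for i
          using image_at_measurable[OF X uK that, measurable] image_at_measurable[OF X' uK that, measurable] by measurable
        then show ?thesis unfolding pred_def[symmetric] by (intro pred_intros_finite(3)) auto
      qed
      finally show ?thesis .
    qed
    have rm: "r J i \<in> borel_measurable ?N" if "J \<in> Js" "i \<in> S J" for J i
      using \<Delta>m[OF Ssl[OF that(2)] JK[OF that], measurable] unfolding r_def[abs_def] by measurable
    have cem: "ce J i \<in> borel_measurable ?N" if "J \<in> Js" "i \<in> S J" for J i
    proof -
      have upd [measurable]: "(\<lambda>g. g(e J i := 0)) \<in> ?N \<rightarrow>\<^sub>M ?N"
        using eE[OF that(1)] that(2) user_errors_block[OF U(1), of n] unfolding block_space_def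
        by (intro measurable_fun_upd[of _ "block_entries K M n"]) auto
      note [measurable] = signal_measurable[OF X uK Ssl[OF that(2)]] signal_measurable[OF X' uK Ssl[OF that(2)]]
        \<Delta>m[OF Ssl[OF that(2)] JK[OF that]]
      show ?thesis unfolding ce_def[abs_def] by measurable
    qed
    have ballm: "ball J \<in> borel_measurable ?N" if J: "J \<in> Js" for J
      unfolding ball_def[abs_def]
    proof (rule borel_measurable_prod_ennreal)
      fix i assume i: "i \<in> S J"
      have "e J i \<in> block_entries K M n" using eE[OF J] i user_errors_block[OF U(1)] by blast
      note [measurable] = entry_measurable[OF this] rm[OF J i] cem[OF J i]
      have "(\<lambda>g. of_bool (cmod (g (e J i) - ce J i g) \<le> r J i g) :: ennreal) \<in> borel_measurable ?N"
        unfolding of_bool_def by measurable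
      then show "(\<lambda>g. indicator {z. cmod (z - ce J i g) \<le> r J i g} (g (e J i)) :: ennreal) \<in> borel_measurable ?N"
        by (simp add: indicator_def)
    qed
    have \<tau>m: "\<tau> \<in> borel_measurable ?N"
      unfolding \<tau>_def[abs_def]
    proof (rule borel_measurable_prod_ennreal)
      fix i assume i: "i \<in> slots n"
      note [measurable] = image_at_measurable[OF X vK(1) i] image_at_measurable[OF X' vK(1) i]
      show "(\<lambda>g. ennreal (alignment (\<beta> i) (image_at P n X' v g i) (image_at P n X v g i))) \<in> borel_measurable ?N"
        by measurable
    qed
    let ?\<psi> = "\<lambda>J g. indicator A g * of_bool (pat J g) :: ennreal"
    have \<psi>m: "?\<psi> J \<in> borel_measurable ?N" for J
      using A'(1) patm[of J, measurable] unfolding of_bool_def by measurable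
    have "emeasure (block_law n) (A \<inter> {g\<in>space ?N. same g}) = (\<integral>\<^sup>+g. indicator (A \<inter> {g\<in>space ?N. same g}) g \<partial>block_law n)"
      using A'(1) Sm by (intro nn_integral_indicator[symmetric]) simp
    also have "\<dots> \<le> (\<integral>\<^sup>+g. (\<Sum>J\<in>Js. ?\<psi> J g * ball J g) \<partial>block_law n)"
    proof (rule nn_integral_mono_AE)
      show "AE g in block_law n. indicator (A \<inter> {g\<in>space ?N. same g}) g \<le> (\<Sum>J\<in>Js. ?\<psi> J g * ball J g)"
        using cover
      proof eventually_elim
        fix g assume "\<exists>J\<in>Js. pat J g"
        then obtain J where J: "J \<in> Js" "pat J g" by auto
        show "indicator (A \<inter> {g\<in>space ?N. same g}) g \<le> (\<Sum>J\<in>Js. ?\<psi> J g * ball J g)"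
        proof (cases "g \<in> A \<and> same g")
          case True
          then have "1 = ?\<psi> J g * ball J g" using J ball1 by simp
          also have "\<dots> \<le> (\<Sum>J\<in>Js. ?\<psi> J g * ball J g)" using J Js by (intro member_le_sum) auto
          finally show ?thesis using True by (simp add: indicator_def)
        qed (auto simp: indicator_def)
      qed
    qed
    also have "\<dots> = (\<Sum>J\<in>Js. (\<integral>\<^sup>+g. ?\<psi> J g * ball J g \<partial>block_law n))"
      using \<psi>m ballm by (intro nn_integral_sum) auto
    also have "\<dots> \<le> (\<Sum>J\<in>Js. (\<integral>\<^sup>+g. ?\<psi> J g * (\<Prod>i\<in>S J. ennreal (c * (r J i g)\<^sup>2)) \<partial>block_law n))"
    proof (rule sum_mono)
      fix J assume J: "J \<in> Js"
      have eN: "e J i \<in> ?E" if "i \<in> S J" for i using eE[OF J] that by auto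
      show "(\<integral>\<^sup>+g. ?\<psi> J g * ball J g \<partial>block_law n) \<le> (\<integral>\<^sup>+g. ?\<psi> J g * (\<Prod>i\<in>S J. ennreal (c * (r J i g)\<^sup>2)) \<partial>block_law n)"
        unfolding ball_def
      proof (rule balls)
        show "finite (S J)" by (simp add: S_def)
        show "inj_on (e J) (S J)" by (auto simp: inj_on_def e_def prod_eq_iff)
        show "e J ` S J \<subseteq> block_entries K M n" using eE[OF J] user_errors_block[OF U(1)] by blast
        show "?\<psi> J \<in> borel_measurable ?N" by (rule \<psi>m)
        show "free_of (e J ` S J) (?\<psi> J)"
          by (rule free_of_subset[OF _ eE[OF J]])
            (use A'(2) patf in \<open>auto simp: free_of_def indicator_def\<close>)
        show "0 \<le> r J i g" for i g using s[of i] by (simp add: r_def)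
        fix i assume i: "i \<in> S J"
        note sl = Ssl[OF i] and jk = JK[OF J i]
        show "r J i \<in> borel_measurable ?N" by (rule rm[OF J i])
        show "ce J i \<in> borel_measurable ?N" by (rule cem[OF J i])
        show "free_of (e J ` S J) (r J i)"
          by (rule free_of_subset[OF _ eE[OF J]]) (use \<Delta>f[OF sl jk] in \<open>auto simp: free_of_def r_def\<close>)
        \<comment> \<open>The entry of slot \<open>i\<close> itself is overwritten by 0 in the
          centre, and entries of other slots do not enter the coefficients of slot
          \<open>i\<close>.\<close>
        show "free_of (e J ` S J) (ce J i)"
          unfolding free_of_def
        proof (intro allI ballI)
          fix g e' z assume "e' \<in> e J ` S J"
          then obtain i' where i': "i' \<in> S J" "e' = e J i'" by auto
          have D: "\<Delta> i (J i) (g(e' := z)) = \<Delta> i (J i) g" using \<Delta>f[OF sl jk] eN i' by auto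
          have "signal P Y u i (g(e' := z, e J i := 0)) = signal P Y u i (g(e J i := 0))" if Y: "estimate_input n Y" for Y
          proof (cases "i' = i")
            case False
            then have ne: "e' \<noteq> e J i" "(fst i', snd i') \<noteq> (fst i, snd i)" using i' by (auto simp: e_def prod_eq_iff)
            have "coeff P u (fst i) (snd i) l (g(e' := z, e J i := 0)) = coeff P u (fst i) (snd i) l (g(e J i := 0))" for l
              using ne i' False by (auto simp: channel_coeff_def e_def prod_eq_iff)
            moreover have "Y (g(e' := z, e J i := 0)) (fst i) (snd i) l = Y (g(e J i := 0)) (fst i) (snd i) l" if "l \<in> {1..K}" for l
            proof -
              have "g(e' := z, e J i := 0) = g(e J i := 0, e' := z)" by (rule fun_upd_twist[OF ne(1)])
              then show ?thesis
                using free_ofD[OF input_free[OF Y U(1) sl that] eN[OF i'(1)], of "g(e J i := 0)" z] i'(2) by simp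
            qed
            ultimately show ?thesis unfolding signal_def by (intro sum.cong) auto
          qed (simp add: i')
          then show "ce J i (g(e' := z)) = ce J i g" unfolding ce_def D using X X' by simp
        qed
      qed
    qed
    also have "\<dots> \<le> (\<Sum>J\<in>Js. (\<integral>\<^sup>+g. ?\<psi> J g * \<tau> g \<partial>block_law n))"
    proof (intro sum_mono nn_integral_mono)
      fix J g assume "J \<in> Js"
      then show "?\<psi> J g * (\<Prod>i\<in>S J. ennreal (c * (r J i g)\<^sup>2)) \<le> ?\<psi> J g * \<tau> g"
        using vol[of J g] by (cases "pat J g") (simp_all add: mult_left_mono)
    qed
    also have "\<dots> = (\<integral>\<^sup>+g. (\<Sum>J\<in>Js. ?\<psi> J g * \<tau> g) \<partial>block_law n)"
      using \<psi>m \<tau>m by (intro nn_integral_sum[symmetric]) auto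
    \<comment> \<open>The patterns exclude each other, so at most one term of the sum is nonzero at
      each \<open>g\<close>.\<close>
    also have "\<dots> \<le> (\<integral>\<^sup>+g. indicator A g * \<tau> g \<partial>block_law n)"
    proof (rule nn_integral_mono)
      fix g
      have "(\<Sum>J\<in>Js. ?\<psi> J g * \<tau> g) = (\<Sum>J\<in>Js. of_bool (pat J g)) * (indicator A g * \<tau> g)"
        by (simp add: sum_distrib_left mult_ac)
      also have "(\<Sum>J\<in>Js. of_bool (pat J g)) \<le> (1::ennreal)"
      proof (cases "\<exists>J\<in>Js. pat J g")
        case True
        then obtain J where J: "J \<in> Js" "pat J g" by auto
        have "of_bool (pat J' g) = (if J' = J then 1 else 0 :: ennreal)" if "J' \<in> Js" for J'
        proof (cases "pat J' g")
          case True
          have "J' = J"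
            using that J(1) unfolding Js_def
          proof (rule PiE_ext)
            fix i assume "i \<in> slots n"
            then show "J' i = J i" using True J(2) by (simp add: pat_def)
          qed
          then show ?thesis using True by simp
        qed (use J in auto)
        then have "(\<Sum>J\<in>Js. of_bool (pat J g)) = (\<Sum>J'\<in>Js. if J' = J then 1 else 0 :: ennreal)"
          by (rule sum.cong[OF refl])
        also have "\<dots> = 1" using J(1) Js by simp
        finally show ?thesis by simp
      qed (simp add: sum.neutral)
      finally show "(\<Sum>J\<in>Js. ?\<psi> J g * \<tau> g) \<le> indicator A g * \<tau> g"
        by (simp add: mult_right_mono)
    qed
    finally show "emeasure (block_law n) (A \<inter> {g\<in>space ?N. image_at P n X u g = image_at P n X' u g})
      \<le> (\<integral>\<^sup>+g. indicator A g * (\<Prod>i\<in>slots n. ennreal (alignment (b * P powr \<alpha> u (fst i))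
            (image_at P n X' v g i) (image_at P n X v g i))) \<partial>block_law n)"
      unfolding \<tau>_def \<beta>_def same_def .
  qed
  qed
qed

end

section \<open>Gaussian noise and decodable images\<close>

definition gauss :: "complex \<Rightarrow> real" where
  "gauss z = exp (- (cmod z)\<^sup>2) / pi"

lemma gauss_nonneg [simp]: "0 \<le> gauss z"
  by (simp add: gauss_def)

lemma gauss_measurable [measurable]: "gauss \<in> borel_measurable borel"
  unfolding gauss_def by measurable

definition gauss_vector :: "'i set \<Rightarrow> ('i \<Rightarrow> complex) measure" where
  "gauss_vector I = PiM I (\<lambda>_. density lborel gauss)"

lemma sets_gauss_vector [simp, measurable_cong]: "sets (gauss_vector I) = sets (PiM I (\<lambda>_. borel))"
  unfolding gauss_vector_def by (intro sets_PiM_cong) auto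

lemma space_gauss_vector [simp]: "space (gauss_vector I) = I \<rightarrow>\<^sub>E UNIV"
  by (simp add: gauss_vector_def space_PiM)

lemma nn_integral_lborel_shift:
  fixes f :: "complex \<Rightarrow> ennreal"
  assumes [measurable]: "f \<in> borel_measurable borel"
  shows "(\<integral>\<^sup>+z. f (c + z) \<partial>lborel) = (\<integral>\<^sup>+z. f z \<partial>lborel)"
proof -
  have "(\<integral>\<^sup>+z. f (c + z) \<partial>lborel) = (\<integral>\<^sup>+z. f z \<partial>distr lborel borel ((+) c))"
    by (subst nn_integral_distr) auto
  also have "distr lborel borel ((+) c) = lborel"
    by (rule lborel_distr_plus)
  finally show ?thesis .
qed

text \<open>The law of the shifted noise and the measure with the shifted product density both agree
  on boxes with the product of the shifted one-dimensional laws. The explicit density is what allows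
  outputs of different messages to be compared on one region.\<close>

lemma emeasure_shifted_gauss_vector:
  assumes I: "finite I" and prob: "prob_space (density lborel gauss)"
    and E: "E \<in> sets (PiM I (\<lambda>_. borel))"
  shows "emeasure (gauss_vector I) {z \<in> space (gauss_vector I). (\<lambda>i\<in>I. S i + z i) \<in> E}
    = (\<integral>\<^sup>+y. (\<Prod>i\<in>I. ennreal (gauss (y i - S i))) * indicator E y \<partial>PiM I (\<lambda>_. lborel))"
proof -
  interpret G: product_prob_space "\<lambda>_. density lborel gauss" I
    by (intro product_prob_spaceI prob)
  interpret L: product_sigma_finite "\<lambda>_. lborel :: complex measure" by standard
  let ?D = "\<lambda>i. density lborel (\<lambda>y. ennreal (gauss (y - S i)))"
  have D: "prob_space (?D i)" for i
  proof
    have "emeasure (?D i) (space (?D i)) = (\<integral>\<^sup>+y. ennreal (gauss (- S i + y)) \<partial>lborel)"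
      by (simp add: emeasure_density)
    also have "\<dots> = (\<integral>\<^sup>+y. ennreal (gauss y) \<partial>lborel)" by (rule nn_integral_lborel_shift) simp
    also have "\<dots> = emeasure (density lborel gauss) (space (density lborel gauss))"
      by (simp add: emeasure_density)
    also have "\<dots> = 1" by (rule prob_space.emeasure_space_1[OF prob])
    finally show "emeasure (?D i) (space (?D i)) = 1" .
  qed
  interpret D: product_prob_space ?D I by (intro product_prob_spaceI D)
  have shm: "(\<lambda>z. \<lambda>i\<in>I. S i + z i) \<in> gauss_vector I \<rightarrow>\<^sub>M PiM I (\<lambda>_. borel)"
    unfolding gauss_vector_def by (intro measurable_restrict) measurable
  have sPD: "sets (PiM I (\<lambda>_. borel)) = sets (PiM I ?D)"
    by (intro sets_PiM_cong) auto
  have sPL: "sets (PiM I (\<lambda>_. lborel)) = sets (PiM I ?D)"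
    by (intro sets_PiM_cong) auto
  have "distr (gauss_vector I) (PiM I (\<lambda>_. borel)) (\<lambda>z. \<lambda>i\<in>I. S i + z i) = PiM I ?D"
  proof (rule D.PiM_eqI[OF I])
    show "sets (distr (gauss_vector I) (PiM I (\<lambda>_. borel)) (\<lambda>z. \<lambda>i\<in>I. S i + z i)) = sets (PiM I ?D)"
      using sPD by simp
    fix A assume "\<And>i. i \<in> I \<Longrightarrow> A i \<in> sets (?D i)"
    then have A [measurable]: "A i \<in> sets borel" if "i \<in> I" for i using that by simp
    have AE: "PiE I A \<in> sets (PiM I (\<lambda>_. borel))"
      using I A by (intro sets_PiM_I_finite) auto
    have "emeasure (distr (gauss_vector I) (PiM I (\<lambda>_. borel)) (\<lambda>z. \<lambda>i\<in>I. S i + z i)) (PiE I A)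
        = emeasure (gauss_vector I) ((\<lambda>z. \<lambda>i\<in>I. S i + z i) -` PiE I A \<inter> space (gauss_vector I))"
      by (rule emeasure_distr[OF shm AE])
    also have "(\<lambda>z. \<lambda>i\<in>I. S i + z i) -` PiE I A \<inter> space (gauss_vector I) = (\<Pi>\<^sub>E i\<in>I. (\<lambda>z. S i + z) -` A i)"
      by (auto simp: PiE_iff)
    also have "emeasure (gauss_vector I) \<dots> = (\<Prod>i\<in>I. emeasure (density lborel gauss) ((\<lambda>z. S i + z) -` A i))"
      unfolding gauss_vector_def
    proof (rule G.emeasure_PiM[OF I])
      fix i assume "i \<in> I"
      have "(\<lambda>z. S i + z) -` A i \<inter> space borel \<in> sets borel"
        by (rule measurable_sets[OF _ A[OF \<open>i \<in> I\<close>]]) measurable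
      then show "(\<lambda>z. S i + z) -` A i \<in> sets (density lborel gauss)" by simp
    qed
    also have "\<dots> = (\<Prod>i\<in>I. emeasure (?D i) (A i))"
    proof (rule prod.cong[OF refl])
      fix i assume i: "i \<in> I"
      have m: "(\<lambda>z. S i + z) -` A i \<in> sets borel"
        using measurable_sets[OF _ A[OF i], of "\<lambda>z. S i + z" borel] by simp
      have "emeasure (density lborel gauss) ((\<lambda>z. S i + z) -` A i)
          = (\<integral>\<^sup>+z. ennreal (gauss ((S i + z) - S i)) * indicator (A i) (S i + z) \<partial>lborel)"
        using m by (subst emeasure_density) (auto intro!: nn_integral_cong simp: indicator_def)
      also have "\<dots> = (\<integral>\<^sup>+z. ennreal (gauss (z - S i)) * indicator (A i) z \<partial>lborel)"
      proof (rule nn_integral_lborel_shift[of "\<lambda>z. ennreal (gauss (z - S i)) * indicator (A i) z"])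
        note [measurable] = A[OF i]
        show "(\<lambda>z. ennreal (gauss (z - S i)) * indicator (A i) z) \<in> borel_measurable borel" by measurable
      qed
      also have "\<dots> = emeasure (?D i) (A i)"
        using A[OF i] by (subst emeasure_density) auto
      finally show "emeasure (density lborel gauss) ((\<lambda>z. S i + z) -` A i) = emeasure (?D i) (A i)" .
    qed
    finally show "emeasure (distr (gauss_vector I) (PiM I (\<lambda>_. borel)) (\<lambda>z. \<lambda>i\<in>I. S i + z i)) (PiE I A)
        = (\<Prod>i\<in>I. emeasure (?D i) (A i))" .
  qed
  moreover have "density (PiM I (\<lambda>_. lborel)) (\<lambda>y. \<Prod>i\<in>I. ennreal (gauss (y i - S i))) = PiM I ?D"
  proof (rule D.PiM_eqI[OF I])
    show "sets (density (PiM I (\<lambda>_. lborel)) (\<lambda>y. \<Prod>i\<in>I. ennreal (gauss (y i - S i)))) = sets (PiM I ?D)"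
      using sPL by simp
    fix A assume "\<And>i. i \<in> I \<Longrightarrow> A i \<in> sets (?D i)"
    then have A [measurable]: "A i \<in> sets borel" if "i \<in> I" for i using that by simp
    have AE: "PiE I A \<in> sets (PiM I (\<lambda>_. lborel))"
      using I A by (intro sets_PiM_I_finite) auto
    have "emeasure (density (PiM I (\<lambda>_. lborel)) (\<lambda>y. \<Prod>i\<in>I. ennreal (gauss (y i - S i)))) (PiE I A)
        = (\<integral>\<^sup>+y. (\<Prod>i\<in>I. ennreal (gauss (y i - S i))) * indicator (PiE I A) y \<partial>PiM I (\<lambda>_. lborel))"
    proof (rule emeasure_density[OF _ AE])
      show "(\<lambda>y. \<Prod>i\<in>I. ennreal (gauss (y i - S i))) \<in> borel_measurable (PiM I (\<lambda>_. lborel))" by measurable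
    qed
    also have "\<dots> = (\<integral>\<^sup>+y. (\<Prod>i\<in>I. ennreal (gauss (y i - S i)) * indicator (A i) (y i)) \<partial>PiM I (\<lambda>_. lborel))"
    proof (rule nn_integral_cong)
      fix y assume y: "y \<in> space (PiM I (\<lambda>_. lborel :: complex measure))"
      have "(indicator (PiE I A) y :: ennreal) = (\<Prod>i\<in>I. indicator (A i) (y i))"
      proof (cases "y \<in> PiE I A")
        case True
        then have "(\<Prod>i\<in>I. indicator (A i) (y i)) = (1::ennreal)" by (intro prod.neutral) (auto simp: PiE_iff)
        then show ?thesis using True by simp
      next
        case False
        then obtain i where "i \<in> I" "y i \<notin> A i" using y by (auto simp: PiE_iff space_PiM)
        then have "(\<Prod>i\<in>I. indicator (A i) (y i)) = (0::ennreal)"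
          using I by (intro prod_zero) (auto intro!: bexI[of _ i])
        then show ?thesis using False by simp
      qed
      then show "(\<Prod>i\<in>I. ennreal (gauss (y i - S i))) * indicator (PiE I A) y
        = (\<Prod>i\<in>I. ennreal (gauss (y i - S i)) * indicator (A i) (y i))"
        by (simp add: prod.distrib)
    qed
    also have "\<dots> = (\<Prod>i\<in>I. \<integral>\<^sup>+z. ennreal (gauss (z - S i)) * indicator (A i) z \<partial>lborel)"
      using A by (intro L.product_nn_integral_prod[OF I, of "\<lambda>i z. ennreal (gauss (z - S i)) * indicator (A i) z"]) measurable
    also have "\<dots> = (\<Prod>i\<in>I. emeasure (?D i) (A i))"
      using A by (intro prod.cong refl) (simp add: emeasure_density)
    finally show "emeasure (density (PiM I (\<lambda>_. lborel)) (\<lambda>y. \<Prod>i\<in>I. ennreal (gauss (y i - S i)))) (PiE I A)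
        = (\<Prod>i\<in>I. emeasure (?D i) (A i))" .
  qed
  ultimately have eq: "distr (gauss_vector I) (PiM I (\<lambda>_. borel)) (\<lambda>z. \<lambda>i\<in>I. S i + z i)
      = density (PiM I (\<lambda>_. lborel)) (\<lambda>y. \<Prod>i\<in>I. ennreal (gauss (y i - S i)))" by simp
  have "emeasure (gauss_vector I) {z \<in> space (gauss_vector I). (\<lambda>i\<in>I. S i + z i) \<in> E}
      = emeasure (distr (gauss_vector I) (PiM I (\<lambda>_. borel)) (\<lambda>z. \<lambda>i\<in>I. S i + z i)) E"
    by (subst emeasure_distr[OF shm E]) (auto intro!: arg_cong[where f="emeasure (gauss_vector I)"])
  also have "\<dots> = (\<integral>\<^sup>+y. (\<Prod>i\<in>I. ennreal (gauss (y i - S i))) * indicator E y \<partial>PiM I (\<lambda>_. lborel))"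
    unfolding eq
  proof (rule emeasure_density)
    show "E \<in> sets (PiM I (\<lambda>_. lborel))" using E sPD sPL by simp
  qed measurable
  finally show ?thesis .
qed

text \<open>Scaling by \<open>sqrt 2\<close> turns the exponent into that of \<open>gauss\<close>
  and multiplies planar volume by 2.\<close>

lemma nn_integral_wide_gauss:
  assumes prob: "prob_space (density lborel gauss)"
  shows "(\<integral>\<^sup>+z. ennreal (exp (- (cmod z)\<^sup>2 / 2) / pi) \<partial>lborel) = 2"
proof -
  have "(\<integral>\<^sup>+z. ennreal (exp (- (cmod z)\<^sup>2 / 2) / pi) \<partial>lborel)
    = (\<integral>\<^sup>+z. ennreal (exp (- (cmod z)\<^sup>2 / 2) / pi) \<partial>density (distr lborel borel (\<lambda>x. 0 + sqrt 2 *\<^sub>R x)) (\<lambda>_. ennreal (\<bar>sqrt 2\<bar> ^ DIM(complex))))"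
    by (subst lborel_affine[of "sqrt 2" "0 :: complex"]) simp_all
  also have "\<dots> = (\<integral>\<^sup>+z. ennreal (\<bar>sqrt 2\<bar> ^ DIM(complex)) * ennreal (exp (- (cmod (sqrt 2 *\<^sub>R z))\<^sup>2 / 2) / pi) \<partial>lborel)"
    by (subst nn_integral_density) (auto simp: nn_integral_distr)
  also have "\<dots> = (\<integral>\<^sup>+z. 2 * ennreal (gauss z) \<partial>lborel)"
    by (intro nn_integral_cong) (simp add: gauss_def power_mult_distrib)
  also have "\<dots> = 2 * (\<integral>\<^sup>+z. ennreal (gauss z) \<partial>lborel)" by (rule nn_integral_cmult) simp
  also have "(\<integral>\<^sup>+z. ennreal (gauss z) \<partial>lborel) = emeasure (density lborel gauss) (space (density lborel gauss))"
    by (simp add: emeasure_density)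
  also have "\<dots> = 1" by (rule prob_space.emeasure_space_1[OF prob])
  finally show ?thesis by simp
qed

definition corner :: "int \<times> int \<Rightarrow> complex" where
  "corner p = Complex (of_int (fst p)) (of_int (snd p))"

text \<open>The corner of the cell of \<open>S\<close> is within distance 2 of \<open>S\<close>;
  giving up half of the exponent and a constant factor absorbs this shift. The right-hand side
  depends on \<open>S\<close> only through its image.\<close>

lemma gauss_le_wide:
  "gauss (y - S) \<le> exp 8 * (exp (- (cmod (y - corner (quantize S)))\<^sup>2 / 2) / pi)"
proof -
  define c where "c = corner (quantize S)"
  have "\<bar>Re (S - c)\<bar> \<le> 1" "\<bar>Im (S - c)\<bar> \<le> 1" unfolding c_def corner_def quantize_def by (simp, linarith)+
  then have S: "cmod (S - c) \<le> 2" using cmod_le[of "S - c"] by linarith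
  have "cmod (y - c) \<le> cmod (y - S) + cmod (S - c)"
    using norm_triangle_ineq[of "y - S" "S - c"] by simp
  then have "(cmod (y - c))\<^sup>2 \<le> (cmod (y - S) + 2)\<^sup>2" using S by (intro power_mono) auto
  also have "\<dots> \<le> 2 * (cmod (y - S))\<^sup>2 + 8"
    using zero_le_power2[of "cmod (y - S) - 2"] by (simp add: power2_eq_square algebra_simps)
  finally have "- (cmod (y - S))\<^sup>2 \<le> 8 + - (cmod (y - c))\<^sup>2 / 2" by simp
  then have "exp (- (cmod (y - S))\<^sup>2) \<le> exp (8 + - (cmod (y - c))\<^sup>2 / 2)" by simp
  then show ?thesis unfolding gauss_def c_def[symmetric] exp_add by (simp add: divide_right_mono)
qed

text \<open>
  Replacing the density of the output by one that depends only on the quantized signal costs a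
  constant factor per slot, so the decoding regions of the messages sharing an image, being
  disjoint, leave room for few of them.
\<close>
lemma card_decodable_le:
  fixes S :: "'w \<Rightarrow> 'i \<Rightarrow> complex" and d :: "('i \<Rightarrow> complex) \<Rightarrow> nat"
  assumes I: "finite I" and prob: "prob_space (density lborel gauss)"
    and V: "finite V" "inj_on f V"
    and d: "d \<in> PiM I (\<lambda>_. borel) \<rightarrow>\<^sub>M count_space UNIV"
    and same: "\<And>w w' i. w \<in> V \<Longrightarrow> w' \<in> V \<Longrightarrow> i \<in> I \<Longrightarrow> quantize (S w i) = quantize (S w' i)"
    and half: "\<And>w. w \<in> V \<Longrightarrow> 1/2 \<le> measure (gauss_vector I) {z \<in> space (gauss_vector I). d (\<lambda>i\<in>I. S w i + z i) = f w}"
  shows "real (card V) \<le> 2 * (2 * exp 8) ^ card I"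
proof (cases "V = {}")
  case False
  then obtain w0 where w0: "w0 \<in> V" by auto
  define c where "c i = corner (quantize (S w0 i))" for i
  define \<psi> where "\<psi> i y = exp 8 * (exp (- (cmod (y - c i))\<^sup>2 / 2) / pi)" for i and y :: complex
  interpret L: product_sigma_finite "\<lambda>_. lborel :: complex measure" by standard
  interpret G: product_prob_space "\<lambda>_. density lborel gauss" I
    by (intro product_prob_spaceI prob)
  interpret GV: prob_space "gauss_vector I" unfolding gauss_vector_def by (intro prob_space_PiM prob)
  have [measurable]: "(\<lambda>y. \<psi> i y) \<in> borel_measurable borel" for i unfolding \<psi>_def by measurable
  have \<psi>int: "(\<integral>\<^sup>+y. ennreal (\<psi> i y) \<partial>lborel) = ennreal (2 * exp 8)" for i
  proof -
    have "(\<integral>\<^sup>+y. ennreal (\<psi> i y) \<partial>lborel) = (\<integral>\<^sup>+y. ennreal (exp 8) * ennreal (exp (- (cmod (- c i + y))\<^sup>2 / 2) / pi) \<partial>lborel)"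
      by (simp add: \<psi>_def ennreal_mult'[symmetric])
    also have "\<dots> = ennreal (exp 8) * (\<integral>\<^sup>+y. ennreal (exp (- (cmod (- c i + y))\<^sup>2 / 2) / pi) \<partial>lborel)"
      by (rule nn_integral_cmult) measurable
    also have "(\<integral>\<^sup>+y. ennreal (exp (- (cmod (- c i + y))\<^sup>2 / 2) / pi) \<partial>lborel) = 2"
      using nn_integral_lborel_shift[of "\<lambda>y. ennreal (exp (- (cmod y)\<^sup>2 / 2) / pi)" "- c i"] nn_integral_wide_gauss[OF prob]
      by simp
    also have "ennreal (exp 8) * 2 = ennreal (2 * exp 8)"
      by (simp add: ennreal_mult' mult.commute)
    finally show ?thesis .
  qed
  define E where "E w = {y \<in> space (PiM I (\<lambda>_. borel)). d y = f w}" for w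
  have E: "E w \<in> sets (PiM I (\<lambda>_. borel))" for w
    unfolding E_def using d by measurable
  have sL: "sets (PiM I (\<lambda>_. borel :: complex measure)) = sets (PiM I (\<lambda>_. lborel))" by (intro sets_PiM_cong) auto
  have EL: "E w \<in> sets (PiM I (\<lambda>_. lborel))" for w using E[of w] sL by simp
  have disj: "disjoint_family_on E V" using V(2) by (auto simp: disjoint_family_on_def E_def inj_on_def)
  \<comment> \<open>Mass 1/2 per message is compared with the total mass of the dominating density,
    \<open>2 * exp 8\<close> per slot: 2 from the doubled variance and \<open>exp 8\<close> from the
    shift to the corner.\<close>
  have "ennreal (real (card V) / 2) = (\<Sum>w\<in>V. ennreal (1/2))"
    by (subst sum_ennreal) auto
  also have "\<dots> \<le> (\<Sum>w\<in>V. \<integral>\<^sup>+y. (\<Prod>i\<in>I. ennreal (\<psi> i (y i))) * indicator (E w) y \<partial>PiM I (\<lambda>_. lborel))"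
  proof (rule sum_mono)
    fix w assume w: "w \<in> V"
    have "ennreal (1/2) \<le> emeasure (gauss_vector I) {z \<in> space (gauss_vector I). d (\<lambda>i\<in>I. S w i + z i) = f w}"
      using half[OF w] by (subst GV.emeasure_eq_measure) (rule ennreal_leI)
    also have "{z \<in> space (gauss_vector I). d (\<lambda>i\<in>I. S w i + z i) = f w}
        = {z \<in> space (gauss_vector I). (\<lambda>i\<in>I. S w i + z i) \<in> E w}"
      by (auto simp: E_def space_PiM)
    also have "emeasure (gauss_vector I) \<dots> = (\<integral>\<^sup>+y. (\<Prod>i\<in>I. ennreal (gauss (y i - S w i))) * indicator (E w) y \<partial>PiM I (\<lambda>_. lborel))"
      by (rule emeasure_shifted_gauss_vector[OF I prob E])
    also have "\<dots> \<le> (\<integral>\<^sup>+y. (\<Prod>i\<in>I. ennreal (\<psi> i (y i))) * indicator (E w) y \<partial>PiM I (\<lambda>_. lborel))"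
    proof (intro nn_integral_mono mult_right_mono prod_ennreal_mono)
      fix y i assume i: "i \<in> I"
      show "gauss (y i - S w i) \<le> \<psi> i (y i)"
        unfolding \<psi>_def c_def same[OF w0 w i] by (rule gauss_le_wide)
    qed auto
    finally show "ennreal (1/2) \<le> (\<integral>\<^sup>+y. (\<Prod>i\<in>I. ennreal (\<psi> i (y i))) * indicator (E w) y \<partial>PiM I (\<lambda>_. lborel))" .
  qed
  also have "\<dots> = (\<integral>\<^sup>+y. (\<Sum>w\<in>V. (\<Prod>i\<in>I. ennreal (\<psi> i (y i))) * indicator (E w) y) \<partial>PiM I (\<lambda>_. lborel))"
  proof (rule nn_integral_sum[symmetric])
    fix w
    note [measurable] = EL[of w]
    show "(\<lambda>y. (\<Prod>i\<in>I. ennreal (\<psi> i (y i))) * indicator (E w) y) \<in> borel_measurable (PiM I (\<lambda>_. lborel))"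
      by measurable
  qed
  also have "\<dots> \<le> (\<integral>\<^sup>+y. (\<Prod>i\<in>I. ennreal (\<psi> i (y i))) \<partial>PiM I (\<lambda>_. lborel))"
  proof (rule nn_integral_mono)
    fix y
    have "(\<Sum>w\<in>V. indicator (E w) y) = (indicator (\<Union>w\<in>V. E w) y :: ennreal)"
      by (rule indicator_UN_disjoint[OF V(1) disj, symmetric])
    then have "(\<Sum>w\<in>V. (\<Prod>i\<in>I. ennreal (\<psi> i (y i))) * indicator (E w) y)
        = (\<Prod>i\<in>I. ennreal (\<psi> i (y i))) * indicator (\<Union>w\<in>V. E w) y"
      by (simp add: sum_distrib_left[symmetric])
    also have "\<dots> \<le> (\<Prod>i\<in>I. ennreal (\<psi> i (y i))) * 1" by (intro mult_left_mono) (auto simp: indicator_def)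
    finally show "(\<Sum>w\<in>V. (\<Prod>i\<in>I. ennreal (\<psi> i (y i))) * indicator (E w) y) \<le> (\<Prod>i\<in>I. ennreal (\<psi> i (y i)))" by simp
  qed
  also have "\<dots> = (\<Prod>i\<in>I. \<integral>\<^sup>+y. ennreal (\<psi> i y) \<partial>lborel)"
    by (rule L.product_nn_integral_prod[OF I, of "\<lambda>i y. ennreal (\<psi> i y)"]) measurable
  also have "\<dots> = ennreal ((2 * exp 8) ^ card I)" unfolding \<psi>int by (simp add: ennreal_power)
  finally have "real (card V) / 2 \<le> (2 * exp 8) ^ card I" by (simp add: ennreal_le_iff)
  then show ?thesis by simp
qed simp

section \<open>Laws of the noise and of the channel block\<close>

context parallel_miso_bc
begin

text \<open>The density is the law of an actual noise variable and hence has total mass 1; this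
  saves evaluating the Gaussian integral.\<close>

lemma prob_space_gauss: "prob_space (density lborel gauss)"
proof -
  have "distributed \<Omega> lborel (Z 1 1 1) (\<lambda>z. ennreal (gauss z))"
    unfolding gauss_def using noise_gaussian[of 1 1 1] users subchannels by simp
  then have "density lborel gauss = distr \<Omega> lborel (Z 1 1 1)" and m: "Z 1 1 1 \<in> measurable \<Omega> lborel"
    by (auto simp: distributed_def)
  then show ?thesis using prob_space_distr[OF m] by simp
qed

definition noise :: "nat \<Rightarrow> nat \<Rightarrow> 'a \<Rightarrow> nat \<times> nat \<Rightarrow> complex" where
  "noise n k \<omega> = (\<lambda>i\<in>slots n. Z k (fst i) (snd i) \<omega>)"

lemma Z_measurable: "k \<in> {1..K} \<Longrightarrow> m \<in> {1..M} \<Longrightarrow> 1 \<le> t \<Longrightarrow> Z k m t \<in> borel_measurable \<Omega>"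
  using noise_gaussian[of k m t] by (simp add: distributed_def)

lemma noise_measurable: "k \<in> {1..K} \<Longrightarrow> noise n k \<in> \<Omega> \<rightarrow>\<^sub>M PiM (slots n) (\<lambda>_. borel)"
  unfolding noise_def by (intro measurable_restrict Z_measurable) (auto simp: slots_def)

lemma noise_law:
  assumes k: "k \<in> {1..K}" and n: "1 \<le> n"
  shows "distr \<Omega> (PiM (slots n) (\<lambda>_. borel)) (noise n k) = gauss_vector (slots n)"
proof -
  let ?T = "{1..K} \<times> {1..M} \<times> {1..} :: (nat \<times> nat \<times> nat) set"
  interpret D: product_prob_space "\<lambda>_. density lborel gauss" "slots n"
    by (intro product_prob_spaceI prob_space_gauss)
  have Zm: "Z k (fst i) (snd i) \<in> borel_measurable \<Omega>" if "i \<in> slots n" for i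
    using that k by (intro Z_measurable) (auto simp: slots_def)
  \<comment> \<open>The product rule for independent variables asks for a nonempty index set; block
    length at least 1 and the existence of a subchannel provide it.\<close>
  have sne: "slots n \<noteq> {}" using n subchannels by (auto simp: slots_def)
  show ?thesis
    unfolding gauss_vector_def
  proof (rule D.PiM_eqI[OF finite_slots])
    show "sets (distr \<Omega> (PiM (slots n) (\<lambda>_. borel)) (noise n k)) = sets (PiM (slots n) (\<lambda>_. density lborel gauss))"
      by (simp, intro sets_PiM_cong) auto
    fix A :: "nat \<times> nat \<Rightarrow> complex set" assume "\<And>i. i \<in> slots n \<Longrightarrow> A i \<in> sets (density lborel gauss)"
    then have A: "A i \<in> sets borel" if "i \<in> slots n" for i using that by simp
    have PA: "PiE (slots n) A \<in> sets (PiM (slots n) (\<lambda>_. borel))"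
      using A by (intro sets_PiM_I_finite) auto
    let ?J = "(\<lambda>i. (k, fst i, snd i)) ` slots n"
    have inj: "inj_on (\<lambda>i. (k, fst i, snd i)) (slots n)" by (auto simp: inj_on_def prod_eq_iff)
    define B where "B = (\<lambda>(k::nat, m, t). A (m, t))"
    have "emeasure (distr \<Omega> (PiM (slots n) (\<lambda>_. borel)) (noise n k)) (PiE (slots n) A)
        = prob (noise n k -` PiE (slots n) A \<inter> space \<Omega>)"
      using emeasure_distr[OF noise_measurable[OF k] PA] by (simp add: emeasure_eq_measure)
    also have "noise n k -` PiE (slots n) A \<inter> space \<Omega>
        = (\<Inter>j\<in>?J. (case j of (k, m, t) \<Rightarrow> Z k m t) -` B j \<inter> space \<Omega>)"
      using sne by (force simp: noise_def PiE_iff B_def)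
    also have "prob \<dots> = (\<Prod>j\<in>?J. prob ((case j of (k, m, t) \<Rightarrow> Z k m t) -` B j \<inter> space \<Omega>))"
    proof (rule indep_varsD[OF noise_indep])
      show "?J \<noteq> {}" "finite ?J" using sne by auto
      show "?J \<subseteq> ?T" using k by (auto simp: slots_def)
      fix j assume "j \<in> ?J" then show "B j \<in> sets borel" using A by (auto simp: B_def)
    qed
    also have "\<dots> = (\<Prod>i\<in>slots n. prob (Z k (fst i) (snd i) -` A i \<inter> space \<Omega>))"
      by (subst prod.reindex[OF inj]) (simp add: B_def comp_def split_def)
    also have "ennreal \<dots> = (\<Prod>i\<in>slots n. emeasure (density lborel gauss) (A i))"
      unfolding prod_ennreal[symmetric, OF measure_nonneg]
    proof (rule prod.cong[OF refl])
      fix i assume i: "i \<in> slots n"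
      have "distributed \<Omega> lborel (Z k (fst i) (snd i)) (\<lambda>z. ennreal (gauss z))"
        unfolding gauss_def using noise_gaussian[of k "fst i" "snd i"] k i by (auto simp: slots_def)
      then have eq: "distr \<Omega> lborel (Z k (fst i) (snd i)) = density lborel gauss" and m: "Z k (fst i) (snd i) \<in> measurable \<Omega> lborel"
        by (auto simp: distributed_def)
      show "ennreal (prob (Z k (fst i) (snd i) -` A i \<inter> space \<Omega>)) = emeasure (density lborel gauss) (A i)"
        unfolding eq[symmetric] using A[OF i] by (subst emeasure_distr[OF m]) (auto simp: emeasure_eq_measure)
    qed
    finally show "emeasure (distr \<Omega> (PiM (slots n) (\<lambda>_. borel)) (noise n k)) (PiE (slots n) A)
        = (\<Prod>i\<in>slots n. emeasure (density lborel gauss) (A i))" .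
  qed
qed

text \<open>Independence is given for the sigma-algebras generated by the complete noise and channel
  processes; the noise vector of one user and the channel block are measurable for one of them each,
  so their joint law is a product.\<close>

lemma noise_block_joint_law:
  assumes k: "k \<in> {1..K}" and n: "1 \<le> n"
  shows "distr \<Omega> (PiM (slots n) (\<lambda>_. borel) \<Otimes>\<^sub>M block_space n) (\<lambda>\<omega>. (noise n k \<omega>, block n \<omega>))
    = gauss_vector (slots n) \<Otimes>\<^sub>M block_law n"
proof -
  let ?T = "{1..K} \<times> {1..M} \<times> {1..} :: (nat \<times> nat \<times> nat) set"
  let ?ZT = "\<lambda>\<omega>. \<lambda>(k, m, t)\<in>?T. Z k m t \<omega>" and ?HT = "\<lambda>\<omega>. \<lambda>e\<in>all_entries K M. H e \<omega>"
  let ?VZ = "vimage_algebra (space \<Omega>) ?ZT (PiM ?T (\<lambda>_. borel))"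
  let ?VH = "vimage_algebra (space \<Omega>) ?HT (PiM (all_entries K M) (\<lambda>_. borel))"
  have mZ: "noise n k \<in> ?VZ \<rightarrow>\<^sub>M PiM (slots n) (\<lambda>_. borel)"
  proof -
    have "?ZT \<in> ?VZ \<rightarrow>\<^sub>M PiM ?T (\<lambda>_. borel)"
      by (rule measurable_vimage_algebra1) (auto simp: space_PiM)
    moreover have "(\<lambda>y. \<lambda>i\<in>slots n. y (k, fst i, snd i)) \<in> PiM ?T (\<lambda>_. borel) \<rightarrow>\<^sub>M PiM (slots n) (\<lambda>_. borel :: complex measure)"
      using k by (intro measurable_restrict measurable_component_singleton) (auto simp: slots_def)
    ultimately have "(\<lambda>\<omega>. \<lambda>i\<in>slots n. ?ZT \<omega> (k, fst i, snd i)) \<in> ?VZ \<rightarrow>\<^sub>M PiM (slots n) (\<lambda>_. borel)"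
      by (rule measurable_compose)
    moreover have "(\<lambda>\<omega>. \<lambda>i\<in>slots n. ?ZT \<omega> (k, fst i, snd i)) = noise n k"
      using k by (intro ext) (auto simp: noise_def slots_def restrict_def)
    ultimately show ?thesis by simp
  qed
  have mH: "block n \<in> ?VH \<rightarrow>\<^sub>M block_space n"
  proof -
    have "?HT \<in> ?VH \<rightarrow>\<^sub>M PiM (all_entries K M) (\<lambda>_. borel)"
      by (rule measurable_vimage_algebra1) (auto simp: space_PiM)
    moreover have "(\<lambda>y. restrict y (block_entries K M n)) \<in> PiM (all_entries K M) (\<lambda>_. borel) \<rightarrow>\<^sub>M block_space n"
      unfolding block_space_def by (rule measurable_restrict_subset[OF block_entries_subset_all])
    ultimately have "(\<lambda>\<omega>. restrict (?HT \<omega>) (block_entries K M n)) \<in> ?VH \<rightarrow>\<^sub>M block_space n"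
      by (rule measurable_compose)
    moreover have "(\<lambda>\<omega>. restrict (?HT \<omega>) (block_entries K M n)) = block n"
      using block_entries_subset_all by (intro ext) (auto simp: block_def restrict_def)
    ultimately show ?thesis by simp
  qed
  interpret G: prob_space "gauss_vector (slots n)"
    unfolding gauss_vector_def by (intro prob_space_PiM prob_space_gauss)
  interpret B: prob_space "block_law n" by (rule prob_space_block_law)
  have mp: "(\<lambda>\<omega>. (noise n k \<omega>, block n \<omega>)) \<in> \<Omega> \<rightarrow>\<^sub>M PiM (slots n) (\<lambda>_. borel) \<Otimes>\<^sub>M block_space n"
    using noise_measurable[OF k] by (intro measurable_Pair) auto
  show ?thesis
  proof (rule pair_measure_eqI[symmetric])
    show "sigma_finite_measure (gauss_vector (slots n))" "sigma_finite_measure (block_law n)"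
      by (rule G.sigma_finite_measure B.sigma_finite_measure)+
    show "sets (gauss_vector (slots n) \<Otimes>\<^sub>M block_law n)
      = sets (distr \<Omega> (PiM (slots n) (\<lambda>_. borel) \<Otimes>\<^sub>M block_space n) (\<lambda>\<omega>. (noise n k \<omega>, block n \<omega>)))"
      by (simp cong: sets_pair_measure_cong)
    fix A B assume "A \<in> sets (gauss_vector (slots n))" "B \<in> sets (block_law n)"
    then have A: "A \<in> sets (PiM (slots n) (\<lambda>_. borel))" and B: "B \<in> sets (block_space n)" by simp_all
    have "emeasure (distr \<Omega> (PiM (slots n) (\<lambda>_. borel) \<Otimes>\<^sub>M block_space n) (\<lambda>\<omega>. (noise n k \<omega>, block n \<omega>))) (A \<times> B)
      = prob ((noise n k -` A \<inter> space \<Omega>) \<inter> (block n -` B \<inter> space \<Omega>))"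
      using A B by (subst emeasure_distr[OF mp]) (auto simp: emeasure_eq_measure intro!: arg_cong[where f=prob])
    also have "\<dots> = prob (noise n k -` A \<inter> space \<Omega>) * prob (block n -` B \<inter> space \<Omega>)"
      using measurable_sets[OF mZ A] measurable_sets[OF mH B]
      by (intro arg_cong[where f=ennreal] indep_setD[OF noise_indep_channel]) (simp_all only: space_vimage_algebra)
    also have "\<dots> = emeasure (gauss_vector (slots n)) A * emeasure (block_law n) B"
      unfolding noise_law[OF assms, symmetric] block_law_def
      using A B noise_measurable[OF k] by (simp add: emeasure_distr emeasure_eq_measure ennreal_mult)
    finally show "emeasure (gauss_vector (slots n)) A * emeasure (block_law n) B
      = emeasure (distr \<Omega> (PiM (slots n) (\<lambda>_. borel) \<Otimes>\<^sub>M block_space n) (\<lambda>\<omega>. (noise n k \<omega>, block n \<omega>))) (A \<times> B)"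
      by simp
  qed
qed

text \<open>Conditional error probability of user \<open>k\<close> given the channel realization
  \<open>g\<close>, with \<open>v\<close> as the correct message of this user: only the noise is
  averaged.\<close>

definition error_mass ::
  "real \<Rightarrow> nat \<Rightarrow> ((entry \<Rightarrow> complex) \<Rightarrow> nat \<Rightarrow> nat \<Rightarrow> nat \<Rightarrow> complex)
    \<Rightarrow> ((nat \<times> nat \<Rightarrow> complex) \<Rightarrow> (entry \<Rightarrow> complex) \<Rightarrow> nat) \<Rightarrow> nat \<Rightarrow> nat \<Rightarrow> (entry \<Rightarrow> complex) \<Rightarrow> ennreal" where
  "error_mass P n X d k v g = emeasure (gauss_vector (slots n))
    {z \<in> space (gauss_vector (slots n)). d (\<lambda>i\<in>slots n. signal P X k i g + z i) g \<noteq> v}"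

text \<open>Fubini for the product law of noise and channel block: averaging the conditional error
  over the channel recovers the error probability, and the slices of a measurable decoder are
  measurable.\<close>

lemma error_mass:
  assumes k: "k \<in> {1..K}" and n: "1 \<le> n" and X: "estimate_input n X"
    and d: "(\<lambda>(y, g). d y g) \<in> PiM (slots n) (\<lambda>_. borel) \<Otimes>\<^sub>M block_space n \<rightarrow>\<^sub>M count_space UNIV"
  shows "error_mass P n X d k v \<in> borel_measurable (block_space n)"
    and "(\<integral>\<^sup>+g. error_mass P n X d k v g \<partial>block_law n)
      = emeasure \<Omega> {\<omega> \<in> space \<Omega>. d (\<lambda>i\<in>slots n. signal P X k i (block n \<omega>) + Z k (fst i) (snd i) \<omega>) (block n \<omega>) \<noteq> v}"
    and "g \<in> space (block_space n) \<Longrightarrow> (\<lambda>y. d y g) \<in> PiM (slots n) (\<lambda>_. borel) \<rightarrow>\<^sub>M count_space UNIV"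
proof -
  let ?G = "gauss_vector (slots n)" and ?N = "block_space n"
  let ?Y = "\<lambda>(z, g). \<lambda>i\<in>slots n. signal P X k i g + z i"
  let ?GN = "PiM (slots n) (\<lambda>_. borel :: complex measure) \<Otimes>\<^sub>M ?N"
  interpret G: prob_space ?G
    unfolding gauss_vector_def by (intro prob_space_PiM prob_space_gauss)
  interpret B: prob_space "block_law n" by (rule prob_space_block_law)
  interpret GB: pair_sigma_finite ?G "block_law n" ..
  have sGB: "sets (?G \<Otimes>\<^sub>M block_law n) = sets ?GN" by (simp cong: sets_pair_measure_cong)
  have Y: "?Y \<in> ?GN \<rightarrow>\<^sub>M PiM (slots n) (\<lambda>_. borel)"
    unfolding case_prod_unfold
  proof (rule measurable_restrict)
    fix i assume i: "i \<in> slots n"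
    have 1: "(\<lambda>x. fst x i) \<in> borel_measurable ?GN"
      by (rule measurable_compose[OF measurable_fst measurable_component_singleton[OF i]])
    have 2: "(\<lambda>x. signal P X k i (snd x)) \<in> borel_measurable ?GN"
      by (rule measurable_compose[OF measurable_snd signal_measurable[OF X k i]])
    show "(\<lambda>x. signal P X k i (snd x) + fst x i) \<in> borel_measurable ?GN"
      by (rule borel_measurable_add[OF 2 1])
  qed
  have dY: "(\<lambda>x. d (?Y x) (snd x)) \<in> ?GN \<rightarrow>\<^sub>M count_space UNIV"
    using measurable_compose[OF measurable_Pair[OF Y measurable_snd] d] by simp
  define T where "T = {x \<in> space ?GN. d (?Y x) (snd x) \<noteq> v}"
  have T: "T \<in> sets ?GN" unfolding T_def using dY by measurable
  have slice: "(\<lambda>z. (z, g)) -` T = {z \<in> space ?G. d (\<lambda>i\<in>slots n. signal P X k i g + z i) g \<noteq> v}"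
    if "g \<in> space ?N" for g
    using that by (auto simp: T_def space_pair_measure space_PiM)
  have "(\<lambda>g. emeasure ?G ((\<lambda>z. (z, g)) -` T)) \<in> borel_measurable (block_law n)"
    using T sGB by (intro GB.measurable_emeasure_Pair2) simp
  then have "(\<lambda>g. emeasure ?G ((\<lambda>z. (z, g)) -` T)) \<in> borel_measurable ?N" by simp
  then show m: "error_mass P n X d k v \<in> borel_measurable ?N"
    by (rule measurable_cong[THEN iffD1, rotated]) (simp add: error_mass_def slice)
  have mp: "(\<lambda>\<omega>. (noise n k \<omega>, block n \<omega>)) \<in> \<Omega> \<rightarrow>\<^sub>M ?GN"
    using noise_measurable[OF k] by (intro measurable_Pair) auto
  have "(\<integral>\<^sup>+g. error_mass P n X d k v g \<partial>block_law n) = (\<integral>\<^sup>+g. emeasure ?G ((\<lambda>z. (z, g)) -` T) \<partial>block_law n)"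
    by (intro nn_integral_cong) (simp add: error_mass_def slice)
  also have "\<dots> = emeasure (?G \<Otimes>\<^sub>M block_law n) T"
    using T sGB by (intro GB.emeasure_pair_measure_alt2[symmetric]) simp
  also have "\<dots> = emeasure \<Omega> ((\<lambda>\<omega>. (noise n k \<omega>, block n \<omega>)) -` T \<inter> space \<Omega>)"
    unfolding noise_block_joint_law[OF k n, symmetric] by (rule emeasure_distr[OF mp T])
  also have "(\<lambda>\<omega>. (noise n k \<omega>, block n \<omega>)) -` T \<inter> space \<Omega>
      = {\<omega> \<in> space \<Omega>. d (\<lambda>i\<in>slots n. signal P X k i (block n \<omega>) + Z k (fst i) (snd i) \<omega>) (block n \<omega>) \<noteq> v}"
  proof -
    have "(\<lambda>i\<in>slots n. signal P X k i (block n \<omega>) + noise n k \<omega> i)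
        = (\<lambda>i\<in>slots n. signal P X k i (block n \<omega>) + Z k (fst i) (snd i) \<omega>)" for \<omega>
      by (auto simp: noise_def)
    then show ?thesis using measurable_space[OF mp] by (auto simp: T_def)
  qed
  finally show "(\<integral>\<^sup>+g. error_mass P n X d k v g \<partial>block_law n)
      = emeasure \<Omega> {\<omega> \<in> space \<Omega>. d (\<lambda>i\<in>slots n. signal P X k i (block n \<omega>) + Z k (fst i) (snd i) \<omega>) (block n \<omega>) \<noteq> v}" .
  show "(\<lambda>y. d y g) \<in> PiM (slots n) (\<lambda>_. borel) \<rightarrow>\<^sub>M count_space UNIV" if "g \<in> space ?N"
    using measurable_compose[OF measurable_Pair2'[OF that] d] by simp
qed

end

section \<open>Channel realizations at which a message is decodable\<close>

context parallel_miso_bc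
begin

text \<open>Carries the encoder from realizations of the estimates over to realizations of the
  block, where the sigma-algebras of the converse live.\<close>

definition encoder_input ::
  "nat \<Rightarrow> ((nat \<Rightarrow> nat) \<Rightarrow> (entry \<Rightarrow> complex) \<Rightarrow> nat \<Rightarrow> nat \<Rightarrow> nat \<Rightarrow> complex)
    \<Rightarrow> (nat \<Rightarrow> nat) \<Rightarrow> (entry \<Rightarrow> complex) \<Rightarrow> nat \<Rightarrow> nat \<Rightarrow> nat \<Rightarrow> complex" where
  "encoder_input n enc w g = enc w (restrict g (estimate_entries K M n))"

lemma estimate_input_encoder:
  assumes "valid_code P n N enc dec" "w \<in> messages N"
  shows "estimate_input n (encoder_input n enc w)"
  unfolding estimate_input_def
proof (intro ballI conjI)
  fix m t j assume mtj: "m \<in> {1..M}" "t \<in> {1..n}" "j \<in> {1..K}"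
  have e: "(\<lambda>g. enc w g m t j) \<in> borel_measurable (PiM (estimate_entries K M n) (\<lambda>_. borel))"
    using assms mtj unfolding valid_code_def by blast
  have "(\<lambda>g. restrict g (estimate_entries K M n)) \<in> block_space n \<rightarrow>\<^sub>M PiM (estimate_entries K M n) (\<lambda>_. borel)"
    unfolding block_space_def by (rule measurable_restrict_subset) (simp add: block_entries_def)
  from measurable_compose[OF this e]
  show "(\<lambda>g. encoder_input n enc w g m t j) \<in> borel_measurable (block_space n)"
    by (simp add: encoder_input_def)
  have "restrict (g(e := z)) (estimate_entries K M n) = restrict g (estimate_entries K M n)"
    if "e \<in> error_entries K M n" for g e and z :: complex
    using that by (intro restrict_ext) (auto simp: error_entries_def estimate_entries_def)
  then show "free_of (error_entries K M n) (\<lambda>g. encoder_input n enc w g m t j)"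
    by (simp add: free_of_def encoder_input_def)
qed

lemma received_eq:
  assumes "k \<in> {1..K}"
  shows "(\<lambda>(m, t)\<in>{1..M} \<times> {1..n}. received P n enc w k m t \<omega>)
    = (\<lambda>i\<in>slots n. signal P (encoder_input n enc w) k i (block n \<omega>) + Z k (fst i) (snd i) \<omega>)"
proof (intro ext)
  fix i
  have r: "restrict (block n \<omega>) (estimate_entries K M n) = (\<lambda>e\<in>estimate_entries K M n. H e \<omega>)"
    by (auto simp: block_def block_entries_def restrict_def)
  have "coeff P k (fst i) (snd i) j (block n \<omega>) = channel_coeff \<alpha> H P k (fst i) (snd i) j \<omega>"
    if "j \<in> {1..K}" "i \<in> slots n" for j
    using that assms by (auto simp: channel_coeff_def block_def slots_def block_entries_def estimate_entries_def error_entries_def)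
  then show "(\<lambda>(m, t)\<in>{1..M} \<times> {1..n}. received P n enc w k m t \<omega>) i
    = (\<lambda>i\<in>slots n. signal P (encoder_input n enc w) k i (block n \<omega>) + Z k (fst i) (snd i) \<omega>) i"
    by (cases i) (auto simp: slots_def received_def signal_def encoder_input_def r intro!: sum.cong)
qed

lemma finite_messages: "finite (messages N)"
  by (simp add: messages_def finite_PiE)

text \<open>A message counts as decodable at \<open>g\<close> when every user has conditional error
  below 1/2; then each decoding region has mass above 1/2, as the packing of these regions asks
  for.\<close>

definition undecodable ::
  "real \<Rightarrow> nat \<Rightarrow> ((nat \<Rightarrow> nat) \<Rightarrow> (entry \<Rightarrow> complex) \<Rightarrow> nat \<Rightarrow> nat \<Rightarrow> nat \<Rightarrow> complex)
    \<Rightarrow> (nat \<Rightarrow> (nat \<times> nat \<Rightarrow> complex) \<Rightarrow> (entry \<Rightarrow> complex) \<Rightarrow> nat) \<Rightarrow> (nat \<Rightarrow> nat) \<Rightarrow> (entry \<Rightarrow> complex) set" where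
  "undecodable P n enc dec w =
    {g \<in> space (block_space n). \<exists>k\<in>{1..K}. 1 \<le> 2 * error_mass P n (encoder_input n enc w) (dec k) k (w k) g}"

text \<open>Markov's inequality for the conditional error at level 1/2 and a union over the users
  give the factor \<open>2 * real K\<close>.\<close>

lemma undecodable:
  assumes v: "valid_code P n N enc dec" and w: "w \<in> messages N" and n: "1 \<le> n"
  shows "undecodable P n enc dec w \<in> sets (block_space n)"
    and "measure (block_law n) (undecodable P n enc dec w) \<le> 2 * real K *
      prob {\<omega>\<in>space \<Omega>. \<exists>k\<in>{1..K}. dec k (\<lambda>(m, t)\<in>{1..M} \<times> {1..n}. received P n enc w k m t \<omega>)
              (\<lambda>e\<in>block_entries K M n. H e \<omega>) \<noteq> w k}"
proof -
  let ?X = "encoder_input n enc w" and ?N = "block_space n"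
  interpret B: prob_space "block_law n" by (rule prob_space_block_law)
  have X: "estimate_input n ?X" by (rule estimate_input_encoder[OF v w])
  have d: "(\<lambda>(y, g). dec k y g) \<in> PiM (slots n) (\<lambda>_. borel) \<Otimes>\<^sub>M ?N \<rightarrow>\<^sub>M count_space UNIV" if "k \<in> {1..K}" for k
    using v that unfolding valid_code_def slots_def block_space_def by blast
  note em = error_mass[OF _ n X d]
  define U where "U k = {g \<in> space ?N. 1 \<le> 2 * error_mass P n ?X (dec k) k (w k) g}" for k
  define E where "E k = {\<omega>\<in>space \<Omega>. dec k (\<lambda>i\<in>slots n. signal P ?X k i (block n \<omega>) + Z k (fst i) (snd i) \<omega>) (block n \<omega>) \<noteq> w k}" for k
  have Um: "U k \<in> sets ?N" if "k \<in> {1..K}" for k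
    unfolding U_def using em(1)[OF that that, measurable] by measurable
  have Uu: "undecodable P n enc dec w = (\<Union>k\<in>{1..K}. U k)"
    by (auto simp: undecodable_def U_def)
  show "undecodable P n enc dec w \<in> sets ?N"
    unfolding Uu using Um by (intro sets.finite_UN) auto
  have Em: "E k \<in> events" if k: "k \<in> {1..K}" for k
  proof -
    have "(\<lambda>\<omega>. \<lambda>i\<in>slots n. signal P ?X k i (block n \<omega>) + Z k (fst i) (snd i) \<omega>) \<in> \<Omega> \<rightarrow>\<^sub>M PiM (slots n) (\<lambda>_. borel)"
    proof (intro measurable_restrict borel_measurable_add)
      fix i assume i: "i \<in> slots n"
      show "(\<lambda>\<omega>. signal P ?X k i (block n \<omega>)) \<in> borel_measurable \<Omega>"
        by (rule measurable_compose[OF block_measurable signal_measurable[OF X k i]])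
      show "Z k (fst i) (snd i) \<in> borel_measurable \<Omega>"
        using i k by (intro Z_measurable) (auto simp: slots_def)
    qed
    from measurable_compose[OF measurable_Pair[OF this block_measurable] d[OF k]]
    have "(\<lambda>\<omega>. dec k (\<lambda>i\<in>slots n. signal P ?X k i (block n \<omega>) + Z k (fst i) (snd i) \<omega>) (block n \<omega>)) \<in> \<Omega> \<rightarrow>\<^sub>M count_space UNIV"
      by simp
    then show ?thesis unfolding E_def by measurable
  qed
  have EE: "{\<omega>\<in>space \<Omega>. \<exists>k\<in>{1..K}. dec k (\<lambda>(m, t)\<in>{1..M} \<times> {1..n}. received P n enc w k m t \<omega>)
              (\<lambda>e\<in>block_entries K M n. H e \<omega>) \<noteq> w k} = (\<Union>k\<in>{1..K}. E k)"
  proof -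
    have bl: "(\<lambda>e\<in>block_entries K M n. H e \<omega>) = block n \<omega>" for \<omega>
      by (simp only: block_def)
    have "dec k (\<lambda>(m, t)\<in>{1..M} \<times> {1..n}. received P n enc w k m t \<omega>) (\<lambda>e\<in>block_entries K M n. H e \<omega>) \<noteq> w k
      \<longleftrightarrow> \<omega> \<in> E k" if "k \<in> {1..K}" "\<omega> \<in> space \<Omega>" for k \<omega>
      unfolding received_eq[OF that(1)] bl E_def using that(2) by simp
    moreover have "E k \<subseteq> space \<Omega>" for k by (auto simp: E_def)
    ultimately show ?thesis by blast
  qed
  have "measure (block_law n) (U k) \<le> 2 * prob (\<Union>k\<in>{1..K}. E k)" if k: "k \<in> {1..K}" for k
  proof -
    have "emeasure (block_law n) (U k) = emeasure (block_law n) ({g\<in>space (block_law n). 1 \<le> 2 * error_mass P n ?X (dec k) k (w k) g} \<inter> space (block_law n))"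
      unfolding U_def by (rule arg_cong[where f="emeasure _"]) auto
    also have "\<dots> \<le> 2 * (\<integral>\<^sup>+g. error_mass P n ?X (dec k) k (w k) g * indicator (space (block_law n)) g \<partial>block_law n)"
      using em(1)[OF k k] by (intro order_trans[OF _ nn_integral_Markov_inequality]) (auto intro!: emeasure_mono)
    also have "(\<integral>\<^sup>+g. error_mass P n ?X (dec k) k (w k) g * indicator (space (block_law n)) g \<partial>block_law n)
        = (\<integral>\<^sup>+g. error_mass P n ?X (dec k) k (w k) g \<partial>block_law n)"
      by (intro nn_integral_cong) simp
    also have "\<dots> = emeasure \<Omega> (E k)" unfolding E_def by (rule em(2)[OF k k])
    also have "\<dots> \<le> emeasure \<Omega> (\<Union>k\<in>{1..K}. E k)"
      using k Em by (intro emeasure_mono sets.finite_UN) auto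
    also have "2 * \<dots> = ennreal (2 * prob (\<Union>k\<in>{1..K}. E k))"
      by (simp add: emeasure_eq_measure ennreal_mult)
    finally have "ennreal (measure (block_law n) (U k)) \<le> ennreal (2 * prob (\<Union>k\<in>{1..K}. E k))"
      by (simp add: B.emeasure_eq_measure mult_left_mono)
    then show ?thesis by (simp add: ennreal_le_iff)
  qed
  then have "(\<Sum>k\<in>{1..K}. measure (block_law n) (U k)) \<le> (\<Sum>k\<in>{1..K}. 2 * prob (\<Union>k\<in>{1..K}. E k))"
    by (rule sum_mono)
  moreover have "measure (block_law n) (\<Union>k\<in>{1..K}. U k) \<le> (\<Sum>k\<in>{1..K}. measure (block_law n) (U k))"
    using Um by (intro B.finite_measure_subadditive_finite) auto
  ultimately show "measure (block_law n) (undecodable P n enc dec w) \<le> 2 * real K *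
      prob {\<omega>\<in>space \<Omega>. \<exists>k\<in>{1..K}. dec k (\<lambda>(m, t)\<in>{1..M} \<times> {1..n}. received P n enc w k m t \<omega>)
              (\<lambda>e\<in>block_entries K M n. H e \<omega>) \<noteq> w k}"
    unfolding Uu EE by (simp add: mult_ac)
qed

text \<open>At fixed \<open>g\<close> the messages of \<open>V\<close> share their image at user
  \<open>k\<close> but differ in \<open>w k\<close>. Their decoding regions are disjoint while their
  output densities have a common majorant, so only a constant number per slot fits.\<close>

lemma decodable_count:
  assumes v: "valid_code P n N enc dec" and n: "1 \<le> n" and k: "k \<in> {1..K}"
    and g: "g \<in> space (block_space n)" and V: "V \<subseteq> messages N" "inj_on (\<lambda>w. w k) V"
    and dec: "\<And>w. w \<in> V \<Longrightarrow> g \<notin> undecodable P n enc dec w"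
    and same: "\<And>w w'. w \<in> V \<Longrightarrow> w' \<in> V \<Longrightarrow>
      image_at P n (encoder_input n enc w) k g = image_at P n (encoder_input n enc w') k g"
  shows "real (card V) \<le> 2 * (2 * exp 8) ^ (n * M)"
proof (cases "V = {}")
  case False
  then obtain w0 where w0: "w0 \<in> V" by auto
  interpret G: prob_space "gauss_vector (slots n) :: (nat \<times> nat \<Rightarrow> complex) measure"
    unfolding gauss_vector_def by (intro prob_space_PiM prob_space_gauss)
  let ?S = "\<lambda>w i. signal P (encoder_input n enc w) k i g"
  have d: "(\<lambda>(y, g). dec k y g) \<in> PiM (slots n) (\<lambda>_. borel) \<Otimes>\<^sub>M block_space n \<rightarrow>\<^sub>M count_space UNIV"
    using v k unfolding valid_code_def slots_def block_space_def by blast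
  have dg: "(\<lambda>y. dec k y g) \<in> PiM (slots n) (\<lambda>_. borel) \<rightarrow>\<^sub>M count_space UNIV"
    using error_mass(3)[OF k n estimate_input_encoder[OF v] d g] w0 V(1) by blast
  have "real (card V) \<le> 2 * (2 * exp 8) ^ card (slots n)"
  proof (rule card_decodable_le[where S="?S" and d="\<lambda>y. dec k y g" and f="\<lambda>w. w k"])
    show "finite V" using V(1) finite_messages finite_subset by blast
    fix w w' i assume ww: "w \<in> V" "w' \<in> V" "i \<in> slots n"
    show "quantize (?S w i) = quantize (?S w' i)"
      using fun_cong[OF same[OF ww(1,2)], of i] ww(3) by (simp add: image_at_def)
  next
    fix w assume w: "w \<in> V"
    let ?D = "{z \<in> space (gauss_vector (slots n)). dec k (\<lambda>i\<in>slots n. ?S w i + z i) g = w k}"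
    let ?U = "{z \<in> space (gauss_vector (slots n)). dec k (\<lambda>i\<in>slots n. ?S w i + z i) g \<noteq> w k}"
    have sh: "(\<lambda>z. \<lambda>i\<in>slots n. ?S w i + z i) \<in> gauss_vector (slots n) \<rightarrow>\<^sub>M PiM (slots n) (\<lambda>_. borel)"
      unfolding gauss_vector_def by (intro measurable_restrict) measurable
    have "(\<lambda>z. dec k (\<lambda>i\<in>slots n. ?S w i + z i) g) \<in> gauss_vector (slots n) \<rightarrow>\<^sub>M count_space UNIV"
      by (rule measurable_compose[OF sh dg])
    then have D: "?D \<in> G.events" by measurable
    have UD: "?U = space (gauss_vector (slots n)) - ?D" by auto
    have "\<not> 1 \<le> 2 * error_mass P n (encoder_input n enc w) (dec k) k (w k) g"
      using dec[OF w] g k unfolding undecodable_def by blast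
    then have "2 * emeasure (gauss_vector (slots n)) ?U < 1" by (simp add: error_mass_def not_le)
    then have "ennreal (2 * G.prob ?U) < ennreal 1"
      by (simp add: G.emeasure_eq_measure ennreal_mult)
    then have "2 * G.prob ?U < 1" by (simp add: ennreal_less_iff)
    moreover have "G.prob ?U = 1 - G.prob ?D" unfolding UD by (rule G.prob_compl[OF D])
    ultimately show "1/2 \<le> G.prob ?D" by linarith
  qed (use V dg prob_space_gauss in auto)
  then show ?thesis by (simp add: card_slots)
qed simp

text \<open>Cauchy-Schwarz over the antennas, with the 4 paid for quantization. Only the sum over
  all slots is bounded, since the power constraint does not restrict single slots.\<close>

lemma image_power_le:
  assumes i: "\<forall>i\<in>slots n. \<forall>j\<in>{1..K}. cmod (coeff P k (fst i) (snd i) j g) \<le> C" and C: "0 \<le> C"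
    and v: "valid_code P n N enc dec" and w: "w \<in> messages N" and n: "1 \<le> n"
  shows "(\<Sum>i\<in>slots n. lat_norm2 (image_at P n (encoder_input n enc w) k g i))
    \<le> real (card (slots n)) * (2 * real K * C\<^sup>2 * P + 4)"
proof -
  let ?g = "restrict g (estimate_entries K M n)" and ?X = "encoder_input n enc w"
  have nM: "0 < real n * real M" using n subchannels by simp
  have "?g \<in> estimate_entries K M n \<rightarrow>\<^sub>E UNIV" by auto
  then have pow: "1 / (real n * real M) * (\<Sum>t=1..n. \<Sum>m=1..M. \<Sum>j=1..K. (cmod (enc w ?g m t j))\<^sup>2) \<le> P"
    using v w unfolding valid_code_def by blast
  have "(\<Sum>i\<in>slots n. \<Sum>j=1..K. (cmod (?X g (fst i) (snd i) j))\<^sup>2)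
      = (\<Sum>t=1..n. \<Sum>m=1..M. \<Sum>j=1..K. (cmod (enc w ?g m t j))\<^sup>2)"
  proof -
    have "(\<Sum>i\<in>slots n. \<Sum>j=1..K. (cmod (?X g (fst i) (snd i) j))\<^sup>2)
        = (\<Sum>m=1..M. \<Sum>t=1..n. \<Sum>j=1..K. (cmod (?X g m t j))\<^sup>2)"
      using sum.cartesian_product[of "\<lambda>m t. \<Sum>j=1..K. (cmod (?X g m t j))\<^sup>2" "{1..n}" "{1..M}"]
      by (simp only: slots_def case_prod_unfold)
    also have "\<dots> = (\<Sum>t=1..n. \<Sum>m=1..M. \<Sum>j=1..K. (cmod (?X g m t j))\<^sup>2)"
      by (rule sum.swap)
    finally show ?thesis by (simp add: encoder_input_def)
  qed
  also have "\<dots> \<le> real n * real M * P"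
    using pow nM by (simp add: field_simps)
  finally have pw: "(\<Sum>i\<in>slots n. \<Sum>j=1..K. (cmod (?X g (fst i) (snd i) j))\<^sup>2) \<le> real n * real M * P" .
  have "(\<Sum>i\<in>slots n. lat_norm2 (image_at P n ?X k g i))
      \<le> (\<Sum>i\<in>slots n. 2 * (real K * C\<^sup>2 * (\<Sum>j=1..K. (cmod (?X g (fst i) (snd i) j))\<^sup>2)) + 4)"
  proof (rule sum_mono)
    fix i assume si: "i \<in> slots n"
    have "cmod (signal P ?X k i g) \<le> (\<Sum>j=1..K. cmod (coeff P k (fst i) (snd i) j g * ?X g (fst i) (snd i) j))"
      unfolding signal_def by (rule norm_sum)
    also have "\<dots> \<le> (\<Sum>j=1..K. C * cmod (?X g (fst i) (snd i) j))"
      using i si by (intro sum_mono) (auto simp: norm_mult intro!: mult_right_mono)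
    finally have "(cmod (signal P ?X k i g))\<^sup>2 \<le> (\<Sum>j=1..K. C * cmod (?X g (fst i) (snd i) j))\<^sup>2"
      by (intro power_mono) auto
    also have "\<dots> \<le> (\<Sum>j=1..K. C\<^sup>2) * (\<Sum>j=1..K. (cmod (?X g (fst i) (snd i) j))\<^sup>2)"
      by (rule Cauchy_Schwarz_ineq_sum)
    finally have "(cmod (signal P ?X k i g))\<^sup>2 \<le> real K * C\<^sup>2 * (\<Sum>j=1..K. (cmod (?X g (fst i) (snd i) j))\<^sup>2)"
      by simp
    then show "lat_norm2 (image_at P n ?X k g i) \<le> 2 * (real K * C\<^sup>2 * (\<Sum>j=1..K. (cmod (?X g (fst i) (snd i) j))\<^sup>2)) + 4"
      using quantize_norm_le[of "signal P ?X k i g"] si by (simp add: image_at_def)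
  qed
  also have "\<dots> = 2 * real K * C\<^sup>2 * (\<Sum>i\<in>slots n. \<Sum>j=1..K. (cmod (?X g (fst i) (snd i) j))\<^sup>2) + 4 * real (card (slots n))"
    by (simp add: sum.distrib sum_distrib_left mult_ac)
  also have "\<dots> \<le> 2 * real K * C\<^sup>2 * (real n * real M * P) + 4 * real (card (slots n))"
    using pw by (intro add_right_mono mult_left_mono) auto
  also have "\<dots> = real (card (slots n)) * (2 * real K * C\<^sup>2 * P + 4)"
    by (simp add: card_slots algebra_simps)
  finally show ?thesis .
qed

end

lemma representatives_mono:
  "representatives N W A f R \<Longrightarrow> sets N \<subseteq> sets N' \<Longrightarrow> representatives N' W A f R"
  unfolding representatives_def by blast

lemma alignment_bounds:
  assumes "0 < \<beta>"
  shows "0 \<le> alignment \<beta> p q" "alignment \<beta> p q \<le> 1"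
  using assms by (auto simp: alignment_def divide_simps)

section \<open>The converse for a single code\<close>

context parallel_miso_bc
begin

definition received_power :: "real \<Rightarrow> real \<Rightarrow> real" where
  "received_power C P = 2 * real K * C\<^sup>2 * P + 4"

text \<open>Total of the collision bounds over all images allowed by the power constraint: the
  single-slot sums, times \<open>exp 1\<close> per slot for the Gaussian weight.\<close>

definition alignment_factor :: "real \<Rightarrow> real \<Rightarrow> real \<Rightarrow> nat \<Rightarrow> nat \<Rightarrow> real" where
  "alignment_factor \<beta> C P n u = exp (real (n * M)) *
     (\<Prod>i\<in>slots n. 4 * (\<beta> * P powr \<alpha> u (fst i)) * (16 + 2 * ln (received_power C P))\<^sup>2)"

text \<open>Index \<open>i\<close> belongs to user \<open>K - i\<close>, so the telescoping runs
  from the last user backwards. The admissible error probability is such that the losses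
  \<open>2 * K\<close> from decodability and \<open>2 ^ (K - 1)\<close> from the thresholds still
  leave more than half of the messages. The constants are fixed before \<open>P\<close>,
  \<open>n\<close> and the code.\<close>

lemma converse_code:
  obtains \<beta> C P0 :: real where "1 \<le> \<beta>" "1 \<le> C" "1 \<le> P0"
    and "\<And>P n N enc dec. P0 \<le> P \<Longrightarrow> 1 \<le> n \<Longrightarrow> valid_code P n N enc dec \<Longrightarrow>
      messages N \<noteq> {} \<Longrightarrow> error_prob P n N enc dec \<le> 1 / (real K * 2 ^ (K + 2)) \<Longrightarrow>
      real (card (messages N)) \<le> 2 * ((2 ^ K * (2 * (2 * exp 8) ^ (n * M))) ^ K *
        (\<Prod>u\<in>{2..K}. 4 * alignment_factor \<beta> C P n u) * (exp (real (n * M)) * (144 * received_power C P) ^ (n * M)))"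
proof (rule coeff_bounds)
  fix c0 C P1 :: real
  assume C: "1 \<le> C" and P1: "1 \<le> P1"
    and bnd: "\<And>P n. P1 \<le> P \<Longrightarrow> AE g in block_law n. \<forall>k\<in>{1..K}. \<forall>i\<in>slots n. \<forall>j\<in>{1..K}.
        c0 \<le> cmod (coeff P k (fst i) (snd i) j g) \<and> cmod (coeff P k (fst i) (snd i) j g) \<le> C"
  show thesis
  proof (rule alignment_probability)
    fix \<beta> P2 :: real
    assume \<beta>: "1 \<le> \<beta>" and P2: "1 \<le> P2"
      and align: "\<And>P n u v U X X' A. P2 \<le> P \<Longrightarrow> U \<subseteq> {1..K} \<Longrightarrow> u \<in> U \<Longrightarrow> v \<in> {1..K} - U \<Longrightarrow>
      estimate_input n X \<Longrightarrow> estimate_input n X' \<Longrightarrow>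
      A \<in> sets (free_events (block_space n) (user_errors n U)) \<Longrightarrow>
      emeasure (block_law n) (A \<inter> {g\<in>space (block_space n). image_at P n X u g = image_at P n X' u g})
      \<le> (\<integral>\<^sup>+g. indicator A g * (\<Prod>i\<in>slots n. ennreal (alignment (\<beta> * P powr \<alpha> u (fst i))
            (image_at P n X' v g i) (image_at P n X v g i))) \<partial>block_law n)"
    show thesis
    proof (rule that[of \<beta> C "max P1 P2"])
      fix P n N enc dec
      assume P: "max P1 P2 \<le> P" and n: "1 \<le> n" and v: "valid_code P n N enc dec"
        and ne: "messages N \<noteq> {}" and err: "error_prob P n N enc dec \<le> 1 / (real K * 2 ^ (K + 2))"
      have K: "1 \<le> K" by (rule users)
      have PP: "P1 \<le> P" "P2 \<le> P" "1 \<le> P" using P P1 by auto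
      define W where "W = messages N"
      have W: "finite W" "W \<noteq> {}" using finite_messages ne by (simp_all add: W_def)
      define X where "X = encoder_input n enc"
      have X: "estimate_input n (X w)" if "w \<in> W" for w
        unfolding X_def using estimate_input_encoder[OF v] that by (simp add: W_def)
      let ?N = "block_space n" and ?M = "block_law n"
      interpret B: prob_space ?M by (rule prob_space_block_law)
      \<comment> \<open>At stage \<open>i\<close> the errors of the users after \<open>K - i\<close>
        are averaged out, while events may depend on all other entries.\<close>
      define U where "U i = {K - i<..K}" for i
      have UK: "U i \<subseteq> {1..K}" for i by (auto simp: U_def)
      define F where "F i = free_events ?N (user_errors n (U i))" for i
      have frS: "free_of (user_errors n (U i)) (\<lambda>g. g \<in> space ?N)" for i
        by (rule free_of_space_block[OF user_errors_block[OF UK]])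
      have sF: "sets (F i) = {A \<in> sets ?N. free_of (user_errors n (U i)) (\<lambda>g. g \<in> A)}" for i
        unfolding F_def by (rule sets_free_events[OF frS])
      have spF: "space (F i) = space ?N" for i
        by (simp add: F_def free_events_def space_measure_of_conv)
      have sub: "subalgebra ?M (F i)" for i
        unfolding F_def by (rule subalgebra_free_events[OF frS]) simp
      have mono: "sets (F (Suc i)) \<subseteq> sets (F i)" for i
      proof -
        have "user_errors n (U i) \<subseteq> user_errors n (U (Suc i))" by (auto simp: user_errors_def U_def)
        then show ?thesis unfolding sF by (auto intro: free_of_subset)
      qed
      define A0 where "A0 w = space ?N - undecodable P n enc dec w" for w
      have A0m: "A0 w \<in> sets (F 0)" if "w \<in> W" for w
        using undecodable(1)[OF v _ n, of w] that
        by (auto simp: A0_def sF W_def free_of_def user_errors_def U_def)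
      have exA: "\<exists>A. \<forall>w\<in>W. A 0 w = A0 w \<and> (\<forall>i. A i w \<in> sets (F i) \<and>
          (\<forall>C\<in>sets (F (Suc i)). C \<subseteq> A (Suc i) w \<longrightarrow> B.prob C \<le> 2 * B.prob (C \<inter> A i w)) \<and>
          B.prob (space ?M - A i w) \<le> 2 ^ i * B.prob (space ?M - A0 w) \<and>
          (\<forall>C\<in>sets (F i). C \<subseteq> A i w \<longrightarrow> B.prob C \<le> 2 ^ i * B.prob (C \<inter> A0 w)))"
        by (rule B.threshold_chain[where F=F and W=W]) (rule sub mono A0m; assumption?)+
      then obtain A where A_all: "\<forall>w\<in>W. A 0 w = A0 w \<and> (\<forall>i. A i w \<in> sets (F i) \<and>
          (\<forall>C\<in>sets (F (Suc i)). C \<subseteq> A (Suc i) w \<longrightarrow> B.prob C \<le> 2 * B.prob (C \<inter> A i w)) \<and>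
          B.prob (space ?M - A i w) \<le> 2 ^ i * B.prob (space ?M - A0 w) \<and>
          (\<forall>C\<in>sets (F i). C \<subseteq> A i w \<longrightarrow> B.prob C \<le> 2 ^ i * B.prob (C \<inter> A0 w)))" ..
      note A_w = bspec[OF A_all]
      have Am: "A i w \<in> sets (F i)" if "w \<in> W" for i w using A_w[OF that] by simp
      have thr: "B.prob D \<le> 2 * B.prob (D \<inter> A i w)" if "w \<in> W" "D \<in> sets (F (Suc i))" "D \<subseteq> A (Suc i) w" for i w D
        using A_w[OF that(1)] that(2,3) by simp
      have comp: "B.prob (space ?M - A i w) \<le> 2 ^ i * B.prob (space ?M - A0 w)" if "w \<in> W" for i w
        using A_w[OF that] by simp
      have cum: "B.prob D \<le> 2 ^ i * B.prob (D \<inter> A0 w)" if "w \<in> W" "D \<in> sets (F i)" "D \<subseteq> A i w" for i w D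
        using A_w[OF that(1)] that(2,3) by simp
      have FM: "D \<in> sets ?M" if "D \<in> sets (F i)" for D i using that by (simp add: sF)
      define a where "a j w g = image_at P n (X w) j g" for j w g
      have am: "{g\<in>space ?N. a j w g = a j w' g} \<in> sets ?N" if "w \<in> W" "w' \<in> W" "j \<in> {1..K}" for j w w'
      proof -
        have "{g\<in>space ?N. a j w g = a j w' g} = {g\<in>space ?N. \<forall>i\<in>slots n. a j w g i = a j w' g i}"
          unfolding a_def image_at_def by (auto simp: fun_eq_iff restrict_def)
        also have "\<dots> \<in> sets ?N"
          unfolding pred_def[symmetric]
        proof (rule pred_intros_finite(3)[OF finite_slots])
          fix i assume i: "i \<in> slots n"
          note [measurable] = image_at_measurable[OF X[OF that(1)] that(3) i, of P, folded a_def]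
            image_at_measurable[OF X[OF that(2)] that(3) i, of P, folded a_def]
          show "Measurable.pred ?N (\<lambda>g. a j w g i = a j w' g i)" by measurable
        qed
        finally show ?thesis .
      qed
      have aF: "{g\<in>space (F i). (p, a (K - i) w g) = (p', a (K - i) w' g)} \<in> sets (F i)"
        if "w \<in> W" "w' \<in> W" "i < K" for i w w' and p p' :: "nat \<Rightarrow> nat"
      proof (cases "p = p'")
        case True
        have j: "K - i \<in> {1..K}" "K - i \<notin> U i" using that(3) by (auto simp: U_def)
        note fr = image_at_free[OF X[OF that(1)] UK j(2), of P] image_at_free[OF X[OF that(2)] UK j(2), of P]
        have "free_of (user_errors n (U i)) (\<lambda>g. g \<in> {g\<in>space ?N. a (K - i) w g = a (K - i) w' g})"
          using frS[of i] fr by (simp add: free_of_def a_def)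
        then show ?thesis using am[OF that(1,2) j(1)] True by (simp add: sF spF)
      next
        case False
        then show ?thesis by simp
      qed
      have exRU: "\<exists>R. representatives (F i) W (A i) (\<lambda>w g. (restrict w {Suc (K - i)..K}, a (K - i) w g)) R" if "i < K" for i
        by (rule representatives_exist[OF W(1) Am aF]) (use that in simp_all)
      \<comment> \<open>\<open>RU i\<close> counts images of user \<open>K - i\<close> paired with
        the messages of the later users; \<open>RV i\<close> below adds the message of user
        \<open>K - i\<close> itself to the key. Both choices are measurable in
        \<open>F i\<close>.\<close>
      define RU where "RU i = (SOME R. representatives (F i) W (A i) (\<lambda>w g. (restrict w {Suc (K - i)..K}, a (K - i) w g)) R)" for i
      have RU: "representatives (F i) W (A i) (\<lambda>w g. (restrict w {Suc (K - i)..K}, a (K - i) w g)) (RU i)" if "i < K" for i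
        unfolding RU_def by (rule someI_ex[OF exRU[OF that]])
      have exRV: "\<exists>R. representatives (F i) W (A i) (\<lambda>w g. (restrict w {K - i..K}, a (K - i) w g)) R" if "i < K" for i
        by (rule representatives_exist[OF W(1) Am aF]) (use that in simp_all)
      define RV where "RV i = (SOME R. representatives (F i) W (A i) (\<lambda>w g. (restrict w {K - i..K}, a (K - i) w g)) R)" for i
      have RV: "representatives (F i) W (A i) (\<lambda>w g. (restrict w {K - i..K}, a (K - i) w g)) (RV i)" if "i < K" for i
        unfolding RV_def by (rule someI_ex[OF exRV[OF that]])
      define u where "u i = (\<Sum>w\<in>W. B.prob (RU i w))" for i
      define vv where "vv i = (\<Sum>w\<in>W. B.prob (RV i w))" for i
      define R where "R = received_power C P"
      have R: "1 \<le> R" using PP C by (simp add: R_def received_power_def)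
      define \<theta> where "\<theta> k = alignment_factor \<beta> C P n k" for k
      have R': "0 \<le> ln R" using R by simp
      have \<theta>0: "0 < \<theta> k" for k
        unfolding \<theta>_def alignment_factor_def R_def[symmetric] using \<beta> PP R'
        by (intro mult_pos_pos prod_pos) auto
      define L where "L = 2 ^ K * (2 * (2 * exp 8) ^ (n * M) :: real)"
      define Q where "Q = exp (real (n * M)) * (144 * R) ^ (n * M)"
      have aU: "a j w g \<in> slots n \<rightarrow>\<^sub>E UNIV" for j w g by (simp add: a_def image_at_def)
      have power: "AE g in ?M. \<forall>j\<in>{1..K}. \<forall>w\<in>W. (\<Sum>i\<in>slots n. lat_norm2 (a j w g i)) \<le> real (card (slots n)) * R"
        using bnd[OF PP(1), of n]
      proof eventually_elim
        fix g assume g: "\<forall>k\<in>{1..K}. \<forall>i\<in>slots n. \<forall>j\<in>{1..K}. c0 \<le> cmod (coeff P k (fst i) (snd i) j g) \<and> cmod (coeff P k (fst i) (snd i) j g) \<le> C"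
        show "\<forall>j\<in>{1..K}. \<forall>w\<in>W. (\<Sum>i\<in>slots n. lat_norm2 (a j w g i)) \<le> real (card (slots n)) * R"
        proof (intro ballI)
          fix j w assume j: "j \<in> {1..K}" and w: "w \<in> W"
          show "(\<Sum>i\<in>slots n. lat_norm2 (a j w g i)) \<le> real (card (slots n)) * R"
            unfolding a_def X_def R_def received_power_def
          proof (rule image_power_le[OF _ _ v _ n])
            show "\<forall>i\<in>slots n. \<forall>l\<in>{1..K}. cmod (coeff P j (fst i) (snd i) l g) \<le> C" using g j by blast
            show "0 \<le> C" using C by simp
            show "w \<in> messages N" using w by (simp add: W_def)
          qed
        qed
      qed
      \<comment> \<open>Distinct representatives in \<open>RV i\<close> with the same key for
        \<open>RU i\<close> share their image but differ in the message of user
        \<open>K - i\<close>, so few of them are decodable. Passing from \<open>A i\<close> to the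
        decodable event \<open>A0\<close> costs \<open>2 ^ i\<close>.\<close>
      have stage_a: "vv i \<le> L * u i" if i: "i < K" for i
      proof -
        have j: "K - i \<in> {1..K}" using i by auto
        note D = representativesD[OF RV[OF i]]
        have "vv i \<le> (\<Sum>w\<in>W. 2 ^ i * B.prob (RV i w \<inter> A0 w))"
          unfolding vv_def using D(1,2) by (intro sum_mono cum) auto
        also have "\<dots> = 2 ^ i * (\<Sum>w\<in>W. B.prob (RV i w \<inter> A0 w))" by (simp add: sum_distrib_left)
        also have "(\<Sum>w\<in>W. B.prob (RV i w \<inter> A0 w)) \<le> (2 * (2 * exp 8) ^ (n * M)) * u i"
        proof -
          have m1: "RV i w \<inter> A0 w \<in> B.events" if "w \<in> W" for w
            using FM[OF D(1)[OF that]] FM[OF A0m[OF that]] by auto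
          have m2: "RU i w \<in> B.events" if "w \<in> W" for w
            using FM[OF representativesD(1)[OF RU[OF i] that]] .
          have pt: "real (card {w\<in>W. g \<in> RV i w \<inter> A0 w}) \<le> (2 * (2 * exp 8) ^ (n * M)) * real (card {w\<in>W. g \<in> RU i w})" for g
          proof -
            define Vs where "Vs = {w\<in>W. g \<in> RV i w \<inter> A0 w}"
            let ?f = "\<lambda>w. (restrict w {Suc (K - i)..K}, a (K - i) w g)"
            have Vs: "finite Vs" "Vs \<subseteq> W" using W by (auto simp: Vs_def)
            have "card Vs = (\<Sum>y\<in>?f ` Vs. card {w\<in>Vs. ?f w = y})"
              using sum.image_gen[OF Vs(1), of "\<lambda>_. 1::nat" ?f] by simp
            then have "real (card Vs) = (\<Sum>y\<in>?f ` Vs. real (card {w\<in>Vs. ?f w = y}))" by simp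
            also have "\<dots> \<le> (\<Sum>y\<in>?f ` Vs. 2 * (2 * exp 8) ^ (n * M))"
            proof (rule sum_mono)
              fix y
              show "real (card {w\<in>Vs. ?f w = y}) \<le> 2 * (2 * exp 8) ^ (n * M)"
              proof (cases "{w\<in>Vs. ?f w = y} = {}")
                case False
                then obtain w1 where w1: "w1 \<in> Vs" by auto
                then have "g \<in> A0 w1" by (simp add: Vs_def)
                then have g: "g \<in> space ?N" by (simp add: A0_def)
                show ?thesis
                proof (rule decodable_count[OF v n j g])
                  show "{w\<in>Vs. ?f w = y} \<subseteq> messages N" using Vs by (auto simp: W_def)
                  show "g \<notin> undecodable P n enc dec w" if "w \<in> {w\<in>Vs. ?f w = y}" for w
                    using that by (auto simp: Vs_def A0_def)
                  show "image_at P n (encoder_input n enc w) (K - i) g = image_at P n (encoder_input n enc w') (K - i) g"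
                    if "w \<in> {w\<in>Vs. ?f w = y}" "w' \<in> {w\<in>Vs. ?f w = y}" for w w'
                    using that by (auto simp: a_def X_def)
                  show "inj_on (\<lambda>w. w (K - i)) {w\<in>Vs. ?f w = y}"
                  proof (rule inj_onI)
                    fix w w' assume ww: "w \<in> {w\<in>Vs. ?f w = y}" "w' \<in> {w\<in>Vs. ?f w = y}" "w (K - i) = w' (K - i)"
                    then have f: "restrict w {Suc (K - i)..K} = restrict w' {Suc (K - i)..K}" "a (K - i) w g = a (K - i) w' g"
                      by auto
                    have "restrict w {K - i..K} = restrict w' {K - i..K}"
                    proof (rule restrict_ext)
                      fix l assume l: "l \<in> {K - i..K}"
                      show "w l = w' l"
                      proof (cases "l = K - i")
                        case False
                        then show ?thesis using fun_cong[OF f(1), of l] l by simp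
                      qed (use ww in simp)
                    qed
                    then show "w = w'"
                      using ww f by (intro D(4)[of w w' g]) (auto simp: Vs_def)
                  qed
                qed
              next
                case True
                show ?thesis unfolding True by simp
              qed
            qed
            also have "\<dots> = (2 * (2 * exp 8) ^ (n * M)) * real (card (?f ` Vs))"
              by (subst sum_constant) (simp only: mult.commute)
            also have "\<dots> \<le> (2 * (2 * exp 8) ^ (n * M)) * real (card {w\<in>W. g \<in> RU i w})"
            proof (intro mult_left_mono of_nat_mono)
              show "card (?f ` Vs) \<le> card {w\<in>W. g \<in> RU i w}"
              proof (rule representatives_countI[OF RU[OF i] W(1) Vs(2)])
                show "g \<in> A i w" if "w \<in> Vs" for w using that D(2)[of w] by (auto simp: Vs_def)
              qed auto
            qed simp
            finally show ?thesis by (simp add: Vs_def)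
          qed
          have "(\<Sum>w\<in>W. B.prob (RV i w \<inter> A0 w)) = (\<integral>g. real (card {w\<in>W. g \<in> RV i w \<inter> A0 w}) \<partial>?M)"
            by (rule B.sum_prob_eq_integral_card(2)[OF W(1) m1])
          also have "\<dots> \<le> (\<integral>g. (2 * (2 * exp 8) ^ (n * M)) * real (card {w\<in>W. g \<in> RU i w}) \<partial>?M)"
            by (intro integral_mono integrable_mult_right pt B.sum_prob_eq_integral_card(1)[OF W(1)] m1 m2)
          also have "\<dots> = (2 * (2 * exp 8) ^ (n * M)) * u i"
            using B.sum_prob_eq_integral_card(2)[OF W(1) m2] by (simp add: u_def)
          finally show ?thesis .
        qed
        also have "2 ^ i * ((2 * (2 * exp 8) ^ (n * M)) * u i) \<le> 2 ^ K * ((2 * (2 * exp 8) ^ (n * M)) * u i)"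
          using i by (intro mult_right_mono power_increasing mult_nonneg_nonneg) (auto simp: u_def sum_nonneg)
        finally show ?thesis by (simp add: L_def mult_ac)
      qed
      \<comment> \<open>The keys of \<open>RU (Suc i)\<close> and \<open>RV i\<close> carry the same
        messages, those of the users from \<open>K - i\<close> on, and differ only in the user whose
        image is taken. Collisions at user \<open>K - i\<close> come from its errors, of which the
        events in \<open>F (Suc i)\<close> are free.\<close>
      have stage_b: "u (Suc i) \<le> 4 * \<theta> (K - i) * vv i" if i: "Suc i < K" for i
      proof -
        have jj: "K - i \<in> {1..K}" "K - Suc i \<in> {1..K}" "Suc (K - Suc i) = K - i" "i < K" using i by auto
        define \<tau> where "\<tau> w l g = (\<Prod>s\<in>slots n. alignment (\<beta> * P powr \<alpha> (K - i) (fst s)) (l s) (a (K - Suc i) w g s))" for w l g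
        have \<beta>P: "1 \<le> \<beta> * P powr \<alpha> (K - i) (fst s)" if "s \<in> slots n" for s
        proof -
          have "0 \<le> \<alpha> (K - i) (fst s)" using quality[OF jj(1), of "fst s"] that by (auto simp: slots_def)
          then have "1 * 1 \<le> \<beta> * P powr \<alpha> (K - i) (fst s)"
            using \<beta> PP by (intro mult_mono ge_one_powr_ge_zero) auto
          then show ?thesis by simp
        qed
        have al: "0 \<le> alignment (\<beta> * P powr \<alpha> (K - i) (fst s)) p q" "alignment (\<beta> * P powr \<alpha> (K - i) (fst s)) p q \<le> 1"
          if "s \<in> slots n" for s p q
          using alignment_bounds[of "\<beta> * P powr \<alpha> (K - i) (fst s)"] \<beta>P[OF that] by auto
        have \<tau>01: "0 \<le> \<tau> w l g" "\<tau> w l g \<le> 1" for w l g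
          unfolding \<tau>_def by (intro prod_nonneg al(1), assumption) (intro prod_le_1 conjI al)
        have \<tau>int: "integrable ?M (\<lambda>g. \<tau> w (a (K - Suc i) w' g) g)" if "w \<in> W" "w' \<in> W" for w w'
        proof (rule B.integrable_const_bound[of _ 1])
          show "AE g in ?M. norm (\<tau> w (a (K - Suc i) w' g) g) \<le> 1" using \<tau>01 by (intro AE_I2) simp
          have "(\<lambda>g. \<tau> w (a (K - Suc i) w' g) g) \<in> borel_measurable ?N"
            unfolding \<tau>_def
          proof (rule borel_measurable_prod)
            fix s assume s: "s \<in> slots n"
            note [measurable] = image_at_measurable[OF X[OF that(1)] jj(2) s, of P, folded a_def]
              image_at_measurable[OF X[OF that(2)] jj(2) s, of P, folded a_def]
            show "(\<lambda>g. alignment (\<beta> * P powr \<alpha> (K - i) (fst s)) (a (K - Suc i) w' g s) (a (K - Suc i) w g s)) \<in> borel_measurable ?N"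
              by measurable
          qed
          then show "(\<lambda>g. \<tau> w (a (K - Suc i) w' g) g) \<in> borel_measurable ?M" by simp
        qed
        show ?thesis
          unfolding u_def vv_def
        proof (rule B.aligned_images_stage[where F="F (Suc i)" and A'="A (Suc i)" and A="A i" and \<tau>=\<tau>
              and \<kappa>="\<lambda>w. restrict w {K - i..K}" and a="a (K - Suc i)" and b="a (K - i)"])
          show "subalgebra ?M (F (Suc i))" by (rule sub)
          show "finite W" by (rule W)
          show "0 < \<theta> (K - i)" by (rule \<theta>0)
          show "A (Suc i) w \<in> sets (F (Suc i))" if "w \<in> W" for w by (rule Am[OF that])
          show "A i w \<in> B.events" if "w \<in> W" for w by (rule FM[OF Am[OF that]])
          show "B.prob D \<le> 2 * B.prob (D \<inter> A i w)" if "w \<in> W" "D \<in> sets (F (Suc i))" "D \<subseteq> A (Suc i) w" for w D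
            by (rule thr[OF that])
          show "{x \<in> space ?M. a (K - i) w x = a (K - i) w' x} \<in> B.events" if "w \<in> W" "w' \<in> W" for w w'
            using am[OF that jj(1)] by simp
          show "representatives (F (Suc i)) W (A (Suc i)) (\<lambda>w x. (restrict w {K - i..K}, a (K - Suc i) w x)) (RU (Suc i))"
            using RU[OF i] unfolding jj(3) .
          show "representatives ?M W (A i) (\<lambda>w x. (restrict w {K - i..K}, a (K - i) w x)) (RV i)"
            by (rule representatives_mono[OF RV[OF jj(4)]]) (auto simp: sF)
          show "integrable ?M (\<lambda>x. \<tau> w (a (K - Suc i) w' x) x)" if "w \<in> W" "w' \<in> W" for w w'
            by (rule \<tau>int[OF that])
          show "B.prob (D \<inter> {x \<in> space ?M. a (K - i) w x = a (K - i) w' x}) \<le> (\<integral>x. indicator D x * \<tau> w (a (K - Suc i) w' x) x \<partial>?M)"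
            if "w \<in> W" "w' \<in> W" "D \<in> sets (F (Suc i))" for w w' D
          proof -
            have "emeasure ?M (D \<inter> {x \<in> space ?N. a (K - i) w x = a (K - i) w' x})
              \<le> (\<integral>\<^sup>+g. indicator D g * (\<Prod>s\<in>slots n. ennreal (alignment (\<beta> * P powr \<alpha> (K - i) (fst s))
                  (a (K - Suc i) w' g s) (a (K - Suc i) w g s))) \<partial>?M)"
              unfolding a_def
            proof (rule align[OF PP(2) UK])
              show "K - i \<in> U (Suc i)" "K - Suc i \<in> {1..K} - U (Suc i)" using i by (auto simp: U_def)
              show "estimate_input n (X w)" "estimate_input n (X w')" using X that by auto
              show "D \<in> sets (free_events ?N (user_errors n (U (Suc i))))" using that(3) by (simp add: F_def)
            qed
            also have "\<dots> = (\<integral>\<^sup>+g. ennreal (indicator D g * \<tau> w (a (K - Suc i) w' g) g) \<partial>?M)"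
              unfolding \<tau>_def using al
              by (intro nn_integral_cong) (auto simp: prod_ennreal indicator_def)
            also have "\<dots> = ennreal (\<integral>g. indicator D g * \<tau> w (a (K - Suc i) w' g) g \<partial>?M)"
              using integrable_mult_indicator[OF FM[OF that(3)] \<tau>int[OF that(1,2)]] \<tau>01
              by (intro nn_integral_eq_integral) auto
            finally show ?thesis
              using \<tau>01 by (simp add: B.emeasure_eq_measure ennreal_le_iff integral_nonneg_AE)
          qed
          show "AE x in ?M. \<forall>w\<in>W. \<forall>U. U \<subseteq> (\<lambda>w'. a (K - Suc i) w' x) ` W \<longrightarrow> (\<Sum>v\<in>U. \<tau> w v x) \<le> \<theta> (K - i)"
            using power
          proof eventually_elim
            fix g assume g: "\<forall>j\<in>{1..K}. \<forall>w\<in>W. (\<Sum>i\<in>slots n. lat_norm2 (a j w g i)) \<le> real (card (slots n)) * R"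
            show "\<forall>w\<in>W. \<forall>U. U \<subseteq> (\<lambda>w'. a (K - Suc i) w' g) ` W \<longrightarrow> (\<Sum>v\<in>U. \<tau> w v g) \<le> \<theta> (K - i)"
            proof (intro ballI allI impI)
              fix w U assume w: "w \<in> W" and U: "U \<subseteq> (\<lambda>w'. a (K - Suc i) w' g) ` W"
              have "(\<Sum>v\<in>U. \<tau> w v g) \<le> exp (real (card (slots n))) *
                  (\<Prod>s\<in>slots n. 4 * (\<beta> * P powr \<alpha> (K - i) (fst s)) * (16 + 2 * ln R)\<^sup>2)"
                unfolding \<tau>_def
              proof (rule sum_prod_power_constraint_le[where R=R])
                show "finite U" using U W finite_subset by blast
                show "U \<subseteq> slots n \<rightarrow>\<^sub>E UNIV" using U aU by blast
                show "(\<Sum>i\<in>slots n. lat_norm2 (v i)) \<le> real (card (slots n)) * R" if "v \<in> U" for v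
                  using that U g jj(2) by blast
                show "(\<Sum>p\<in>G. alignment (\<beta> * P powr \<alpha> (K - i) (fst s)) p (a (K - Suc i) w g s) * exp (- lat_norm2 p / R))
                  \<le> 4 * (\<beta> * P powr \<alpha> (K - i) (fst s)) * (16 + 2 * ln R)\<^sup>2" if "s \<in> slots n" "finite G" for s G
                  by (rule sum_gauss_alignment_le[OF that(2) R \<beta>P[OF that(1)]])
              qed (use R al in auto)
              then show "(\<Sum>v\<in>U. \<tau> w v g) \<le> \<theta> (K - i)"
                by (simp add: \<theta>_def alignment_factor_def R_def card_slots)
            qed
          qed
        qed
      qed
      \<comment> \<open>For the last user no message remains in the key, so representatives are
        separated by their images alone, and these are lattice points under the power
        constraint.\<close>
      have stage_c: "u 0 \<le> Q"
      proof -
        have K0: "0 < K" "K \<in> {1..K}" using K by auto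
        note D = representativesD[OF RU[OF K0(1)]]
        have m: "RU 0 w \<in> B.events" if "w \<in> W" for w using FM[OF D(1)[OF that]] .
        have "u 0 = (\<integral>g. real (card {w\<in>W. g \<in> RU 0 w}) \<partial>?M)"
          unfolding u_def by (rule B.sum_prob_eq_integral_card(2)[OF W(1) m])
        also have "\<dots> \<le> (\<integral>g. Q \<partial>?M)"
        proof (rule integral_mono_AE)
          show "integrable ?M (\<lambda>g. real (card {w\<in>W. g \<in> RU 0 w}))"
            by (rule B.sum_prob_eq_integral_card(1)[OF W(1) m])
          show "AE g in ?M. real (card {w\<in>W. g \<in> RU 0 w}) \<le> Q"
            using power
          proof eventually_elim
            fix g assume g: "\<forall>j\<in>{1..K}. \<forall>w\<in>W. (\<Sum>i\<in>slots n. lat_norm2 (a j w g i)) \<le> real (card (slots n)) * R"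
            define Vs where "Vs = {w\<in>W. g \<in> RU 0 w}"
            have "inj_on (\<lambda>w. a K w g) Vs"
              by (intro inj_onI D(4)[of _ _ g]) (auto simp: Vs_def)
            then have "real (card Vs) = (\<Sum>l\<in>(\<lambda>w. a K w g) ` Vs. 1)" by (simp add: card_image)
            also have "\<dots> = (\<Sum>l\<in>(\<lambda>w. a K w g) ` Vs. \<Prod>s\<in>slots n. 1)" by simp
            also have "\<dots> \<le> exp (real (card (slots n))) * (\<Prod>s\<in>slots n. 144 * R)"
            proof (rule sum_prod_power_constraint_le[where R=R and \<tau>="\<lambda>_ _. 1"])
              show "finite ((\<lambda>w. a K w g) ` Vs)" using W by (auto simp: Vs_def)
              show "(\<lambda>w. a K w g) ` Vs \<subseteq> slots n \<rightarrow>\<^sub>E UNIV" using aU by blast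
              show "(\<Sum>i\<in>slots n. lat_norm2 (v i)) \<le> real (card (slots n)) * R" if "v \<in> (\<lambda>w. a K w g) ` Vs" for v
                using that g K0(2) by (auto simp: Vs_def)
              show "(\<Sum>p\<in>G. 1 * exp (- lat_norm2 p / R)) \<le> 144 * R" if "finite G" for G
                using sum_gauss_lattice_le[OF that R] by simp
            qed (use R in auto)
            finally show "real (card {w\<in>W. g \<in> RU 0 w}) \<le> Q" by (simp add: Vs_def Q_def card_slots)
          qed
        qed simp
        also have "(\<integral>g. Q \<partial>?M) = Q" using B.prob_space by (simp del: space_block_law)
        finally show ?thesis .
      qed
      \<comment> \<open>For user 1 the key contains the whole message tuple, so every active message
        represents itself.\<close>
      have stage_d: "real (card W) / 2 \<le> vv (K - 1)"
      proof -
        have K1: "K - 1 < K" "K - (K - 1) = 1" using K by auto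
        note D = representativesD[OF RV[OF K1(1)], unfolded K1(2)]
        have sub1: "A (K - 1) w \<subseteq> RV (K - 1) w" if w: "w \<in> W" for w
        proof
          fix g assume "g \<in> A (K - 1) w"
          then obtain w' where w': "w' \<in> W" "g \<in> RV (K - 1) w'" "(restrict w' {1..K}, a 1 w' g) = (restrict w {1..K}, a 1 w g)"
            using D(3)[OF w] by blast
          have "restrict w' {1..K} = w'" "restrict w {1..K} = w"
            using w w'(1) by (auto simp: W_def messages_def PiE_restrict)
          then have "w' = w" using w'(3) by simp
          then show "g \<in> RV (K - 1) w" using w'(2) by simp
        qed
        define p where "p w = prob {\<omega>\<in>space \<Omega>. \<exists>k\<in>{1..K}. dec k (\<lambda>(m, t)\<in>{1..M} \<times> {1..n}. received P n enc w k m t \<omega>)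
              (\<lambda>e\<in>block_entries K M n. H e \<omega>) \<noteq> w k}" for w
        have "(\<Sum>w\<in>W. p w) / real (card W) \<le> 1 / (real K * 2 ^ (K + 2))"
          using err unfolding error_prob_def W_def[symmetric] p_def .
        then have psum: "(\<Sum>w\<in>W. p w) \<le> real (card W) / (real K * 2 ^ (K + 2))"
          using W by (simp add: card_gt_0_iff field_simps)
        have "real (card W) - (2 ^ (K - 1) * (2 * real K)) * (\<Sum>w\<in>W. p w) = (\<Sum>w\<in>W. 1 - (2 ^ (K - 1) * (2 * real K)) * p w)"
          unfolding sum_subtractf sum_distrib_left by simp
        also have "\<dots> \<le> (\<Sum>w\<in>W. B.prob (RV (K - 1) w))"
        proof (rule sum_mono)
          fix w assume w: "w \<in> W"
          have wm: "w \<in> messages N" using w by (simp add: W_def)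
          have "space ?M - A0 w = undecodable P n enc dec w"
            using sets.sets_into_space[OF undecodable(1)[OF v wm n]] by (auto simp: A0_def)
          then have "B.prob (space ?M - A0 w) \<le> 2 * real K * p w"
            using undecodable(2)[OF v wm n] by (simp add: p_def)
          then have "B.prob (space ?M - A (K - 1) w) \<le> 2 ^ (K - 1) * (2 * real K * p w)"
            by (intro order_trans[OF comp[OF w, of "K - 1"]] mult_left_mono) simp_all
          moreover have "B.prob (space ?M - A (K - 1) w) = 1 - B.prob (A (K - 1) w)"
            by (rule B.prob_compl[OF FM[OF Am[OF w]]])
          moreover have "B.prob (A (K - 1) w) \<le> B.prob (RV (K - 1) w)"
            by (rule B.finite_measure_mono[OF sub1[OF w] FM[OF D(1)[OF w]]])
          ultimately show "1 - (2 ^ (K - 1) * (2 * real K)) * p w \<le> B.prob (RV (K - 1) w)" by (simp only: mult.assoc)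
        qed
        finally have h1: "real (card W) - (2 ^ (K - 1) * (2 * real K)) * (\<Sum>w\<in>W. p w) \<le> vv (K - 1)" by (simp add: vv_def)
        have h2: "(2 ^ (K - 1) * (2 * real K)) * (\<Sum>w\<in>W. p w) \<le> (2 ^ (K - 1) * (2 * real K)) * (real (card W) / (real K * 2 ^ (K + 2)))"
          using psum by (intro mult_left_mono) auto
        \<comment> \<open>\<open>2 ^ (K - 1) * (2 * K)\<close> divided by
          \<open>K * 2 ^ (K + 2)\<close> is 1/4: at most a quarter of the messages is lost.\<close>
        have h3: "(2 ^ (K - 1) * (2 * real K)) * (real (card W) / (real K * 2 ^ (K + 2))) = real (card W) / 4"
        proof -
          have "(2::real) ^ (K + 2) = 2 ^ (K - 1) * 8" using K by (cases K) auto
          then show ?thesis using K by (simp add: field_simps)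
        qed
        have half: "x / 2 \<le> z" if "x - y \<le> z" "y \<le> y'" "y' = x / 4" "0 \<le> x" for x y y' z :: real
          using that by linarith
        show ?thesis by (rule half[OF h1 h2 h3]) simp
      qed
      have Lp: "0 < L" by (simp add: L_def)
      have "vv i \<le> L ^ Suc i * (\<Prod>k\<in>{Suc (K - i)..K}. 4 * \<theta> k) * Q" if "i < K" for i
        using that
      proof (induction i)
        case 0
        have "vv 0 \<le> L * u 0" using stage_a K by simp
        also have "\<dots> \<le> L * Q" using stage_c Lp by (intro mult_left_mono) auto
        finally show ?case by simp
      next
        case (Suc i)
        have S: "Suc (K - Suc i) = K - i" using Suc.prems by simp
        have "vv (Suc i) \<le> L * u (Suc i)" by (rule stage_a[OF Suc.prems])
        also have "\<dots> \<le> L * (4 * \<theta> (K - i) * vv i)"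
          using stage_b[OF Suc.prems] Lp by (intro mult_left_mono) auto
        also have "\<dots> \<le> L * (4 * \<theta> (K - i) * (L ^ Suc i * (\<Prod>k\<in>{Suc (K - i)..K}. 4 * \<theta> k) * Q))"
          using Suc.IH Suc.prems Lp \<theta>0[of "K - i"] by (intro mult_left_mono) auto
        also have "\<dots> = L ^ Suc (Suc i) * (\<Prod>k\<in>{Suc (K - Suc i)..K}. 4 * \<theta> k) * Q"
          unfolding S by (subst prod.atLeast_Suc_atMost[of "K - i" K]) (simp_all add: mult_ac)
        finally show ?case .
      qed
      from this[of "K - 1"] have "vv (K - 1) \<le> L ^ K * (\<Prod>k\<in>{2..K}. 4 * \<theta> k) * Q"
        using K by (simp add: numeral_2_eq_2)
      then have "real (card W) / 2 \<le> L ^ K * (\<Prod>k\<in>{2..K}. 4 * \<theta> k) * Q" using stage_d by linarith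
      then show "real (card (messages N)) \<le> 2 * ((2 ^ K * (2 * (2 * exp 8) ^ (n * M))) ^ K *
        (\<Prod>u\<in>{2..K}. 4 * alignment_factor \<beta> C P n u) * (exp (real (n * M)) * (144 * received_power C P) ^ (n * M)))"
        by (simp add: W_def L_def \<theta>_def Q_def R_def)
    qed (use \<beta> C P1 P2 in auto)
  qed
qed

end

section \<open>From a single code to rates and degrees of freedom\<close>

context parallel_miso_bc
begin

text \<open>Each subchannel occupies \<open>n\<close> of the slots, so the exponents of
  \<open>P\<close> add up to \<open>n * M\<close> times the average quality of the user.\<close>

lemma ln_alignment_factor:
  assumes \<beta>: "1 \<le> \<beta>" and P: "1 \<le> P" and u: "u \<in> {1..K}" and C: "1 \<le> C"
  shows "0 < alignment_factor \<beta> C P n u"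
    and "ln (4 * alignment_factor \<beta> C P n u) = ln 4 + real (n * M) *
      (1 + ln (4 * \<beta>) + 2 * ln (16 + 2 * ln (received_power C P)) + avg_quality M \<alpha> u * ln P)"
proof -
  define l where "l = 16 + 2 * ln (received_power C P)"
  have "1 \<le> received_power C P" using P C by (simp add: received_power_def)
  then have l: "0 < l" by (simp add: l_def add_pos_nonneg)
  have f: "0 < 4 * (\<beta> * P powr \<alpha> u (fst i)) * l\<^sup>2" for i using \<beta> P l by simp
  have af: "alignment_factor \<beta> C P n u = exp (real (n * M)) * (\<Prod>i\<in>slots n. 4 * (\<beta> * P powr \<alpha> u (fst i)) * l\<^sup>2)"
    by (simp only: alignment_factor_def l_def)
  have pp: "0 < (\<Prod>i\<in>slots n. 4 * (\<beta> * P powr \<alpha> u (fst i)) * l\<^sup>2)" using f by (intro prod_pos) auto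
  then show pos: "0 < alignment_factor \<beta> C P n u" unfolding af by simp
  have "ln (4 * alignment_factor \<beta> C P n u) = ln 4 + (real (n * M) + (\<Sum>i\<in>slots n. ln (4 * (\<beta> * P powr \<alpha> u (fst i)) * l\<^sup>2)))"
  proof -
    have "ln (\<Prod>i\<in>slots n. 4 * (\<beta> * P powr \<alpha> u (fst i)) * l\<^sup>2) = (\<Sum>i\<in>slots n. ln (4 * (\<beta> * P powr \<alpha> u (fst i)) * l\<^sup>2))"
      by (rule ln_prod[OF finite_slots less_imp_neq[OF f, symmetric]])
    then show ?thesis unfolding af using pp by (simp only: ln_mult_pos ln_exp exp_gt_zero mult_pos_pos zero_less_numeral)
  qed
  also have "(\<Sum>i\<in>slots n. ln (4 * (\<beta> * P powr \<alpha> u (fst i)) * l\<^sup>2)) = (\<Sum>i\<in>slots n. (ln (4 * \<beta>) + 2 * ln l) + \<alpha> u (fst i) * ln P)"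
  proof (rule sum.cong[OF refl])
    fix i
    show "ln (4 * (\<beta> * P powr \<alpha> u (fst i)) * l\<^sup>2) = (ln (4 * \<beta>) + 2 * ln l) + \<alpha> u (fst i) * ln P"
      using \<beta> P l by (simp add: ln_mult ln_realpow ln_powr)
  qed
  also have "\<dots> = real (n * M) * (ln (4 * \<beta>) + 2 * ln l) + (\<Sum>i\<in>slots n. \<alpha> u (fst i)) * ln P"
    by (simp add: sum.distrib card_slots sum_distrib_right)
  also have "(\<Sum>i\<in>slots n. \<alpha> u (fst i)) = real n * (\<Sum>m=1..M. \<alpha> u m)"
  proof -
    have "(\<Sum>i\<in>slots n. \<alpha> u (fst i)) = (\<Sum>m\<in>{1..M}. \<Sum>t\<in>{1..n}. \<alpha> u m)"
      unfolding slots_def using sum.cartesian_product[of "\<lambda>m t. \<alpha> u m" "{1..n}" "{1..M}"]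
      by (simp only: case_prod_unfold)
    then show ?thesis by (simp add: sum_distrib_left)
  qed
  also have "\<dots> = real (n * M) * avg_quality M \<alpha> u"
    using subchannels by (simp add: avg_quality_def)
  finally show "ln (4 * alignment_factor \<beta> C P n u) = ln 4 + real (n * M) *
      (1 + ln (4 * \<beta>) + 2 * ln (16 + 2 * ln (received_power C P)) + avg_quality M \<alpha> u * ln P)"
    by (simp add: l_def algebra_simps)
qed

lemma card_messages: "card (messages N) = (\<Prod>k\<in>{1..K}. N k)"
  by (simp add: messages_def card_PiE)

text \<open>The error of the codes tends to 0, so the bound for a single code applies to all long
  blocks. After taking logarithms and dividing by \<open>n\<close>, everything not proportional to
  \<open>n\<close> disappears in the limit; at fixed \<open>P\<close> there remain the main term, a
  constant and a doubly logarithmic term.\<close>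

lemma converse_rate:
  obtains c \<rho> P0 :: real where "0 < \<rho>" "1 \<le> P0"
    and "\<And>P R. P0 \<le> P \<Longrightarrow> R \<in> achievable_rates P \<Longrightarrow>
      (\<Sum>k=1..K. R k) * ln 2 \<le> real M * ((1 + (\<Sum>k=2..K. avg_quality M \<alpha> k)) * ln P + c + 2 * real K * ln (16 + 2 * ln (\<rho> * P)))"
proof (rule converse_code)
  fix \<beta> C P0 :: real
  assume \<beta>: "1 \<le> \<beta>" and C: "1 \<le> C" and P0: "1 \<le> P0"
    and bound: "\<And>P n N enc dec. P0 \<le> P \<Longrightarrow> 1 \<le> n \<Longrightarrow> valid_code P n N enc dec \<Longrightarrow>
      messages N \<noteq> {} \<Longrightarrow> error_prob P n N enc dec \<le> 1 / (real K * 2 ^ (K + 2)) \<Longrightarrow>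
      real (card (messages N)) \<le> 2 * ((2 ^ K * (2 * (2 * exp 8) ^ (n * M))) ^ K *
        (\<Prod>u\<in>{2..K}. 4 * alignment_factor \<beta> C P n u) * (exp (real (n * M)) * (144 * received_power C P) ^ (n * M)))"
  define \<rho> where "\<rho> = 2 * real K * C\<^sup>2 + 4"
  define c where "c = real K * ln (2 * exp 8) + real K * (1 + ln (4 * \<beta>)) + 1 + ln (144 * \<rho>)"
  have \<rho>: "4 \<le> \<rho>" by (simp add: \<rho>_def)
  show thesis
  proof (rule that[of \<rho> P0 c])
    show "0 < \<rho>" using \<rho> by simp
    show "1 \<le> P0" by fact
    fix P R assume P: "P0 \<le> P" and R: "R \<in> achievable_rates P"
    have P1: "1 \<le> P" using P P0 by simp
    define Rp where "Rp = received_power C P"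
    have Rp: "1 \<le> Rp" "Rp \<le> \<rho> * P" using P1 C by (simp_all add: Rp_def received_power_def \<rho>_def algebra_simps)
    define l where "l = 16 + 2 * ln (\<rho> * P)"
    have l1: "16 + 2 * ln Rp \<le> l" using Rp by (simp add: l_def)
    have l0: "1 \<le> 16 + 2 * ln Rp" using Rp(1) ln_ge_zero[of Rp] by linarith
    define A where "A = (\<Sum>k=2..K. avg_quality M \<alpha> k)"
    define B where "B = (1 + A) * ln P + c + 2 * real K * ln l"
    define c0 where "c0 = ln 2 + real K * (real K * ln 2 + ln 2) + real K * ln 4"
    have ev: "\<forall>\<^sub>F n in sequentially. (\<Sum>k=1..K. R k) * ln 2 \<le> c0 / real n + real M * B"
    proof -
      obtain enc dec where v: "\<And>n. 1 \<le> n \<Longrightarrow> valid_code P n (\<lambda>k. nat \<lceil>2 powr (real n * R k)\<rceil>) (enc n) (dec n)"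
        and lim: "(\<lambda>n. error_prob P n (\<lambda>k. nat \<lceil>2 powr (real n * R k)\<rceil>) (enc n) (dec n)) \<longlonglongrightarrow> 0"
        using R unfolding achievable_rates_def by blast
      have e0: "0 < 1 / (real K * 2 ^ (K + 2))" using users by simp
      have "\<forall>\<^sub>F n in sequentially. error_prob P n (\<lambda>k. nat \<lceil>2 powr (real n * R k)\<rceil>) (enc n) (dec n) < 1 / (real K * 2 ^ (K + 2))"
        using order_tendstoD(2)[OF lim e0] .
      then show ?thesis
        using eventually_ge_at_top[of 1]
      proof eventually_elim
        fix n :: nat
        let ?N = "\<lambda>k. nat \<lceil>2 powr (real n * R k)\<rceil>"
        assume err: "error_prob P n ?N (enc n) (dec n) < 1 / (real K * 2 ^ (K + 2))" and n: "1 \<le> n"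
        have N: "2 powr (real n * R k) \<le> real (?N k)" for k by (rule of_nat_ceiling)
        have N1: "0 < ?N k" for k using N[of k] by (simp add: zero_less_nat_eq)
        have "0 < card (messages ?N)" unfolding card_messages by (intro prod_pos N1)
        then have ne: "messages ?N \<noteq> {}" by (metis card.empty less_irrefl)
        have "2 powr (real n * (\<Sum>k=1..K. R k)) = (\<Prod>k\<in>{1..K}. 2 powr (real n * R k))"
          by (simp add: powr_sum sum_distrib_left)
        also have "\<dots> \<le> (\<Prod>k\<in>{1..K}. real (?N k))" by (intro prod_mono conjI N) simp
        also have "\<dots> = real (card (messages ?N))" unfolding card_messages by simp
        also have "\<dots> \<le> 2 * ((2 ^ K * (2 * (2 * exp 8) ^ (n * M))) ^ K *
          (\<Prod>u\<in>{2..K}. 4 * alignment_factor \<beta> C P n u) * (exp (real (n * M)) * (144 * Rp) ^ (n * M)))"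
          unfolding Rp_def using bound[OF P n v[OF n] ne] err by simp
        finally have le: "2 powr (real n * (\<Sum>k=1..K. R k)) \<le> 2 * ((2 ^ K * (2 * (2 * exp 8) ^ (n * M))) ^ K *
          (\<Prod>u\<in>{2..K}. 4 * alignment_factor \<beta> C P n u) * (exp (real (n * M)) * (144 * Rp) ^ (n * M)))" .
        have u1: "u \<in> {1..K}" if "u \<in> {2..K}" for u using that by auto
        note laf = ln_alignment_factor[OF \<beta> P1 u1 C, of _ n]
        define AF where "AF u = 4 * alignment_factor \<beta> C P n u" for u
        have AF: "0 < AF u" if "u \<in> {2..K}" for u using laf(1)[OF that] by (simp add: AF_def)
        have AFp: "0 < (\<Prod>u\<in>{2..K}. AF u)" using AF by (intro prod_pos) auto
        have "ln (2 powr (real n * (\<Sum>k=1..K. R k))) \<le> ln (2 * ((2 ^ K * (2 * (2 * exp 8) ^ (n * M))) ^ K *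
          (\<Prod>u\<in>{2..K}. AF u) * (exp (real (n * M)) * (144 * Rp) ^ (n * M))))"
          unfolding AF_def by (rule ln_mono[OF le]) simp
        also have "\<dots> = ln 2 + (real K * (real K * ln 2 + (ln 2 + real (n * M) * ln (2 * exp 8))) + ln (\<Prod>u\<in>{2..K}. AF u)
            + (real (n * M) + real (n * M) * ln (144 * Rp)))"
          using AFp Rp(1) by (simp only: ln_mult_pos ln_realpow ln_exp exp_gt_zero mult_pos_pos zero_less_numeral zero_less_power zero_less_one order_less_le_trans[OF zero_less_one Rp(1)])
        also have "ln (\<Prod>u\<in>{2..K}. AF u) = (\<Sum>u\<in>{2..K}. ln (AF u))"
          by (rule ln_prod[OF finite_atLeastAtMost]) (metis AF less_irrefl)
        also have "\<dots> \<le> (\<Sum>u\<in>{2..K}. ln 4 + real (n * M) * (1 + ln (4 * \<beta>) + 2 * ln l + avg_quality M \<alpha> u * ln P))"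
        proof (rule sum_mono)
          fix u assume u: "u \<in> {2..K}"
          have "ln (16 + 2 * ln Rp) \<le> ln l" using l0 l1 by simp
          then show "ln (AF u) \<le> ln 4 + real (n * M) * (1 + ln (4 * \<beta>) + 2 * ln l + avg_quality M \<alpha> u * ln P)"
            unfolding AF_def laf(2)[OF u] Rp_def by (intro add_left_mono mult_left_mono) auto
        qed
        also have "\<dots> = real (K - 1) * (ln 4 + real (n * M) * (1 + ln (4 * \<beta>) + 2 * ln l)) + real (n * M) * (A * ln P)"
          by (simp add: A_def sum.distrib sum_distrib_left sum_distrib_right algebra_simps)
        also have "real (K - 1) * (ln 4 + real (n * M) * (1 + ln (4 * \<beta>) + 2 * ln l))
            \<le> real K * (ln 4 + real (n * M) * (1 + ln (4 * \<beta>) + 2 * ln l))"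
          using \<beta> l0 l1 by (intro mult_right_mono add_nonneg_nonneg mult_nonneg_nonneg) auto
        also have "ln (144 * Rp) \<le> ln (144 * \<rho>) + ln P"
        proof -
          have "ln (144 * Rp) \<le> ln (144 * \<rho> * P)" using Rp by (intro ln_mono) auto
          also have "\<dots> = ln (144 * \<rho>) + ln P" using \<rho> P1 by (intro ln_mult_pos) auto
          finally show ?thesis .
        qed
        finally have "real n * (\<Sum>k=1..K. R k) * ln 2 \<le> ln 2 + (real K * (real K * ln 2 + (ln 2 + real (n * M) * ln (2 * exp 8))) +
            (real K * (ln 4 + real (n * M) * (1 + ln (4 * \<beta>) + 2 * ln l)) + real (n * M) * (A * ln P))
            + (real (n * M) + real (n * M) * (ln (144 * \<rho>) + ln P)))"
          by (simp add: ln_powr mult_left_mono)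
        also have "\<dots> = c0 + real (n * M) * B"
          by (simp add: c0_def B_def c_def algebra_simps)
        finally have "(real n * (\<Sum>k=1..K. R k) * ln 2) / real n \<le> (c0 + real (n * M) * B) / real n"
          by (rule divide_right_mono) simp
        then show "(\<Sum>k=1..K. R k) * ln 2 \<le> c0 / real n + real M * B"
          using n by (simp add: add_divide_distrib)
      qed
    qed
    have "(\<lambda>n. c0 / real n + real M * B) \<longlonglongrightarrow> 0 + real M * B"
      by (intro tendsto_intros lim_const_over_n)
    from tendsto_lowerbound[OF this ev] 
    show "(\<Sum>k=1..K. R k) * ln 2 \<le> real M * ((1 + (\<Sum>k=2..K. avg_quality M \<alpha> k)) * ln P + c + 2 * real K * ln (16 + 2 * ln (\<rho> * P)))"
      by (simp add: B_def A_def l_def)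
  qed
qed

lemma continuous_on_coord_sum: "continuous_on UNIV (\<lambda>d :: nat \<Rightarrow> real. \<Sum>k\<in>J. d k)"
  by (intro continuous_on_sum continuous_on_product_coordinates)

text \<open>The rate bound defines a closed half-space and so passes from achievable rates to the
  capacity region; after division by \<open>log P\<close> the doubly logarithmic term
  vanishes.\<close>

lemma achievable_dof_sum_le:
  assumes "d \<in> achievable_dof"
  shows "(\<Sum>k=1..K. d k) \<le> 1 + (\<Sum>k=2..K. avg_quality M \<alpha> k)"
proof (rule converse_rate)
  fix c \<rho> P0 :: real
  assume \<rho>: "0 < \<rho>" and P0: "1 \<le> P0"
    and bound: "\<And>P R. P0 \<le> P \<Longrightarrow> R \<in> achievable_rates P \<Longrightarrow>
      (\<Sum>k=1..K. R k) * ln 2 \<le> real M * ((1 + (\<Sum>k=2..K. avg_quality M \<alpha> k)) * ln P + c + 2 * real K * ln (16 + 2 * ln (\<rho> * P)))"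
  define A where "A = 1 + (\<Sum>k=2..K. avg_quality M \<alpha> k)"
  obtain R where R: "\<forall>\<^sub>F P in at_top. R P \<in> capacity_region P"
    and lim: "\<And>k. k \<in> {1..K} \<Longrightarrow> ((\<lambda>P. R P k / (real M * log 2 P)) \<longlongrightarrow> d k) at_top"
    using assms unfolding achievable_dof_def by blast
  have M: "0 < real M" using subchannels by simp
  have lS: "((\<lambda>P. \<Sum>k=1..K. R P k / (real M * log 2 P)) \<longlongrightarrow> (\<Sum>k=1..K. d k)) at_top"
    by (intro tendsto_sum lim)
  have lA: "((\<lambda>P. A + (c + 2 * real K * ln (16 + 2 * ln (\<rho> * P))) / ln P) \<longlongrightarrow> A + 0) at_top"
  proof (intro tendsto_add tendsto_const)
    show "((\<lambda>P. (c + 2 * real K * ln (16 + 2 * ln (\<rho> * P))) / ln P) \<longlongrightarrow> 0) at_top"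
      using \<rho> by real_asymp
  qed
  have ev: "\<forall>\<^sub>F P in at_top. (\<Sum>k=1..K. R P k / (real M * log 2 P)) \<le> A + (c + 2 * real K * ln (16 + 2 * ln (\<rho> * P))) / ln P"
    using R eventually_ge_at_top[of "max P0 2"]
  proof eventually_elim
    fix P assume R: "R P \<in> capacity_region P" and P: "max P0 2 \<le> P"
    define b where "b = real M * (A * ln P + c + 2 * real K * ln (16 + 2 * ln (\<rho> * P)))"
    have "capacity_region P \<subseteq> {r. (\<Sum>k=1..K. r k) * ln 2 \<le> b}"
      unfolding capacity_region_def
    proof (rule closure_minimal)
      show "achievable_rates P \<subseteq> {r. (\<Sum>k=1..K. r k) * ln 2 \<le> b}"
        using bound[of P] P by (auto simp: b_def A_def)
      show "closed {r :: nat \<Rightarrow> real. (\<Sum>k=1..K. r k) * ln 2 \<le> b}"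
        by (intro closed_Collect_le continuous_on_mult continuous_on_const continuous_on_coord_sum)
    qed
    then have Rb: "(\<Sum>k=1..K. R P k) * ln 2 \<le> b" using R by auto
    have lnP: "0 < ln P" using P by simp
    have "(\<Sum>k=1..K. R P k / (real M * log 2 P)) = (\<Sum>k=1..K. R P k) * ln 2 / (real M * ln P)"
      unfolding sum_divide_distrib[symmetric] by (simp add: log_def)
    also have "\<dots> \<le> b / (real M * ln P)" using Rb lnP M by (intro divide_right_mono) auto
    also have "\<dots> = A + (c + 2 * real K * ln (16 + 2 * ln (\<rho> * P))) / ln P"
      using lnP M by (simp add: b_def field_simps)
    finally show "(\<Sum>k=1..K. R P k / (real M * log 2 P)) \<le> A + (c + 2 * real K * ln (16 + 2 * ln (\<rho> * P))) / ln P" .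
  qed
  show "(\<Sum>k=1..K. d k) \<le> 1 + (\<Sum>k=2..K. avg_quality M \<alpha> k)"
    using tendsto_le[OF trivial_limit_at_top_linorder lA lS ev] by (simp add: A_def)
qed

lemma achievable_dof_nonneg:
  assumes "d \<in> achievable_dof" "k \<in> {1..K}"
  shows "0 \<le> d k"
proof -
  obtain R where R: "\<forall>\<^sub>F P in at_top. R P \<in> capacity_region P"
    and lim: "((\<lambda>P. R P k / (real M * log 2 P)) \<longlongrightarrow> d k) at_top"
    using assms unfolding achievable_dof_def by blast
  have "capacity_region P \<subseteq> {r. 0 \<le> r k}" for P
    unfolding capacity_region_def
  proof (rule closure_minimal)
    show "achievable_rates P \<subseteq> {r. 0 \<le> r k}" using assms(2) by (auto simp: achievable_rates_def)
    show "closed {r :: nat \<Rightarrow> real. 0 \<le> r k}"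
      by (intro closed_Collect_le continuous_on_const continuous_on_product_coordinates)
  qed
  then have nn: "0 \<le> R P k" if "R P \<in> capacity_region P" for P using that by blast
  have "\<forall>\<^sub>F P in at_top. 0 \<le> R P k / (real M * log 2 P)"
    using R eventually_ge_at_top[of "1::real"] by eventually_elim (simp add: nn)
  from tendsto_lowerbound[OF lim this] show ?thesis by simp
qed

text \<open>All conditions are closed under pointwise convergence. The value
  \<open>undefined\<close> outside of the users is recorded because the closure is formed among all
  functions on the naturals, and the proof of compactness confines those coordinates to one
  point.\<close>

lemma dof_region_subset:
  "dof_region \<subseteq> {d. (\<forall>k\<in>{1..K}. 0 \<le> d k) \<and> (\<forall>k. k \<notin> {1..K} \<longrightarrow> d k = undefined) \<and>
    (\<Sum>k=1..K. d k) \<le> 1 + (\<Sum>k=2..K. avg_quality M \<alpha> k)}"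
  unfolding dof_region_def
proof (rule closure_minimal)
  show "achievable_dof \<subseteq> {d. (\<forall>k\<in>{1..K}. 0 \<le> d k) \<and> (\<forall>k. k \<notin> {1..K} \<longrightarrow> d k = undefined) \<and>
    (\<Sum>k=1..K. d k) \<le> 1 + (\<Sum>k=2..K. avg_quality M \<alpha> k)}"
  proof
    fix d assume d: "d \<in> achievable_dof"
    then have "d \<in> {1..K} \<rightarrow>\<^sub>E UNIV" by (simp add: achievable_dof_def)
    then have "\<forall>k. k \<notin> {1..K} \<longrightarrow> d k = undefined" by (auto simp: PiE_def extensional_def)
    then show "d \<in> {d. (\<forall>k\<in>{1..K}. 0 \<le> d k) \<and> (\<forall>k. k \<notin> {1..K} \<longrightarrow> d k = undefined) \<and>
      (\<Sum>k=1..K. d k) \<le> 1 + (\<Sum>k=2..K. avg_quality M \<alpha> k)}"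
      using achievable_dof_sum_le[OF d] achievable_dof_nonneg[OF d] by blast
  qed
  have c1: "closed {d :: nat \<Rightarrow> real. \<forall>k\<in>{1..K}. 0 \<le> d k}"
  proof -
    have "{d :: nat \<Rightarrow> real. \<forall>k\<in>{1..K}. 0 \<le> d k} = (\<Inter>k\<in>{1..K}. {d. 0 \<le> d k})" by auto
    also have "closed \<dots>"
      by (intro closed_INT ballI closed_Collect_le continuous_on_const continuous_on_product_coordinates)
    finally show ?thesis .
  qed
  have c2: "closed {d :: nat \<Rightarrow> real. \<forall>k. k \<notin> {1..K} \<longrightarrow> d k = undefined}"
  proof -
    have "{d :: nat \<Rightarrow> real. \<forall>k. k \<notin> {1..K} \<longrightarrow> d k = undefined} = (\<Inter>k\<in>- {1..K}. {d. d k = undefined})" by auto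
    also have "closed \<dots>"
      by (intro closed_INT ballI closed_Collect_eq continuous_on_const continuous_on_product_coordinates)
    finally show ?thesis .
  qed
  have c3: "closed {d :: nat \<Rightarrow> real. (\<Sum>k=1..K. d k) \<le> 1 + (\<Sum>k=2..K. avg_quality M \<alpha> k)}"
    by (intro closed_Collect_le continuous_on_const continuous_on_coord_sum)
  show "closed {d. (\<forall>k\<in>{1..K}. 0 \<le> d k) \<and> (\<forall>k. k \<notin> {1..K} \<longrightarrow> d k = undefined) \<and>
    (\<Sum>k=1..K. d k) \<le> 1 + (\<Sum>k=2..K. avg_quality M \<alpha> k)}"
    by (intro closed_Collect_conj c1 c2 c3)
qed

text \<open>The sum-DoF is a maximum and has to be attained. Nonnegativity and the bound on the sum
  confine each coordinate to a compact set, and Tychonoff's theorem applies to their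
  product.\<close>

lemma compact_dof_region: "compact dof_region"
proof -
  define b where "b = 1 + (\<Sum>k=2..K. avg_quality M \<alpha> k)"
  let ?S = "\<lambda>k. if k \<in> {1..K} then {0..b} else {undefined :: real}"
  have "compactin (product_topology (\<lambda>_. euclidean) UNIV) (PiE UNIV ?S)"
    by (subst compactin_PiE) auto
  then have c: "compact (PiE UNIV ?S)" by (simp add: euclidean_product_topology)
  have "dof_region \<subseteq> PiE UNIV ?S"
  proof
    fix d assume "d \<in> dof_region"
    then have d: "\<forall>k\<in>{1..K}. 0 \<le> d k" "\<forall>k. k \<notin> {1..K} \<longrightarrow> d k = undefined" "(\<Sum>k=1..K. d k) \<le> b"
      using dof_region_subset by (auto simp: b_def)
    have "d k \<le> b" if k: "k \<in> {1..K}" for k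
    proof -
      have "d k \<le> (\<Sum>k=1..K. d k)" using d(1) k by (intro member_le_sum) auto
      then show ?thesis using d(3) by linarith
    qed
    then show "d \<in> PiE UNIV ?S" using d by auto
  qed
  moreover have "closed dof_region" by (simp add: dof_region_def)
  ultimately show ?thesis using c closed_Int_compact[of dof_region "PiE UNIV ?S"] by (simp add: Int_absorb2)
qed

text \<open>Supplies a point of the region: at rate 0 every user has the single message 0, and the
  constant decoder never errs.\<close>

lemma zero_dof_achievable: "(\<lambda>k\<in>{1..K}. 0) \<in> achievable_dof"
proof -
  let ?z = "\<lambda>k\<in>{1..K}. 0 :: real"
  have "?z \<in> achievable_rates P" if P: "0 \<le> P" for P
  proof -
    let ?N = "\<lambda>n k. nat \<lceil>2 powr (real n * ?z k)\<rceil>"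
    have N: "?N n k = 1" if "k \<in> {1..K}" for n k using that by simp
    have v: "valid_code P n (?N n) (\<lambda>_ _ _ _ _. 0) (\<lambda>_ _ _. 0)" for n
      unfolding valid_code_def using P by simp
    have "error_prob P n (?N n) (\<lambda>_ _ _ _ _. 0) (\<lambda>_ _ _. 0) = 0" for n
    proof -
      have "{\<omega> \<in> space \<Omega>. \<exists>k\<in>{1..K}. (0::nat) \<noteq> w k} = {}" if "w \<in> messages (?N n)" for w
      proof -
        have "w k = 0" if k: "k \<in> {1..K}" for k
        proof -
          have "w k \<in> {..<?N n k}"
            using \<open>w \<in> messages (?N n)\<close> k unfolding messages_def by (rule PiE_mem)
          then show ?thesis unfolding N[OF k] by simp
        qed
        then show ?thesis by auto
      qed
      then have "(\<Sum>w\<in>messages (?N n). prob {\<omega> \<in> space \<Omega>. \<exists>k\<in>{1..K}. (0::nat) \<noteq> w k}) = (\<Sum>w\<in>messages (?N n). 0)"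
        by (intro sum.cong refl) (simp only: measure_empty)
      then show ?thesis unfolding error_prob_def by (simp only: sum.neutral_const div_0)
    qed
    then have "(\<lambda>n. error_prob P n (?N n) (\<lambda>_ _ _ _ _. 0) (\<lambda>_ _ _. 0)) \<longlonglongrightarrow> 0" by simp
    with v show ?thesis unfolding achievable_rates_def
      by (intro CollectI conjI exI[of _ "\<lambda>_ _ _ _ _ _. 0"] exI[of _ "\<lambda>_ _ _ _. 0"]) auto
  qed
  then have zc: "?z \<in> capacity_region P" if "0 \<le> P" for P
    using that closure_subset unfolding capacity_region_def by blast
  have "\<forall>\<^sub>F P in at_top. ?z \<in> capacity_region P"
    using eventually_ge_at_top[of "0::real"] by eventually_elim (rule zc)
  then show ?thesis unfolding achievable_dof_def
    by (intro CollectI conjI exI[of _ "\<lambda>_. ?z"]) auto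
qed

lemma is_sum_dof_exists:
  shows "\<exists>s. is_sum_dof s \<and> s \<le> 1 + (\<Sum>k=2..K. avg_quality M \<alpha> k)"
    and "is_sum_dof s \<Longrightarrow> d \<in> achievable_dof \<Longrightarrow> (\<Sum>k=1..K. d k) \<le> s"
proof -
  have ne: "dof_region \<noteq> {}" using zero_dof_achievable closure_subset unfolding dof_region_def by blast
  have "continuous_on dof_region (\<lambda>d :: nat \<Rightarrow> real. \<Sum>k=1..K. d k)"
    using continuous_on_coord_sum continuous_on_subset by blast
  from continuous_attains_sup[OF compact_dof_region ne this]
  obtain d where d: "d \<in> dof_region" "\<forall>y\<in>dof_region. (\<Sum>k=1..K. y k) \<le> (\<Sum>k=1..K. d k)" by blast
  then have "is_sum_dof (\<Sum>k=1..K. d k)" unfolding is_sum_dof_def by blast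
  moreover have "(\<Sum>k=1..K. d k) \<le> 1 + (\<Sum>k=2..K. avg_quality M \<alpha> k)" using d(1) dof_region_subset by blast
  ultimately show "\<exists>s. is_sum_dof s \<and> s \<le> 1 + (\<Sum>k=2..K. avg_quality M \<alpha> k)" by blast
  show "is_sum_dof s \<Longrightarrow> d \<in> achievable_dof \<Longrightarrow> (\<Sum>k=1..K. d k) \<le> s" for d
    unfolding is_sum_dof_def dof_region_def using closure_subset by blast
qed

end

section \<open>Codes, symbols and zero-forcing vectors\<close>

definition hamming :: "'t set \<Rightarrow> ('t \<Rightarrow> 'a) \<Rightarrow> ('t \<Rightarrow> 'a) \<Rightarrow> nat" where
  "hamming T x y = card {t \<in> T. x t \<noteq> y t}"

text \<open>A word of the ball is determined by the set of positions where it deviates from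
  \<open>c\<close> and its letters there. The crude count \<open>2 ^ card T\<close> of position sets
  costs one bit per slot, which is negligible for alphabets growing with the power.\<close>

lemma card_hamming_ball_le:
  assumes T: "finite T" and A: "finite A" "A \<noteq> {}"
  shows "card {x \<in> T \<rightarrow>\<^sub>E A. hamming T c x \<le> D} \<le> 2 ^ card T * card A ^ D"
proof -
  define F where "F S = {x \<in> T \<rightarrow>\<^sub>E A. \<forall>t\<in>T - S. x t = c t}" for S
  have F: "finite (F S)" "card (F S) \<le> card A ^ card S" if S: "S \<subseteq> T" for S
  proof -
    have fS: "finite S" by (rule finite_subset[OF S T])
    have W: "finite (T \<rightarrow>\<^sub>E A)" using T A(1) by (rule finite_PiE)
    show "finite (F S)" unfolding F_def by (rule finite_subset[OF Collect_restrict W])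
    have "card (F S) \<le> card (S \<rightarrow>\<^sub>E A)"
    proof (rule card_inj_on_le[where f="\<lambda>x. restrict x S"])
      show "inj_on (\<lambda>x. restrict x S) (F S)"
      proof (rule inj_onI)
        fix x y assume x: "x \<in> F S" and y: "y \<in> F S" and eq: "restrict x S = restrict y S"
        have PE: "x \<in> T \<rightarrow>\<^sub>E A" "y \<in> T \<rightarrow>\<^sub>E A" using x y unfolding F_def by (blast dest: CollectD)+
        show "x = y"
        proof (rule PiE_ext[OF PE])
          fix t assume t: "t \<in> T"
          show "x t = y t"
          proof (cases "t \<in> S")
            case True
            from fun_cong[OF eq, of t] True show ?thesis by simp
          next
            case False
            have "x t = c t" using x t False unfolding F_def by blast
            moreover have "y t = c t" using y t False unfolding F_def by blast
            ultimately show ?thesis by (simp only:)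
          qed
        qed
      qed
      show "(\<lambda>x. restrict x S) ` F S \<subseteq> S \<rightarrow>\<^sub>E A"
      proof (rule image_subsetI)
        fix x assume "x \<in> F S"
        then have "x \<in> T \<rightarrow>\<^sub>E A" unfolding F_def by blast
        from PiE_mem[OF this subsetD[OF S]] show "restrict x S \<in> S \<rightarrow>\<^sub>E A"
          by (intro PiE_I) simp_all
      qed
      show "finite (S \<rightarrow>\<^sub>E A)" using fS A(1) by (rule finite_PiE)
    qed
    then show "card (F S) \<le> card A ^ card S" using fS by (simp add: card_PiE)
  qed
  have A1: "1 \<le> card A" using card_gt_0_iff[THEN iffD2, OF conjI[OF A(2,1)]] by linarith
  let ?Ss = "{S. S \<subseteq> T \<and> card S \<le> D}"
  have fin: "finite ?Ss" by (rule finite_subset[OF _ finite_Pow_iff[THEN iffD2, OF T]]) blast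
  have "{x \<in> T \<rightarrow>\<^sub>E A. hamming T c x \<le> D} \<subseteq> (\<Union>S\<in>?Ss. F S)"
  proof
    fix x assume x: "x \<in> {x \<in> T \<rightarrow>\<^sub>E A. hamming T c x \<le> D}"
    have "{t \<in> T. c t \<noteq> x t} \<in> ?Ss" using x unfolding hamming_def by blast
    moreover have "x \<in> F {t \<in> T. c t \<noteq> x t}" using x unfolding F_def by simp
    ultimately show "x \<in> (\<Union>S\<in>?Ss. F S)" by (rule UN_I)
  qed
  moreover have "finite (\<Union>S\<in>?Ss. F S)"
  proof (rule finite_UN_I[OF fin])
    fix S assume "S \<in> ?Ss"
    then show "finite (F S)" using F(1)[of S] by simp
  qed
  ultimately have "card {x \<in> T \<rightarrow>\<^sub>E A. hamming T c x \<le> D} \<le> card (\<Union>S\<in>?Ss. F S)"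
    by (rule card_mono[rotated])
  also have "\<dots> \<le> (\<Sum>S\<in>?Ss. card (F S))" by (rule card_UN_le[OF fin])
  also have "\<dots> \<le> (\<Sum>S\<in>?Ss. card A ^ D)"
  proof (rule sum_mono)
    fix S assume "S \<in> ?Ss"
    then have "S \<subseteq> T" "card S \<le> D" by simp_all
    then have "card A ^ card S \<le> card A ^ D" using A1 by (intro power_increasing)
    with F(2)[OF \<open>S \<subseteq> T\<close>] show "card (F S) \<le> card A ^ D" by linarith
  qed
  also have "\<dots> = card ?Ss * card A ^ D" by simp
  also have "card ?Ss \<le> card (Pow T)" using T by (intro card_mono) auto
  also have "card (Pow T) = 2 ^ card T" using T by (rule card_Pow)
  finally show ?thesis by simp
qed

text \<open>Around a code of maximal size with distances above \<open>D\<close>, the balls of radius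
  \<open>D\<close> cover the whole space, for an uncovered word could be added.\<close>

lemma gilbert_varshamov:
  assumes T: "finite T" and A: "finite A" "A \<noteq> {}"
  shows "\<exists>C \<subseteq> T \<rightarrow>\<^sub>E A. (\<forall>x\<in>C. \<forall>y\<in>C. x \<noteq> y \<longrightarrow> D < hamming T x y) \<and>
    card A ^ card T \<le> card C * (2 ^ card T * card A ^ D)"
proof -
  let ?W = "T \<rightarrow>\<^sub>E A"
  have W: "finite ?W" using T A by (intro finite_PiE) auto
  define P where "P C \<longleftrightarrow> C \<subseteq> ?W \<and> (\<forall>x\<in>C. \<forall>y\<in>C. x \<noteq> y \<longrightarrow> D < hamming T x y)" for C
  have "P {}" by (simp add: P_def)
  moreover have "\<forall>C. P C \<longrightarrow> card C < Suc (card ?W)"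
  proof (intro allI impI)
    fix C assume "P C"
    then have "C \<subseteq> ?W" unfolding P_def by (rule conjunct1)
    from card_mono[OF W this] show "card C < Suc (card ?W)" by (rule le_imp_less_Suc)
  qed
  ultimately have "\<exists>C. P C \<and> (\<forall>C'. P C' \<longrightarrow> card C' \<le> card C)"
    by (rule ex_has_greatest_nat)
  then obtain C where C: "P C" "\<And>C'. P C' \<Longrightarrow> card C' \<le> card C" by blast
  have CW1: "C \<subseteq> ?W" using C(1) unfolding P_def by (rule conjunct1)
  note CW = CW1 finite_subset[OF CW1 W]
  have sym: "hamming T x y = hamming T y x" for x y :: "_ \<Rightarrow> 'b" by (simp add: hamming_def eq_commute[of "x _" "y _"])
  have "?W \<subseteq> (\<Union>c\<in>C. {x \<in> ?W. hamming T c x \<le> D})"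
  proof
    fix x assume x: "x \<in> ?W"
    show "x \<in> (\<Union>c\<in>C. {x \<in> ?W. hamming T c x \<le> D})"
    proof (rule ccontr)
      assume "x \<notin> (\<Union>c\<in>C. {x \<in> ?W. hamming T c x \<le> D})"
      have far: "D < hamming T c x" if c: "c \<in> C" for c
      proof (rule ccontr)
        assume "\<not> D < hamming T c x"
        then have "x \<in> {x \<in> ?W. hamming T c x \<le> D}" using x by simp
        then have "x \<in> (\<Union>c\<in>C. {x \<in> ?W. hamming T c x \<le> D})" by (rule UN_I[OF c])
        with \<open>x \<notin> _\<close> show False by (rule notE)
      qed
      have "x \<notin> C"
      proof
        assume "x \<in> C"
        from far[OF this] show False by (simp add: hamming_def)
      qed
      moreover have "P (insert x C)" 
      proof -
        have far': "D < hamming T x c" if "c \<in> C" for c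
          using far[OF that] sym[of x c] by linarith
        have C1': "\<forall>x\<in>C. \<forall>y\<in>C. x \<noteq> y \<longrightarrow> D < hamming T x y"
          using C(1) unfolding P_def by (rule conjunct2)
        have C1: "\<And>y z. y \<in> C \<Longrightarrow> z \<in> C \<Longrightarrow> y \<noteq> z \<Longrightarrow> D < hamming T y z"
          by (rule C1'[rule_format])
        show ?thesis unfolding P_def
        proof (intro conjI ballI impI)
          show "insert x C \<subseteq> ?W" using x CW1 by (rule insert_subsetI)
          fix y z assume "y \<in> insert x C" "z \<in> insert x C" "y \<noteq> z"
          then consider "y = x" "z \<in> C" | "z = x" "y \<in> C" | "y \<in> C" "z \<in> C" by (elim insertE) simp_all
          then show "D < hamming T y z"
          proof cases
            case 1
            from far'[OF this(2)] this(1) show ?thesis by simp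
          next
            case 2
            from far[OF this(2)] this(1) show ?thesis by simp
          next
            case 3
            from C1[OF this \<open>y \<noteq> z\<close>] show ?thesis .
          qed
        qed
      qed
      ultimately show False using C(2)[of "insert x C"] card_insert_disjoint[OF CW(2), of x] by linarith
    qed
  qed
  then have "card ?W \<le> card (\<Union>c\<in>C. {x \<in> ?W. hamming T c x \<le> D})"
  proof (rule card_mono[rotated])
    show "finite (\<Union>c\<in>C. {x \<in> ?W. hamming T c x \<le> D})"
    proof (rule finite_UN_I[OF CW(2)])
      fix c show "finite {x \<in> ?W. hamming T c x \<le> D}" by (rule finite_subset[OF _ W]) (rule Collect_restrict)
    qed
  qed
  also have "\<dots> \<le> (\<Sum>c\<in>C. card {x \<in> ?W. hamming T c x \<le> D})" by (rule card_UN_le[OF CW(2)])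
  also have "\<dots> \<le> (\<Sum>c\<in>C. 2 ^ card T * card A ^ D)" by (rule sum_mono) (rule card_hamming_ball_le[OF T A])
  also have "\<dots> = card C * (2 ^ card T * card A ^ D)" by simp
  finally have "card A ^ card T \<le> card C * (2 ^ card T * card A ^ D)" using T by (simp add: card_PiE)
  moreover have "\<forall>x\<in>C. \<forall>y\<in>C. x \<noteq> y \<longrightarrow> D < hamming T x y"
    using C(1) unfolding P_def by (rule conjunct2)
  ultimately show ?thesis using CW1 by (intro exI[of _ C] conjI)
qed

text \<open>A union over the sets of more than \<open>\<delta> * card T\<close> indices, of which
  there are at most \<open>2 ^ card T\<close>. The hypothesis is a product bound for simultaneous
  occurrence, as the gains at different times may be dependent; with
  \<open>2 * p powr \<delta> < 1\<close> the conclusion decays exponentially.\<close>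

lemma (in prob_space) prob_many_le:
  fixes p \<delta> :: real
  assumes T: "finite T" and B: "\<And>t. t \<in> T \<Longrightarrow> B t \<in> events" and p: "0 < p" "p \<le> 1" and \<delta>: "0 \<le> \<delta>"
    and all: "\<And>S. S \<subseteq> T \<Longrightarrow> prob {\<omega> \<in> space M. \<forall>t\<in>S. \<omega> \<in> B t} \<le> p ^ card S"
  shows "{\<omega> \<in> space M. \<delta> * real (card T) < real (card {t \<in> T. \<omega> \<in> B t})} \<in> events"
    and "prob {\<omega> \<in> space M. \<delta> * real (card T) < real (card {t \<in> T. \<omega> \<in> B t})} \<le> (2 * p powr \<delta>) ^ card T"
proof -
  let ?E = "\<lambda>S. {\<omega> \<in> space M. \<forall>t\<in>S. \<omega> \<in> B t}"
  let ?Ss = "{S. S \<subseteq> T \<and> \<delta> * real (card T) < real (card S)}"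
  have fin: "finite ?Ss" by (rule finite_subset[OF _ finite_Pow_iff[THEN iffD2, OF T]]) blast
  have E: "?E S \<in> events" if "S \<subseteq> T" for S
  proof -
    have fS: "finite S" by (rule finite_subset[OF that T])
    have "Measurable.pred M (\<lambda>\<omega>. \<forall>t\<in>S. \<omega> \<in> B t)"
    proof (rule pred_intros_finite(3)[OF fS])
      fix t assume t: "t \<in> S"
      have [measurable]: "B t \<in> events" by (rule B[OF subsetD[OF that t]])
      show "Measurable.pred M (\<lambda>\<omega>. \<omega> \<in> B t)" by measurable
    qed
    then show ?thesis unfolding pred_def .
  qed
  have eq: "{\<omega> \<in> space M. \<delta> * real (card T) < real (card {t \<in> T. \<omega> \<in> B t})} = (\<Union>S\<in>?Ss. ?E S)"
  proof
    show "{\<omega> \<in> space M. \<delta> * real (card T) < real (card {t \<in> T. \<omega> \<in> B t})} \<subseteq> (\<Union>S\<in>?Ss. ?E S)"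
    proof
      fix \<omega> assume w: "\<omega> \<in> {\<omega> \<in> space M. \<delta> * real (card T) < real (card {t \<in> T. \<omega> \<in> B t})}"
      have "{t \<in> T. \<omega> \<in> B t} \<in> ?Ss" using w by simp
      moreover have "\<omega> \<in> ?E {t \<in> T. \<omega> \<in> B t}" using w by simp
      ultimately show "\<omega> \<in> (\<Union>S\<in>?Ss. ?E S)" by (rule UN_I)
    qed
    show "(\<Union>S\<in>?Ss. ?E S) \<subseteq> {\<omega> \<in> space M. \<delta> * real (card T) < real (card {t \<in> T. \<omega> \<in> B t})}"
    proof
      fix \<omega> assume "\<omega> \<in> (\<Union>S\<in>?Ss. ?E S)"
      then obtain S where S: "S \<in> ?Ss" "\<omega> \<in> ?E S" by (rule UN_E)
      have "S \<subseteq> {t \<in> T. \<omega> \<in> B t}" using S by simp blast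
      moreover have "finite {t \<in> T. \<omega> \<in> B t}" using T by simp
      ultimately have "card S \<le> card {t \<in> T. \<omega> \<in> B t}" by (intro card_mono)
      moreover have "\<delta> * real (card T) < real (card S)" "\<omega> \<in> space M" using S by simp_all
      ultimately show "\<omega> \<in> {\<omega> \<in> space M. \<delta> * real (card T) < real (card {t \<in> T. \<omega> \<in> B t})}" by simp
    qed
  qed
  show "{\<omega> \<in> space M. \<delta> * real (card T) < real (card {t \<in> T. \<omega> \<in> B t})} \<in> events"
    unfolding eq by (rule sets.finite_UN[OF fin]) (rule E, simp)
  have "prob (\<Union>S\<in>?Ss. ?E S) \<le> (\<Sum>S\<in>?Ss. prob (?E S))"
  proof (rule finite_measure_subadditive_finite[OF fin])
    show "?E ` ?Ss \<subseteq> events" using E by blast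
  qed
  also have "\<dots> \<le> (\<Sum>S\<in>?Ss. p powr (\<delta> * real (card T)))"
  proof (rule sum_mono)
    fix S assume S: "S \<in> ?Ss"
    have "prob (?E S) \<le> p ^ card S" using S by (intro all) simp
    also have "\<dots> = p powr real (card S)" using p by (simp add: powr_realpow)
    also have "\<dots> \<le> p powr (\<delta> * real (card T))" using S p by (intro powr_mono') auto
    finally show "prob (?E S) \<le> p powr (\<delta> * real (card T))" .
  qed
  also have "\<dots> = real (card ?Ss) * p powr (\<delta> * real (card T))" by simp
  also have "\<dots> \<le> 2 ^ card T * p powr (\<delta> * real (card T))"
  proof (rule mult_right_mono)
    have "card ?Ss \<le> card (Pow T)" using T by (intro card_mono) auto
    then have "real (card ?Ss) \<le> real (2 ^ card T)" using T by (simp add: card_Pow)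
    then show "real (card ?Ss) \<le> 2 ^ card T" by simp
  qed simp
  also have "\<dots> = (2 * p powr \<delta>) ^ card T"
    using p by (simp add: power_mult_distrib powr_powr[symmetric] powr_realpow)
  finally show "prob {\<omega> \<in> space M. \<delta> * real (card T) < real (card {t \<in> T. \<omega> \<in> B t})} \<le> (2 * p powr \<delta>) ^ card T"
    unfolding eq .
qed

text \<open>Elimination: an equation with a nonzero coefficient is solved for one unknown, which
  lowers the numbers of equations and unknowns by one each.\<close>

lemma underdetermined_system:
  fixes a :: "'l \<Rightarrow> 'j \<Rightarrow> 'f :: field"
  assumes "finite L" "finite J" "card L < card J"
  shows "\<exists>x. (\<exists>j\<in>J. x j \<noteq> 0) \<and> (\<forall>l\<in>L. (\<Sum>j\<in>J. a l j * x j) = 0)"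
  using assms
proof (induction L arbitrary: J a rule: finite_induct)
  case empty
  then obtain j where "j \<in> J" by (cases "J = {}") auto
  then show ?case by (intro exI[of _ "\<lambda>_. 1"]) auto
next
  case (insert l L)
  show ?case
  proof (cases "\<forall>j\<in>J. a l j = 0")
    case True
    have "card L < card J" using insert.prems insert.hyps by simp
    from insert.IH[OF insert.prems(1) this, of a] obtain x
      where "\<exists>j\<in>J. x j \<noteq> 0" "\<forall>l\<in>L. (\<Sum>j\<in>J. a l j * x j) = 0" by blast
    then show ?thesis using True by (intro exI[of _ x]) auto
  next
    case False
    then obtain j0 where j0: "j0 \<in> J" "a l j0 \<noteq> 0" by blast
    define J' where "J' = J - {j0}"
    have J': "finite J'" "card L < card J'" "j0 \<notin> J'" "J = insert j0 J'"
      using insert.prems insert.hyps j0 by (auto simp: J'_def)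
    define a' where "a' l' j = a l' j - a l' j0 * a l j / a l j0" for l' j
    from insert.IH[OF J'(1,2), of a'] obtain x where x: "\<exists>j\<in>J'. x j \<noteq> 0"
      "\<forall>l\<in>L. (\<Sum>j\<in>J'. a' l j * x j) = 0" by blast
    define s where "s = (\<Sum>j\<in>J'. a l j * x j)"
    define y where "y = x(j0 := - s / a l j0)"
    have yx: "y j = x j" if "j \<in> J'" for j using that J'(3) by (auto simp: y_def)
    have sy: "(\<Sum>j\<in>J. a l' j * y j) = a l' j0 * (- s / a l j0) + (\<Sum>j\<in>J'. a l' j * x j)" for l'
      unfolding J'(4) using J'(1,3) yx by (simp add: y_def cong: sum.cong)
    have "(\<Sum>j\<in>J. a l j * y j) = 0" unfolding sy using j0 by (simp add: s_def)
    moreover have "(\<Sum>j\<in>J. a l' j * y j) = 0" if l': "l' \<in> L" for l'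
    proof -
      have "0 = (\<Sum>j\<in>J'. a' l' j * x j)" using x(2) l' by simp
      also have "\<dots> = (\<Sum>j\<in>J'. a l' j * x j) - (a l' j0 / a l j0) * s"
        by (simp add: a'_def s_def sum_distrib_left algebra_simps sum_subtractf)
      finally show ?thesis unfolding sy by (simp add: field_simps)
    qed
    moreover have "\<exists>j\<in>J. y j \<noteq> 0" using x(1) yx J'(4) by auto
    ultimately show ?thesis by (intro exI[of _ y]) auto
  qed
qed

lemma find_measurable:
  assumes "\<And>v. v \<in> set vs \<Longrightarrow> Measurable.pred N (Q v)"
  shows "(\<lambda>g. find (\<lambda>v. Q v g) vs) \<in> N \<rightarrow>\<^sub>M count_space UNIV"
  using assms
proof (induction vs)
  case (Cons v vs)
  have [measurable]: "Measurable.pred N (Q v)" "(\<lambda>g. find (\<lambda>v. Q v g) vs) \<in> N \<rightarrow>\<^sub>M count_space UNIV"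
    using Cons by auto
  have "(\<lambda>g. if Q v g then Some v else find (\<lambda>v. Q v g) vs) \<in> N \<rightarrow>\<^sub>M count_space UNIV" by measurable
  then show ?case by simp
qed simp

section \<open>Symbol grids and zero-forcing vectors\<close>

definition grid :: "nat \<Rightarrow> complex set" where
  "grid Q = (\<lambda>(p, q). Complex (real p / real Q) (real q / real Q)) ` ({..<Q} \<times> {..<Q})"

lemma finite_grid [simp]: "finite (grid Q)"
  by (simp add: grid_def)

lemma card_grid: "1 \<le> Q \<Longrightarrow> card (grid Q) = Q * Q"
  unfolding grid_def by (subst card_image) (auto simp: inj_on_def)

lemma grid_norm_le:
  assumes "u \<in> grid Q"
  shows "cmod u \<le> 2"
proof -
  obtain p q where u: "u = Complex (real p / real Q) (real q / real Q)" "p < Q" "q < Q"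
    using assms unfolding grid_def by auto
  have "cmod u \<le> \<bar>Re u\<bar> + \<bar>Im u\<bar>" by (rule cmod_le)
  moreover have "\<bar>Re u\<bar> \<le> 1" "\<bar>Im u\<bar> \<le> 1" using u by simp_all
  ultimately show ?thesis by linarith
qed

lemma grid_separated:
  assumes "u \<in> grid Q" "u' \<in> grid Q" "u \<noteq> u'"
  shows "1 / real Q \<le> cmod (u - u')"
proof -
  obtain p q where u: "u = Complex (real p / real Q) (real q / real Q)" "p < Q" "q < Q"
    using assms(1) unfolding grid_def by auto
  obtain p' q' where u': "u' = Complex (real p' / real Q) (real q' / real Q)" "p' < Q" "q' < Q"
    using assms(2) unfolding grid_def by auto
  have frac: "1 / real Q \<le> \<bar>real x / real Q - real y / real Q\<bar>" if "x \<noteq> y" for x y :: nat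
  proof -
    have "1 \<le> \<bar>real x - real y\<bar>" using that by linarith
    then show ?thesis using u(2) by (simp add: diff_divide_distrib[symmetric] divide_right_mono)
  qed
  have "p \<noteq> p' \<or> q \<noteq> q'" using assms(3) u(1) u'(1) by auto
  then show ?thesis
  proof
    assume "p \<noteq> p'"
    from frac[OF this] have "1 / real Q \<le> \<bar>Re (u - u')\<bar>" using u(1) u'(1) by simp
    then show ?thesis using abs_Re_le_cmod[of "u - u'"] by linarith
  next
    assume "q \<noteq> q'"
    from frac[OF this] have "1 / real Q \<le> \<bar>Im (u - u')\<bar>" using u(1) u'(1) by simp
    then show ?thesis using abs_Im_le_cmod[of "u - u'"] by linarith
  qed
qed

text \<open>Level 1 stands for silence, and the separation conditions exempt it.\<close>

lemma grid_1: "u \<in> grid (Suc 0) \<Longrightarrow> u = 0"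
  by (auto simp: grid_def complex_eq_iff)

text \<open>Two layers are resolved successively. Both candidate pairs lie within \<open>E\<close>
  of \<open>y\<close>, hence the \<open>2 * E\<close>. If the common symbols differed, their
  difference would outweigh this and any private difference, which is at most
  \<open>4 * Y * G\<close>. Once they agree, a private difference would be visible through the
  gain.\<close>

lemma symbols_separated:
  fixes y h g u u' p p' :: complex and X Y E c g0 G :: real
  assumes u: "u \<in> grid Qc" "u' \<in> grid Qc" and p: "p \<in> grid Qp" "p' \<in> grid Qp"
    and Q: "1 \<le> Qc" "1 \<le> Qp"
    and r: "cmod (y - (of_real X * h * u + of_real Y * g * p)) \<le> E"
    and r': "cmod (y - (of_real X * h * u' + of_real Y * g * p')) \<le> E"
    and XY: "0 \<le> X" "0 \<le> Y" and h: "c \<le> cmod h" and g: "cmod g \<le> G" "Qp = 1 \<or> g0 \<le> cmod g"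
    and sc: "Qc = 1 \<or> 2 * E + 4 * Y * G < X * c / real Qc"
    and sp: "Qp = 1 \<or> 2 * E < Y * g0 / real Qp"
  shows "u = u'" "p = p'"
proof -
  let ?d = "of_real X * h * (u - u') + of_real Y * g * (p - p')"
  have de: "?d = (y - (of_real X * h * u' + of_real Y * g * p')) - (y - (of_real X * h * u + of_real Y * g * p))"
    by (simp add: algebra_simps)
  have d: "cmod ?d \<le> 2 * E"
    unfolding de using norm_triangle_ineq4[of "y - (of_real X * h * u' + of_real Y * g * p')" "y - (of_real X * h * u + of_real Y * g * p)"]
      r r' by linarith
  show uu: "u = u'"
  proof (rule ccontr)
    assume ne: "u \<noteq> u'"
    have "Qc \<noteq> 1"
    proof
      assume "Qc = 1"
      then have "u = 0" "u' = 0" using u grid_1 by simp_all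
      with ne show False by simp
    qed
    with sc have sc': "2 * E + 4 * Y * G < X * c / real Qc" by simp
    have pp: "cmod (p - p') \<le> 4"
      using norm_triangle_ineq4[of p p'] grid_norm_le[OF p(1)] grid_norm_le[OF p(2)] by linarith
    have "cmod (of_real Y * g * (p - p')) = Y * (cmod g * cmod (p - p'))"
      using XY by (simp add: norm_mult)
    also have "\<dots> \<le> Y * (G * 4)"
      using XY g pp order_trans[OF norm_ge_zero g(1)] by (intro mult_left_mono mult_mono) simp_all
    finally have 1: "cmod (of_real Y * g * (p - p')) \<le> 4 * Y * G" by simp
    have "X * c / real Qc = X * (c * (1 / real Qc))" by simp
    also have "\<dots> \<le> X * (cmod h * cmod (u - u'))"
      using XY h grid_separated[OF u ne] by (intro mult_left_mono mult_mono) simp_all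
    also have "\<dots> = cmod (of_real X * h * (u - u'))" using XY by (simp add: norm_mult)
    also have "of_real X * h * (u - u') = ?d - of_real Y * g * (p - p')" by simp
    also have "cmod \<dots> \<le> cmod ?d + cmod (of_real Y * g * (p - p'))" by (rule norm_triangle_ineq4)
    finally show False using d 1 sc' by linarith
  qed
  show "p = p'"
  proof (rule ccontr)
    assume ne: "p \<noteq> p'"
    have "Qp \<noteq> 1"
    proof
      assume "Qp = 1"
      then have "p = 0" "p' = 0" using p grid_1 by simp_all
      with ne show False by simp
    qed
    with sp g have sp': "2 * E < Y * g0 / real Qp" "g0 \<le> cmod g" by simp_all
    have "Y * g0 / real Qp = Y * (g0 * (1 / real Qp))" by simp
    also have "\<dots> \<le> Y * (cmod g * cmod (p - p'))"
      using XY sp' grid_separated[OF p ne] by (intro mult_left_mono mult_mono) simp_all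
    also have "\<dots> = cmod ?d" using XY by (simp add: norm_mult uu)
    finally show False using d sp' by linarith
  qed
qed

lemma round_to_mesh:
  fixes z :: complex and q :: nat
  assumes q: "0 < q" and z: "cmod z \<le> 1"
  obtains a b :: int where "a \<in> {-int q..int q}" "b \<in> {-int q..int q}"
    "cmod (Complex (real_of_int a / real q) (real_of_int b / real q) - z) \<le> 2 / real q"
proof -
  have key: "\<lfloor>real q * x\<rfloor> \<in> {-int q..int q}" "\<bar>real_of_int \<lfloor>real q * x\<rfloor> / real q - x\<bar> \<le> 1 / real q"
    if "\<bar>x\<bar> \<le> 1" for x
  proof -
    have "real q * \<bar>x\<bar> \<le> real q * 1" using that by (intro mult_left_mono) simp_all
    then have b: "\<bar>real q * x\<bar> \<le> real q" by (simp add: abs_mult)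
    then have "- real q \<le> real q * x" "real q * x \<le> real q" by linarith+
    then have "- int q \<le> \<lfloor>real q * x\<rfloor>" "\<lfloor>real q * x\<rfloor> \<le> int q" by linarith+
    then show "\<lfloor>real q * x\<rfloor> \<in> {-int q..int q}" by simp
    have "\<bar>real_of_int \<lfloor>real q * x\<rfloor> - real q * x\<bar> \<le> 1" by linarith
    then have "\<bar>real_of_int \<lfloor>real q * x\<rfloor> - real q * x\<bar> / real q \<le> 1 / real q"
      by (rule divide_right_mono) simp
    also have "\<bar>real_of_int \<lfloor>real q * x\<rfloor> - real q * x\<bar> / real q = \<bar>(real_of_int \<lfloor>real q * x\<rfloor> - real q * x) / real q\<bar>"
      by (simp add: abs_divide)
    also have "(real_of_int \<lfloor>real q * x\<rfloor> - real q * x) / real q = real_of_int \<lfloor>real q * x\<rfloor> / real q - x"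
      using q by (simp add: diff_divide_distrib)
    finally show "\<bar>real_of_int \<lfloor>real q * x\<rfloor> / real q - x\<bar> \<le> 1 / real q" .
  qed
  have r: "\<bar>Re z\<bar> \<le> 1" "\<bar>Im z\<bar> \<le> 1" using abs_Re_le_cmod[of z] abs_Im_le_cmod[of z] z by linarith+
  let ?w = "Complex (real_of_int \<lfloor>real q * Re z\<rfloor> / real q) (real_of_int \<lfloor>real q * Im z\<rfloor> / real q)"
  have "cmod (?w - z) \<le> \<bar>Re (?w - z)\<bar> + \<bar>Im (?w - z)\<bar>" by (rule cmod_le)
  also have "\<dots> \<le> 1 / real q + 1 / real q"
    using key(2)[OF r(1)] key(2)[OF r(2)] by (intro add_mono) simp_all
  finally have "cmod (?w - z) \<le> 2 / real q" by simp
  with key(1)[OF r(1)] key(1)[OF r(2)] show thesis by (rule that)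
qed

text \<open>
  The zero-forcing vectors come from a finite mesh, so that a measurable choice is the first mesh
  vector in a list that passes the test; exact solutions would need a measurable selection.
\<close>
lemma zero_forcing_mesh:
  fixes B \<eta> :: real and L :: "'l set" and J :: "'j set"
  assumes L: "finite L" "card L < card J" and J: "finite J" and B: "0 \<le> B" "0 < \<eta>"
  obtains V :: "('j \<Rightarrow> complex) set" where "finite V"
    "\<And>v j. v \<in> V \<Longrightarrow> cmod (v j) \<le> 2" "\<And>v. v \<in> V \<Longrightarrow> \<exists>j\<in>J. 1 / 2 \<le> cmod (v j)"
    "\<And>a. (\<And>l j. l \<in> L \<Longrightarrow> j \<in> J \<Longrightarrow> cmod (a l j) \<le> B) \<Longrightarrow>
      \<exists>v\<in>V. \<forall>l\<in>L. cmod (\<Sum>j\<in>J. a l j * v j) \<le> \<eta>"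
proof -
  obtain q0 :: nat where q0: "2 * (real (card J) * B) / \<eta> \<le> real q0" using real_arch_simple by blast
  \<comment> \<open>The mesh is fine enough for the rounding errors of all coordinates together to
    stay below \<open>\<eta>\<close>; the 4 keeps a coordinate of modulus 1 at 1/2 or above after
    rounding.\<close>
  define q where "q = q0 + 4"
  have q: "0 < q" "4 \<le> real q" by (simp_all add: q_def)
  have qb: "real (card J) * (B * (2 / real q)) \<le> \<eta>"
  proof -
    have "2 * (real (card J) * B) / \<eta> \<le> real q" using q0 by (simp add: q_def)
    then have "2 * (real (card J) * B) \<le> real q * \<eta>" using B by (simp add: divide_le_eq)
    then show ?thesis using q by (simp add: field_simps)
  qed
  define W where "W = (\<lambda>(a, b). Complex (real_of_int a / real q) (real_of_int b / real q)) ` ({-int q..int q} \<times> {-int q..int q})"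
  define V where "V = {v \<in> (\<lambda>v j. if j \<in> J then v j else 0) ` (J \<rightarrow>\<^sub>E W).
    (\<forall>j. cmod (v j) \<le> 2) \<and> (\<exists>j\<in>J. 1 / 2 \<le> cmod (v j))}"
  have "finite W" by (simp add: W_def)
  with J have "finite (J \<rightarrow>\<^sub>E W)" by (rule finite_PiE)
  then have "finite V" unfolding V_def by simp
  then show thesis
  proof (rule that)
    show "cmod (v j) \<le> 2" if "v \<in> V" for v j using that unfolding V_def by blast
    show "\<exists>j\<in>J. 1 / 2 \<le> cmod (v j)" if "v \<in> V" for v using that unfolding V_def by blast
    fix a :: "'l \<Rightarrow> 'j \<Rightarrow> complex"
    assume aB: "\<And>l j. l \<in> L \<Longrightarrow> j \<in> J \<Longrightarrow> cmod (a l j) \<le> B"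
    obtain x0 where x0: "\<exists>j\<in>J. x0 j \<noteq> 0" "\<forall>l\<in>L. (\<Sum>j\<in>J. a l j * x0 j) = 0"
      using underdetermined_system[OF L(1) J L(2), of a] by blast
    \<comment> \<open>Division by the largest modulus bounds all coordinates by 1 and makes one of
      them have modulus exactly 1.\<close>
    define s where "s = Max ((\<lambda>j. cmod (x0 j)) ` J)"
    have Jne: "J \<noteq> {}" using x0(1) by blast
    have fin: "finite ((\<lambda>j. cmod (x0 j)) ` J)" using J by simp
    have s_ge: "cmod (x0 j) \<le> s" if "j \<in> J" for j unfolding s_def by (rule Max_ge[OF fin]) (rule imageI[OF that])
    have "s \<in> (\<lambda>j. cmod (x0 j)) ` J" unfolding s_def by (rule Max_in[OF fin]) (simp add: Jne)
    then obtain j1 where j1: "j1 \<in> J" "s = cmod (x0 j1)" by blast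
    obtain j2 where j2: "j2 \<in> J" "x0 j2 \<noteq> 0" using x0(1) by blast
    have s0: "0 < s" using s_ge[OF j2(1)] zero_less_norm_iff[of "x0 j2"] j2(2) by linarith
    define x where "x j = x0 j / of_real s" for j
    have xn: "cmod (x j) \<le> 1" if "j \<in> J" for j
      using s_ge[OF that] s0 by (simp add: x_def norm_divide divide_le_eq)
    have x1: "cmod (x j1) = 1" using j1 s0 by (simp add: x_def norm_divide)
    have xz: "(\<Sum>j\<in>J. a l j * x j) = 0" if "l \<in> L" for l
    proof -
      have "(\<Sum>j\<in>J. a l j * x j) = (\<Sum>j\<in>J. a l j * x0 j) / of_real s"
        by (simp add: x_def sum_divide_distrib)
      then show ?thesis using x0(2) that by simp
    qed
    have "\<exists>w\<in>W. cmod (w - x j) \<le> 2 / real q" if j: "j \<in> J" for j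
    proof (rule round_to_mesh[OF q(1) xn[OF j]])
      fix a b assume ab: "a \<in> {-int q..int q}" "b \<in> {-int q..int q}"
        and d: "cmod (Complex (real_of_int a / real q) (real_of_int b / real q) - x j) \<le> 2 / real q"
      have "Complex (real_of_int a / real q) (real_of_int b / real q) \<in> W"
        unfolding W_def by (rule image_eqI[of _ _ "(a, b)"]) (use ab in simp_all)
      with d show ?thesis by (rule bexI)
    qed
    then obtain w where w: "\<And>j. j \<in> J \<Longrightarrow> w j \<in> W" "\<And>j. j \<in> J \<Longrightarrow> cmod (w j - x j) \<le> 2 / real q" by metis
    define v where "v j = (if j \<in> J then w j else 0)" for j
    have v_im: "v \<in> (\<lambda>v j. if j \<in> J then v j else 0) ` (J \<rightarrow>\<^sub>E W)"
    proof (rule image_eqI)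
      show "restrict w J \<in> J \<rightarrow>\<^sub>E W" using w(1) by (intro PiE_I) simp_all
      show "v = (\<lambda>j. if j \<in> J then restrict w J j else 0)" by (rule ext) (simp add: v_def)
    qed
    have q2: "2 / real q \<le> 1 / 2" using q by (simp add: divide_le_eq)
    have v2: "cmod (v j) \<le> 2" for j
    proof (cases "j \<in> J")
      case True
      have "cmod (w j) \<le> cmod (w j - x j) + cmod (x j)" using norm_triangle_ineq[of "w j - x j" "x j"] by simp
      then show ?thesis using w(2)[OF True] xn[OF True] q2 True unfolding v_def by simp
    qed (simp add: v_def)
    have "cmod (x j1) \<le> cmod (w j1 - x j1) + cmod (w j1)"
      using norm_triangle_ineq4[of "w j1" "w j1 - x j1"] by simp
    then have "1 / 2 \<le> cmod (v j1)" using w(2)[OF j1(1)] x1 q2 j1(1) unfolding v_def by simp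
    with v2 v_im j1(1) have "v \<in> V" unfolding V_def by blast
    moreover have "cmod (\<Sum>j\<in>J. a l j * v j) \<le> \<eta>" if l: "l \<in> L" for l
    proof -
      have "(\<Sum>j\<in>J. a l j * v j) = (\<Sum>j\<in>J. a l j * (v j - x j)) + (\<Sum>j\<in>J. a l j * x j)"
        by (simp add: sum.distrib[symmetric] algebra_simps)
      then have "cmod (\<Sum>j\<in>J. a l j * v j) \<le> (\<Sum>j\<in>J. cmod (a l j * (v j - x j)))"
        using xz[OF l] norm_sum[of "\<lambda>j. a l j * (v j - x j)" J] by simp
      also have "\<dots> \<le> (\<Sum>j\<in>J. B * (2 / real q))"
      proof (rule sum_mono)
        fix j assume j: "j \<in> J"
        have "cmod (v j - x j) \<le> 2 / real q" using w(2)[OF j] j by (simp add: v_def)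
        then show "cmod (a l j * (v j - x j)) \<le> B * (2 / real q)"
          unfolding norm_mult using aB[OF l j] B by (intro mult_mono) simp_all
      qed
      also have "\<dots> = real (card J) * (B * (2 / real q))" by simp
      finally show ?thesis using qb by linarith
    qed
    ultimately show "\<exists>v\<in>V. \<forall>l\<in>L. cmod (\<Sum>j\<in>J. a l j * v j) \<le> \<eta>" by blast
  qed
qed

text \<open>The choice is a search through a fixed list, so it is measurable and depends only on the
  entries over \<open>L\<close> and \<open>J\<close>. Both norm bounds hold for every
  \<open>a\<close>; the boundedness of entries is presupposed for the nulling alone.\<close>

lemma zero_forcing_selection:
  fixes B \<eta> :: real and L :: "'l set" and J :: "'j set"
  assumes L: "finite L" "card L < card J" and J: "finite J" and B: "0 \<le> B" "0 < \<eta>"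
  obtains sel :: "('l \<Rightarrow> 'j \<Rightarrow> complex) \<Rightarrow> 'j \<Rightarrow> complex" where
    "\<And>a j. cmod (sel a j) \<le> 2" "\<And>a. \<exists>j\<in>J. 1 / 2 \<le> cmod (sel a j)"
    "\<And>a l. (\<And>l j. l \<in> L \<Longrightarrow> j \<in> J \<Longrightarrow> cmod (a l j) \<le> B) \<Longrightarrow> l \<in> L \<Longrightarrow>
      cmod (\<Sum>j\<in>J. a l j * sel a j) \<le> \<eta>"
    "\<And>a a'. (\<And>l j. l \<in> L \<Longrightarrow> j \<in> J \<Longrightarrow> a l j = a' l j) \<Longrightarrow> sel a = sel a'"
    "\<And>(N :: 'g measure) A j. (\<And>l j. l \<in> L \<Longrightarrow> j \<in> J \<Longrightarrow> (\<lambda>g. A g l j) \<in> borel_measurable N) \<Longrightarrow>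
      (\<lambda>g. sel (A g) j) \<in> borel_measurable N"
proof (rule zero_forcing_mesh[OF assms])
  fix V :: "('j \<Rightarrow> complex) set"
  assume V: "finite V" "\<And>v j. v \<in> V \<Longrightarrow> cmod (v j) \<le> 2" "\<And>v. v \<in> V \<Longrightarrow> \<exists>j\<in>J. 1 / 2 \<le> cmod (v j)"
    and ex: "\<And>a. (\<And>l j. l \<in> L \<Longrightarrow> j \<in> J \<Longrightarrow> cmod (a l j) \<le> B) \<Longrightarrow>
      \<exists>v\<in>V. \<forall>l\<in>L. cmod (\<Sum>j\<in>J. a l j * v j) \<le> \<eta>"
  obtain vs where vs: "set vs = V" using finite_list[OF V(1)] by blast
  define ok where "ok v a \<longleftrightarrow> (\<forall>l\<in>L. cmod (\<Sum>j\<in>J. a l j * v j) \<le> \<eta>)" for v :: "'j \<Rightarrow> complex" and a :: "'l \<Rightarrow> 'j \<Rightarrow> complex"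
  \<comment> \<open>The vector of ones is the default when no mesh vector passes the test; it
    respects both norm bounds.\<close>
  define dv where "dv x = (case x of Some v \<Rightarrow> v | None \<Rightarrow> (\<lambda>_. 1))" for x :: "('j \<Rightarrow> complex) option"
  define sel where "sel a = dv (find (\<lambda>v. ok v a) vs)" for a
  have cases: "(sel a \<in> V \<and> ok (sel a) a) \<or> (sel a = (\<lambda>_. 1) \<and> (\<forall>v\<in>V. \<not> ok v a))" for a
  proof (cases "find (\<lambda>v. ok v a) vs")
    case None
    then have "\<forall>v\<in>V. \<not> ok v a" unfolding find_None_iff vs by blast
    then show ?thesis using None by (simp add: sel_def dv_def)
  next
    case (Some v)
    then have "v \<in> V" "ok v a" unfolding find_Some_iff using vs nth_mem by blast+
    then show ?thesis using Some by (simp add: sel_def dv_def)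
  qed
  have "card J \<noteq> 0" using L by linarith
  then have Jne: "J \<noteq> {}" by auto
  show thesis
  proof (rule that)
    show "cmod (sel a j) \<le> 2" for a j using cases[of a] V(2)[of "sel a" j] by auto
    show "\<exists>j\<in>J. 1 / 2 \<le> cmod (sel a j)" for a using cases[of a] V(3)[of "sel a"] Jne by auto
    show "cmod (\<Sum>j\<in>J. a l j * sel a j) \<le> \<eta>"
      if "\<And>l j. l \<in> L \<Longrightarrow> j \<in> J \<Longrightarrow> cmod (a l j) \<le> B" "l \<in> L" for a l
    proof -
      have "\<exists>v\<in>V. ok v a" unfolding ok_def by (rule ex) (rule that(1))
      then have "ok (sel a) a" using cases[of a] by blast
      then show ?thesis using that(2) unfolding ok_def by blast
    qed
    show "sel a = sel a'" if "\<And>l j. l \<in> L \<Longrightarrow> j \<in> J \<Longrightarrow> a l j = a' l j" for a a'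
    proof -
      have "ok v a = ok v a'" for v unfolding ok_def using that by (simp cong: sum.cong)
      then show ?thesis by (simp add: sel_def)
    qed
    fix N :: "'g measure" and A :: "'g \<Rightarrow> 'l \<Rightarrow> 'j \<Rightarrow> complex" and j
    assume A: "\<And>l j. l \<in> L \<Longrightarrow> j \<in> J \<Longrightarrow> (\<lambda>g. A g l j) \<in> borel_measurable N"
    have "Measurable.pred N (\<lambda>g. ok v (A g))" for v
      unfolding ok_def
    proof (rule pred_intros_finite(3)[OF L(1)])
      fix l assume l: "l \<in> L"
      have "(\<lambda>g. \<Sum>j\<in>J. A g l j * v j) \<in> borel_measurable N"
        by (rule borel_measurable_sum) (rule borel_measurable_times[OF A[OF l] borel_measurable_const])
      then have "(\<lambda>g. cmod (\<Sum>j\<in>J. A g l j * v j)) \<in> borel_measurable N" by simp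
      then show "Measurable.pred N (\<lambda>g. cmod (\<Sum>j\<in>J. A g l j * v j) \<le> \<eta>)" by (rule pred_le_real) simp
    qed
    then have "(\<lambda>g. find (\<lambda>v. ok v (A g)) vs) \<in> N \<rightarrow>\<^sub>M count_space UNIV" by (rule find_measurable)
    from measurable_compose[OF this, of "\<lambda>x. dv x j" borel]
    show "(\<lambda>g. sel (A g) j) \<in> borel_measurable N" unfolding sel_def by simp
  qed
qed

text \<open>Of the two bits of rate given up per slot, one pays for the factor \<open>2 ^ n\<close>
  in the covering by balls and one for rounding the number of messages up. At rate 0 there is a
  single message, whatever the alphabet.\<close>

lemma code_exists:
  fixes A :: "'s set" and R \<delta> :: real
  assumes A: "finite A" "A \<noteq> {}" and n: "1 \<le> n" and \<delta>: "0 \<le> \<delta>" and R: "0 \<le> R"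
    and rate: "R = 0 \<or> R \<le> (1 - 2 * \<delta>) * log 2 (real (card A)) - 2"
  shows "\<exists>cw :: nat \<Rightarrow> nat \<Rightarrow> 's. \<forall>w < nat \<lceil>2 powr (real n * R)\<rceil>. cw w \<in> {1..n} \<rightarrow>\<^sub>E A \<and>
    (\<forall>w' < nat \<lceil>2 powr (real n * R)\<rceil>. w \<noteq> w' \<longrightarrow> 2 * \<delta> * real n < real (hamming {1..n} (cw w) (cw w')))"
proof (cases "R = 0")
  case True
  obtain s where s: "s \<in> A" using A by blast
  have "(\<lambda>t\<in>{1..n}. s) \<in> {1..n} \<rightarrow>\<^sub>E A" using s by simp
  then show ?thesis using True by (intro exI[of _ "\<lambda>_. \<lambda>t\<in>{1..n}. s"]) simp
next
  case False
  define N where "N = nat \<lceil>2 powr (real n * R)\<rceil>"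
  define D where "D = nat \<lfloor>2 * \<delta> * real n\<rfloor>"
  define a where "a = real (card A)"
  have a1: "1 \<le> a" using card_gt_0_iff[THEN iffD2, OF conjI[OF A(2,1)]] unfolding a_def by linarith
  obtain C where C: "C \<subseteq> {1..n} \<rightarrow>\<^sub>E A" "\<forall>x\<in>C. \<forall>y\<in>C. x \<noteq> y \<longrightarrow> D < hamming {1..n} x y"
    "card A ^ card {1..n} \<le> card C * (2 ^ card {1..n} * card A ^ D)"
    using gilbert_varshamov[OF finite_atLeastAtMost A, of 1 n D] by blast
  have finC: "finite C" by (rule finite_subset[OF C(1)]) (rule finite_PiE, simp, rule A(1))
  have "real (card A ^ n) \<le> real (card C * (2 ^ n * card A ^ D))" using C(3) by (simp only: card_atLeastAtMost of_nat_le_iff diff_Suc_1)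
  then have cC: "a ^ n \<le> real (card C) * (2 ^ n * a ^ D)" by (simp add: a_def)
  have aD: "a ^ D \<le> a powr (2 * \<delta> * real n)"
  proof -
    have "0 \<le> 2 * \<delta> * real n" using \<delta> by simp
    then have "real D \<le> 2 * \<delta> * real n" unfolding D_def by linarith
    then have "a powr real D \<le> a powr (2 * \<delta> * real n)" using a1 by (intro powr_mono) simp_all
    then show ?thesis using a1 by (simp add: powr_realpow)
  qed
  define s where "s = a powr (2 * \<delta> * real n)"
  have s0: "0 < s" using a1 by (simp add: s_def)
  have "a ^ n \<le> real (card C) * (2 ^ n * s)"
  proof (rule order_trans[OF cC])
    have "2 ^ n * a ^ D \<le> 2 ^ n * s" using aD unfolding s_def by (rule mult_left_mono) simp
    then show "real (card C) * (2 ^ n * a ^ D) \<le> real (card C) * (2 ^ n * s)" by (rule mult_left_mono) simp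
  qed
  then have cC2: "a ^ n / (2 ^ n * s) \<le> real (card C)" using s0 by (simp add: divide_le_eq)
  have "real n * R + real n \<le> real n * ((1 - 2 * \<delta>) * log 2 a) - real n"
  proof -
    have "R + 1 \<le> (1 - 2 * \<delta>) * log 2 a - 1" using rate False by (simp add: a_def)
    then have "real n * (R + 1) \<le> real n * ((1 - 2 * \<delta>) * log 2 a - 1)" by (rule mult_left_mono) simp
    then show ?thesis by (simp add: algebra_simps)
  qed
  then have e: "real n * R + real n \<le> log 2 a * real n - real n - log 2 a * (2 * \<delta> * real n)"
    by (simp add: algebra_simps)
  have a2: "a powr x = 2 powr (log 2 a * x)" for x
    using a1 by (simp add: powr_powr[symmetric])
  have "2 powr (real n * R) * 2 powr real n = 2 powr (real n * R + real n)" by (simp add: powr_add)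
  also have "\<dots> \<le> 2 powr (log 2 a * real n - real n - log 2 a * (2 * \<delta> * real n))"
    using e by (intro powr_mono) simp_all
  also have "\<dots> = a powr real n / (2 powr real n * s)"
    by (simp add: powr_diff s_def a2)
  also have "\<dots> = a ^ n / (2 ^ n * s)" using a1 by (simp add: powr_realpow)
  finally have b1: "2 powr (real n * R) * 2 powr real n \<le> real (card C)" using cC2 by linarith
  have p1: "1 \<le> 2 powr (real n * R)" using R by (intro ge_one_powr_ge_zero) simp_all
  have "2 powr 1 \<le> 2 powr real n" using n by (intro powr_mono) simp_all
  then have p2: "2 powr (real n * R) * 2 \<le> 2 powr (real n * R) * 2 powr real n"
    by (intro mult_left_mono) simp_all
  have "real N \<le> 2 powr (real n * R) + 1" unfolding N_def using p1 by linarith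
  then have "real N \<le> real (card C)" using p1 p2 b1 by linarith
  then have "card {..<N} \<le> card C" by simp
  then obtain cw where cw: "cw ` {..<N} \<subseteq> C" "inj_on cw {..<N}"
    using card_le_inj[OF finite_lessThan finC] by blast
  have "cw w \<in> {1..n} \<rightarrow>\<^sub>E A" if "w < N" for w using cw(1) C(1) that by blast
  moreover have "2 * \<delta> * real n < real (hamming {1..n} (cw w) (cw w'))" if w: "w < N" "w' < N" "w \<noteq> w'" for w w'
  proof -
    have "cw w \<noteq> cw w'" using inj_onD[OF cw(2), of w w'] w by blast
    moreover have "cw w \<in> C" "cw w' \<in> C" using cw(1) w by blast+
    ultimately have "D < hamming {1..n} (cw w) (cw w')" using C(2) by blast
    then show ?thesis unfolding D_def by linarith
  qed
  ultimately show ?thesis unfolding N_def by blast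
qed

section \<open>Tails of noise and gains, and bounds for single entries\<close>

context parallel_miso_bc
begin

text \<open>Continuity from above gives a level that the noise of one slot exceeds with probability
  at most \<open>p\<close>; independence over time multiplies these probabilities.\<close>

lemma noise_tail:
  fixes p :: real
  assumes p: "0 < p"
  obtains \<tau> :: real where "0 < \<tau>" "\<And>k m S. k \<in> {1..K} \<Longrightarrow> m \<in> {1..M} \<Longrightarrow> finite S \<Longrightarrow> S \<subseteq> {1..} \<Longrightarrow>
    prob {\<omega> \<in> space \<Omega>. \<forall>t\<in>S. \<tau> < cmod (Z k m t \<omega>)} \<le> p ^ card S"
proof -
  define G where "G = density lborel (\<lambda>z. ennreal (gauss z))"
  interpret G: prob_space G unfolding G_def by (rule prob_space_gauss)
  have sG: "space G = UNIV" "sets G = sets borel" by (simp_all add: G_def)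
  let ?A = "\<lambda>i::nat. {z :: complex. real i < cmod z}"
  have A: "?A i \<in> sets borel" for i by measurable
  have "(\<lambda>i. measure G (?A i)) \<longlonglongrightarrow> measure G (\<Inter>i. ?A i)"
  proof (rule G.finite_Lim_measure_decseq)
    show "range ?A \<subseteq> sets G" unfolding sG using A by blast
    show "decseq ?A" by (rule decseq_SucI) auto
  qed
  moreover have "(\<Inter>i. ?A i) = {}"
  proof -
    have False if "\<forall>i. real i < cmod z" for z
    proof -
      obtain i :: nat where "cmod z \<le> real i" using real_arch_simple by blast
      with that show False using not_le by blast
    qed
    then show ?thesis by auto
  qed
  ultimately have "(\<lambda>i. measure G (?A i)) \<longlonglongrightarrow> 0" by simp
  then have "\<forall>\<^sub>F i in sequentially. measure G (?A i) < p" by (rule order_tendstoD) (rule p)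
  then obtain i0 where i0: "\<And>i. i0 \<le> i \<Longrightarrow> measure G (?A i) < p" unfolding eventually_sequentially by blast
  define i where "i = Suc i0"
  have i: "measure G (?A i) \<le> p" using i0[of i] by (simp add: i_def less_imp_le)
  show thesis
  proof (rule that[of "real i"])
    show "0 < real i" by (simp add: i_def)
    fix k m and S :: "nat set" assume k: "k \<in> {1..K}" and m: "m \<in> {1..M}" and S: "finite S" "S \<subseteq> {1..}"
    have one: "prob (Z k m t -` ?A i \<inter> space \<Omega>) \<le> p" if t: "1 \<le> t" for t
    proof -
      have d: "distributed \<Omega> lborel (Z k m t) (\<lambda>z. ennreal (gauss z))"
        using noise_gaussian[OF k m t] by (simp add: gauss_def)
      have "prob (Z k m t -` ?A i \<inter> space \<Omega>) = measure (distr \<Omega> lborel (Z k m t)) (?A i)"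
        using Z_measurable[OF k m t] A by (subst measure_distr) simp_all
      also have "distr \<Omega> lborel (Z k m t) = G" unfolding G_def by (rule distributed_distr_eq_density[OF d])
      finally show ?thesis using i by simp
    qed
    show "prob {\<omega> \<in> space \<Omega>. \<forall>t\<in>S. real i < cmod (Z k m t \<omega>)} \<le> p ^ card S"
    proof (cases "S = {}")
      case True
      then show ?thesis by simp
    next
      case False
      let ?f = "\<lambda>t. (k, m, t)"
      let ?X = "\<lambda>(k, m, t). Z k m t"
      have "prob (\<Inter>x\<in>?f ` S. ?X x -` ?A i \<inter> space \<Omega>) = (\<Prod>x\<in>?f ` S. prob (?X x -` ?A i \<inter> space \<Omega>))"
      proof (rule indep_varsD[OF noise_indep])
        show "?f ` S \<noteq> {}" using False by simp
        show "finite (?f ` S)" using S by simp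
        show "?f ` S \<subseteq> {1..K} \<times> {1..M} \<times> {1..}" using k m S by auto
      qed (rule A)
      also have "\<dots> = (\<Prod>t\<in>S. prob (Z k m t -` ?A i \<inter> space \<Omega>))"
        by (subst prod.reindex) (simp_all add: inj_on_def)
      also have "\<dots> \<le> (\<Prod>t\<in>S. p)"
        using one S by (intro prod_mono) (auto simp: subset_iff)
      also have "\<dots> = p ^ card S" by simp
      also have "(\<Inter>x\<in>?f ` S. ?X x -` ?A i \<inter> space \<Omega>) = {\<omega> \<in> space \<Omega>. \<forall>t\<in>S. real i < cmod (Z k m t \<omega>)}"
        using False by auto
      finally show ?thesis .
    qed
  qed
qed

text \<open>The gain is affine in the estimates of user \<open>k\<close>, and the vector
  \<open>V t\<close> is free of them. Along a coordinate of \<open>V t\<close> of modulus at least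
  1/2, a gain below \<open>g0\<close> puts one estimate entry into a disc of radius
  \<open>2 * g0\<close>. The coordinate varies with the realization, hence a union over the
  \<open>K ^ card S\<close> selections.\<close>

lemma gain_tail:
  fixes p :: real
  assumes p: "0 < p"
  obtains g0 :: real where "0 < g0"
    "\<And>P n k m (V :: nat \<Rightarrow> nat \<Rightarrow> (entry \<Rightarrow> complex) \<Rightarrow> complex) S. k \<in> {1..K} \<Longrightarrow> m \<in> {1..M} \<Longrightarrow> S \<subseteq> {1..n} \<Longrightarrow>
      (\<And>t j. t \<in> S \<Longrightarrow> j \<in> {1..K} \<Longrightarrow> V t j \<in> borel_measurable (block_space n)) \<Longrightarrow>
      (\<And>t j. t \<in> S \<Longrightarrow> j \<in> {1..K} \<Longrightarrow> free_of {Estimate k m t j | t j. True} (V t j)) \<Longrightarrow>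
      (\<And>t g. t \<in> S \<Longrightarrow> \<exists>j\<in>{1..K}. 1 / 2 \<le> cmod (V t j g)) \<Longrightarrow>
      measure (block_law n) {g \<in> space (block_space n). \<forall>t\<in>S. cmod (\<Sum>j=1..K. coeff P k m t j g * V t j g) < g0}
        \<le> p ^ card S"
proof (rule small_balls_estimate[where 'i = nat])
  fix c :: real
  assume c: "0 < c"
    and sb: "\<And>n S (e :: nat \<Rightarrow> entry) (\<psi> :: (entry \<Rightarrow> complex) \<Rightarrow> ennreal) ce r. finite S \<Longrightarrow> inj_on e S \<Longrightarrow>
      e ` S \<subseteq> block_entries K M n \<Longrightarrow>
      \<psi> \<in> borel_measurable (block_space n) \<Longrightarrow>
      (\<And>i. i \<in> S \<Longrightarrow> ce i \<in> borel_measurable (block_space n)) \<Longrightarrow>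
      (\<And>i. i \<in> S \<Longrightarrow> r i \<in> borel_measurable (block_space n)) \<Longrightarrow> (\<And>i g. 0 \<le> r i g) \<Longrightarrow>
      free_of (e ` S) \<psi> \<Longrightarrow> (\<And>i. i \<in> S \<Longrightarrow> free_of (e ` S) (ce i)) \<Longrightarrow> (\<And>i. i \<in> S \<Longrightarrow> free_of (e ` S) (r i)) \<Longrightarrow>
      (\<integral>\<^sup>+g. \<psi> g * (\<Prod>i\<in>S. indicator {z. cmod (z - ce i g) \<le> r i g} (g (e i))) \<partial>block_law n)
        \<le> (\<integral>\<^sup>+g. \<psi> g * (\<Prod>i\<in>S. ennreal (c * (r i g)\<^sup>2)) \<partial>block_law n)"
  \<comment> \<open>Solves \<open>K * (c * (2 * g0)\<^sup>2) = p\<close>: the factor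
    \<open>K\<close> for the selection of a coordinate in each slot, the rest for the area of a
    disc.\<close>
  define g0 where "g0 = sqrt (p / (4 * c * real K))"
  have K0: "0 < real K" using users by simp
  have g0: "0 < g0" "real K * (c * (2 * g0)\<^sup>2) = p"
    using p c K0 by (simp_all add: g0_def power_mult_distrib)
  show thesis
  proof (rule that[OF g0(1)])
    fix P n k m and V :: "nat \<Rightarrow> nat \<Rightarrow> (entry \<Rightarrow> complex) \<Rightarrow> complex" and S
    assume k: "k \<in> {1..K}" and m: "m \<in> {1..M}" and S: "S \<subseteq> {1..n}"
      and Vm: "\<And>t j. t \<in> S \<Longrightarrow> j \<in> {1..K} \<Longrightarrow> V t j \<in> borel_measurable (block_space n)"
      and Vf: "\<And>t j. t \<in> S \<Longrightarrow> j \<in> {1..K} \<Longrightarrow> free_of {Estimate k m t j | t j. True} (V t j)"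
      and Vn: "\<And>t g. t \<in> S \<Longrightarrow> \<exists>j\<in>{1..K}. 1 / 2 \<le> cmod (V t j g)"
    interpret B: prob_space "block_law n" by (rule prob_space_block_law)
    have fS: "finite S" by (rule finite_subset[OF S finite_atLeastAtMost])
    define s where "s = complex_of_real (sqrt (P powr - \<alpha> k m))"
    define rest where "rest J t g = (\<Sum>j\<in>{1..K} - {J t}. coeff P k m t j g * V t j g) + s * g (Error k m t (J t)) * V t (J t) g"
      for J :: "nat \<Rightarrow> nat" and t g
    define ce where "ce J t g = - rest J t g / V t (J t) g" for J t g
    define E where "E J = {g \<in> space (block_space n). \<forall>t\<in>S. cmod (g (Estimate k m t (J t)) - ce J t g) \<le> 2 * g0}" for J
    have sum_eq: "(\<Sum>j=1..K. coeff P k m t j g * V t j g) = g (Estimate k m t (J t)) * V t (J t) g + rest J t g"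
      if "J t \<in> {1..K}" for J t g
    proof -
      have "(\<Sum>j=1..K. coeff P k m t j g * V t j g) = coeff P k m t (J t) g * V t (J t) g
          + (\<Sum>j\<in>{1..K} - {J t}. coeff P k m t j g * V t j g)"
        by (rule sum.remove[OF finite_atLeastAtMost that])
      then show ?thesis by (simp add: rest_def channel_coeff_def[of _ _ _ _ _ _ "J t"] s_def algebra_simps)
    qed
    have ent: "Estimate k m t j \<in> block_entries K M n" "Error k m t j \<in> block_entries K M n"
      if "t \<in> S" "j \<in> {1..K}" for t j
      using that S k m by (auto simp: block_entries_def estimate_entries_def error_entries_def)
    have cem: "ce J t \<in> borel_measurable (block_space n)" if J: "J \<in> S \<rightarrow>\<^sub>E {1..K}" and t: "t \<in> S" for J t
    proof -
      have Jt: "J t \<in> {1..K}" using PiE_mem[OF J t] .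
      have sl: "(m, t) \<in> slots n" using t S m by (auto simp: slots_def)
      have 1: "coeff P k m t j \<in> borel_measurable (block_space n)" if "j \<in> {1..K}" for j
        using coeff_measurable[OF k sl that, of P] by simp
      have "(\<lambda>g. \<Sum>j\<in>{1..K} - {J t}. coeff P k m t j g * V t j g) \<in> borel_measurable (block_space n)"
        by (rule borel_measurable_sum, rule borel_measurable_times) (rule 1 Vm[OF t], erule DiffD1)+
      note [measurable] = this Vm[OF t Jt] entry_measurable[OF ent(2)[OF t Jt]]
      show ?thesis unfolding ce_def rest_def by measurable
    qed
    have bound: "B.prob (E J) \<le> (c * (2 * g0)\<^sup>2) ^ card S" "E J \<in> B.events" if J: "J \<in> S \<rightarrow>\<^sub>E {1..K}" for J
    proof -
      let ?e = "\<lambda>t. Estimate k m t (J t)"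
      have inj: "inj_on ?e S" by (rule inj_onI) simp
      have eb: "?e ` S \<subseteq> block_entries K M n" using ent(1) PiE_mem[OF J] by blast
      have fr: "free_of (?e ` S) (ce J t)" if t: "t \<in> S" for t
        unfolding free_of_def
      proof (intro allI ballI)
        fix g e z assume "e \<in> ?e ` S"
        then obtain t' where t': "e = Estimate k m t' (J t')" "t' \<in> S" by blast
        have V: "V t j (g(e := z)) = V t j g" if "j \<in> {1..K}" for j
          by (rule free_ofD[OF Vf[OF t that]]) (use t' in blast)
        have co: "coeff P k m t j (g(e := z)) = coeff P k m t j g" if "j \<noteq> J t" for j
          using that t' by (auto simp: channel_coeff_def)
        have Jt: "J t \<in> {1..K}" using PiE_mem[OF J t] .
        have "(\<Sum>j\<in>{1..K} - {J t}. coeff P k m t j (g(e := z)) * V t j (g(e := z)))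
            = (\<Sum>j\<in>{1..K} - {J t}. coeff P k m t j g * V t j g)"
          using V co by (intro sum.cong refl) simp
        moreover have "(g(e := z)) (Error k m t (J t)) = g (Error k m t (J t))" using t' by simp
        ultimately show "ce J t (g(e := z)) = ce J t g" unfolding ce_def rest_def V[OF Jt] by (simp only:)
      qed
      have pr: "Measurable.pred (block_space n) (\<lambda>g. \<forall>t\<in>S. cmod (g (?e t) - ce J t g) \<le> 2 * g0)"
      proof (rule pred_intros_finite(3)[OF fS])
        fix t assume t: "t \<in> S"
        note [measurable] = cem[OF J t] entry_measurable[OF ent(1)[OF t PiE_mem[OF J t]]]
        show "Measurable.pred (block_space n) (\<lambda>g. cmod (g (?e t) - ce J t g) \<le> 2 * g0)" by measurable
      qed
      then show ev: "E J \<in> B.events" unfolding E_def pred_def by simp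
      have "emeasure (block_law n) (E J) = (\<integral>\<^sup>+g. indicator (E J) g \<partial>block_law n)"
        by (rule nn_integral_indicator[OF ev, symmetric])
      also have "\<dots> = (\<integral>\<^sup>+g. 1 * (\<Prod>t\<in>S. indicator {z. cmod (z - ce J t g) \<le> 2 * g0} (g (?e t))) \<partial>block_law n)"
      proof (rule nn_integral_cong)
        fix g assume g: "g \<in> space (block_law n)"
        show "indicator (E J) g = (1 :: ennreal) * (\<Prod>t\<in>S. indicator {z. cmod (z - ce J t g) \<le> 2 * g0} (g (?e t)))"
        proof (cases "g \<in> E J")
          case True
          then show ?thesis unfolding E_def by simp
        next
          case False
          then obtain t where t: "t \<in> S" "\<not> cmod (g (?e t) - ce J t g) \<le> 2 * g0" using g unfolding E_def by auto
          then have "(indicator {z. cmod (z - ce J t g) \<le> 2 * g0} (g (?e t)) :: ennreal) = 0" by simp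
          then have "(\<Prod>t\<in>S. indicator {z. cmod (z - ce J t g) \<le> 2 * g0} (g (?e t))) = (0 :: ennreal)"
            using fS t(1) by (intro prod_zero) auto
          then show ?thesis using False by simp
        qed
      qed
      also have "\<dots> \<le> (\<integral>\<^sup>+g. 1 * (\<Prod>t\<in>S. ennreal (c * (2 * g0)\<^sup>2)) \<partial>block_law n)"
        by (rule sb[OF fS inj eb _ cem[OF J]]) (use g0 fr in \<open>simp_all add: free_of_def\<close>)
      also have "\<dots> = ennreal (c * (2 * g0)\<^sup>2) ^ card S" using B.emeasure_space_1 by simp
      also have "\<dots> = ennreal ((c * (2 * g0)\<^sup>2) ^ card S)" using c by (simp add: ennreal_power)
      finally show "B.prob (E J) \<le> (c * (2 * g0)\<^sup>2) ^ card S"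
        unfolding B.emeasure_eq_measure using c by simp
    qed
    have "{g \<in> space (block_space n). \<forall>t\<in>S. cmod (\<Sum>j=1..K. coeff P k m t j g * V t j g) < g0} \<subseteq> (\<Union>J\<in>S \<rightarrow>\<^sub>E {1..K}. E J)"
    proof
      fix g assume g: "g \<in> {g \<in> space (block_space n). \<forall>t\<in>S. cmod (\<Sum>j=1..K. coeff P k m t j g * V t j g) < g0}"
      have "\<forall>t\<in>S. \<exists>j. j \<in> {1..K} \<and> 1 / 2 \<le> cmod (V t j g)" using Vn by blast
      then obtain J0 where J0: "\<And>t. t \<in> S \<Longrightarrow> J0 t \<in> {1..K} \<and> 1 / 2 \<le> cmod (V t (J0 t) g)" by metis
      define J where "J = restrict J0 S"
      have J: "J \<in> S \<rightarrow>\<^sub>E {1..K}" unfolding J_def using J0 by (intro PiE_I) simp_all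
      have "cmod (g (Estimate k m t (J t)) - ce J t g) \<le> 2 * g0" if t: "t \<in> S" for t
      proof -
        have Jt: "J t \<in> {1..K}" "1 / 2 \<le> cmod (V t (J t) g)" using J0[OF t] t by (simp_all add: J_def)
        then have nz: "V t (J t) g \<noteq> 0" by auto
        have "g (Estimate k m t (J t)) - ce J t g = (\<Sum>j=1..K. coeff P k m t j g * V t j g) / V t (J t) g"
          unfolding sum_eq[of J t, OF Jt(1)] ce_def using nz by (simp add: field_simps)
        then have eq: "cmod (g (Estimate k m t (J t)) - ce J t g) = cmod (\<Sum>j=1..K. coeff P k m t j g * V t j g) / cmod (V t (J t) g)"
          by (simp add: norm_divide)
        also have "\<dots> \<le> g0 / (1 / 2)" using g t Jt(2) g0(1) by (intro frac_le) (simp_all add: less_imp_le)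
        finally show ?thesis by simp
      qed
      then have "g \<in> E J" using g unfolding E_def by simp
      with J show "g \<in> (\<Union>J\<in>S \<rightarrow>\<^sub>E {1..K}. E J)" by blast
    qed
    moreover have fin: "finite (S \<rightarrow>\<^sub>E {1..K})" using fS by (intro finite_PiE) simp_all
    ultimately have "B.prob {g \<in> space (block_space n). \<forall>t\<in>S. cmod (\<Sum>j=1..K. coeff P k m t j g * V t j g) < g0}
        \<le> B.prob (\<Union>J\<in>S \<rightarrow>\<^sub>E {1..K}. E J)"
      using bound(2) by (intro B.finite_measure_mono sets.finite_UN)
    also have "\<dots> \<le> (\<Sum>J\<in>S \<rightarrow>\<^sub>E {1..K}. B.prob (E J))"
      using bound(2) fin by (intro B.finite_measure_subadditive_finite) auto
    also have "\<dots> \<le> (\<Sum>J\<in>S \<rightarrow>\<^sub>E {1..K}. (c * (2 * g0)\<^sup>2) ^ card S)" by (rule sum_mono) (rule bound(1))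
    also have "\<dots> = real K ^ card S * (c * (2 * g0)\<^sup>2) ^ card S" using fS by (simp add: card_PiE)
    also have "\<dots> = p ^ card S" unfolding power_mult_distrib[symmetric] g0(2) ..
    finally show "B.prob {g \<in> space (block_space n). \<forall>t\<in>S. cmod (\<Sum>j=1..K. coeff P k m t j g * V t j g) < g0} \<le> p ^ card S" .
  qed
qed

text \<open>Estimate and error do not vary with the power, so the coefficients at the powers
  \<open>P0\<close> and \<open>2 * P0\<close> are two linear combinations of them. For positive
  quality these are independent, and both entries are bounded. At quality 0 they coincide, and only
  the sum of estimate and error is controlled.\<close>

lemma estimate_bounds:
  obtains B :: real where "1 \<le> B" "\<And>n. AE g in block_law n. \<forall>k\<in>{1..K}. \<forall>m\<in>{1..M}. \<forall>t\<in>{1..n}. \<forall>j\<in>{1..K}.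
    0 < \<alpha> k m \<longrightarrow> cmod (g (Estimate k m t j)) \<le> B \<and> cmod (g (Error k m t j)) \<le> B"
proof (rule coeff_bounds)
  fix c C P0 :: real
  assume C: "1 \<le> C" and P0: "1 \<le> P0"
    and b: "\<And>P n. P0 \<le> P \<Longrightarrow> AE g in block_law n. \<forall>k\<in>{1..K}. \<forall>i\<in>slots n. \<forall>j\<in>{1..K}.
        c \<le> cmod (coeff P k (fst i) (snd i) j g) \<and> cmod (coeff P k (fst i) (snd i) j g) \<le> C"
  let ?s = "\<lambda>P k m. sqrt (P powr - \<alpha> k m)"
  let ?d = "\<lambda>k m. ?s P0 k m - ?s (2 * P0) k m"
  \<comment> \<open>A sum in place of a maximum serves as one bound for all users and subchannels;
    pairs without positive quality are set to 0, as the difference of scales in the denominator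
    vanishes at quality 0.\<close>
  define D where "D = (\<Sum>(k, m)\<in>{1..K} \<times> {1..M}. if 0 < \<alpha> k m then 2 * C / ?d k m else 0)"
  have d0: "0 < ?d k m" if "0 < \<alpha> k m" for k m
  proof -
    have "(2 * P0) powr - \<alpha> k m < P0 powr - \<alpha> k m" using P0 that by (intro powr_less_mono2_neg) simp_all
    then show ?thesis by simp
  qed
  have nn: "0 \<le> (if 0 < \<alpha> k m then 2 * C / ?d k m else 0)" for k m
    using divide_nonneg_pos[OF _ d0, of "2 * C"] C by simp
  have Dge: "2 * C / ?d k m \<le> D" if "k \<in> {1..K}" "m \<in> {1..M}" "0 < \<alpha> k m" for k m
  proof -
    have "(case (k, m) of (k, m) \<Rightarrow> if 0 < \<alpha> k m then 2 * C / ?d k m else 0) \<le> D"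
      unfolding D_def by (rule member_le_sum) (use that nn in auto)
    then show ?thesis using that by simp
  qed
  have D0: "0 \<le> D" unfolding D_def using nn by (intro sum_nonneg) auto
  show thesis
  proof (rule that[of "C + D"])
    show "1 \<le> C + D" using C D0 by simp
    fix n
    have "P0 \<le> 2 * P0" using P0 by simp
    from b[OF order_refl, of n] b[OF this, of n]
    show "AE g in block_law n. \<forall>k\<in>{1..K}. \<forall>m\<in>{1..M}. \<forall>t\<in>{1..n}. \<forall>j\<in>{1..K}.
      0 < \<alpha> k m \<longrightarrow> cmod (g (Estimate k m t j)) \<le> C + D \<and> cmod (g (Error k m t j)) \<le> C + D"
    proof eventually_elim
      case (elim g)
      show ?case
      proof (intro ballI impI)
        fix k m t j assume k: "k \<in> {1..K}" and m: "m \<in> {1..M}" and t: "t \<in> {1..n}" and j: "j \<in> {1..K}" and pos: "0 < \<alpha> k m"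
        have sl: "(m, t) \<in> slots n" using m t by (simp add: slots_def)
        have b1: "cmod (coeff P0 k m t j g) \<le> C" using elim(1) k sl j by fastforce
        have b2: "cmod (coeff (2 * P0) k m t j g) \<le> C" using elim(2) k sl j by fastforce
        let ?E = "g (Error k m t j)"
        have "coeff P0 k m t j g - coeff (2 * P0) k m t j g = of_real (?d k m) * ?E"
          by (simp add: channel_coeff_def algebra_simps)
        then have "?d k m * cmod ?E = cmod (coeff P0 k m t j g - coeff (2 * P0) k m t j g)"
          using d0[OF pos] by (simp only: norm_mult norm_of_real abs_of_pos)
        also have "\<dots> \<le> 2 * C" using norm_triangle_ineq4[of "coeff P0 k m t j g" "coeff (2 * P0) k m t j g"] b1 b2 by linarith
        finally have "cmod ?E \<le> 2 * C / ?d k m" using d0[OF pos] by (subst pos_le_divide_eq) (simp_all only: mult.commute)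
        with Dge[OF k m pos] have e: "cmod ?E \<le> D" by linarith
        have "P0 powr - \<alpha> k m \<le> 1" using P0 pos powr_mono[of "- \<alpha> k m" 0 P0] by simp
        then have s1: "?s P0 k m \<le> 1" by simp
        have "g (Estimate k m t j) = coeff P0 k m t j g - of_real (?s P0 k m) * ?E"
          by (simp add: channel_coeff_def)
        then have "cmod (g (Estimate k m t j)) \<le> cmod (coeff P0 k m t j g) + cmod (of_real (?s P0 k m) * ?E)"
          by (simp only: norm_triangle_ineq4)
        also have "cmod (of_real (?s P0 k m) * ?E) = ?s P0 k m * cmod ?E" by (simp add: norm_mult)
        also have "\<dots> \<le> 1 * D" using s1 e by (intro mult_mono) simp_all
        finally show "cmod (g (Estimate k m t j)) \<le> C + D \<and> cmod ?E \<le> C + D" using b1 e C by simp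
      qed
    qed
  qed
qed

end

text \<open>
  \<open>X\<close> and \<open>Y m\<close> are the amplitudes of the common and the private symbols, \<open>I k m\<close> bounds the
  residual gain of foreign private symbols at user \<open>k\<close>, and \<open>E k m\<close> is the tolerance of its decoder.
  A code letter is a pair of private and common symbols, indexed by subchannels; the second
  component is a dummy for the users other than \<open>l\<close>.
\<close>
locale zero_forcing_code = parallel_miso_bc \<Omega> K M \<alpha> H Z
  for \<Omega> :: "'a measure" and K M \<alpha> H Z +
  fixes l n :: nat and P \<delta> \<tau> p g0 c C X :: real and Y :: "nat \<Rightarrow> real" and I E :: "nat \<Rightarrow> nat \<Rightarrow> real"
    and Qc :: "nat \<Rightarrow> nat" and Qp :: "nat \<Rightarrow> nat \<Rightarrow> nat"
    and sel :: "nat \<Rightarrow> nat \<Rightarrow> (nat \<Rightarrow> nat \<Rightarrow> complex) \<Rightarrow> nat \<Rightarrow> complex"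
    and N :: "nat \<Rightarrow> nat" and cw :: "nat \<Rightarrow> nat \<Rightarrow> nat \<Rightarrow> (nat \<Rightarrow> complex) \<times> (nat \<Rightarrow> complex)"
  assumes leader: "l \<in> {1..K}" and n: "1 \<le> n" and \<delta>: "0 < \<delta>" and P: "0 \<le> P" and p: "0 < p" "p \<le> 1"
    and p_small: "2 * p powr (\<delta> / (2 * real M)) \<le> 1 / 2"
    and Q: "\<And>m. 1 \<le> Qc m" "\<And>k m. 1 \<le> Qp k m"
    and sel_norm: "\<And>k m a j. k \<in> {1..K} \<Longrightarrow> m \<in> {1..M} \<Longrightarrow> cmod (sel k m a j) \<le> 2"
    and sel_big: "\<And>k m a. k \<in> {1..K} \<Longrightarrow> m \<in> {1..M} \<Longrightarrow> \<exists>j\<in>{1..K}. 1 / 2 \<le> cmod (sel k m a j)"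
    and sel_cong: "\<And>k m a a'. k \<in> {1..K} \<Longrightarrow> m \<in> {1..M} \<Longrightarrow>
      (\<And>i j. i \<in> {1..K} - {k} \<Longrightarrow> j \<in> {1..K} \<Longrightarrow> a i j = a' i j) \<Longrightarrow> sel k m a = sel k m a'"
    and sel_measurable: "\<And>k m (S :: (entry \<Rightarrow> complex) measure) A j. k \<in> {1..K} \<Longrightarrow> m \<in> {1..M} \<Longrightarrow>
      (\<And>i j. i \<in> {1..K} - {k} \<Longrightarrow> j \<in> {1..K} \<Longrightarrow> (\<lambda>g. A g i j) \<in> borel_measurable S) \<Longrightarrow>
      (\<lambda>g. sel k m (A g) j) \<in> borel_measurable S"
    and noise_rare: "\<And>k m S. k \<in> {1..K} \<Longrightarrow> m \<in> {1..M} \<Longrightarrow> S \<subseteq> {1..n} \<Longrightarrow>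
      prob {\<omega> \<in> space \<Omega>. \<forall>t\<in>S. \<tau> < cmod (Z k m t \<omega>)} \<le> p ^ card S"
    and gain_rare: "\<And>k m (V :: nat \<Rightarrow> nat \<Rightarrow> (entry \<Rightarrow> complex) \<Rightarrow> complex) S. k \<in> {1..K} \<Longrightarrow> m \<in> {1..M} \<Longrightarrow> S \<subseteq> {1..n} \<Longrightarrow>
      (\<And>t j. t \<in> S \<Longrightarrow> j \<in> {1..K} \<Longrightarrow> V t j \<in> borel_measurable (block_space n)) \<Longrightarrow>
      (\<And>t j. t \<in> S \<Longrightarrow> j \<in> {1..K} \<Longrightarrow> free_of {Estimate k m t j | t j. True} (V t j)) \<Longrightarrow>
      (\<And>t g. t \<in> S \<Longrightarrow> \<exists>j\<in>{1..K}. 1 / 2 \<le> cmod (V t j g)) \<Longrightarrow>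
      measure (block_law n) {g \<in> space (block_space n). \<forall>t\<in>S. cmod (\<Sum>j=1..K. coeff P k m t j g * V t j g) < g0}
        \<le> p ^ card S"
    and coeff_ae: "AE g in block_law n. \<forall>k\<in>{1..K}. \<forall>i\<in>slots n. \<forall>j\<in>{1..K}.
        c \<le> cmod (coeff P k (fst i) (snd i) j g) \<and> cmod (coeff P k (fst i) (snd i) j g) \<le> C"
    and interference_ae: "AE g in block_law n. \<forall>k\<in>{1..K}. \<forall>i\<in>{1..K}. i \<noteq> k \<longrightarrow> (\<forall>m\<in>{1..M}. \<forall>t\<in>{1..n}.
        cmod (\<Sum>j=1..K. coeff P k m t j g * sel i m (\<lambda>i j. g (Estimate i m t j)) j) \<le> I k m)"
    and XY: "0 \<le> X" "\<And>m. 0 \<le> Y m" "\<And>m. m \<in> {1..M} \<Longrightarrow> Y m \<le> X" and power: "real K * (6 * real K * X)\<^sup>2 \<le> P"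
    and residual: "\<And>k m. k \<in> {1..K} \<Longrightarrow> m \<in> {1..M} \<Longrightarrow> 2 * real K * (Y m * I k m) + \<tau> \<le> E k m"
    and I: "\<And>k m. 0 \<le> I k m"
    and common_gap: "\<And>k m. k \<in> {1..K} \<Longrightarrow> m \<in> {1..M} \<Longrightarrow>
      Qc m = 1 \<or> 2 * E k m + 4 * Y m * (2 * real K * C) < X * c / real (Qc m)"
    and private_gap: "\<And>k m. k \<in> {1..K} \<Longrightarrow> m \<in> {1..M} \<Longrightarrow>
      Qp k m = 1 \<or> 2 * E k m < Y m * g0 / real (Qp k m)"
    and cw: "\<And>k w. k \<in> {1..K} \<Longrightarrow> w < N k \<Longrightarrow> cw k w \<in> {1..n} \<rightarrow>\<^sub>E
      (\<Pi>\<^sub>E m\<in>{1..M}. grid (Qp k m)) \<times> (if k = l then \<Pi>\<^sub>E m\<in>{1..M}. grid (Qc m) else {\<lambda>_. 0})"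
    and cw_far: "\<And>k w w'. k \<in> {1..K} \<Longrightarrow> w < N k \<Longrightarrow> w' < N k \<Longrightarrow> w \<noteq> w' \<Longrightarrow>
      2 * \<delta> * real n < real (hamming {1..n} (cw k w) (cw k w'))"
begin

section \<open>The zero-forcing scheme: encoder and decoder\<close>

definition zf :: "nat \<Rightarrow> nat \<Rightarrow> nat \<Rightarrow> (entry \<Rightarrow> complex) \<Rightarrow> nat \<Rightarrow> complex" where
  "zf k m t g j = sel k m (\<lambda>i j. g (Estimate i m t j)) j"

text \<open>Gain at user \<open>k\<close> of the private stream meant for user \<open>i\<close>: the
  useful one for \<open>i = k\<close>, residual interference otherwise.\<close>

definition gain :: "nat \<Rightarrow> nat \<Rightarrow> nat \<Rightarrow> nat \<Rightarrow> (entry \<Rightarrow> complex) \<Rightarrow> complex" where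
  "gain k i m t g = (\<Sum>j=1..K. coeff P k m t j g * zf i m t g j)"

text \<open>The common symbol leaves from antenna 1 alone; this reaches every user because all
  coefficients are bounded away from 0.\<close>

definition enc :: "(nat \<Rightarrow> nat) \<Rightarrow> (entry \<Rightarrow> complex) \<Rightarrow> nat \<Rightarrow> nat \<Rightarrow> nat \<Rightarrow> complex" where
  "enc w g m t j = (if j = 1 then of_real X * snd (cw l (w l) t) m else 0)
    + (\<Sum>k=1..K. zf k m t g j * (of_real (Y m) * fst (cw k (w k) t) m))"

text \<open>Users other than \<open>l\<close> resolve the common symbol slot by slot, without using its code.\<close>
definition consistent :: "nat \<Rightarrow> (nat \<Rightarrow> complex) \<times> (nat \<Rightarrow> complex) \<Rightarrow> nat \<Rightarrow> (nat \<times> nat \<Rightarrow> complex) \<Rightarrow> (entry \<Rightarrow> complex) \<Rightarrow> bool" where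
  "consistent k s t y g \<longleftrightarrow> (\<forall>m\<in>{1..M}. \<exists>u\<in>grid (Qc m). (k = l \<longrightarrow> u = snd s m) \<and>
    cmod (y (m, t) - (of_real X * coeff P k m t 1 g * u + of_real (Y m) * gain k k m t g * fst s m)) \<le> E k m)"

text \<open>Bounded-distance decoding: codewords are more than \<open>2 * \<delta> * n\<close>
  apart, so \<open>\<delta> * n\<close> inconsistent slots are tolerated. \<open>LEAST\<close> turns
  the search into a measurable function of the output.\<close>

definition dec :: "nat \<Rightarrow> (nat \<times> nat \<Rightarrow> complex) \<Rightarrow> (entry \<Rightarrow> complex) \<Rightarrow> nat" where
  "dec k y g = (LEAST w. w < N k \<and> real (card {t \<in> {1..n}. \<not> consistent k (cw k w t) t y g}) \<le> \<delta> * real n)"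

lemma cw_at:
  assumes "k \<in> {1..K}" "w < N k" "t \<in> {1..n}"
  shows "fst (cw k w t) \<in> (\<Pi>\<^sub>E m\<in>{1..M}. grid (Qp k m))"
    and "snd (cw k w t) \<in> (if k = l then \<Pi>\<^sub>E m\<in>{1..M}. grid (Qc m) else {\<lambda>_. 0})"
  using PiE_mem[OF cw[OF assms(1,2)] assms(3)] by (simp_all add: mem_Times_iff)

lemma private_grid: "k \<in> {1..K} \<Longrightarrow> w < N k \<Longrightarrow> t \<in> {1..n} \<Longrightarrow> m \<in> {1..M} \<Longrightarrow> fst (cw k w t) m \<in> grid (Qp k m)"
  by (rule PiE_mem[OF cw_at(1)])

lemma common_grid: "w < N l \<Longrightarrow> t \<in> {1..n} \<Longrightarrow> m \<in> {1..M} \<Longrightarrow> snd (cw l w t) m \<in> grid (Qc m)"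
  using PiE_mem[of "snd (cw l w t)" "{1..M}" "\<lambda>m. grid (Qc m)" m] cw_at(2)[OF leader, of w t] by simp

lemma zf_measurable:
  assumes "k \<in> {1..K}" "m \<in> {1..M}" "t \<in> {1..n}"
    and "\<And>e. e \<in> estimate_entries K M n \<Longrightarrow> (\<lambda>g. g e) \<in> borel_measurable S"
  shows "(\<lambda>g. zf k m t g j) \<in> borel_measurable S"
  unfolding zf_def
  by (rule sel_measurable[OF assms(1,2)], rule assms(4)) (use assms in \<open>auto simp: estimate_entries_def\<close>)

lemma zf_block_measurable:
  "k \<in> {1..K} \<Longrightarrow> m \<in> {1..M} \<Longrightarrow> t \<in> {1..n} \<Longrightarrow> (\<lambda>g. zf k m t g j) \<in> borel_measurable (block_space n)"
  by (rule zf_measurable) (auto simp: block_entries_def intro: entry_measurable)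

lemma gain_measurable:
  assumes "k \<in> {1..K}" "i \<in> {1..K}" "m \<in> {1..M}" "t \<in> {1..n}"
  shows "gain k i m t \<in> borel_measurable (block_space n)"
proof -
  have "(m, t) \<in> slots n" using assms by (simp add: slots_def)
  from coeff_measurable[OF assms(1) this] have "coeff P k m t j \<in> borel_measurable (block_space n)" if "j \<in> {1..K}" for j
    using that by simp
  then show ?thesis unfolding gain_def[abs_def]
    by (intro borel_measurable_sum borel_measurable_times zf_block_measurable assms)
qed

text \<open>The vector for user \<open>k\<close> is computed from the estimates of the other users
  alone; the own estimates remain random relative to it, which is what the tail bound for the gain
  exploits.\<close>

lemma zf_free:
  assumes "k \<in> {1..K}" "m \<in> {1..M}"
  shows "free_of {Estimate k m t j | t j. True} (\<lambda>g. zf k m t g j)"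
  unfolding free_of_def zf_def
  by (intro allI ballI fun_cong[OF sel_cong[OF assms]]) auto

text \<open>The power constraint is imposed for every realization, so it rests on the unconditional
  bound for the vectors. Per antenna and slot the amplitude is at most \<open>2 * X\<close> from the
  common symbol and \<open>4 * K * X\<close> from the private ones.\<close>

lemma enc_valid: "valid_code P n N enc dec"
  unfolding valid_code_def
proof (intro conjI ballI)
  fix w m t j assume w: "w \<in> messages N" and m: "m \<in> {1..M}" and t: "t \<in> {1..n}" and j: "j \<in> {1..K}"
  let ?S = "\<Pi>\<^sub>M e\<in>estimate_entries K M n. (borel :: complex measure)"
  have "(\<lambda>g. zf k m t g j) \<in> borel_measurable ?S" if "k \<in> {1..K}" for k
    by (rule zf_measurable[OF that m t]) (rule measurable_component_singleton)
  then show "(\<lambda>g. enc w g m t j) \<in> borel_measurable ?S"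
    unfolding enc_def by (intro borel_measurable_add borel_measurable_sum borel_measurable_times) simp_all
next
  fix w and g :: "entry \<Rightarrow> complex" assume w: "w \<in> messages N"
  have wN: "w k < N k" if "k \<in> {1..K}" for k
    using PiE_mem[of w "{1..K}" "\<lambda>k. {..<N k}"] w that unfolding messages_def by simp
  have K1: "1 \<le> real K" using users by simp
  have b: "(cmod (enc w g m t j))\<^sup>2 \<le> (6 * real K * X)\<^sup>2" if m: "m \<in> {1..M}" and t: "t \<in> {1..n}" for m t j
  proof -
    have "cmod (if j = 1 then of_real X * snd (cw l (w l) t) m else 0) \<le> X * 2"
      using grid_norm_le[OF common_grid[OF wN[OF leader] t m]] XY(1) by (simp add: norm_mult mult_left_mono)
    moreover have "cmod (\<Sum>k=1..K. zf k m t g j * (of_real (Y m) * fst (cw k (w k) t) m)) \<le> (\<Sum>k=1..K. 2 * (X * 2))"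
    proof (rule order_trans[OF norm_sum sum_mono])
      fix k assume k: "k \<in> {1..K}"
      have "cmod (of_real (Y m) * fst (cw k (w k) t) m) \<le> X * 2"
        unfolding norm_mult using grid_norm_le[OF private_grid[OF k wN[OF k] t m]] XY(2)[of m] XY(3)[OF m] XY(1)
        by (intro mult_mono) simp_all
      moreover have "cmod (zf k m t g j) \<le> 2" unfolding zf_def by (rule sel_norm[OF k m])
      ultimately show "cmod (zf k m t g j * (of_real (Y m) * fst (cw k (w k) t) m)) \<le> 2 * (X * 2)"
        unfolding norm_mult[of "zf k m t g j"] using XY(1) by (intro mult_mono) simp_all
    qed
    ultimately have "cmod (enc w g m t j) \<le> X * 2 + (\<Sum>k=1..K. 2 * (X * 2))"
      unfolding enc_def by (rule norm_triangle_mono)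
    also have "\<dots> = 2 * X + 4 * (real K * X)" by simp
    also have "\<dots> \<le> 6 * real K * X" using mult_right_mono[OF K1 XY(1)] by (simp only: mult.assoc)
    finally show ?thesis by (rule power_mono) simp
  qed
  have "(\<Sum>t=1..n. \<Sum>m=1..M. \<Sum>j=1..K. (cmod (enc w g m t j))\<^sup>2) \<le> (\<Sum>t=1..n. \<Sum>m=1..M. \<Sum>j=1..K. (6 * real K * X)\<^sup>2)"
    by (intro sum_mono b)
  also have "\<dots> = real n * real M * (real K * (6 * real K * X)\<^sup>2)" by simp
  also have "\<dots> \<le> real n * real M * P" using power by (rule mult_left_mono) simp
  finally have "(\<Sum>t=1..n. \<Sum>m=1..M. \<Sum>j=1..K. (cmod (enc w g m t j))\<^sup>2) \<le> real n * real M * P" .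
  then show "1 / (real n * real M) * (\<Sum>t=1..n. \<Sum>m=1..M. \<Sum>j=1..K. (cmod (enc w g m t j))\<^sup>2) \<le> P"
    using n subchannels by (simp add: divide_le_eq mult.commute)
next
  fix k assume k: "k \<in> {1..K}"
  let ?N = "PiM (slots n) (\<lambda>_. borel :: complex measure) \<Otimes>\<^sub>M block_space n"
  have cons: "Measurable.pred ?N (\<lambda>x. consistent k s t (fst x) (snd x))" if t: "t \<in> {1..n}" for s t
    unfolding consistent_def
  proof (intro pred_intros_finite(3) pred_intros_finite(4) finite_grid finite_atLeastAtMost)
    fix m u assume m: "m \<in> {1..M}"
    have sl: "(m, t) \<in> slots n" using m t by (simp add: slots_def)
    have y: "(\<lambda>x. fst x (m, t)) \<in> borel_measurable ?N"
      by (rule measurable_compose[OF measurable_fst measurable_component_singleton[OF sl]])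
    have k1: "(1::nat) \<in> {1..K}" using users by simp
    have h: "(\<lambda>x. coeff P k m t 1 (snd x)) \<in> borel_measurable ?N"
      using measurable_compose[OF measurable_snd coeff_measurable[OF k sl k1, of P]] by simp
    have g: "(\<lambda>x. gain k k m t (snd x)) \<in> borel_measurable ?N"
      by (rule measurable_compose[OF measurable_snd gain_measurable[OF k k m t]])
    have "(\<lambda>x. fst x (m, t) - (of_real X * coeff P k m t 1 (snd x) * u + of_real (Y m) * gain k k m t (snd x) * fst s m)) \<in> borel_measurable ?N"
      by (intro borel_measurable_diff borel_measurable_add borel_measurable_times y h g borel_measurable_const)
    then have "(\<lambda>x. cmod (fst x (m, t) - (of_real X * coeff P k m t 1 (snd x) * u + of_real (Y m) * gain k k m t (snd x) * fst s m))) \<in> borel_measurable ?N"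
      by simp
    then have "Measurable.pred ?N (\<lambda>x. cmod (fst x (m, t) - (of_real X * coeff P k m t 1 (snd x) * u + of_real (Y m) * gain k k m t (snd x) * fst s m)) \<le> E k m)"
      by (rule pred_le_real) simp
    then show "Measurable.pred ?N (\<lambda>x. (k = l \<longrightarrow> u = snd s m) \<and>
      cmod (fst x (m, t) - (of_real X * coeff P k m t 1 (snd x) * u + of_real (Y m) * gain k k m t (snd x) * fst s m)) \<le> E k m)"
      by (rule pred_intros_logic(3)[rotated]) simp
  qed
  have "Measurable.pred ?N (\<lambda>x. w < N k \<and> real (card {t \<in> {1..n}. \<not> consistent k (cw k w t) t (fst x) (snd x)}) \<le> \<delta> * real n)" for w
  proof -
    have eq: "real (card {t \<in> {1..n}. \<not> consistent k (cw k w t) t (fst x) (snd x)})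
      = (\<Sum>t=1..n. if consistent k (cw k w t) t (fst x) (snd x) then 0 else 1)" for x
      by (simp add: sum.If_cases Int_def)
    have "(\<lambda>x. if consistent k (cw k w t) t (fst x) (snd x) then 0 else 1 :: real) \<in> borel_measurable ?N" if "t \<in> {1..n}" for t
      using cons[OF that] by (intro measurable_If borel_measurable_const) (simp add: pred_def)
    then have "(\<lambda>x. \<Sum>t=1..n. if consistent k (cw k w t) t (fst x) (snd x) then 0 else 1 :: real) \<in> borel_measurable ?N"
      by (rule borel_measurable_sum)
    then have "Measurable.pred ?N (\<lambda>x. real (card {t \<in> {1..n}. \<not> consistent k (cw k w t) t (fst x) (snd x)}) \<le> \<delta> * real n)"
      unfolding eq by (rule pred_le_real) simp
    then show ?thesis by (rule pred_intros_logic(3)[rotated]) simp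
  qed
  then have "(\<lambda>x. dec k (fst x) (snd x)) \<in> ?N \<rightarrow>\<^sub>M count_space UNIV"
    unfolding dec_def by (rule measurable_Least)
  then show "(\<lambda>(y, g). dec k y g) \<in> (\<Pi>\<^sub>M i\<in>{1..M} \<times> {1..n}. borel) \<Otimes>\<^sub>M (\<Pi>\<^sub>M e\<in>block_entries K M n. borel) \<rightarrow>\<^sub>M count_space UNIV"
    by (simp add: split_beta' slots_def block_space_def)
qed

section \<open>Correct decoding when few slots are bad\<close>

definition channel_output :: "(nat \<Rightarrow> nat) \<Rightarrow> nat \<Rightarrow> 'a \<Rightarrow> nat \<times> nat \<Rightarrow> complex" where
  "channel_output w k \<omega> = (\<lambda>(m, t)\<in>{1..M} \<times> {1..n}. received P n enc w k m t \<omega>)"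

lemma channel_output_eq:
  assumes k: "k \<in> {1..K}" and m: "m \<in> {1..M}" and t: "t \<in> {1..n}"
  shows "channel_output w k \<omega> (m, t) = of_real X * coeff P k m t 1 (block n \<omega>) * snd (cw l (w l) t) m
    + (\<Sum>i=1..K. of_real (Y m) * gain k i m t (block n \<omega>) * fst (cw i (w i) t) m) + Z k m t \<omega>"
proof -
  let ?g = "block n \<omega>"
  have ent: "Estimate i m t j \<in> estimate_entries K M n" "Estimate i m t j \<in> block_entries K M n" "Error i m t j \<in> block_entries K M n"
    if "i \<in> {1..K}" "j \<in> {1..K}" for i j
    using that m t by (auto simp: block_entries_def estimate_entries_def error_entries_def)
  have zf: "zf i m t (\<lambda>e\<in>estimate_entries K M n. H e \<omega>) j = zf i m t ?g j" if "i \<in> {1..K}" for i j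
    unfolding zf_def by (rule fun_cong[OF sel_cong[OF that m]]) (simp add: ent block_def)
  have enc: "enc w (\<lambda>e\<in>estimate_entries K M n. H e \<omega>) m t j = enc w ?g m t j" for j
    unfolding enc_def using zf by simp
  have co: "channel_coeff \<alpha> H P k m t j \<omega> = coeff P k m t j ?g" if "j \<in> {1..K}" for j
    using ent[OF k that] by (simp add: channel_coeff_def block_def)
  have k1: "(1::nat) \<in> {1..K}" using users by simp
  have "channel_output w k \<omega> (m, t) = (\<Sum>j=1..K. coeff P k m t j ?g * enc w ?g m t j) + Z k m t \<omega>"
    using m t co enc by (simp add: channel_output_def received_def)
  also have "(\<Sum>j=1..K. coeff P k m t j ?g * enc w ?g m t j)
    = (\<Sum>j=1..K. if j = 1 then coeff P k m t j ?g * (of_real X * snd (cw l (w l) t) m) else 0)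
      + (\<Sum>j=1..K. \<Sum>i=1..K. coeff P k m t j ?g * (zf i m t ?g j * (of_real (Y m) * fst (cw i (w i) t) m)))"
    unfolding sum.distrib[symmetric]
    by (rule sum.cong) (simp_all add: enc_def distrib_left sum_distrib_left)
  also have "(\<Sum>j=1..K. if j = 1 then coeff P k m t j ?g * (of_real X * snd (cw l (w l) t) m) else 0)
    = of_real X * coeff P k m t 1 ?g * snd (cw l (w l) t) m" using k1 by simp
  also have "(\<Sum>j=1..K. \<Sum>i=1..K. coeff P k m t j ?g * (zf i m t ?g j * (of_real (Y m) * fst (cw i (w i) t) m)))
    = (\<Sum>i=1..K. of_real (Y m) * gain k i m t ?g * fst (cw i (w i) t) m)"
    unfolding gain_def by (subst sum.swap) (simp add: sum_distrib_left sum_distrib_right ac_simps)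
  finally show ?thesis .
qed

definition good :: "nat \<Rightarrow> nat \<Rightarrow> 'a \<Rightarrow> bool" where
  "good k t \<omega> \<longleftrightarrow> (\<forall>m\<in>{1..M}. cmod (Z k m t \<omega>) \<le> \<tau> \<and> g0 \<le> cmod (gain k k m t (block n \<omega>)))"

definition regular :: "'a \<Rightarrow> bool" where
  "regular \<omega> \<longleftrightarrow> (\<forall>k\<in>{1..K}. \<forall>i\<in>slots n. \<forall>j\<in>{1..K}.
      c \<le> cmod (coeff P k (fst i) (snd i) j (block n \<omega>)) \<and> cmod (coeff P k (fst i) (snd i) j (block n \<omega>)) \<le> C) \<and>
    (\<forall>k\<in>{1..K}. \<forall>i\<in>{1..K}. i \<noteq> k \<longrightarrow> (\<forall>m\<in>{1..M}. \<forall>t\<in>{1..n}. cmod (gain k i m t (block n \<omega>)) \<le> I k m))"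

lemma regular_ae: "AE \<omega> in \<Omega>. regular \<omega>"
  using AE_distrD[OF block_measurable coeff_ae[unfolded block_law_def]]
    AE_distrD[OF block_measurable interference_ae[unfolded block_law_def]]
  unfolding regular_def gain_def zf_def by eventually_elim (rule conjI)

text \<open>With the true symbols, the residual consists of the noise and fewer than
  \<open>K\<close> foreign streams, each at most \<open>2 * Y m * I k m\<close>, and stays within
  the tolerance. Conversely, two pairs of symbols within the tolerance agree by the separation of
  the layers, so in a good slot only the true letter is consistent.\<close>

lemma good_consistent:
  assumes reg: "regular \<omega>" and good: "good k t \<omega>" and k: "k \<in> {1..K}" and t: "t \<in> {1..n}" and w: "w \<in> messages N"
  shows "consistent k (cw k (w k) t) t (channel_output w k \<omega>) (block n \<omega>)"
    and "w' < N k \<Longrightarrow> consistent k (cw k w' t) t (channel_output w k \<omega>) (block n \<omega>) \<Longrightarrow> cw k w' t = cw k (w k) t"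
proof -
  let ?g = "block n \<omega>" and ?y = "channel_output w k \<omega>"
  have wN: "w k < N k" if "k \<in> {1..K}" for k
    using PiE_mem[of w "{1..K}" "\<lambda>k. {..<N k}"] w that unfolding messages_def by simp
  let ?r = "\<lambda>m u q. cmod (?y (m, t) - (of_real X * coeff P k m t 1 ?g * u + of_real (Y m) * gain k k m t ?g * q))"
  have true: "?r m (snd (cw l (w l) t) m) (fst (cw k (w k) t) m) \<le> E k m" if m: "m \<in> {1..M}" for m
  proof -
    let ?x = "\<lambda>i. of_real (Y m) * gain k i m t ?g * fst (cw i (w i) t) m"
    have "(\<Sum>i=1..K. ?x i) = ?x k + (\<Sum>i\<in>{1..K} - {k}. ?x i)" by (rule sum.remove[OF finite_atLeastAtMost k])
    then have "?y (m, t) - (of_real X * coeff P k m t 1 ?g * snd (cw l (w l) t) m + ?x k) = (\<Sum>i\<in>{1..K} - {k}. ?x i) + Z k m t \<omega>"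
      unfolding channel_output_eq[OF k m t] by simp
    then have "?r m (snd (cw l (w l) t) m) (fst (cw k (w k) t) m) \<le> cmod (\<Sum>i\<in>{1..K} - {k}. ?x i) + cmod (Z k m t \<omega>)"
      by (simp only: norm_triangle_ineq)
    also have "cmod (\<Sum>i\<in>{1..K} - {k}. ?x i) \<le> (\<Sum>i\<in>{1..K} - {k}. 2 * (Y m * I k m))"
    proof (rule order_trans[OF norm_sum sum_mono])
      fix i assume "i \<in> {1..K} - {k}"
      then have i: "i \<in> {1..K}" "i \<noteq> k" by simp_all
      have "cmod (gain k i m t ?g) \<le> I k m" using reg k i m t unfolding regular_def by blast
      then have "cmod (of_real (Y m) * gain k i m t ?g) \<le> Y m * I k m"
        using XY(2)[of m] by (simp add: norm_mult mult_left_mono)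
      then have "cmod (?x i) \<le> Y m * I k m * 2"
        unfolding norm_mult[of "of_real (Y m) * gain k i m t ?g"]
        using grid_norm_le[OF private_grid[OF i(1) wN[OF i(1)] t m]] XY(2)[of m] I[of k m] by (intro mult_mono) simp_all
      then show "cmod (?x i) \<le> 2 * (Y m * I k m)" by simp
    qed
    also have "(\<Sum>i\<in>{1..K} - {k}. 2 * (Y m * I k m)) \<le> (\<Sum>i\<in>{1..K}. 2 * (Y m * I k m))"
      using XY(2)[of m] I[of k m] by (intro sum_mono2) simp_all
    also have "\<dots> = 2 * real K * (Y m * I k m)" by simp
    also have "cmod (Z k m t \<omega>) \<le> \<tau>" using good m unfolding good_def by blast
    finally show ?thesis using residual[OF k m] by linarith
  qed
  show "consistent k (cw k (w k) t) t ?y ?g"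
    unfolding consistent_def
  proof (intro ballI bexI conjI impI)
    fix m assume m: "m \<in> {1..M}"
    show "snd (cw l (w l) t) m = snd (cw k (w k) t) m" if "k = l" using that by simp
    show "snd (cw l (w l) t) m \<in> grid (Qc m)" by (rule common_grid[OF wN[OF leader] t m])
  qed (rule true)
  assume w': "w' < N k" and con: "consistent k (cw k w' t) t ?y ?g"
  have eq: "(k = l \<longrightarrow> snd (cw k w' t) m = snd (cw k (w k) t) m) \<and> fst (cw k w' t) m = fst (cw k (w k) t) m"
    if m: "m \<in> {1..M}" for m
  proof -
    obtain u where u: "u \<in> grid (Qc m)" "k = l \<longrightarrow> u = snd (cw k w' t) m" "?r m u (fst (cw k w' t) m) \<le> E k m"
      using con m unfolding consistent_def by blast
    have sl: "(m, t) \<in> slots n" using m t by (simp add: slots_def)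
    have cb: "c \<le> cmod (coeff P k m t j ?g)" "cmod (coeff P k m t j ?g) \<le> C" if "j \<in> {1..K}" for j
      using bspec[OF bspec[OF bspec[OF conjunct1[OF reg[unfolded regular_def]] k] sl] that] by simp_all
    have k1: "(1::nat) \<in> {1..K}" using users by simp
    have C0: "0 \<le> C" using order_trans[OF norm_ge_zero cb(2)[OF k1]] .
    have "cmod (gain k k m t ?g) \<le> (\<Sum>j=1..K. C * 2)"
      unfolding gain_def
    proof (rule order_trans[OF norm_sum sum_mono])
      fix j assume "j \<in> {1..K}"
      then show "cmod (coeff P k m t j ?g * zf k m t ?g j) \<le> C * 2"
        unfolding norm_mult zf_def using cb(2) sel_norm[OF k m] C0 by (intro mult_mono) simp_all
    qed
    then have G: "cmod (gain k k m t ?g) \<le> 2 * real K * C" by (simp add: mult.commute mult.left_commute)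
    have g: "Qp k m = 1 \<or> g0 \<le> cmod (gain k k m t ?g)" using good m unfolding good_def by blast
    note sep = symbols_separated[OF u(1) common_grid[OF wN[OF leader] t m] private_grid[OF k w' t m]
        private_grid[OF k wN[OF k] t m] Q u(3) true[OF m] XY(1,2) cb(1)[OF k1] G g common_gap[OF k m] private_gap[OF k m]]
    show ?thesis using sep u(2) by simp
  qed
  show "cw k w' t = cw k (w k) t"
  proof (rule prod_eqI)
    show "fst (cw k w' t) = fst (cw k (w k) t)"
      by (rule PiE_ext[OF cw_at(1)[OF k w' t] cw_at(1)[OF k wN[OF k] t]]) (use eq in blast)
    show "snd (cw k w' t) = snd (cw k (w k) t)"
    proof (cases "k = l")
      case True
      then have "snd (cw k w' t) \<in> (\<Pi>\<^sub>E m\<in>{1..M}. grid (Qc m))" "snd (cw k (w k) t) \<in> (\<Pi>\<^sub>E m\<in>{1..M}. grid (Qc m))"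
        using cw_at(2)[OF k w' t] cw_at(2)[OF k wN[OF k] t] by simp_all
      then show ?thesis by (rule PiE_ext) (use eq True in blast)
    next
      case False
      then show ?thesis using cw_at(2)[OF k w' t] cw_at(2)[OF k wN[OF k] t] by simp
    qed
  qed
qed

text \<open>Where a competing codeword differs from the true one, either it is inconsistent or the
  slot is not good. Each occurs in at most \<open>\<delta> * n\<close> slots, which the distance of
  the code excludes.\<close>

lemma decoding_correct:
  assumes reg: "regular \<omega>" and k: "k \<in> {1..K}" and w: "w \<in> messages N"
    and few: "real (card {t \<in> {1..n}. \<not> good k t \<omega>}) \<le> \<delta> * real n"
  shows "dec k (channel_output w k \<omega>) (block n \<omega>) = w k"
proof -
  let ?bad = "\<lambda>w'. {t \<in> {1..n}. \<not> consistent k (cw k w' t) t (channel_output w k \<omega>) (block n \<omega>)}"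
  let ?ok = "\<lambda>w'. w' < N k \<and> real (card (?bad w')) \<le> \<delta> * real n"
  have wN: "w k < N k"
    using PiE_mem[of w "{1..K}" "\<lambda>k. {..<N k}"] w k unfolding messages_def by simp
  have "?bad (w k) \<subseteq> {t \<in> {1..n}. \<not> good k t \<omega>}"
  proof
    fix t assume t: "t \<in> ?bad (w k)"
    then have t1: "t \<in> {1..n}" by simp
    have "\<not> good k t \<omega>"
    proof
      assume "good k t \<omega>"
      from good_consistent(1)[OF reg this k t1 w] t show False by simp
    qed
    with t1 show "t \<in> {t \<in> {1..n}. \<not> good k t \<omega>}" by simp
  qed
  then have "card (?bad (w k)) \<le> card {t \<in> {1..n}. \<not> good k t \<omega>}" by (intro card_mono) simp_all
  then have ok: "?ok (w k)" using few wN by simp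
  have "w' = w k" if w': "?ok w'" for w'
  proof (rule ccontr)
    assume ne: "w' \<noteq> w k"
    have "{t \<in> {1..n}. cw k w' t \<noteq> cw k (w k) t} \<subseteq> ?bad w' \<union> {t \<in> {1..n}. \<not> good k t \<omega>}"
    proof
      fix t assume t: "t \<in> {t \<in> {1..n}. cw k w' t \<noteq> cw k (w k) t}"
      then have t1: "t \<in> {1..n}" "cw k w' t \<noteq> cw k (w k) t" by simp_all
      show "t \<in> ?bad w' \<union> {t \<in> {1..n}. \<not> good k t \<omega>}"
      proof (cases "good k t \<omega>")
        case True
        have "\<not> consistent k (cw k w' t) t (channel_output w k \<omega>) (block n \<omega>)"
        proof
          assume "consistent k (cw k w' t) t (channel_output w k \<omega>) (block n \<omega>)"
          from good_consistent(2)[OF reg True k t1(1) w conjunct1[OF w'] this] t1(2) show False by (simp only:)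
        qed
        with t1(1) have "t \<in> ?bad w'" by simp
        then show ?thesis by (rule UnI1)
      next
        case False
        with t1(1) show ?thesis by simp
      qed
    qed
    then have "hamming {1..n} (cw k w') (cw k (w k)) \<le> card (?bad w' \<union> {t \<in> {1..n}. \<not> good k t \<omega>})"
      unfolding hamming_def by (intro card_mono) simp_all
    also have "\<dots> \<le> card (?bad w') + card {t \<in> {1..n}. \<not> good k t \<omega>}" by (rule card_Un_le)
    finally have "real (hamming {1..n} (cw k w') (cw k (w k))) \<le> real (card (?bad w') + card {t \<in> {1..n}. \<not> good k t \<omega>})"
      unfolding of_nat_le_iff .
    then have "real (hamming {1..n} (cw k w') (cw k (w k))) \<le> real (card (?bad w')) + real (card {t \<in> {1..n}. \<not> good k t \<omega>})"
      unfolding of_nat_add .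
    then show False using cw_far[OF k conjunct1[OF w'] wN ne] conjunct2[OF w'] few by linarith
  qed
  note unique = this
  show ?thesis unfolding dec_def
  proof (rule Least_equality[where P = ?ok, OF ok])
    fix w' assume "?ok w'"
    from unique[OF this] show "w k \<le> w'" by (rule eq_refl[OF sym])
  qed
qed

section \<open>Probability of a decoding error\<close>

definition noisy :: "nat \<Rightarrow> nat \<Rightarrow> 'a set" where
  "noisy k m = {\<omega> \<in> space \<Omega>. \<delta> / (2 * real M) * real n < real (card {t \<in> {1..n}. \<tau> < cmod (Z k m t \<omega>)})}"

definition faded :: "nat \<Rightarrow> nat \<Rightarrow> 'a set" where
  "faded k m = {\<omega> \<in> space \<Omega>. \<delta> / (2 * real M) * real n < real (card {t \<in> {1..n}. cmod (gain k k m t (block n \<omega>)) < g0})}"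

lemma noisy_rare:
  assumes k: "k \<in> {1..K}" and m: "m \<in> {1..M}"
  shows "noisy k m \<in> events" "prob (noisy k m) \<le> (1 / 2) ^ n"
proof -
  let ?B = "\<lambda>t. {\<omega> \<in> space \<Omega>. \<tau> < cmod (Z k m t \<omega>)}"
  have ev: "?B t \<in> events" if "t \<in> {1..n}" for t
  proof -
    have [measurable]: "Z k m t \<in> borel_measurable \<Omega>" using that by (intro Z_measurable k m) simp
    show ?thesis by measurable
  qed
  have all: "prob {\<omega> \<in> space \<Omega>. \<forall>t\<in>S. \<omega> \<in> ?B t} \<le> p ^ card S" if "S \<subseteq> {1..n}" for S
  proof -
    have "{\<omega> \<in> space \<Omega>. \<forall>t\<in>S. \<omega> \<in> ?B t} = {\<omega> \<in> space \<Omega>. \<forall>t\<in>S. \<tau> < cmod (Z k m t \<omega>)}" by blast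
    then show ?thesis using noise_rare[OF k m that] by simp
  qed
  have d: "0 \<le> \<delta> / (2 * real M)" using \<delta> by simp
  have eq: "{\<omega> \<in> space \<Omega>. \<delta> / (2 * real M) * real (card {1..n}) < real (card {t \<in> {1..n}. \<omega> \<in> ?B t})} = noisy k m"
    unfolding noisy_def by (rule Collect_cong) (simp cong: conj_cong)
  note many = prob_many_le[OF finite_atLeastAtMost[of 1 n] ev p d all, unfolded eq]
  show "noisy k m \<in> events" by (rule many(1))
  have "(2 * p powr (\<delta> / (2 * real M))) ^ card {1..n} \<le> (1 / 2) ^ card {1..n}"
    using p_small by (rule power_mono) simp
  with many(2) show "prob (noisy k m) \<le> (1 / 2) ^ n" by simp
qed

text \<open>Gains of different slots may be dependent; \<open>gain_rare\<close> bounds the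
  intersections of their fading events directly, with the zero-forcing vectors as parameters free of
  the estimates of user \<open>k\<close>.\<close>

lemma faded_rare:
  assumes k: "k \<in> {1..K}" and m: "m \<in> {1..M}"
  shows "faded k m \<in> events" "prob (faded k m) \<le> (1 / 2) ^ n"
proof -
  let ?B = "\<lambda>t. {\<omega> \<in> space \<Omega>. cmod (gain k k m t (block n \<omega>)) < g0}"
  have gm: "Measurable.pred (block_space n) (\<lambda>g. cmod (gain k k m t g) < g0)" if "t \<in> {1..n}" for t
  proof -
    note [measurable] = gain_measurable[OF k k m that]
    show ?thesis by measurable
  qed
  have ev: "?B t \<in> events" if "t \<in> {1..n}" for t
    using measurable_compose[OF block_measurable gm[OF that]] unfolding pred_def .
  have all: "prob {\<omega> \<in> space \<Omega>. \<forall>t\<in>S. \<omega> \<in> ?B t} \<le> p ^ card S" if S: "S \<subseteq> {1..n}" for S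
  proof -
    let ?G = "{g \<in> space (block_space n). \<forall>t\<in>S. cmod (gain k k m t g) < g0}"
    have "Measurable.pred (block_space n) (\<lambda>g. \<forall>t\<in>S. cmod (gain k k m t g) < g0)"
      by (rule pred_intros_finite(3)[OF finite_subset[OF S finite_atLeastAtMost]]) (rule gm, rule subsetD[OF S])
    then have Gs: "?G \<in> sets (block_space n)" unfolding pred_def .
    have "{\<omega> \<in> space \<Omega>. \<forall>t\<in>S. \<omega> \<in> ?B t} = block n -` ?G \<inter> space \<Omega>"
      using measurable_space[OF block_measurable[of n]] by auto
    then have "prob {\<omega> \<in> space \<Omega>. \<forall>t\<in>S. \<omega> \<in> ?B t} = measure (block_law n) ?G"
      unfolding block_law_def using measure_distr[OF block_measurable Gs] by simp
    also have "\<dots> \<le> p ^ card S"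
      unfolding gain_def
    proof (rule gain_rare[OF k m S])
      fix t j assume t: "t \<in> S"
      show "(\<lambda>g. zf k m t g j) \<in> borel_measurable (block_space n)"
        by (rule zf_block_measurable[OF k m subsetD[OF S t]])
      show "free_of {Estimate k m t j |t j. True} (\<lambda>g. zf k m t g j)" by (rule zf_free[OF k m])
      show "\<exists>j\<in>{1..K}. 1 / 2 \<le> cmod (zf k m t g j)" for g unfolding zf_def by (rule sel_big[OF k m])
    qed
    finally show ?thesis .
  qed
  have d: "0 \<le> \<delta> / (2 * real M)" using \<delta> by simp
  have eq: "{\<omega> \<in> space \<Omega>. \<delta> / (2 * real M) * real (card {1..n}) < real (card {t \<in> {1..n}. \<omega> \<in> ?B t})} = faded k m"
    unfolding faded_def by (rule Collect_cong) (simp cong: conj_cong)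
  note many = prob_many_le[OF finite_atLeastAtMost[of 1 n] ev p d all, unfolded eq]
  show "faded k m \<in> events" by (rule many(1))
  have "(2 * p powr (\<delta> / (2 * real M))) ^ card {1..n} \<le> (1 / 2) ^ card {1..n}"
    using p_small by (rule power_mono) simp
  with many(2) show "prob (faded k m) \<le> (1 / 2) ^ n" by simp
qed

text \<open>The budget of \<open>\<delta> * n\<close> bad slots is divided over \<open>M\<close>
  subchannels and two causes, noise and fading; this is the origin of
  \<open>\<delta> / (2 * real M)\<close> in the thresholds.\<close>

lemma few_bad:
  assumes \<omega>: "\<omega> \<in> space \<Omega>" and ok: "\<And>m. m \<in> {1..M} \<Longrightarrow> \<omega> \<notin> noisy k m" "\<And>m. m \<in> {1..M} \<Longrightarrow> \<omega> \<notin> faded k m"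
  shows "real (card {t \<in> {1..n}. \<not> good k t \<omega>}) \<le> \<delta> * real n"
proof -
  let ?A = "\<lambda>m. {t \<in> {1..n}. \<tau> < cmod (Z k m t \<omega>)}"
  let ?B = "\<lambda>m. {t \<in> {1..n}. cmod (gain k k m t (block n \<omega>)) < g0}"
  have "{t \<in> {1..n}. \<not> good k t \<omega>} \<subseteq> (\<Union>m\<in>{1..M}. ?A m \<union> ?B m)"
    unfolding good_def by (auto simp: not_le)
  then have "card {t \<in> {1..n}. \<not> good k t \<omega>} \<le> card (\<Union>m\<in>{1..M}. ?A m \<union> ?B m)"
    by (intro card_mono finite_UN_I finite_UnI) simp_all
  also have "\<dots> \<le> (\<Sum>m=1..M. card (?A m \<union> ?B m))" by (rule card_UN_le) simp
  also have "\<dots> \<le> (\<Sum>m=1..M. card (?A m) + card (?B m))" by (intro sum_mono card_Un_le)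
  finally have "real (card {t \<in> {1..n}. \<not> good k t \<omega>}) \<le> (\<Sum>m=1..M. real (card (?A m)) + real (card (?B m)))"
    unfolding of_nat_add[symmetric] of_nat_sum[symmetric] of_nat_le_iff .
  also have "\<dots> \<le> (\<Sum>m=1..M. \<delta> / (2 * real M) * real n + \<delta> / (2 * real M) * real n)"
  proof (rule sum_mono)
    fix m assume "m \<in> {1..M}"
    then show "real (card (?A m)) + real (card (?B m)) \<le> \<delta> / (2 * real M) * real n + \<delta> / (2 * real M) * real n"
    proof (intro add_mono)
      assume m: "m \<in> {1..M}"
      show "real (card (?A m)) \<le> \<delta> / (2 * real M) * real n"
      proof (rule ccontr)
        assume "\<not> real (card (?A m)) \<le> \<delta> / (2 * real M) * real n"
        with \<omega> have "\<omega> \<in> noisy k m" unfolding noisy_def by (intro CollectI conjI) (simp_all only: not_le)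
        with ok(1)[OF m] show False by (rule notE)
      qed
      show "real (card (?B m)) \<le> \<delta> / (2 * real M) * real n"
      proof (rule ccontr)
        assume "\<not> real (card (?B m)) \<le> \<delta> / (2 * real M) * real n"
        with \<omega> have "\<omega> \<in> faded k m" unfolding faded_def by (intro CollectI conjI) (simp_all only: not_le)
        with ok(2)[OF m] show False by (rule notE)
      qed
    qed
  qed
  also have "\<dots> = \<delta> * real n" using subchannels by (simp add: field_simps)
  finally show ?thesis .
qed

text \<open>Almost surely, a decoding error forces too many noisy or too many faded slots for some
  user on some subchannel; the factor counts these cases.\<close>

lemma error_bound:
  assumes w: "w \<in> messages N"
  shows "prob {\<omega> \<in> space \<Omega>. \<exists>k\<in>{1..K}. dec k (channel_output w k \<omega>) (block n \<omega>) \<noteq> w k} \<le> 2 * real K * real M * (1 / 2) ^ n"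
proof -
  let ?T = "{1..K} \<times> {1..M}"
  let ?Bad = "\<Union>x\<in>?T. noisy (fst x) (snd x) \<union> faded (fst x) (snd x)"
  have ev: "noisy (fst x) (snd x) \<union> faded (fst x) (snd x) \<in> events" if "x \<in> ?T" for x
    using that noisy_rare(1) faded_rare(1) by (intro sets.Un) auto
  then have Bad: "?Bad \<in> events" by (intro sets.finite_UN) simp_all
  have "prob {\<omega> \<in> space \<Omega>. \<exists>k\<in>{1..K}. dec k (channel_output w k \<omega>) (block n \<omega>) \<noteq> w k} \<le> prob ?Bad"
  proof (rule finite_measure_mono_AE[OF _ Bad])
    show "AE \<omega> in \<Omega>. \<omega> \<in> {\<omega> \<in> space \<Omega>. \<exists>k\<in>{1..K}. dec k (channel_output w k \<omega>) (block n \<omega>) \<noteq> w k} \<longrightarrow> \<omega> \<in> ?Bad"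
      using regular_ae
    proof eventually_elim
      case (elim \<omega>)
      show ?case
      proof (rule impI, rule ccontr)
        assume e: "\<omega> \<in> {\<omega> \<in> space \<Omega>. \<exists>k\<in>{1..K}. dec k (channel_output w k \<omega>) (block n \<omega>) \<noteq> w k}" and nb: "\<omega> \<notin> ?Bad"
        from e have \<omega>: "\<omega> \<in> space \<Omega>" by blast
        from e obtain k where k: "k \<in> {1..K}" "dec k (channel_output w k \<omega>) (block n \<omega>) \<noteq> w k" by blast
        have "\<omega> \<notin> noisy k m" "\<omega> \<notin> faded k m" if "m \<in> {1..M}" for m
        proof -
          have km: "(k, m) \<in> ?T" using k(1) that by simp
          show "\<omega> \<notin> noisy k m"
          proof
            assume "\<omega> \<in> noisy k m"
            then have "\<omega> \<in> ?Bad" by (intro UN_I[OF km] UnI1) simp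
            with nb show False by (rule notE)
          qed
          show "\<omega> \<notin> faded k m"
          proof
            assume "\<omega> \<in> faded k m"
            then have "\<omega> \<in> ?Bad" by (intro UN_I[OF km] UnI2) simp
            with nb show False by (rule notE)
          qed
        qed
        from few_bad[OF \<omega> this] have "dec k (channel_output w k \<omega>) (block n \<omega>) = w k"
          by (intro decoding_correct[OF elim k(1) w]) 
        with k(2) show False by (rule notE)
      qed
    qed
  qed
  also have "\<dots> \<le> (\<Sum>x\<in>?T. prob (noisy (fst x) (snd x) \<union> faded (fst x) (snd x)))"
    by (rule finite_measure_subadditive_finite) (use ev in auto)
  also have "\<dots> \<le> (\<Sum>x\<in>?T. (1 / 2) ^ n + (1 / 2) ^ n)"
  proof (rule sum_mono)
    fix x assume "x \<in> ?T"
    then have x: "fst x \<in> {1..K}" "snd x \<in> {1..M}" by auto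
    have "prob (noisy (fst x) (snd x) \<union> faded (fst x) (snd x)) \<le> prob (noisy (fst x) (snd x)) + prob (faded (fst x) (snd x))"
      by (rule measure_Un_le[OF noisy_rare(1)[OF x] faded_rare(1)[OF x]])
    then show "prob (noisy (fst x) (snd x) \<union> faded (fst x) (snd x)) \<le> (1 / 2) ^ n + (1 / 2) ^ n"
      using noisy_rare(2)[OF x] faded_rare(2)[OF x] by linarith
  qed
  also have "\<dots> = 2 * real K * real M * (1 / 2) ^ n" by (simp add: card_cartesian_product)
  finally show ?thesis .
qed

lemma error_prob_bound: "0 \<le> error_prob P n N enc dec" "error_prob P n N enc dec \<le> 2 * real K * real M * (1 / 2) ^ n"
proof -
  show "0 \<le> error_prob P n N enc dec" unfolding error_prob_def by (intro divide_nonneg_nonneg sum_nonneg) simp_all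
  have "(\<Sum>w\<in>messages N. prob {\<omega> \<in> space \<Omega>. \<exists>k\<in>{1..K}. dec k (channel_output w k \<omega>) (block n \<omega>) \<noteq> w k})
      \<le> real (card (messages N)) * (2 * real K * real M * (1 / 2) ^ n)"
    by (rule sum_bounded_above) (rule error_bound)
  then show "error_prob P n N enc dec \<le> 2 * real K * real M * (1 / 2) ^ n"
    unfolding error_prob_def channel_output_def block_def
    by (cases "card (messages N) = 0") (simp_all add: divide_le_eq mult.commute)
qed

end

text \<open>
  A trivial level \<open>1\<close> stands for an alphabet with the single symbol \<open>0\<close>; it is taken when the
  nominal number of levels is below \<open>1\<close>.
\<close>
definition level :: "real \<Rightarrow> nat" where
  "level x = nat (max 1 \<lfloor>x\<rfloor>)"

lemma level_ge_1: "1 \<le> level x"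
  unfolding level_def by linarith

lemma level_le: "level x = 1 \<or> real (level x) \<le> x"
  unfolding level_def by linarith

lemma level_ge_half: "x / 2 \<le> real (level x)"
  unfolding level_def by linarith

text \<open>Rounding loses at most a factor 2 in each of the two real dimensions, hence 2 bits.
  Negative \<open>b\<close> is covered as well: the level is then 1.\<close>

lemma log_level_ge:
  assumes "1 \<le> P"
  shows "b * log 2 P - 2 \<le> log 2 (real (level (P powr (b / 2)) * level (P powr (b / 2))))"
proof -
  let ?v = "real (level (P powr (b / 2)))"
  have P: "0 < P powr (b / 2)" using assms by simp
  have v: "P powr (b / 2) / 2 \<le> ?v" by (rule level_ge_half)
  have v0: "0 < ?v" using level_ge_1[of "P powr (b / 2)"] by linarith
  have "log 2 (P powr (b / 2) / 2) \<le> log 2 ?v" using P v v0 by (subst log_le_cancel_iff) simp_all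
  moreover have "log 2 (P powr (b / 2) / 2) = b / 2 * log 2 P - 1"
    using P assms by (simp add: log_divide log_powr)
  moreover have "log 2 (real (level (P powr (b / 2)) * level (P powr (b / 2)))) = 2 * log 2 ?v"
    using v0 by (simp add: log_mult)
  ultimately show ?thesis by (simp add: algebra_simps)
qed

lemma log_card_grids:
  assumes "finite I" "\<And>i. i \<in> I \<Longrightarrow> 1 \<le> q i"
  shows "log 2 (real (card (\<Pi>\<^sub>E i\<in>I. grid (q i)))) = (\<Sum>i\<in>I. log 2 (real (q i * q i)))"
    and "0 < card (\<Pi>\<^sub>E i\<in>I. grid (q i))"
proof -
  have c: "card (\<Pi>\<^sub>E i\<in>I. grid (q i)) = (\<Prod>i\<in>I. q i * q i)"
    unfolding card_PiE[OF assms(1)] by (rule prod.cong[OF refl]) (rule card_grid[OF assms(2)])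
  have pos: "0 < q i * q i" if "i \<in> I" for i using assms(2)[OF that] by simp
  then show "0 < card (\<Pi>\<^sub>E i\<in>I. grid (q i))" unfolding c by (intro prod_pos) 
  show "log 2 (real (card (\<Pi>\<^sub>E i\<in>I. grid (q i)))) = (\<Sum>i\<in>I. log 2 (real (q i * q i)))"
    unfolding c of_nat_prod log_def sum_divide_distrib[symmetric]
    by (subst ln_prod) (use pos assms in \<open>auto simp: Suc_le_eq\<close>)
qed

section \<open>Alphabets, their rates, and the gap conditions\<close>

context parallel_miso_bc
begin

text \<open>The margin \<open>\<epsilon>\<close> in the exponent lets symbol distances exceed the
  interference by \<open>P powr (\<epsilon> / 2)\<close>, which outgrows every constant.\<close>

definition private_level :: "real \<Rightarrow> real \<Rightarrow> nat \<Rightarrow> nat \<Rightarrow> nat" where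
  "private_level \<epsilon> P k m = level (P powr ((\<alpha> k m - \<epsilon>) / 2))"

definition common_level :: "real \<Rightarrow> real \<Rightarrow> nat \<Rightarrow> nat \<Rightarrow> nat" where
  "common_level \<epsilon> P l m = level (P powr ((1 - \<alpha> l m - \<epsilon>) / 2))"

definition alphabet :: "real \<Rightarrow> real \<Rightarrow> nat \<Rightarrow> nat \<Rightarrow> ((nat \<Rightarrow> complex) \<times> (nat \<Rightarrow> complex)) set" where
  "alphabet \<epsilon> P l k = (\<Pi>\<^sub>E m\<in>{1..M}. grid (private_level \<epsilon> P k m)) \<times>
    (if k = l then \<Pi>\<^sub>E m\<in>{1..M}. grid (common_level \<epsilon> P l m) else {\<lambda>_. 0})"

text \<open>User \<open>l\<close> carries \<open>\<alpha> l m\<close> with its private and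
  \<open>1 - \<alpha> l m\<close> with the common symbols of each subchannel, together one degree of
  freedom.\<close>

definition target_dof :: "nat \<Rightarrow> nat \<Rightarrow> real" where
  "target_dof l k = (if k = l then 1 else avg_quality M \<alpha> k)"

lemma avg_quality_bounds:
  assumes "k \<in> {1..K}"
  shows "real M * avg_quality M \<alpha> k = (\<Sum>m=1..M. \<alpha> k m)" "avg_quality M \<alpha> k \<le> 1"
proof -
  show e: "real M * avg_quality M \<alpha> k = (\<Sum>m=1..M. \<alpha> k m)" using subchannels by (simp add: avg_quality_def)
  have "(\<Sum>m=1..M. \<alpha> k m) \<le> (\<Sum>m=1..M. 1)" using quality[OF assms] by (intro sum_mono) simp
  then show "avg_quality M \<alpha> k \<le> 1" using subchannels by (simp add: avg_quality_def divide_le_eq)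
qed

lemma alphabet_card:
  assumes k: "k \<in> {1..K}" and P: "1 \<le> P" and \<epsilon>: "0 < \<epsilon>"
  shows "finite (alphabet \<epsilon> P l k)" "alphabet \<epsilon> P l k \<noteq> {}"
    and "real M * (target_dof l k - 2 * \<epsilon>) * log 2 P - 4 * real M \<le> log 2 (real (card (alphabet \<epsilon> P l k)))"
proof -
  let ?A = "\<Pi>\<^sub>E m\<in>{1..M}. grid (private_level \<epsilon> P k m)"
  let ?B = "\<Pi>\<^sub>E m\<in>{1..M}. grid (common_level \<epsilon> P l m)"
  have q: "1 \<le> private_level \<epsilon> P k m" "1 \<le> common_level \<epsilon> P l m" for m
    unfolding private_level_def common_level_def by (rule level_ge_1)+
  note A = log_card_grids[where q = "private_level \<epsilon> P k", OF finite_atLeastAtMost[of 1 M] q(1)] and B = log_card_grids[where q = "common_level \<epsilon> P l", OF finite_atLeastAtMost[of 1 M] q(2)]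
  have L0: "0 \<le> log 2 P" using P by simp
  have A_ge: "(\<Sum>m=1..M. (\<alpha> k m - \<epsilon>) * log 2 P - 2) \<le> log 2 (real (card ?A))"
    unfolding A(1) unfolding private_level_def by (rule sum_mono) (rule log_level_ge[OF P])
  have B_ge: "(\<Sum>m=1..M. (1 - \<alpha> l m - \<epsilon>) * log 2 P - 2) \<le> log 2 (real (card ?B))"
    unfolding B(1) unfolding common_level_def by (rule sum_mono) (rule log_level_ge[OF P])
  have fin: "finite ?A" "finite ?B" using card_ge_0_finite[OF A(2)] card_ge_0_finite[OF B(2)] .
  have sA: "(\<Sum>m=1..M. (\<alpha> k m - \<epsilon>) * log 2 P - 2) = ((\<Sum>m=1..M. \<alpha> k m) - real M * \<epsilon>) * log 2 P - 2 * real M"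
    by (simp add: sum_subtractf sum_distrib_right[symmetric])
  have sB: "(\<Sum>m=1..M. (1 - \<alpha> l m - \<epsilon>) * log 2 P - 2) = (real M - (\<Sum>m=1..M. \<alpha> l m) - real M * \<epsilon>) * log 2 P - 2 * real M"
    by (simp add: sum_subtractf sum_distrib_right[symmetric])
  show f: "finite (alphabet \<epsilon> P l k)" unfolding alphabet_def using fin by simp
  have ne: "?A \<noteq> {}" "?B \<noteq> {}" using A(2) B(2) by (metis card.empty less_irrefl)+
  then show "alphabet \<epsilon> P l k \<noteq> {}" unfolding alphabet_def by simp
  show "real M * (target_dof l k - 2 * \<epsilon>) * log 2 P - 4 * real M \<le> log 2 (real (card (alphabet \<epsilon> P l k)))"
  proof (cases "k = l")
    case True
    have "alphabet \<epsilon> P l k = ?A \<times> ?B" unfolding alphabet_def if_P[OF True] ..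
    then have "real (card (alphabet \<epsilon> P l k)) = real (card ?A) * real (card ?B)"
      by (simp only: card_cartesian_product of_nat_mult)
    then have "log 2 (real (card (alphabet \<epsilon> P l k))) = log 2 (real (card ?A)) + log 2 (real (card ?B))"
      using A(2) B(2) by (simp only: log_mult_pos of_nat_0_less_iff)
    moreover have "real M * (target_dof l k - 2 * \<epsilon>) * log 2 P - 4 * real M
      = (((\<Sum>m=1..M. \<alpha> l m) - real M * \<epsilon>) * log 2 P - 2 * real M)
        + ((real M - (\<Sum>m=1..M. \<alpha> l m) - real M * \<epsilon>) * log 2 P - 2 * real M)"
      using True by (simp add: target_dof_def algebra_simps)
    ultimately show ?thesis using A_ge[unfolded sA] B_ge[unfolded sB] unfolding True by linarith
  next
    case False
    have "log 2 (real (card (alphabet \<epsilon> P l k))) = log 2 (real (card ?A))"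
      unfolding alphabet_def if_not_P[OF False] card_cartesian_product by (simp only: is_singletonI is_singleton_altdef[THEN iffD1] mult_1_right)
    moreover have "real M * (avg_quality M \<alpha> k - 2 * \<epsilon>) * log 2 P - 4 * real M
        \<le> ((\<Sum>m=1..M. \<alpha> k m) - real M * \<epsilon>) * log 2 P - 2 * real M"
    proof -
      have "real M * (avg_quality M \<alpha> k - 2 * \<epsilon>) \<le> (\<Sum>m=1..M. \<alpha> k m) - real M * \<epsilon>"
        using avg_quality_bounds(1)[OF k] \<epsilon> by (simp add: algebra_simps)
      from mult_right_mono[OF this L0] show ?thesis by simp
    qed
    ultimately show ?thesis using A_ge False unfolding sA target_dof_def by simp
  qed
qed

text \<open>Of the loss \<open>6 * \<epsilon>\<close>, a share \<open>2 * \<epsilon>\<close> is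
  reserved for the margins of the alphabets, another for the redundancy of the code, and the last
  covers all constants as soon as \<open>\<epsilon> * log 2 P\<close> reaches 3.\<close>

lemma rate_supported:
  assumes k: "k \<in> {1..K}" and P: "1 \<le> P" and \<epsilon>: "0 < \<epsilon>" "\<epsilon> < 1 / 2" and big: "3 \<le> \<epsilon> * log 2 P"
  shows "max 0 (real M * (target_dof l k - 6 * \<epsilon>) * log 2 P) = 0 \<or>
    max 0 (real M * (target_dof l k - 6 * \<epsilon>) * log 2 P) \<le> (1 - 2 * \<epsilon>) * log 2 (real (card (alphabet \<epsilon> P l k))) - 2"
proof -
  let ?d = "target_dof l k" and ?L = "log 2 P" and ?M = "real M"
  have d1: "?d \<le> 1" using avg_quality_bounds(2)[OF k] by (simp add: target_dof_def)
  have L0: "0 \<le> ?L" using P by simp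
  have M1: "1 \<le> ?M" using subchannels by simp
  have nn: "0 \<le> ?M * ?L" using L0 M1 by simp
  have "(1 - 2 * \<epsilon>) * (?M * (?d - 2 * \<epsilon>) * ?L - 4 * ?M) \<le> (1 - 2 * \<epsilon>) * log 2 (real (card (alphabet \<epsilon> P l k)))"
    using alphabet_card(3)[OF k P \<epsilon>(1), of l] \<epsilon> by (intro mult_left_mono) simp_all
  moreover have "?M * (?d - 6 * \<epsilon>) * ?L + 2 \<le> (1 - 2 * \<epsilon>) * (?M * (?d - 2 * \<epsilon>) * ?L - 4 * ?M)"
  proof -
    have "(?d - 2 * \<epsilon>) * (?M * ?L) \<le> 1 * (?M * ?L)" using d1 \<epsilon> nn by (intro mult_right_mono) simp_all
    then have "2 * \<epsilon> * ((?d - 2 * \<epsilon>) * (?M * ?L)) \<le> 2 * \<epsilon> * (?M * ?L)" using \<epsilon> by (intro mult_left_mono) simp_all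
    moreover have "3 * ?M \<le> \<epsilon> * ?L * ?M" using big M1 by (intro mult_right_mono) simp_all
    moreover have "0 \<le> 8 * \<epsilon> * ?M" using \<epsilon> by simp
    moreover have "(1 - 2 * \<epsilon>) * (?M * (?d - 2 * \<epsilon>) * ?L - 4 * ?M) - (?M * (?d - 6 * \<epsilon>) * ?L + 2)
      = 4 * (\<epsilon> * ?L * ?M) - 4 * ?M - 2 - 2 * \<epsilon> * ((?d - 2 * \<epsilon>) * (?M * ?L)) + 8 * \<epsilon> * ?M"
      by (simp add: algebra_simps)
    moreover have "2 * \<epsilon> * (?M * ?L) = 2 * (\<epsilon> * ?L * ?M)" by simp
    ultimately show ?thesis using M1 by linarith
  qed
  ultimately have "?M * (?d - 6 * \<epsilon>) * ?L \<le> (1 - 2 * \<epsilon>) * log 2 (real (card (alphabet \<epsilon> P l k))) - 2"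
    by linarith
  then show ?thesis by linarith
qed

text \<open>For positive quality the estimate part is nulled up to
  \<open>P powr (- (1 / 2))\<close>, and the error part carries the scale
  \<open>P powr (- \<alpha> k m / 2)\<close>. For quality 0 the claim is mere boundedness of the
  gain and follows from that of the coefficients.\<close>

lemma interference_bound:
  fixes P B C :: real
  assumes P: "1 \<le> P" and B: "1 \<le> B" and C: "1 \<le> C" and k: "k \<in> {1..K}" and m: "m \<in> {1..M}"
    and v: "\<And>j. cmod (v j) \<le> 2"
    and co: "\<And>j. j \<in> {1..K} \<Longrightarrow> cmod (coeff P k m t j g) \<le> C"
    and er: "\<And>j. j \<in> {1..K} \<Longrightarrow> 0 < \<alpha> k m \<Longrightarrow> cmod (g (Error k m t j)) \<le> B"
    and zf: "0 < \<alpha> k m \<Longrightarrow> cmod (\<Sum>j=1..K. g (Estimate k m t j) * v j) \<le> P powr (- (1 / 2))"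
  shows "cmod (\<Sum>j=1..K. coeff P k m t j g * v j) \<le> (1 + 2 * real K * B + 2 * real K * C) * P powr (- \<alpha> k m / 2)"
proof -
  let ?x = "P powr (- \<alpha> k m / 2)"
  have x0: "0 \<le> ?x" by simp
  have a: "0 \<le> \<alpha> k m" "\<alpha> k m \<le> 1" using quality[OF k m] by simp_all
  have KB: "0 \<le> real K * B" "0 \<le> real K * C" using B C by simp_all
  show ?thesis
  proof (cases "0 < \<alpha> k m")
    case True
    have sq: "sqrt (P powr - \<alpha> k m) = ?x" using P by (simp add: powr_half_sqrt[symmetric] powr_powr)
    have "(\<Sum>j=1..K. coeff P k m t j g * v j)
        = (\<Sum>j=1..K. g (Estimate k m t j) * v j) + of_real ?x * (\<Sum>j=1..K. g (Error k m t j) * v j)"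
      unfolding channel_coeff_def sq sum_distrib_left sum.distrib[symmetric]
      by (intro sum.cong refl) (simp add: distrib_right mult.assoc)
    then have "cmod (\<Sum>j=1..K. coeff P k m t j g * v j)
        \<le> cmod (\<Sum>j=1..K. g (Estimate k m t j) * v j) + cmod (of_real ?x * (\<Sum>j=1..K. g (Error k m t j) * v j))"
      by (simp only: norm_triangle_ineq)
    moreover have "cmod (\<Sum>j=1..K. g (Estimate k m t j) * v j) \<le> ?x"
    proof (rule order_trans[OF zf[OF True]])
      show "P powr (- (1 / 2)) \<le> ?x" using P a by (intro powr_mono) simp_all
    qed
    moreover have "cmod (of_real ?x * (\<Sum>j=1..K. g (Error k m t j) * v j)) \<le> ?x * (2 * real K * B)"
    proof -
      have "cmod (\<Sum>j=1..K. g (Error k m t j) * v j) \<le> (\<Sum>j=1..K. B * 2)"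
      proof (rule order_trans[OF norm_sum sum_mono])
        fix j assume "j \<in> {1..K}"
        then have "cmod (g (Error k m t j)) \<le> B" using er True by blast
        then show "cmod (g (Error k m t j) * v j) \<le> B * 2"
          unfolding norm_mult using v B by (intro mult_mono) simp_all
      qed
      also have "(\<Sum>j=1..K. B * 2) = 2 * real K * B" by simp
      finally have "?x * cmod (\<Sum>j=1..K. g (Error k m t j) * v j) \<le> ?x * (2 * real K * B)"
        using x0 by (rule mult_left_mono)
      then show ?thesis unfolding norm_mult norm_of_real abs_of_nonneg[OF x0] .
    qed
    ultimately have "cmod (\<Sum>j=1..K. coeff P k m t j g * v j) \<le> ?x + ?x * (2 * real K * B)"
      by linarith
    moreover have "0 \<le> 2 * (real K * C) * ?x" using KB by simp
    ultimately show ?thesis by (simp add: algebra_simps)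
  next
    case False
    then have x1: "?x = 1" using a P by simp
    have "cmod (\<Sum>j=1..K. coeff P k m t j g * v j) \<le> (\<Sum>j=1..K. C * 2)"
    proof (rule order_trans[OF norm_sum sum_mono])
      fix j assume "j \<in> {1..K}"
      then show "cmod (coeff P k m t j g * v j) \<le> C * 2"
        unfolding norm_mult using co v C by (intro mult_mono) simp_all
    qed
    also have "(\<Sum>j=1..K. C * 2) = 2 * real K * C" by simp
    finally show ?thesis unfolding x1 using KB by simp
  qed
qed

text \<open>The vector of user \<open>k\<close> nulls the other users of positive quality: at most
  \<open>K - 1\<close> equations in \<open>K\<close> unknowns. Users of quality 0 impose no
  equation, since their estimates need not be bounded.\<close>

lemma zero_forcers:
  assumes B: "1 \<le> B" and \<eta>: "0 < \<eta>"
  obtains sel :: "nat \<Rightarrow> nat \<Rightarrow> (nat \<Rightarrow> nat \<Rightarrow> complex) \<Rightarrow> nat \<Rightarrow> complex" where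
    "\<And>k m a j. k \<in> {1..K} \<Longrightarrow> m \<in> {1..M} \<Longrightarrow> cmod (sel k m a j) \<le> 2"
    "\<And>k m a. k \<in> {1..K} \<Longrightarrow> m \<in> {1..M} \<Longrightarrow> \<exists>j\<in>{1..K}. 1 / 2 \<le> cmod (sel k m a j)"
    "\<And>k m a i. k \<in> {1..K} \<Longrightarrow> m \<in> {1..M} \<Longrightarrow>
      (\<And>i j. i \<in> {1..K} \<Longrightarrow> 0 < \<alpha> i m \<Longrightarrow> j \<in> {1..K} \<Longrightarrow> cmod (a i j) \<le> B) \<Longrightarrow>
      i \<in> {1..K} \<Longrightarrow> i \<noteq> k \<Longrightarrow> 0 < \<alpha> i m \<Longrightarrow> cmod (\<Sum>j=1..K. a i j * sel k m a j) \<le> \<eta>"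
    "\<And>k m a a'. k \<in> {1..K} \<Longrightarrow> m \<in> {1..M} \<Longrightarrow>
      (\<And>i j. i \<in> {1..K} - {k} \<Longrightarrow> j \<in> {1..K} \<Longrightarrow> a i j = a' i j) \<Longrightarrow> sel k m a = sel k m a'"
    "\<And>k m (S :: (entry \<Rightarrow> complex) measure) A j. k \<in> {1..K} \<Longrightarrow> m \<in> {1..M} \<Longrightarrow>
      (\<And>i j. i \<in> {1..K} - {k} \<Longrightarrow> j \<in> {1..K} \<Longrightarrow> (\<lambda>g. A g i j) \<in> borel_measurable S) \<Longrightarrow>
      (\<lambda>g. sel k m (A g) j) \<in> borel_measurable S"
proof -
  let ?L = "\<lambda>k m. {i \<in> {1..K} - {k}. 0 < \<alpha> i m}"
  let ?Q = "\<lambda>k m sel. (\<forall>a j. cmod (sel a j) \<le> 2) \<and> (\<forall>a. \<exists>j\<in>{1..K}. 1 / 2 \<le> cmod (sel a j)) \<and>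
      (\<forall>a i. (\<forall>i\<in>?L k m. \<forall>j\<in>{1..K}. cmod (a i j) \<le> B) \<longrightarrow> i \<in> ?L k m \<longrightarrow> cmod (\<Sum>j=1..K. a i j * sel a j) \<le> \<eta>) \<and>
      (\<forall>a a'. (\<forall>i\<in>?L k m. \<forall>j\<in>{1..K}. a i j = a' i j) \<longrightarrow> sel a = sel a') \<and>
      (\<forall>(S :: (entry \<Rightarrow> complex) measure) A j. (\<forall>i\<in>?L k m. \<forall>j\<in>{1..K}. (\<lambda>g. A g i j) \<in> borel_measurable S) \<longrightarrow>
        (\<lambda>g. sel (A g) j) \<in> borel_measurable S)"
  have ex: "\<exists>sel. ?Q k m sel" if k: "k \<in> {1..K}" for k m
  proof (rule zero_forcing_selection[where L = "?L k m" and J = "{1..K}" and B = B and \<eta> = \<eta> and 'g = "entry \<Rightarrow> complex"])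
    show "finite (?L k m)" "finite {1..K}" "0 < \<eta>" "0 \<le> B" using \<eta> B by simp_all
    have "card (?L k m) \<le> card ({1..K} - {k})" by (intro card_mono) auto
    also have "\<dots> < card {1..K}" using k by (intro card_Diff1_less) simp_all
    finally show "card (?L k m) < card {1..K}" .
  next
    fix sel :: "(nat \<Rightarrow> nat \<Rightarrow> complex) \<Rightarrow> nat \<Rightarrow> complex"
    assume s: "\<And>a j. cmod (sel a j) \<le> 2" "\<And>a. \<exists>j\<in>{1..K}. 1 / 2 \<le> cmod (sel a j)"
      "\<And>a l. (\<And>l j. l \<in> ?L k m \<Longrightarrow> j \<in> {1..K} \<Longrightarrow> cmod (a l j) \<le> B) \<Longrightarrow> l \<in> ?L k m \<Longrightarrow>
        cmod (\<Sum>j=1..K. a l j * sel a j) \<le> \<eta>"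
      "\<And>a a'. (\<And>l j. l \<in> ?L k m \<Longrightarrow> j \<in> {1..K} \<Longrightarrow> a l j = a' l j) \<Longrightarrow> sel a = sel a'"
      "\<And>(N :: (entry \<Rightarrow> complex) measure) A j. (\<And>l j. l \<in> ?L k m \<Longrightarrow> j \<in> {1..K} \<Longrightarrow> (\<lambda>g. A g l j) \<in> borel_measurable N) \<Longrightarrow>
        (\<lambda>g. sel (A g) j) \<in> borel_measurable N"
    show "\<exists>sel. ?Q k m sel"
    proof (intro exI[of _ sel] conjI allI impI)
      show "cmod (sel a j) \<le> 2" for a j by (rule s(1))
      show "\<exists>j\<in>{1..K}. 1 / 2 \<le> cmod (sel a j)" for a by (rule s(2))
      show "cmod (\<Sum>j=1..K. a i j * sel a j) \<le> \<eta>"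
        if "\<forall>i\<in>?L k m. \<forall>j\<in>{1..K}. cmod (a i j) \<le> B" "i \<in> ?L k m" for a i
        by (rule s(3)[OF bspec[OF bspec[OF that(1)]] that(2)])
      show "sel a = sel a'" if "\<forall>i\<in>?L k m. \<forall>j\<in>{1..K}. a i j = a' i j" for a a'
        by (rule s(4)[OF bspec[OF bspec[OF that]]])
      show "(\<lambda>g. sel (A g) j) \<in> borel_measurable S"
        if "\<forall>i\<in>?L k m. \<forall>j\<in>{1..K}. (\<lambda>g. A g i j) \<in> borel_measurable S"
        for S :: "(entry \<Rightarrow> complex) measure" and A j
        by (rule s(5)[OF bspec[OF bspec[OF that]]])
    qed
  qed
  define sel where "sel k m = (SOME s. ?Q k m s)" for k m
  have sel: "?Q k m (sel k m)" if "k \<in> {1..K}" for k m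
    unfolding sel_def by (rule someI_ex[where P = "?Q k m", OF ex[OF that]])
  show thesis
  proof (rule that[of sel])
    fix k m assume k: "k \<in> {1..K}"
    note s = sel[OF k, of m, THEN conjunct1] sel[OF k, of m, THEN conjunct2, THEN conjunct1]
      sel[OF k, of m, THEN conjunct2, THEN conjunct2, THEN conjunct1]
      sel[OF k, of m, THEN conjunct2, THEN conjunct2, THEN conjunct2, THEN conjunct1]
      sel[OF k, of m, THEN conjunct2, THEN conjunct2, THEN conjunct2, THEN conjunct2]
    show "cmod (sel k m a j) \<le> 2" for a j by (rule s(1)[rule_format])
    show "\<exists>j\<in>{1..K}. 1 / 2 \<le> cmod (sel k m a j)" for a by (rule s(2)[rule_format])
    show "cmod (\<Sum>j=1..K. a i j * sel k m a j) \<le> \<eta>"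
      if a: "\<And>i j. i \<in> {1..K} \<Longrightarrow> 0 < \<alpha> i m \<Longrightarrow> j \<in> {1..K} \<Longrightarrow> cmod (a i j) \<le> B"
        and i: "i \<in> {1..K}" "i \<noteq> k" "0 < \<alpha> i m" for a i
      by (rule s(3)[rule_format]) (use a i in simp_all)
    show "sel k m a = sel k m a'" if "\<And>i j. i \<in> {1..K} - {k} \<Longrightarrow> j \<in> {1..K} \<Longrightarrow> a i j = a' i j" for a a'
      by (rule s(4)[rule_format]) (use that in simp_all)
    show "(\<lambda>g. sel k m (A g) j) \<in> borel_measurable S"
      if "\<And>i j. i \<in> {1..K} - {k} \<Longrightarrow> j \<in> {1..K} \<Longrightarrow> (\<lambda>g. A g i j) \<in> borel_measurable S"
      for S :: "(entry \<Rightarrow> complex) measure" and A j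
      by (rule s(5)[rule_format]) (use that in simp_all)
  qed
qed

end

text \<open>Common symbols are separated by order \<open>P powr ((a + \<epsilon>) / 2)\<close>,
  while tolerance and private symbols amount to order \<open>P powr (a / 2)\<close>; the margin
  beats the constants.\<close>

lemma common_gap_level:
  fixes P \<kappa> c C D a b \<epsilon> :: real
  assumes P: "1 \<le> P" and \<kappa>: "0 < \<kappa>" "0 < c" "0 \<le> C" and b: "b \<le> a"
    and big: "2 * C + D < \<kappa> * c * P powr (\<epsilon> / 2)"
  defines "q \<equiv> level (P powr ((1 - a - \<epsilon>) / 2))"
  shows "q = 1 \<or> 2 * (C * P powr (b / 2)) + D * P powr (a / 2) < \<kappa> * sqrt P * c / real q"
proof (cases "q = 1")
  case False
  then have q: "real q \<le> P powr ((1 - a - \<epsilon>) / 2)" using level_le unfolding q_def by blast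
  have q0: "0 < real q" using level_ge_1[of "P powr ((1 - a - \<epsilon>) / 2)"] unfolding q_def by linarith
  have "P powr (b / 2) \<le> P powr (a / 2)" using P b by (intro powr_mono) simp_all
  then have "C * P powr (b / 2) \<le> C * P powr (a / 2)" using \<kappa> by (intro mult_left_mono)
  then have "2 * (C * P powr (b / 2)) + D * P powr (a / 2) \<le> (2 * C + D) * P powr (a / 2)"
    by (simp add: algebra_simps)
  also have "\<dots> < \<kappa> * c * P powr (\<epsilon> / 2) * P powr (a / 2)" using big P by (intro mult_strict_right_mono) simp_all
  also have "\<dots> = \<kappa> * c * (P powr (\<epsilon> / 2) * P powr (a / 2))" by simp
  also have "P powr (\<epsilon> / 2) * P powr (a / 2) = P powr (1 / 2) / P powr ((1 - a - \<epsilon>) / 2)"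
    unfolding powr_add[symmetric] powr_diff[symmetric] by (rule arg_cong[where f = "(powr) P"]) (simp add: field_simps)
  also have "\<kappa> * c * (P powr (1 / 2) / P powr ((1 - a - \<epsilon>) / 2)) = \<kappa> * sqrt P * c / P powr ((1 - a - \<epsilon>) / 2)"
    using P by (simp add: powr_half_sqrt)
  also have "\<dots> \<le> \<kappa> * sqrt P * c / real q" using q q0 \<kappa> P by (intro divide_left_mono) simp_all
  finally show ?thesis by (rule disjI2)
qed simp

text \<open>Private symbols of a user of quality \<open>b\<close> are separated by order
  \<open>P powr ((a - b + \<epsilon>) / 2)\<close>, against a tolerance of order
  \<open>P powr ((a - b) / 2)\<close>.\<close>

lemma private_gap_level:
  fixes P \<kappa> g C a b \<epsilon> :: real
  assumes P: "1 \<le> P" and \<kappa>: "0 < \<kappa>" "0 < g"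
    and big: "2 * C < \<kappa> * g * P powr (\<epsilon> / 2)"
  defines "q \<equiv> level (P powr ((b - \<epsilon>) / 2))"
  shows "q = 1 \<or> 2 * (C * P powr ((a - b) / 2)) < \<kappa> * P powr (a / 2) * g / real q"
proof (cases "q = 1")
  case False
  then have q: "real q \<le> P powr ((b - \<epsilon>) / 2)" using level_le unfolding q_def by blast
  have q0: "0 < real q" using level_ge_1[of "P powr ((b - \<epsilon>) / 2)"] unfolding q_def by linarith
  have "2 * (C * P powr ((a - b) / 2)) = 2 * C * P powr ((a - b) / 2)" by simp
  also have "\<dots> < \<kappa> * g * P powr (\<epsilon> / 2) * P powr ((a - b) / 2)" using big P by (intro mult_strict_right_mono) simp_all
  also have "\<dots> = \<kappa> * g * (P powr (\<epsilon> / 2) * P powr ((a - b) / 2))" by simp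
  also have "P powr (\<epsilon> / 2) * P powr ((a - b) / 2) = P powr (a / 2) / P powr ((b - \<epsilon>) / 2)"
    unfolding powr_add[symmetric] powr_diff[symmetric] by (rule arg_cong[where f = "(powr) P"]) (simp add: field_simps)
  also have "\<kappa> * g * (P powr (a / 2) / P powr ((b - \<epsilon>) / 2)) = \<kappa> * P powr (a / 2) * g / P powr ((b - \<epsilon>) / 2)"
    by simp
  also have "\<dots> \<le> \<kappa> * P powr (a / 2) * g / real q" using q q0 \<kappa> P by (intro divide_left_mono) simp_all
  finally show ?thesis by (rule disjI2)
qed simp

section \<open>Achievable rates and the lower bound for the sum\<close>

context parallel_miso_bc
begin

text \<open>The order of choices matters: \<open>\<epsilon>\<close> determines the rarity
  \<open>p\<close> of bad slots, \<open>p\<close> determines noise level and minimal gain, and only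
  with these constants fixed is \<open>P\<close> taken so large that the margins dominate. Accuracy
  of zero forcing and alphabets depend on \<open>P\<close>, but not on \<open>n\<close>.\<close>

lemma zero_forcing_rates:
  assumes l: "l \<in> {1..K}" and lead: "\<And>k m. k \<in> {1..K} \<Longrightarrow> m \<in> {1..M} \<Longrightarrow> \<alpha> k m \<le> \<alpha> l m"
    and \<epsilon>: "0 < \<epsilon>" "\<epsilon> < 1 / 2"
  shows "\<forall>\<^sub>F P in at_top. (\<lambda>k\<in>{1..K}. max 0 (real M * (target_dof l k - 6 * \<epsilon>) * log 2 P)) \<in> achievable_rates P"
proof -
  obtain c C P0 :: real where c: "0 < c" and C: "1 \<le> C" and P0: "1 \<le> P0"
    and co: "\<And>P n. P0 \<le> P \<Longrightarrow> AE g in block_law n. \<forall>k\<in>{1..K}. \<forall>i\<in>slots n. \<forall>j\<in>{1..K}.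
        c \<le> cmod (coeff P k (fst i) (snd i) j g) \<and> cmod (coeff P k (fst i) (snd i) j g) \<le> C"
    by (rule coeff_bounds) (rule that)
  obtain B :: real where B: "1 \<le> B" and es: "\<And>n. AE g in block_law n. \<forall>k\<in>{1..K}. \<forall>m\<in>{1..M}. \<forall>t\<in>{1..n}. \<forall>j\<in>{1..K}.
    0 < \<alpha> k m \<longrightarrow> cmod (g (Estimate k m t j)) \<le> B \<and> cmod (g (Error k m t j)) \<le> B"
    by (rule estimate_bounds) (rule that)
  \<comment> \<open>Chosen such that \<open>2 * p powr (\<epsilon> / (2 * real M))\<close> equals
    1/2.\<close>
  define p :: real where "p = (1 / 4) powr (2 * real M / \<epsilon>)"
  have M0: "0 < real M" and K1: "1 \<le> real K" using subchannels users by simp_all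
  have p: "0 < p" "p \<le> 1" "2 * p powr (\<epsilon> / (2 * real M)) \<le> 1 / 2"
  proof -
    show "0 < p" by (simp add: p_def)
    show "p \<le> 1" unfolding p_def using M0 \<epsilon> by (intro powr_le1) simp_all
    have "p powr (\<epsilon> / (2 * real M)) = 1 / 4" unfolding p_def powr_powr using M0 \<epsilon> by simp
    then show "2 * p powr (\<epsilon> / (2 * real M)) \<le> 1 / 2" by simp
  qed
  obtain \<tau> :: real where \<tau>: "0 < \<tau>" and noisy: "\<And>k m S. k \<in> {1..K} \<Longrightarrow> m \<in> {1..M} \<Longrightarrow> finite S \<Longrightarrow> S \<subseteq> {1..} \<Longrightarrow>
    prob {\<omega> \<in> space \<Omega>. \<forall>t\<in>S. \<tau> < cmod (Z k m t \<omega>)} \<le> p ^ card S"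
    by (rule noise_tail[OF p(1)]) (rule that)
  obtain g0 :: real where g0: "0 < g0" and faded:
    "\<And>P n k m (V :: nat \<Rightarrow> nat \<Rightarrow> (entry \<Rightarrow> complex) \<Rightarrow> complex) S. k \<in> {1..K} \<Longrightarrow> m \<in> {1..M} \<Longrightarrow> S \<subseteq> {1..n} \<Longrightarrow>
      (\<And>t j. t \<in> S \<Longrightarrow> j \<in> {1..K} \<Longrightarrow> V t j \<in> borel_measurable (block_space n)) \<Longrightarrow>
      (\<And>t j. t \<in> S \<Longrightarrow> j \<in> {1..K} \<Longrightarrow> free_of {Estimate k m t j | t j. True} (V t j)) \<Longrightarrow>
      (\<And>t g. t \<in> S \<Longrightarrow> \<exists>j\<in>{1..K}. 1 / 2 \<le> cmod (V t j g)) \<Longrightarrow>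
      measure (block_law n) {g \<in> space (block_space n). \<forall>t\<in>S. cmod (\<Sum>j=1..K. coeff P k m t j g * V t j g) < g0}
        \<le> p ^ card S"
    apply (rule gain_tail[OF p(1)])
    subgoal premises prems for g0 by (rule prems(1)[of g0]) (fact prems)+
    done
  \<comment> \<open>With amplitude \<open>6 * K * \<kappa> * sqrt P\<close> on each of the
    \<open>K\<close> antennas, the power of a slot is \<open>P / K\<close>.\<close>
  define \<kappa> where "\<kappa> = 1 / (6 * (real K)\<^sup>2)"
  have \<kappa>: "0 < \<kappa>" using K1 by (simp add: \<kappa>_def)
  define F where "F = 1 + 2 * real K * B + 2 * real K * C"
  have F0: "0 \<le> F" using B C by (simp add: F_def)
  define C4 where "C4 = 2 * real K * \<kappa> * F + \<tau>"
  have C40: "0 \<le> C4" using F0 \<kappa> \<tau> by (simp add: C4_def)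
  have "\<forall>\<^sub>F P in at_top. max 1 P0 \<le> P \<and> 3 \<le> \<epsilon> * log 2 P \<and>
    2 * C4 + 8 * real K * C * \<kappa> < \<kappa> * c * P powr (\<epsilon> / 2) \<and> 2 * C4 < \<kappa> * g0 * P powr (\<epsilon> / 2)"
  proof (intro eventually_conj)
    show "\<forall>\<^sub>F P in at_top. max 1 P0 \<le> P" by (rule eventually_ge_at_top)
    have "filterlim (\<lambda>P. \<epsilon> * log 2 P) at_top at_top" using \<epsilon> by real_asymp
    then show "\<forall>\<^sub>F P in at_top. 3 \<le> \<epsilon> * log 2 P" unfolding filterlim_at_top by blast
    have "filterlim (\<lambda>P. \<kappa> * c * P powr (\<epsilon> / 2)) at_top at_top" using \<epsilon> \<kappa> c by real_asymp
    then show "\<forall>\<^sub>F P in at_top. 2 * C4 + 8 * real K * C * \<kappa> < \<kappa> * c * P powr (\<epsilon> / 2)"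
      unfolding filterlim_at_top_dense by blast
    have "filterlim (\<lambda>P. \<kappa> * g0 * P powr (\<epsilon> / 2)) at_top at_top" using \<epsilon> \<kappa> g0 by real_asymp
    then show "\<forall>\<^sub>F P in at_top. 2 * C4 < \<kappa> * g0 * P powr (\<epsilon> / 2)"
      unfolding filterlim_at_top_dense by blast
  qed
  then show ?thesis
  proof eventually_elim
    case (elim P)
    then have P: "1 \<le> P" "P0 \<le> P" and L3: "3 \<le> \<epsilon> * log 2 P"
      and big1: "2 * C4 + 8 * real K * C * \<kappa> < \<kappa> * c * P powr (\<epsilon> / 2)" and big2: "2 * C4 < \<kappa> * g0 * P powr (\<epsilon> / 2)" by simp_all
    let ?R = "\<lambda>k\<in>{1..K}. max 0 (real M * (target_dof l k - 6 * \<epsilon>) * log 2 P)"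
    let ?N = "\<lambda>n k. nat \<lceil>2 powr (real n * ?R k)\<rceil>"
    have \<eta>: "0 < P powr (- (1 / 2))" using P by simp
    obtain sel :: "nat \<Rightarrow> nat \<Rightarrow> (nat \<Rightarrow> nat \<Rightarrow> complex) \<Rightarrow> nat \<Rightarrow> complex" where sel:
      "\<And>k m a j. k \<in> {1..K} \<Longrightarrow> m \<in> {1..M} \<Longrightarrow> cmod (sel k m a j) \<le> 2"
      "\<And>k m a. k \<in> {1..K} \<Longrightarrow> m \<in> {1..M} \<Longrightarrow> \<exists>j\<in>{1..K}. 1 / 2 \<le> cmod (sel k m a j)"
      "\<And>k m a i. k \<in> {1..K} \<Longrightarrow> m \<in> {1..M} \<Longrightarrow>
        (\<And>i j. i \<in> {1..K} \<Longrightarrow> 0 < \<alpha> i m \<Longrightarrow> j \<in> {1..K} \<Longrightarrow> cmod (a i j) \<le> B) \<Longrightarrow>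
        i \<in> {1..K} \<Longrightarrow> i \<noteq> k \<Longrightarrow> 0 < \<alpha> i m \<Longrightarrow> cmod (\<Sum>j=1..K. a i j * sel k m a j) \<le> P powr (- (1 / 2))"
      "\<And>k m a a'. k \<in> {1..K} \<Longrightarrow> m \<in> {1..M} \<Longrightarrow>
        (\<And>i j. i \<in> {1..K} - {k} \<Longrightarrow> j \<in> {1..K} \<Longrightarrow> a i j = a' i j) \<Longrightarrow> sel k m a = sel k m a'"
      "\<And>k m (S :: (entry \<Rightarrow> complex) measure) A j. k \<in> {1..K} \<Longrightarrow> m \<in> {1..M} \<Longrightarrow>
        (\<And>i j. i \<in> {1..K} - {k} \<Longrightarrow> j \<in> {1..K} \<Longrightarrow> (\<lambda>g. A g i j) \<in> borel_measurable S) \<Longrightarrow>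
        (\<lambda>g. sel k m (A g) j) \<in> borel_measurable S"
      apply (rule zero_forcers[OF B \<eta>])
      subgoal premises prems for sel by (rule prems(1)[of sel]) (fact prems)+
      done
    have code: "\<exists>enc dec. valid_code P n (?N n) enc dec \<and> 0 \<le> error_prob P n (?N n) enc dec \<and>
      error_prob P n (?N n) enc dec \<le> 2 * real K * real M * (1 / 2) ^ n" if n: "1 \<le> n" for n
    proof -
      have ex: "\<exists>cw :: nat \<Rightarrow> nat \<Rightarrow> (nat \<Rightarrow> complex) \<times> (nat \<Rightarrow> complex). \<forall>w < ?N n k. cw w \<in> {1..n} \<rightarrow>\<^sub>E alphabet \<epsilon> P l k \<and>
        (\<forall>w' < ?N n k. w \<noteq> w' \<longrightarrow> 2 * \<epsilon> * real n < real (hamming {1..n} (cw w) (cw w')))" if k: "k \<in> {1..K}" for k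
      proof (rule code_exists[OF alphabet_card(1,2)[OF k P(1) \<epsilon>(1)] n])
        show "0 \<le> \<epsilon>" using \<epsilon> by simp
        show "0 \<le> ?R k" using k by simp
        show "?R k = 0 \<or> ?R k \<le> (1 - 2 * \<epsilon>) * log 2 (real (card (alphabet \<epsilon> P l k))) - 2"
          using rate_supported[OF k P(1) \<epsilon> L3, of l] unfolding restrict_apply'[OF k] .
      qed
      let ?W = "\<lambda>k cw :: nat \<Rightarrow> nat \<Rightarrow> (nat \<Rightarrow> complex) \<times> (nat \<Rightarrow> complex). \<forall>w < ?N n k. cw w \<in> {1..n} \<rightarrow>\<^sub>E alphabet \<epsilon> P l k \<and>
        (\<forall>w' < ?N n k. w \<noteq> w' \<longrightarrow> 2 * \<epsilon> * real n < real (hamming {1..n} (cw w) (cw w')))"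
      define cw where "cw k = (SOME f. ?W k f)" for k
      have cw: "?W k (cw k)" if "k \<in> {1..K}" for k
        unfolding cw_def by (rule someI_ex[where P = "?W k", OF ex[OF that]])
      interpret S: zero_forcing_code \<Omega> K M \<alpha> H Z l n P \<epsilon> \<tau> p g0 c C "\<kappa> * sqrt P"
        "\<lambda>m. \<kappa> * P powr (\<alpha> l m / 2)" "\<lambda>k m. F * P powr (- \<alpha> k m / 2)" "\<lambda>k m. C4 * P powr ((\<alpha> l m - \<alpha> k m) / 2)"
        "common_level \<epsilon> P l" "private_level \<epsilon> P" sel "?N n" cw
      proof (intro zero_forcing_code.intro zero_forcing_code_axioms.intro)
        show "parallel_miso_bc \<Omega> K M \<alpha> H Z" by (rule parallel_miso_bc_axioms)
        show "l \<in> {1..K}" "1 \<le> n" "0 < \<epsilon>" "0 < p" "p \<le> 1" "2 * p powr (\<epsilon> / (2 * real M)) \<le> 1 / 2" by fact+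
        show "0 \<le> P" using P by simp
        show "1 \<le> common_level \<epsilon> P l m" for m unfolding common_level_def by (rule level_ge_1)
        show "1 \<le> private_level \<epsilon> P k m" for k m unfolding private_level_def by (rule level_ge_1)
        show "cmod (sel k m a j) \<le> 2" if "k \<in> {1..K}" "m \<in> {1..M}" for k m a j by (rule sel(1)[OF that])
        show "\<exists>j\<in>{1..K}. 1 / 2 \<le> cmod (sel k m a j)" if "k \<in> {1..K}" "m \<in> {1..M}" for k m a by (rule sel(2)[OF that])
        show "sel k m a = sel k m a'" if "k \<in> {1..K}" "m \<in> {1..M}"
          "\<And>i j. i \<in> {1..K} - {k} \<Longrightarrow> j \<in> {1..K} \<Longrightarrow> a i j = a' i j" for k m a a' by (rule sel(4)[OF that])
        show "(\<lambda>g. sel k m (A g) j) \<in> borel_measurable S" if "k \<in> {1..K}" "m \<in> {1..M}"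
          "\<And>i j. i \<in> {1..K} - {k} \<Longrightarrow> j \<in> {1..K} \<Longrightarrow> (\<lambda>g. A g i j) \<in> borel_measurable S"
          for k m and S :: "(entry \<Rightarrow> complex) measure" and A j by (rule sel(5)[OF that])
        show "prob {\<omega> \<in> space \<Omega>. \<forall>t\<in>S. \<tau> < cmod (Z k m t \<omega>)} \<le> p ^ card S"
          if "k \<in> {1..K}" "m \<in> {1..M}" "S \<subseteq> {1..n}" for k m S
        proof (rule noisy[OF that(1,2)])
          show "finite S" by (rule finite_subset[OF that(3) finite_atLeastAtMost])
          show "S \<subseteq> {1..}" using that(3) by (rule order_trans) auto
        qed
        show "measure (block_law n) {g \<in> space (block_space n). \<forall>t\<in>S. cmod (\<Sum>j=1..K. coeff P k m t j g * V t j g) < g0} \<le> p ^ card S"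
          if "k \<in> {1..K}" "m \<in> {1..M}" "S \<subseteq> {1..n}"
            "\<And>t j. t \<in> S \<Longrightarrow> j \<in> {1..K} \<Longrightarrow> V t j \<in> borel_measurable (block_space n)"
            "\<And>t j. t \<in> S \<Longrightarrow> j \<in> {1..K} \<Longrightarrow> free_of {Estimate k m t j | t j. True} (V t j)"
            "\<And>t g. t \<in> S \<Longrightarrow> \<exists>j\<in>{1..K}. 1 / 2 \<le> cmod (V t j g)"
          for k m S and V :: "nat \<Rightarrow> nat \<Rightarrow> (entry \<Rightarrow> complex) \<Rightarrow> complex" by (rule faded[OF that])
        show "AE g in block_law n. \<forall>k\<in>{1..K}. \<forall>i\<in>slots n. \<forall>j\<in>{1..K}.
          c \<le> cmod (coeff P k (fst i) (snd i) j g) \<and> cmod (coeff P k (fst i) (snd i) j g) \<le> C" by (rule co[OF P(2)])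
        show "AE g in block_law n. \<forall>k\<in>{1..K}. \<forall>i\<in>{1..K}. i \<noteq> k \<longrightarrow> (\<forall>m\<in>{1..M}. \<forall>t\<in>{1..n}.
          cmod (\<Sum>j=1..K. coeff P k m t j g * sel i m (\<lambda>i j. g (Estimate i m t j)) j) \<le> F * P powr (- \<alpha> k m / 2))"
          using co[OF P(2), of n] es[of n]
        proof eventually_elim
          case (elim g)
          show ?case
          proof (intro ballI impI)
            fix k i m t assume k: "k \<in> {1..K}" and i: "i \<in> {1..K}" "i \<noteq> k" and m: "m \<in> {1..M}" and t: "t \<in> {1..n}"
            have sl: "(m, t) \<in> slots n" using m t by (simp add: slots_def)
            show "cmod (\<Sum>j=1..K. coeff P k m t j g * sel i m (\<lambda>i j. g (Estimate i m t j)) j) \<le> F * P powr (- \<alpha> k m / 2)"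
              unfolding F_def
            proof (rule interference_bound[OF P(1) B C k m sel(1)[OF i(1) m]])
              fix j assume j: "j \<in> {1..K}"
              show "cmod (coeff P k m t j g) \<le> C"
                using bspec[OF bspec[OF bspec[OF elim(1) k] sl] j] by simp
              show "cmod (g (Error k m t j)) \<le> B" if "0 < \<alpha> k m"
                using bspec[OF bspec[OF bspec[OF bspec[OF elim(2) k] m] t] j] that by simp
            next
              assume pos: "0 < \<alpha> k m"
              show "cmod (\<Sum>j=1..K. g (Estimate k m t j) * sel i m (\<lambda>i j. g (Estimate i m t j)) j) \<le> P powr (- (1 / 2))"
              proof (rule sel(3)[OF i(1) m _ k i(2)[symmetric] pos])
                fix i' j assume i': "i' \<in> {1..K}" "0 < \<alpha> i' m" "j \<in> {1..K}"
                show "cmod (g (Estimate i' m t j)) \<le> B"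
                  using bspec[OF bspec[OF bspec[OF bspec[OF elim(2) i'(1)] m] t] i'(3)] i'(2) by simp
              qed
            qed
          qed
        qed
        show "0 \<le> \<kappa> * sqrt P" using \<kappa> P by simp
        show "0 \<le> \<kappa> * P powr (\<alpha> l m / 2)" for m using \<kappa> by simp
        show "\<kappa> * P powr (\<alpha> l m / 2) \<le> \<kappa> * sqrt P" if "m \<in> {1..M}" for m
        proof -
          have "\<alpha> l m \<le> 1" using quality[OF l that] by simp
          then have "P powr (\<alpha> l m / 2) \<le> P powr (1 / 2)" using P by (intro powr_mono) simp_all
          then have "P powr (\<alpha> l m / 2) \<le> sqrt P" using P by (simp add: powr_half_sqrt)
          then show ?thesis using \<kappa> by (intro mult_left_mono) simp_all
        qed
        show "real K * (6 * real K * (\<kappa> * sqrt P))\<^sup>2 \<le> P"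
        proof -
          have "6 * real K * (\<kappa> * sqrt P) = sqrt P / real K" using K1 by (simp add: \<kappa>_def power2_eq_square)
          then have "real K * (6 * real K * (\<kappa> * sqrt P))\<^sup>2 = P / real K" using P K1 by (simp add: power_divide power2_eq_square)
          also have "\<dots> \<le> P / 1" using P K1 by (intro divide_left_mono) simp_all
          finally show ?thesis by simp
        qed
        \<comment> \<open>The leadership of \<open>l\<close> enters here: the exponent
          \<open>\<alpha> l m - \<alpha> k m\<close> is nonnegative, so the constant noise level is
          absorbed by a tolerance that scales like the interference.\<close>
        show "2 * real K * (\<kappa> * P powr (\<alpha> l m / 2) * (F * P powr (- \<alpha> k m / 2))) + \<tau> \<le> C4 * P powr ((\<alpha> l m - \<alpha> k m) / 2)"
          if "k \<in> {1..K}" "m \<in> {1..M}" for k m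
        proof -
          have e: "P powr (\<alpha> l m / 2) * P powr (- \<alpha> k m / 2) = P powr ((\<alpha> l m - \<alpha> k m) / 2)"
            unfolding powr_add[symmetric] by (rule arg_cong[where f = "(powr) P"]) (simp add: field_simps)
          have "1 \<le> P powr ((\<alpha> l m - \<alpha> k m) / 2)" using lead[OF that] P by (intro ge_one_powr_ge_zero) simp_all
          then have "\<tau> * 1 \<le> \<tau> * P powr ((\<alpha> l m - \<alpha> k m) / 2)" using \<tau> by (intro mult_left_mono) simp_all
          moreover have "2 * real K * (\<kappa> * P powr (\<alpha> l m / 2) * (F * P powr (- \<alpha> k m / 2)))
            = 2 * real K * \<kappa> * F * P powr ((\<alpha> l m - \<alpha> k m) / 2)" unfolding e[symmetric] by (simp only: ac_simps)
          ultimately show ?thesis unfolding C4_def distrib_right by linarith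
        qed
        show "0 \<le> F * P powr (- \<alpha> k m / 2)" for k m using F0 by simp
        show "common_level \<epsilon> P l m = 1 \<or> 2 * (C4 * P powr ((\<alpha> l m - \<alpha> k m) / 2)) + 4 * (\<kappa> * P powr (\<alpha> l m / 2)) * (2 * real K * C)
            < \<kappa> * sqrt P * c / real (common_level \<epsilon> P l m)" if "k \<in> {1..K}" "m \<in> {1..M}" for k m
        proof -
          have "\<alpha> l m - \<alpha> k m \<le> \<alpha> l m" using quality[OF that] by simp
          from common_gap_level[OF P(1) \<kappa> c C40 this big1]
          have "common_level \<epsilon> P l m = 1 \<or> 2 * (C4 * P powr ((\<alpha> l m - \<alpha> k m) / 2)) + 8 * real K * C * \<kappa> * P powr (\<alpha> l m / 2)
            < \<kappa> * sqrt P * c / real (common_level \<epsilon> P l m)" unfolding common_level_def .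
          moreover have "8 * real K * C * \<kappa> * P powr (\<alpha> l m / 2) = 4 * (\<kappa> * P powr (\<alpha> l m / 2)) * (2 * real K * C)" by simp
          ultimately show ?thesis by (simp only:)
        qed
        show "private_level \<epsilon> P k m = 1 \<or> 2 * (C4 * P powr ((\<alpha> l m - \<alpha> k m) / 2))
            < \<kappa> * P powr (\<alpha> l m / 2) * g0 / real (private_level \<epsilon> P k m)" if "k \<in> {1..K}" "m \<in> {1..M}" for k m
          using private_gap_level[OF P(1) \<kappa> g0 big2, of "\<alpha> k m" "\<alpha> l m"] unfolding private_level_def .
        show "cw k w \<in> {1..n} \<rightarrow>\<^sub>E (\<Pi>\<^sub>E m\<in>{1..M}. grid (private_level \<epsilon> P k m)) \<times>
            (if k = l then \<Pi>\<^sub>E m\<in>{1..M}. grid (common_level \<epsilon> P l m) else {\<lambda>_. 0})"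
          if "k \<in> {1..K}" "w < ?N n k" for k w
          using conjunct1[OF cw[OF that(1), rule_format, OF that(2)]] unfolding alphabet_def .
        show "2 * \<epsilon> * real n < real (hamming {1..n} (cw k w) (cw k w'))"
          if "k \<in> {1..K}" "w < ?N n k" "w' < ?N n k" "w \<noteq> w'" for k w w'
          by (rule conjunct2[OF cw[OF that(1), rule_format, OF that(2)], rule_format, OF that(3,4)])
      qed
      show ?thesis by (intro exI[of _ S.enc] exI[of _ S.dec] conjI S.enc_valid S.error_prob_bound)
    qed
    \<comment> \<open>Encoder and decoder are chosen as a pair for every block length; the empty
      block is unconstrained.\<close>
    have "\<forall>n. \<exists>ed. 1 \<le> n \<longrightarrow> valid_code P n (?N n) (fst ed) (snd ed) \<and> 0 \<le> error_prob P n (?N n) (fst ed) (snd ed) \<and>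
      error_prob P n (?N n) (fst ed) (snd ed) \<le> 2 * real K * real M * (1 / 2) ^ n"
    proof
      fix n
      show "\<exists>ed. 1 \<le> n \<longrightarrow> valid_code P n (?N n) (fst ed) (snd ed) \<and> 0 \<le> error_prob P n (?N n) (fst ed) (snd ed) \<and>
        error_prob P n (?N n) (fst ed) (snd ed) \<le> 2 * real K * real M * (1 / 2) ^ n"
      proof (cases "1 \<le> n")
        case True
        from code[OF this] obtain e d where ed: "valid_code P n (?N n) e d" "0 \<le> error_prob P n (?N n) e d"
          "error_prob P n (?N n) e d \<le> 2 * real K * real M * (1 / 2) ^ n" by (elim exE conjE)
        show ?thesis by (rule exI[of _ "(e, d)"]) (unfold fst_conv snd_conv, intro impI conjI ed)
      qed (intro exI impI, erule notE, assumption)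
    qed
    then obtain ed where ed: "\<forall>n. 1 \<le> n \<longrightarrow> valid_code P n (?N n) (fst (ed n)) (snd (ed n)) \<and>
      0 \<le> error_prob P n (?N n) (fst (ed n)) (snd (ed n)) \<and>
      error_prob P n (?N n) (fst (ed n)) (snd (ed n)) \<le> 2 * real K * real M * (1 / 2) ^ n"
      by (rule choice[THEN exE])
    have "(\<lambda>n. error_prob P n (?N n) (fst (ed n)) (snd (ed n))) \<longlonglongrightarrow> 0"
    proof (rule tendsto_sandwich)
      show "(\<lambda>_. 0 :: real) \<longlonglongrightarrow> 0" by (rule tendsto_const)
      have "(\<lambda>n. (1 / 2 :: real) ^ n) \<longlonglongrightarrow> 0" by (rule LIMSEQ_realpow_zero) simp_all
      from tendsto_mult_right_zero[OF this] show "(\<lambda>n. 2 * real K * real M * (1 / 2) ^ n) \<longlonglongrightarrow> 0" .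
      show "\<forall>\<^sub>F n in sequentially. 0 \<le> error_prob P n (?N n) (fst (ed n)) (snd (ed n))"
        using eventually_ge_at_top[of 1] by eventually_elim (rule ed[THEN spec, THEN mp, THEN conjunct2, THEN conjunct1])
      show "\<forall>\<^sub>F n in sequentially. error_prob P n (?N n) (fst (ed n)) (snd (ed n)) \<le> 2 * real K * real M * (1 / 2) ^ n"
        using eventually_ge_at_top[of 1] by eventually_elim (rule ed[THEN spec, THEN mp, THEN conjunct2, THEN conjunct2])
    qed
    moreover have "?R \<in> {1..K} \<rightarrow>\<^sub>E {0..}" by (rule restrict_PiE_iff[THEN iffD2]) simp
    moreover have "\<forall>n\<ge>1. valid_code P n (?N n) (fst (ed n)) (snd (ed n))"
      by (intro allI impI) (rule ed[THEN spec, THEN mp, THEN conjunct1])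
    ultimately show ?case unfolding achievable_rates_def
      by (intro CollectI conjI exI[of _ "\<lambda>n. fst (ed n)"] exI[of _ "\<lambda>n. snd (ed n)"])
  qed
qed

text \<open>The rates are multiples of \<open>log 2 P\<close>, so the quotients are constant for
  \<open>P > 1\<close>. Truncation at 0 covers users whose target lies below
  \<open>6 * \<epsilon>\<close>.\<close>

lemma zero_forcing_dof:
  assumes l: "l \<in> {1..K}" and lead: "\<And>k m. k \<in> {1..K} \<Longrightarrow> m \<in> {1..M} \<Longrightarrow> \<alpha> k m \<le> \<alpha> l m"
    and \<epsilon>: "0 < \<epsilon>" "\<epsilon> < 1 / 2"
  shows "(\<lambda>k\<in>{1..K}. max 0 (target_dof l k - 6 * \<epsilon>)) \<in> achievable_dof"
proof -
  let ?R = "\<lambda>P. \<lambda>k\<in>{1..K}. max 0 (real M * (target_dof l k - 6 * \<epsilon>) * log 2 P)"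
  let ?d = "\<lambda>k\<in>{1..K}. max 0 (target_dof l k - 6 * \<epsilon>)"
  have M0: "0 < real M" using subchannels by simp
  have ev: "\<forall>\<^sub>F P in at_top. ?R P \<in> achievable_rates P"
    by (rule zero_forcing_rates[OF l _ \<epsilon>]) (rule lead)
  have "\<forall>\<^sub>F P in at_top. ?R P \<in> capacity_region P"
    using ev by eventually_elim (unfold capacity_region_def, rule subsetD[OF closure_subset])
  moreover have "((\<lambda>P. ?R P k / (real M * log 2 P)) \<longlongrightarrow> ?d k) at_top" if k: "k \<in> {1..K}" for k
  proof (rule tendsto_eventually)
    show "\<forall>\<^sub>F P in at_top. ?R P k / (real M * log 2 P) = ?d k"
      using eventually_gt_at_top[of 1]
    proof eventually_elim
      case (elim P)
      then have "0 < log 2 P" by simp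
      with M0 have z: "0 < real M * log 2 P" by simp
      define x where "x = target_dof l k - 6 * \<epsilon>"
      have xz: "real M * x * log 2 P = x * (real M * log 2 P)" by (simp only: ac_simps)
      have "max 0 (real M * x * log 2 P) = max 0 x * (real M * log 2 P)"
      proof (cases "0 \<le> x")
        case True
        then have "0 \<le> x * (real M * log 2 P)" using less_imp_le[OF z] by (rule mult_nonneg_nonneg)
        then show ?thesis unfolding xz max_absorb2[OF True] by (rule max_absorb2)
      next
        case False
        then have "x \<le> 0" by simp
        from mult_nonpos_nonneg[OF this less_imp_le[OF z]] have "x * (real M * log 2 P) \<le> 0" .
        moreover have "max 0 x = 0" using False by simp
        ultimately show ?thesis unfolding xz by (simp only: max_absorb1 mult_zero_left)
      qed
      then have "max 0 (real M * x * log 2 P) / (real M * log 2 P) = max 0 x"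
        using nonzero_mult_div_cancel_right[OF less_imp_neq[OF z, symmetric], of "max 0 x"] by (simp only:)
      then show ?case unfolding restrict_apply'[OF k] x_def .
    qed
  qed
  moreover have "?d \<in> {1..K} \<rightarrow>\<^sub>E UNIV" by (rule restrict_PiE_iff[THEN iffD2]) simp
  ultimately show ?thesis unfolding achievable_dof_def
    by (intro CollectI conjI exI[of _ ?R] ballI)
qed

text \<open>The first user of the ordering leads on every subchannel. It need not be user 1, but its
  average is at most that of user 1, so removing it from the sum over all users leaves at least the
  sum from 2 to \<open>K\<close>. The loss \<open>6 * \<epsilon>\<close> per user disappears as
  \<open>\<epsilon>\<close> tends to 0, because \<open>s\<close> bounds all achievable sums.\<close>

lemma ordered_sum_dof_ge:
  assumes ord: "totally_ordered_quality K M \<alpha>"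
    and avg: "\<forall>k\<in>{1..K}. \<forall>l\<in>{k..K}. avg_quality M \<alpha> l \<le> avg_quality M \<alpha> k"
    and s: "is_sum_dof s"
  shows "1 + (\<Sum>k=2..K. avg_quality M \<alpha> k) \<le> s"
proof -
  obtain \<pi> where \<pi>: "\<pi> permutes {1..K}" "\<forall>m\<in>{1..M}. \<forall>i\<in>{1..K}. \<forall>j\<in>{i..K}. \<alpha> (\<pi> j) m \<le> \<alpha> (\<pi> i) m"
    using ord unfolding totally_ordered_quality_def by blast
  have one: "(1::nat) \<in> {1..K}" using users by simp
  define l where "l = \<pi> 1"
  have l: "l \<in> {1..K}" unfolding l_def using permutes_in_image[OF \<pi>(1)] one by blast
  have lead: "\<alpha> k m \<le> \<alpha> l m" if k: "k \<in> {1..K}" and m: "m \<in> {1..M}" for k m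
  proof -
    have "k \<in> \<pi> ` {1..K}" using permutes_image[OF \<pi>(1)] k by simp
    then obtain j where j: "k = \<pi> j" "j \<in> {1..K}" by (rule imageE)
    show ?thesis unfolding j(1) l_def using bspec[OF bspec[OF bspec[OF \<pi>(2) m] one] j(2)] .
  qed
  let ?q = "avg_quality M \<alpha>"
  have "?q l \<le> ?q 1" using avg one l by blast
  then have "?q l + (\<Sum>k=2..K. ?q k) \<le> (\<Sum>k=1..K. ?q k)"
    unfolding sum.atLeast_Suc_atMost[OF users] Suc_1 by (rule add_right_mono)
  also have "(\<Sum>k=1..K. ?q k) = ?q l + (\<Sum>k\<in>{1..K} - {l}. ?q k)" by (rule sum.remove[OF finite_atLeastAtMost l])
  finally have "(\<Sum>k=2..K. ?q k) \<le> (\<Sum>k\<in>{1..K} - {l}. ?q k)" by simp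
  moreover have "(\<Sum>k=1..K. target_dof l k) = 1 + (\<Sum>k\<in>{1..K} - {l}. ?q k)"
    unfolding sum.remove[OF finite_atLeastAtMost l] by (simp add: target_dof_def)
  ultimately have t: "1 + (\<Sum>k=2..K. ?q k) \<le> (\<Sum>k=1..K. target_dof l k)" by simp
  show ?thesis
  proof (rule field_le_epsilon)
    fix e :: real assume e: "0 < e"
    define \<epsilon> where "\<epsilon> = min (1 / 4) (e / (6 * real K))"
    have K1: "1 \<le> real K" using users by simp
    have \<epsilon>: "0 < \<epsilon>" "\<epsilon> < 1 / 2" using e K1 unfolding \<epsilon>_def by (simp_all add: min_def)
    have "\<epsilon> \<le> e / (6 * real K)" by (simp add: \<epsilon>_def)
    then have Ke: "6 * real K * \<epsilon> \<le> e" using K1 by (simp add: le_divide_eq mult.commute)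
    have "(\<Sum>k=1..K. target_dof l k) - 6 * real K * \<epsilon> = (\<Sum>k=1..K. target_dof l k - 6 * \<epsilon>)"
      by (simp add: sum_subtractf)
    also have "\<dots> \<le> (\<Sum>k=1..K. (\<lambda>k\<in>{1..K}. max 0 (target_dof l k - 6 * \<epsilon>)) k)"
      by (rule sum_mono) simp
    also have "\<dots> \<le> s"
      by (rule is_sum_dof_exists(2)[OF s], rule zero_forcing_dof[OF l _ \<epsilon>]) (rule lead)
    finally show "1 + (\<Sum>k=2..K. ?q k) \<le> s + e" using t Ke by linarith
  qed
qed

end

theorem theorem1:
  fixes \<Omega> :: "'a measure"
    and K M :: nat
    and \<alpha> :: "nat \<Rightarrow> nat \<Rightarrow> real"
    and H :: "entry \<Rightarrow> 'a \<Rightarrow> complex"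
    and Z :: "nat \<Rightarrow> nat \<Rightarrow> nat \<Rightarrow> 'a \<Rightarrow> complex"
  assumes "parallel_miso_bc \<Omega> K M \<alpha> H Z"
    and "\<forall>k\<in>{1..K}. \<forall>l\<in>{k..K}. avg_quality M \<alpha> l \<le> avg_quality M \<alpha> k"
  shows "\<exists>d_sum. parallel_miso_bc.is_sum_dof \<Omega> K M \<alpha> H Z d_sum \<and>
    d_sum \<le> 1 + (\<Sum>k=2..K. avg_quality M \<alpha> k) \<and>
    (totally_ordered_quality K M \<alpha> \<longrightarrow> d_sum = 1 + (\<Sum>k=2..K. avg_quality M \<alpha> k))"
proof -
  interpret parallel_miso_bc \<Omega> K M \<alpha> H Z by (rule assms(1))
  obtain s where s: "is_sum_dof s" "s \<le> 1 + (\<Sum>k=2..K. avg_quality M \<alpha> k)"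
    using is_sum_dof_exists(1) by blast
  show ?thesis
  proof (intro exI[of _ s] conjI impI)
    show "is_sum_dof s" "s \<le> 1 + (\<Sum>k=2..K. avg_quality M \<alpha> k)" by (fact s)+
    assume "totally_ordered_quality K M \<alpha>"
    from ordered_sum_dof_ge[OF this assms(2) s(1)] s(2)
    show "s = 1 + (\<Sum>k=2..K. avg_quality M \<alpha> k)" by linarith
  qed
qed


end
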